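(* Fix any constant $\varepsilon>0$ and let $\delta=n^{-(1/3+\varepsilon)}$. There is an algorithm which, given $n$ and access to independent traces drawn from $\mathrm{Del}_\delta(x)$, where $x\in\{0,1\}^n$ is arbitrary and unknown to the algorithm, uses $O(n^{4/3})$ such traces, runs in $O(n^{7/3})$ time, and outputs $x$ with probability at least $9/10$.
   Context: For $x\in\{0,1\}^n$ and $0<\delta<1$, $\mathrm{Del}_\delta(x)$ (the deletion channel) is the distribution over $\{0,1\}^{\le n}$ of the string obtained from $x$ by deleting each bit independently with probability $\delta$ and concatenating the surviving bits; a sample from it is called a trace of $x$. *)

theory Defs
  imports
    "HOL-Probability.Probability"
    "HOL-Library.Landau_Symbols"
    "HOL-Library.Log_Nat"
begin

text \<open>
  Strings are \<^typ>\<open>bool list\<close>. The set of deleted positions is obtained from independent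
  \<open>\<delta>\<close>-coins, one per position; the trace consists of the remaining bits, in order.
\<close>

definition deletion_channel :: "real \<Rightarrow> bool list \<Rightarrow> bool list pmf" where
  "deletion_channel \<delta> x =
     map_pmf (\<lambda>deleted. nths x {i. \<not> deleted i})
       (Pi_pmf {..<length x} False (\<lambda>_. bernoulli_pmf \<delta>))"

text \<open>
  Algorithms are programs for a deterministic word RAM with structured control flow. A program
  mentions only finitely many scalar variables (registers) and finitely many arrays, so the
  named arrays are a fixed partition of one random-access memory. All cells are initially 0.
  Every operation, including an array access, has unit cost.

  The unknown string is accessible only through \<open>Draw\<close>, which requests a fresh trace, and \<open>Read\<close>,
  which delivers the next bit of the current trace (0 or 1), or 2 at the end of the trace. Thus
  reading a whole trace takes time proportional to its length.
\<close>

type_synonym vname = string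

datatype bop = Add | Sub | Mul | Div | Mod | Less | Eq

datatype exp =
    Const nat
  | Var vname
  | Index vname exp
  | Bin bop exp exp

datatype com =
    Skip
  | Assign vname exp
  | Store vname exp exp
  | Seq com com
  | Cond exp com com
  | While exp com
  | Draw
  | Read vname

record state =
  var :: "vname \<Rightarrow> nat"
  arr :: "vname \<Rightarrow> nat \<Rightarrow> nat"
  rest :: "bool list"  \<comment> \<open>unread part of the current trace\<close>
  drawn :: nat         \<comment> \<open>number of traces requested so far\<close>

fun apply_bop :: "bop \<Rightarrow> nat \<Rightarrow> nat \<Rightarrow> nat" where
  "apply_bop Add a b = a + b"
| "apply_bop Sub a b = a - b"
| "apply_bop Mul a b = a * b"
| "apply_bop Div a b = a div b"
| "apply_bop Mod a b = a mod b"
| "apply_bop Less a b = of_bool (a < b)"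
| "apply_bop Eq a b = of_bool (a = b)"

text \<open>Arithmetic is modulo \<open>2 ^ w\<close>, where \<open>w\<close> is the word size; subtraction truncates at 0.\<close>

fun eval :: "nat \<Rightarrow> exp \<Rightarrow> state \<Rightarrow> nat" where
  "eval w (Const c) s = c mod 2 ^ w"
| "eval w (Var v) s = var s v"
| "eval w (Index a e) s = arr s a (eval w e s)"
| "eval w (Bin f e1 e2) s = apply_bop f (eval w e1 s) (eval w e2 s) mod 2 ^ w"

fun cost :: "exp \<Rightarrow> nat" where
  "cost (Const c) = 1"
| "cost (Var v) = 1"
| "cost (Index a e) = 1 + cost e"
| "cost (Bin f e1 e2) = 1 + cost e1 + cost e2"

text \<open>
  \<open>big_step w \<omega> c s t s'\<close>: with word size \<open>w\<close> and \<open>\<omega> i\<close> being the answer to the \<open>i\<close>-th request for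
  a trace, running \<open>c\<close> from \<open>s\<close> terminates in \<open>s'\<close> after \<open>t\<close> time steps.
\<close>

inductive big_step ::
  "nat \<Rightarrow> (nat \<Rightarrow> bool list) \<Rightarrow> com \<Rightarrow> state \<Rightarrow> nat \<Rightarrow> state \<Rightarrow> bool"
  for w :: nat and \<omega> :: "nat \<Rightarrow> bool list"
where
  Skip: "big_step w \<omega> Skip s 1 s"
| Assign: "big_step w \<omega> (Assign v e) s (1 + cost e) (s\<lparr>var := (var s)(v := eval w e s)\<rparr>)"
| Store: "big_step w \<omega> (Store a i e) s (1 + cost i + cost e)
    (s\<lparr>arr := (arr s)(a := (arr s a)(eval w i s := eval w e s))\<rparr>)"
| Seq: "big_step w \<omega> c1 s t1 s1 \<Longrightarrow> big_step w \<omega> c2 s1 t2 s2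
    \<Longrightarrow> big_step w \<omega> (Seq c1 c2) s (t1 + t2) s2"
| CondTrue: "eval w b s \<noteq> 0 \<Longrightarrow> big_step w \<omega> c1 s t s'
    \<Longrightarrow> big_step w \<omega> (Cond b c1 c2) s (1 + cost b + t) s'"
| CondFalse: "eval w b s = 0 \<Longrightarrow> big_step w \<omega> c2 s t s'
    \<Longrightarrow> big_step w \<omega> (Cond b c1 c2) s (1 + cost b + t) s'"
| WhileFalse: "eval w b s = 0 \<Longrightarrow> big_step w \<omega> (While b c) s (1 + cost b) s"
| WhileTrue: "eval w b s \<noteq> 0 \<Longrightarrow> big_step w \<omega> c s t1 s1 \<Longrightarrow> big_step w \<omega> (While b c) s1 t2 s2
    \<Longrightarrow> big_step w \<omega> (While b c) s (1 + cost b + t1 + t2) s2"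
| Draw: "big_step w \<omega> Draw s 1 (s\<lparr>rest := \<omega> (drawn s), drawn := Suc (drawn s)\<rparr>)"
| ReadBit: "rest s = b # bs
    \<Longrightarrow> big_step w \<omega> (Read v) s 1 (s\<lparr>var := (var s)(v := of_bool b), rest := bs\<rparr>)"
| ReadEnd: "rest s = []
    \<Longrightarrow> big_step w \<omega> (Read v) s 1 (s\<lparr>var := (var s)(v := 2)\<rparr>)"

inductive_cases SkipE: "big_step w \<omega> Skip s t s'"
inductive_cases AssignE: "big_step w \<omega> (Assign v e) s t s'"
inductive_cases StoreE: "big_step w \<omega> (Store a i e) s t s'"
inductive_cases SeqE: "big_step w \<omega> (Seq c1 c2) s t s'"
inductive_cases CondE: "big_step w \<omega> (Cond b c1 c2) s t s'"
inductive_cases WhileE: "big_step w \<omega> (While b c) s t s'"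
inductive_cases DrawE: "big_step w \<omega> Draw s t s'"
inductive_cases ReadE: "big_step w \<omega> (Read v) s t s'"

lemma big_step_deterministic:
  "big_step w \<omega> c s t s' \<Longrightarrow> big_step w \<omega> c s u s'' \<Longrightarrow> u = t \<and> s'' = s'"
proof (induction arbitrary: u s'' rule: big_step.induct)
  case (Skip s)
  then show ?case by (rule SkipE) simp
next
  case (Assign v e s)
  then show ?case by (rule AssignE) simp
next
  case (Store a i e s)
  then show ?case by (rule StoreE) simp
next
  case (Seq c1 s t1 s1 c2 t2 s2)
  from Seq.prems obtain u1 r u2 where u: "u = u1 + u2"
    and 1: "big_step w \<omega> c1 s u1 r" and 2: "big_step w \<omega> c2 r u2 s''"
    by (rule SeqE)
  have "u1 = t1 \<and> r = s1" by (rule Seq.IH(1)[OF 1])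
  moreover from this 2 have "u2 = t2 \<and> s'' = s2" by (intro Seq.IH(2)) simp
  ultimately show ?case using u by simp
next
  case (CondTrue b s c1 t s' c2)
  from CondTrue.prems show ?case by (rule CondE) (use CondTrue.hyps(1) CondTrue.IH in simp_all)
next
  case (CondFalse b s c2 t s' c1)
  from CondFalse.prems show ?case by (rule CondE) (use CondFalse.hyps(1) CondFalse.IH in simp_all)
next
  case (WhileFalse b s c)
  from WhileFalse.prems show ?case by (rule WhileE) (use WhileFalse.hyps in auto)
next
  case (WhileTrue b s c t1 s1 t2 s2)
  from WhileTrue.prems show ?case
  proof (rule WhileE)
    assume "eval w b s = 0"
    with WhileTrue.hyps(1) show ?thesis by contradiction
  next
    fix u1 r u2
    assume u: "u = Suc (cost b + u1 + u2)"
      and 1: "big_step w \<omega> c s u1 r" and 2: "big_step w \<omega> (While b c) r u2 s''"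
    have "u1 = t1 \<and> r = s1" by (rule WhileTrue.IH(1)[OF 1])
    moreover from this 2 have "u2 = t2 \<and> s'' = s2" by (intro WhileTrue.IH(2)) simp
    ultimately show ?thesis using u by simp
  qed
next
  case (Draw s)
  then show ?case by (rule DrawE) simp
next
  case (ReadBit s b bs v)
  from ReadBit.prems show ?case by (rule ReadE) (use ReadBit.hyps in auto)
next
  case (ReadEnd s v)
  from ReadEnd.prems show ?case by (rule ReadE) (use ReadEnd.hyps in auto)
qed

text \<open>
  The only input besides the traces is \<open>n\<close>. The word size is a constant multiple \<open>k\<close> of the number
  of bits of \<open>n\<close>. The output is left in the first \<open>n\<close> cells of an array.
\<close>

definition init_state :: "nat \<Rightarrow> state" where
  "init_state n = \<lparr>var = (\<lambda>_. 0)(''n'' := n), arr = (\<lambda>_ _. 0), rest = [], drawn = 0\<rparr>"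

definition word_size :: "nat \<Rightarrow> nat \<Rightarrow> nat" where
  "word_size k n = k * floorlog 2 n"

definition run ::
  "nat \<Rightarrow> com \<Rightarrow> nat \<Rightarrow> (nat \<Rightarrow> bool list) \<Rightarrow> nat \<Rightarrow> state \<Rightarrow> bool" where
  "run k c n \<omega> t s \<longleftrightarrow> big_step (word_size k n) \<omega> c (init_state n) t s"

definition outputs :: "nat \<Rightarrow> state \<Rightarrow> bool list \<Rightarrow> bool" where
  "outputs n s x \<longleftrightarrow> map (arr s ''out'') [0..<n] = map of_bool x"

end

theory Submission
  imports Defs "HOL-Real_Asymp.Real_Asymp"
begin

text \<open>
  Put \<open>\<beta> = -\<delta>/(1-\<delta>)\<close> and let \<open>gaps v t m\<close> count the embeddings of \<open>v\<close> into \<open>t\<close> as a subsequence that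
  skip \<open>m\<close> letters. If \<open>t\<close> is a trace of \<open>x\<close>, then \<open>\<Sum>m. \<beta>^m * gaps v t m\<close> has expectation
  \<open>(1-\<delta>)^|v|\<close> or \<open>0\<close>, according to whether \<open>v\<close> is a prefix of \<open>x\<close>: in the recursion over the first letter
  of \<open>x\<close> the coefficient of not using it is \<open>\<delta> + (1-\<delta>)\<beta> = 0\<close>. Summing over all start positions \<open>j\<close> of the
  embedding with a weight \<open>\<phi>(j)\<close> gives \<open>(1-\<delta>)^|v|\<close> times the sum of \<open>E \<phi>(Bin(k, 1-\<delta>))\<close> over the
  occurrences \<open>k\<close> of \<open>v\<close> as a factor of \<open>x\<close>.

  The bits of \<open>x\<close> are found from left to right. Let \<open>R = n^(1/3) / log n\<close> and \<open>N = n^(2/3)\<close>, up to rounding.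
  To find the bit at \<open>p\<close>, let \<open>u\<close> be the factor of length \<open>8R\<close> that starts at \<open>a = p - 8R\<close> and ends just before
  \<open>p\<close>, choose a bit \<open>b\<close> such that \<open>v = ub\<close> has no period up to \<open>4R\<close>, and take \<open>\<phi>(j) = c + 1/2 - j\<close> for \<open>j\<close>
  within distance \<open>R\<close> of \<open>c = (1-\<delta>)a\<close> and \<open>\<phi>(j) = 0\<close> elsewhere. The position of a letter in the trace
  has standard deviation about \<open>n^(1/3-\<epsilon>/2)\<close>, which is far below \<open>R\<close>, so that occurrences of \<open>v\<close> far from \<open>a\<close> do
  not matter. If bit \<open>p\<close> is \<open>b\<close>, then \<open>a\<close> is an occurrence, contributing about \<open>1/2\<close>, and by aperiodicity the
  only one nearby. Otherwise there is no occurrence at \<open>a\<close>, nor shortly before \<open>a\<close> (it would overlap with \<open>u\<close>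
  and give \<open>v\<close> a short period), and those to the right of \<open>a\<close> contribute at most about \<open>0\<close>. So comparing the
  empirical mean over the traces with \<open>1/4\<close> decides the bit.

  Since \<open>\<beta>R\<close> is a negative power of \<open>n\<close>, the sum over \<open>m\<close> may be cut off at a constant \<open>K\<close>. The embeddings of
  a nonconstant word that start in a window of length \<open>O(R)\<close> and skip \<open>m\<close> letters number \<open>O(R^m)\<close>, so the
  statistic of one trace is \<open>O(R)\<close>, and by Hoeffding's inequality \<open>N\<close> traces fail with probability
  \<open>exp(-\<Omega>(N/R^2)) = exp(-\<Omega>(log^2 n))\<close>. The sum is computed by dynamic programming in time \<open>O(R)\<close> for each start
  position, hence \<open>O(nNR^2) = O(n^(7/3))\<close> in total. The program does not compute \<open>\<delta>\<close>; it uses the average trace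
  length instead. For small \<open>n\<close> it waits for a trace of length \<open>n\<close>.
\<close>

subsection \<open>Subsequence embeddings\<close>

text \<open>The linear weight is there because of occurrences of \<open>v\<close> shortly to the
  right of \<open>a\<close> when bit \<open>p\<close> is not \<open>b\<close>: aperiodicity of
  \<open>v\<close> does not exclude them, and the indicator of the window would count them like one
  at \<open>a\<close>. By linearity an occurrence at \<open>k\<close> contributes about
  \<open>c + 1/2 - (1-\<delta>)k\<close>, which is 1/2 at \<open>k = a\<close> and, as
  \<open>1-\<delta>\<close> is at least 1/2, at most 0 for every larger \<open>k\<close>. So
  neighbouring positions are told apart although a trace blurs each of them over
  \<open>n^(1/3-\<epsilon>/2)\<close> places. The price is a statistic of size \<open>R\<close> in
  place of 1.

  Several constraints fix the parameters. The union bound over positions and window centres needs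
  \<open>N/R^2\<close> to be large against \<open>log n\<close>; here it is about
  \<open>log^2 n\<close>. The average trace length must give \<open>c\<close>, a number of order
  \<open>n\<close>, up to a small constant; by Chebyshev's inequality this works if
  \<open>n\<delta> = n^(2/3-\<epsilon>)\<close> is small against \<open>N\<close>. Estimating
  \<beta> changes the statistic of a trace by \<open>O(R^3/n)\<close>, a bound that tends to 0
  thanks to the logarithm in \<open>R\<close>.\<close>

text \<open>The letters after the last matched one do not count as skipped.\<close>

fun gaps :: "'a list \<Rightarrow> 'a list \<Rightarrow> nat \<Rightarrow> nat" where
  "gaps [] t m = of_bool (m = 0)"
| "gaps (b # v) [] m = 0"
| "gaps (b # v) (c # t) 0 = (if b = c then gaps v t 0 else 0)"
| "gaps (b # v) (c # t) (Suc m) = (if b = c then gaps v t (Suc m) else 0) + gaps (b # v) t m"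

text \<open>\<open>gaps\<close> recurses on the first letter, as the expectation over a random trace
  does, whereas the dynamic program extends embeddings at their end. With \<open>m\<close> skips in
  all, the last letter is forced to position \<open>length v + m\<close>, and only the number
  \<open>i\<close> of skips among the earlier letters remains to be summed over.\<close>

lemma gaps_snoc:
  "gaps (v @ [b]) t m =
     (if length v + m < length t \<and> t ! (length v + m) = b then \<Sum>i\<le>m. gaps v t i else 0)"
proof (induction v t m rule: gaps.induct)
  case (1 t m)
  show ?case
  proof (induction t arbitrary: m)
    case (Cons c t)
    have [simp]: "(\<Sum>i\<le>k. of_bool (i = 0)) = (1 :: nat)" for k :: nat
      by (induction k) auto
    show ?case using Cons.IH by (cases m) (auto simp: Cons)
  qed auto
next
  case (4 a v c t m)
  have s: "(\<Sum>i\<le>Suc m. gaps (a # v) (c # t) i)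
    = (if a = c then \<Sum>i\<le>Suc m. gaps v t i else 0) + (\<Sum>i\<le>m. gaps (a # v) t i)"
    by (simp only: sum.atMost_Suc_shift gaps.simps) (simp add: sum.distrib)
  show ?case using 4 unfolding s by simp
qed auto

text \<open>\<open>s i\<close> is the number of letters skipped before letter \<open>i\<close> of
  \<open>v\<close> is matched. Writing positions as \<open>i + s i\<close> turns the strict increase
  of positions into monotonicity of \<open>s\<close>.\<close>

lemma gaps_pos_embedding:
  assumes "gaps v t m > 0"
  shows "\<exists>s. mono s \<and> (\<forall>i<length v. s i \<le> m \<and> i + s i < length t \<and> t ! (i + s i) = v ! i)"
  using assms
proof (induction v t m rule: gaps.induct)
  case (1 t m)
  then show ?case by (intro exI[of _ "\<lambda>_. 0"]) (auto simp: mono_def)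
next
  case (3 b v c t)
  from 3 obtain s where s: "mono s"
    "\<forall>i<length v. s i \<le> 0 \<and> i + s i < length t \<and> t ! (i + s i) = v ! i" and [simp]: "c = b"
    by (auto split: if_splits)
  show ?case using s
    by (intro exI[of _ "\<lambda>i. case i of 0 \<Rightarrow> 0 | Suc i \<Rightarrow> s i"])
      (auto simp: mono_def nth_Cons split: nat.splits)
next
  case (4 b v c t m)
  show ?case
  proof (cases "gaps (b # v) t m > 0")
    case True
    with 4 obtain s where s: "mono s"
      "\<forall>i<length (b # v). s i \<le> m \<and> i + s i < length t \<and> t ! (i + s i) = (b # v) ! i" by blast
    show ?thesis using s
      by (intro exI[of _ "\<lambda>i. Suc (s i)"]) (auto simp: mono_def)
  next
    case False
    with 4 obtain s where s: "mono s"
      "\<forall>i<length v. s i \<le> Suc m \<and> i + s i < length t \<and> t ! (i + s i) = v ! i" and [simp]: "c = b"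
      by (auto split: if_splits)
    show ?thesis using s
      by (intro exI[of _ "\<lambda>i. case i of 0 \<Rightarrow> 0 | Suc i \<Rightarrow> s i"])
        (auto simp: mono_def nth_Cons split: nat.splits)
  qed
qed auto

section \<open>Bounds on the number of embeddings with a given number of skips\<close>

lemma gaps_0: "gaps v t 0 = of_bool (length v \<le> length t \<and> (\<forall>i<length v. t ! i = v ! i))"
proof (induction v t "0::nat" rule: gaps.induct)
  case (3 b v c t)
  have *: "(\<forall>i<Suc n. P i) \<longleftrightarrow> P 0 \<and> (\<forall>i<n. P (Suc i))" for P n
    using less_Suc_eq_0_disj by auto
  show ?case using 3 by (auto simp: *)
qed auto

text \<open>Sort the embeddings by the index \<open>d\<close> of the letter before which the first
  skip occurs: the rest of \<open>v\<close> is then embedded behind the skipped letter with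
  \<open>m\<close> further skips. The right side forgets that the first \<open>d\<close> letters
  match, whence only an inequality.\<close>

lemma gaps_Suc_le:
  "gaps v t (Suc m) \<le> (\<Sum>d<length v. gaps (drop d v) (drop (Suc d) t) m)"
proof (induction v arbitrary: t)
  case (Cons b v)
  show ?case
  proof (cases t)
    case [simp]: (Cons c t')
    have "(if b = c then gaps v t' (Suc m) else 0) \<le> (\<Sum>d<length v. gaps (drop d v) (drop (Suc d) t') m)"
      using Cons.IH[of t'] by auto
    then show ?thesis by (simp add: sum.lessThan_Suc_shift del: sum.lessThan_Suc)
  qed auto
qed auto

text \<open>An embedding with one skip is given by the place \<open>d\<close> of the skip: before it
  \<open>v\<close> matches unshifted, from there on shifted by one.\<close>

lemma gaps_1:
  "gaps v t (Suc 0) = card {d. d < length v \<and> Suc (length v) \<le> length t \<and> (\<forall>i<d. t ! i = v ! i)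
      \<and> (\<forall>i. d \<le> i \<and> i < length v \<longrightarrow> t ! Suc i = v ! i)}" (is "_ = card (?D v t)")
proof (induction v arbitrary: t)
  case (Cons b v)
  show ?case
  proof (cases t)
    case [simp]: (Cons c t')
    have "?D (b # v) t = {d. d = 0 \<and> length (b # v) \<le> length t' \<and> (\<forall>i<length (b # v). t' ! i = (b # v) ! i)}
       \<union> Suc ` {d. b = c \<and> d \<in> ?D v t'}" (is "_ = ?A \<union> ?B")
    proof -
      have "d \<in> ?D (b # v) t \<longleftrightarrow> d \<in> ?A \<union> ?B" for d
      proof (cases d)
        case 0
        then show ?thesis by auto
      next
        case [simp]: (Suc e)
        have *: "(\<forall>i<Suc n. P i) \<longleftrightarrow> P 0 \<and> (\<forall>i<n. P (Suc i))" for P n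
          using less_Suc_eq_0_disj by auto
        have **: "(\<forall>i. Suc e \<le> i \<and> i < Suc n \<longrightarrow> P i) \<longleftrightarrow> (\<forall>i. e \<le> i \<and> i < n \<longrightarrow> P (Suc i))" for P n
          by (metis Suc_le_D Suc_le_mono Suc_less_eq)
        have "(\<forall>i<d. t ! i = (b # v) ! i) \<longleftrightarrow> b = c \<and> (\<forall>i<e. t' ! i = v ! i)"
          by (simp only: Suc *) auto
        moreover have "(\<forall>i. d \<le> i \<and> i < length (b # v) \<longrightarrow> t ! Suc i = (b # v) ! i) \<longleftrightarrow>
            (\<forall>i. e \<le> i \<and> i < length v \<longrightarrow> t' ! Suc i = v ! i)"
          by (simp only: Suc list.size add_Suc_right add_0_right **) simp
        ultimately show ?thesis by (simp add: image_iff) blast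
      qed
      then show ?thesis by (rule set_eqI)
    qed
    moreover have "card (?A \<union> ?B) = card ?A + card ?B"
      by (rule card_Un_disjoint) auto
    moreover have "card ?A = gaps (b # v) t' 0"
      by (auto simp: gaps_0)
    moreover have "card ?B = (if b = c then gaps v t' (Suc 0) else 0)"
      by (subst card_image) (auto simp: Cons.IH)
    ultimately show ?thesis by simp
  qed auto
qed auto

text \<open>If the skip can be placed at \<open>d\<close> and at a later \<open>e\<close>, then
  between them \<open>t\<close> agrees with \<open>v\<close> both unshifted and shifted by one, so
  \<open>v\<close> is constant on \<open>d..<e\<close>. All possible places therefore lie in one run
  together with the index behind it, which gives \<open>Suc h\<close> of them.\<close>

lemma gaps_1_le:
  assumes runs: "\<And>i. i + h < length v \<Longrightarrow> \<exists>j\<le>h. v ! (i + j) \<noteq> v ! i"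
  shows "gaps v t (Suc 0) \<le> Suc h"
proof -
  define D where "D = {d. d < length v \<and> Suc (length v) \<le> length t \<and> (\<forall>i<d. t ! i = v ! i)
      \<and> (\<forall>i. d \<le> i \<and> i < length v \<longrightarrow> t ! Suc i = v ! i)}"
  have fin: "finite D" by (auto simp: D_def)
  show ?thesis
  proof (cases "D = {}")
    case True
    then show ?thesis by (simp only: gaps_1 D_def[symmetric]) simp
  next
    case False
    define d where "d = Min D"
    have d: "d \<in> D" using fin False by (simp add: d_def)
    have "e \<le> d + h" if e: "e \<in> D" for e
    proof (rule ccontr)
      assume *: "\<not> e \<le> d + h"
      have dA: "\<And>i. d \<le> i \<Longrightarrow> i < length v \<Longrightarrow> t ! Suc i = v ! i" using d by (auto simp: D_def)
      have eA: "\<And>i. i < e \<Longrightarrow> t ! i = v ! i" and el: "e < length v" using e by (auto simp: D_def)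
      have "v ! (d + j) = v ! d" if "j \<le> h" for j
        using that
      proof (induction j)
        case (Suc j)
        have "t ! Suc (d + j) = v ! (d + j)" using dA Suc.prems el * by simp
        moreover have "t ! Suc (d + j) = v ! Suc (d + j)" using eA Suc.prems * by simp
        ultimately show ?case using Suc by simp
      qed auto
      moreover have "d + h < length v" using * e by (auto simp: D_def)
      ultimately show False using runs by blast
    qed
    moreover have "d \<le> e" if "e \<in> D" for e using that fin by (simp add: d_def)
    ultimately have "D \<subseteq> {d..d + h}" by auto
    then have "card D \<le> card {d..d + h}" by (intro card_mono) auto
    then show ?thesis by (simp only: gaps_1 D_def[symmetric]) simp
  qed
qed

text \<open>Only one of the skips profits from the bound on runs; by \<open>gaps_Suc_le\<close>
  every other skip costs a factor \<open>length v\<close>. Suffixes of \<open>v\<close> inherit the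
  bound on runs.\<close>

lemma gaps_le_runs:
  assumes runs: "\<And>i. i + h < length v \<Longrightarrow> \<exists>j\<le>h. v ! (i + j) \<noteq> v ! i"
  shows "gaps v t (Suc m) \<le> length v ^ m * Suc h"
  using assms
proof (induction m arbitrary: v t)
  case 0
  then show ?case using gaps_1_le[of h v t] by simp
next
  case (Suc m)
  have "gaps (drop d v) (drop (Suc d) t) (Suc m) \<le> length v ^ m * Suc h" if d: "d < length v" for d
  proof -
    have "gaps (drop d v) (drop (Suc d) t) (Suc m) \<le> length (drop d v) ^ m * Suc h"
    proof (rule Suc.IH)
      fix i assume "i + h < length (drop d v)"
      then show "\<exists>j\<le>h. drop d v ! (i + j) \<noteq> drop d v ! i"
        using Suc.prems[of "d + i"] d by (auto simp: add.assoc)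
    qed
    also have "\<dots> \<le> length v ^ m * Suc h"
      by (intro mult_right_mono power_mono) auto
    finally show ?thesis .
  qed
  then have "(\<Sum>d<length v. gaps (drop d v) (drop (Suc d) t) (Suc m)) \<le> (\<Sum>d<length v. length v ^ m * Suc h)"
    by (intro sum_mono) auto
  then have "(\<Sum>d<length v. gaps (drop d v) (drop (Suc d) t) (Suc m)) \<le> length v ^ Suc m * Suc h"
    by (simp add: algebra_simps)
  then show ?case using gaps_Suc_le[of v t "Suc m"] by (rule order.trans[rotated])
qed

text \<open>\<open>X = 1 / (1 - B)\<close> is the sum of the geometric series over the skips before
  one letter, and \<open>X = 1 + B * X\<close> says that a letter is matched at once or after one
  more skip. Hence one factor \<open>X\<close> for each letter of \<open>v\<close>, whatever
  \<open>t\<close> is.\<close>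

lemma gaps_weight_le:
  fixes B :: real
  assumes B: "0 \<le> B" "B < 1"
  shows "(\<Sum>m\<le>M. real (gaps v t m) * B ^ m) \<le> (1 / (1 - B)) ^ length v"
proof (induction v arbitrary: t M)
  case Nil
  have "(\<Sum>m\<le>M. real (of_bool (m = 0)) * B ^ m) = 1"
    by (induction M) auto
  then show ?case by simp
next
  case (Cons b v)
  define X where "X = 1 / (1 - B)"
  have X: "X > 0" "X = 1 + B * X" "1 \<le> X" using B by (auto simp: X_def field_simps)
  show ?case unfolding X_def[symmetric]
  proof (induction t arbitrary: M)
    case (Cons c t)
    have IHv: "(\<Sum>m\<le>M. real (gaps v t m) * B ^ m) \<le> X ^ length v" for M
      using Cons.IH[folded X_def] \<open>\<And>t M. (\<Sum>m\<le>M. real (gaps v t m) * B ^ m) \<le> (1 / (1 - B)) ^ length v\<close>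
      by (simp add: X_def)
    have IHt: "(\<Sum>m\<le>M. real (gaps (b # v) t m) * B ^ m) \<le> X ^ length (b # v)" for M
      using Cons.IH by simp
    have Xm: "X ^ length v \<le> X ^ length (b # v)"
      using X B by simp
    show ?case
    proof (cases M)
      case 0
      have "real (gaps v t 0) \<le> X ^ length v" using IHv[of 0] by simp
      then show ?thesis using 0 Xm X by (auto intro: order.trans)
    next
      case [simp]: (Suc k)
      have "(\<Sum>m\<le>M. real (gaps (b # v) (c # t) m) * B ^ m) =
        (if b = c then (\<Sum>m\<le>M. real (gaps v t m) * B ^ m) else 0)
         + B * (\<Sum>m\<le>k. real (gaps (b # v) t m) * B ^ m)"
        unfolding Suc by (simp only: sum.atMost_Suc_shift gaps.simps)
          (simp add: sum.distrib algebra_simps sum_distrib_left)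
      also have "\<dots> \<le> X ^ length v + B * X ^ length (b # v)"
        using IHv[of M] IHt[of k] B X by (intro add_mono mult_left_mono) auto
      also have "\<dots> = X ^ length v * (1 + B * X)" by (simp add: algebra_simps)
      also have "\<dots> = X ^ length (b # v)" using X(2) by (metis length_Cons power_Suc2)
      finally show ?thesis .
    qed
  qed (use X in auto)
qed

text \<open>Embeddings whose first letter is the first letter of \<open>t\<close>. Applied to
  \<open>drop j t\<close> this isolates the start position \<open>j\<close>, whereas
  \<open>gaps\<close> would also count the embeddings that start later.\<close>

definition starts :: "'a list \<Rightarrow> 'a list \<Rightarrow> nat \<Rightarrow> nat" where
  "starts v t m = (case (v, t) of (b # v', c # t') \<Rightarrow> if b = c then gaps v' t' m else 0 | _ \<Rightarrow> 0)"

lemma starts_simps [simp]: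
  "starts [] t m = 0" "starts v [] m = 0"
  "starts (b # v) (c # t) m = (if b = c then gaps v t m else 0)"
  by (auto simp: starts_def split: list.splits)

lemma starts_pos_embedding:
  assumes "starts v (drop j t) m > 0"
  shows "\<exists>s. mono s \<and> (\<forall>i<length v. s i \<le> m \<and> j + i + s i < length t \<and> t ! (j + i + s i) = v ! i)"
proof -
  obtain b v' where v: "v = b # v'" using assms by (cases v) auto
  obtain t' where t: "drop j t = b # t'" and g: "gaps v' t' m > 0"
    using assms unfolding v by (cases "drop j t") (auto split: if_splits)
  have j: "j < length t" using t by (metis drop_all list.distinct(1) not_le)
  have t': "t' = drop (Suc j) t" using t by (metis drop_Suc list.sel(3) tl_drop)
  have tj: "t ! j = b" using t j by (metis hd_drop_conv_nth list.sel(1))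
  obtain s where s: "mono s" "\<forall>i<length v'. s i \<le> m \<and> i + s i < length t' \<and> t' ! (i + s i) = v' ! i"
    using gaps_pos_embedding[OF g] by blast
  show ?thesis using s j tj unfolding t' v
    by (intro exI[of _ "\<lambda>i. case i of 0 \<Rightarrow> 0 | Suc i \<Rightarrow> s i"])
      (auto simp: mono_def nth_Cons add_ac split: nat.splits)
qed

lemma starts_le_runs:
  assumes runs: "\<And>i. i + h < length v \<Longrightarrow> \<exists>j\<le>h. v ! (i + j) \<noteq> v ! i"
  shows "starts v t (Suc m) \<le> length v ^ m * Suc h"
proof (cases "starts v t (Suc m) = 0")
  case False
  then obtain b v' t' where v: "v = b # v'" and "t = b # t'"
    by (cases v; cases t) (auto split: if_splits)
  then have "starts v t (Suc m) = gaps v' t' (Suc m)" by simp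
  also have "\<dots> \<le> length v' ^ m * Suc h"
  proof (rule gaps_le_runs)
    fix i assume "i + h < length v'"
    then show "\<exists>j\<le>h. v' ! (i + j) \<noteq> v' ! i"
      using runs[of "Suc i"] v by auto
  qed
  also have "\<dots> \<le> length v ^ m * Suc h"
    unfolding v by (intro mult_right_mono power_mono) auto
  finally show ?thesis .
qed auto

section \<open>Density of the start positions of embeddings\<close>

lemma card_window_sparse:
  fixes J :: "nat set"
  assumes "\<And>y. card (J \<inter> {y..<y + g}) \<le> c" and "finite J"
  shows "card (J \<inter> {y..<y + k * g}) \<le> k * c"
proof (induction k)
  case (Suc k)
  have "J \<inter> {y..<y + Suc k * g} \<subseteq> (J \<inter> {y..<y + k * g}) \<union> (J \<inter> {y + k * g..<y + k * g + g})"
    by auto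
  then have "card (J \<inter> {y..<y + Suc k * g})
     \<le> card ((J \<inter> {y..<y + k * g}) \<union> (J \<inter> {y + k * g..<y + k * g + g}))"
    using assms by (intro card_mono) auto
  also have "\<dots> \<le> k * c + c"
    using card_Un_le Suc assms(1)[of "y + k * g"] by (meson add_mono order.trans)
  finally show ?case by simp
qed auto

context
  fixes v t :: "'a list" and c :: 'a and \<rho> h ob m :: nat and J :: "nat set"
  assumes run: "\<And>i. \<rho> \<le> i \<Longrightarrow> i < \<rho> + h \<Longrightarrow> v ! i = c" and rl: "\<rho> + h \<le> length v" "h > 0"
    and ob: "ob < length v" "v ! ob \<noteq> c"
    and J: "finite J" "\<And>j. j \<in> J \<Longrightarrow> starts v (drop j t) m > 0"
begin

text \<open>The embedding from \<open>j\<close> spreads the run over an interval of at most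
  \<open>h + m\<close> places, of which at most \<open>m\<close> carry a letter other than
  \<open>c\<close>. The two inequalities with their margin \<open>m\<close> force the image of
  \<open>ob\<close> under the embedding from \<open>j'\<close> into that interval, so onto one of
  these places; as the shift is at most \<open>m\<close>, each place accounts for at most
  \<open>m + 1\<close> values of \<open>j'\<close>.\<close>

lemma card_starts_in_run:
  assumes j: "j \<in> J"
  shows "card {j' \<in> J. j + \<rho> + m \<le> j' + ob \<and> j' + ob + m < j + \<rho> + h} \<le> m * (m + 1)"
proof -
  have "\<forall>j\<in>J. \<exists>s. mono s \<and> (\<forall>i<length v. s i \<le> m \<and> j + i + s i < length t \<and> t ! (j + i + s i) = v ! i)"
    using starts_pos_embedding J by blast
  then obtain s where s: "\<And>j. j \<in> J \<Longrightarrow> mono (s j)"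
    "\<And>j i. j \<in> J \<Longrightarrow> i < length v \<Longrightarrow> s j i \<le> m \<and> t ! (j + i + s j i) = v ! i" by metis
  define B where "B = {j + \<rho> + s j \<rho>..j + (\<rho> + h - 1) + s j (\<rho> + h - 1)}"
  define im where "im = (\<lambda>i. j + i + s j i) ` {\<rho>..<\<rho> + h}"
  have mono: "s j i \<le> s j i'" if "i \<le> i'" for i i' using s(1)[OF j] that by (auto simp: mono_def)
  have "inj_on (\<lambda>i. j + i + s j i) {\<rho>..<\<rho> + h}"
  proof (rule inj_onI)
    fix i i' assume "j + i + s j i = j + i' + s j i'"
    then show "i = i'" using mono[of i i'] mono[of i' i] by linarith
  qed
  then have cim: "card im = h" unfolding im_def by (simp add: card_image)
  have imB: "im \<subseteq> B"
  proof
    fix q assume "q \<in> im"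
    then obtain i where i: "\<rho> \<le> i" "i < \<rho> + h" "q = j + i + s j i" by (auto simp: im_def)
    have le: "i \<le> \<rho> + h - 1" using i by simp
    then show "q \<in> B" using mono[OF i(1)] mono[OF le] i unfolding B_def atLeastAtMost_iff by linarith
  qed
  have imc: "t ! q = c" if "q \<in> im" for q
    using that s(2)[OF j] run rl unfolding im_def by auto
  define U where "U = {q \<in> B. t ! q \<noteq> c}"
  have "U \<subseteq> B - im" using imc by (auto simp: U_def)
  then have "card U \<le> card (B - im)" by (intro card_mono) (auto simp: B_def)
  also have "\<dots> = card B - h" using imB cim by (subst card_Diff_subset) (auto simp: im_def)
  also have "\<dots> \<le> m"
  proof -
    have "\<rho> + h - 1 < length v" using rl by linarith
    then have "s j (\<rho> + h - 1) \<le> m" using s(2)[OF j] by blast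
    then show ?thesis using rl by (simp add: B_def)
  qed
  finally have U: "card U \<le> m" .
  have "{j' \<in> J. j + \<rho> + m \<le> j' + ob \<and> j' + ob + m < j + \<rho> + h} \<subseteq> (\<Union>q\<in>U. {q - ob - m..q - ob})"
  proof safe
    fix j' assume j': "j' \<in> J" "j + \<rho> + m \<le> j' + ob" "j' + ob + m < j + \<rho> + h"
    have a: "s j' ob \<le> m" "t ! (j' + ob + s j' ob) \<noteq> c" using s(2)[OF j'(1) ob(1)] ob by auto
    have b: "s j \<rho> \<le> m" using s(2)[OF j] rl by auto
    have "j' + ob + s j' ob \<in> U" using a b j' by (auto simp: U_def B_def)
    then show "j' \<in> (\<Union>q\<in>U. {q - ob - m..q - ob})" using a by (intro UN_I) auto
  qed
  then have "card {j' \<in> J. j + \<rho> + m \<le> j' + ob \<and> j' + ob + m < j + \<rho> + h}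
     \<le> card (\<Union>q\<in>U. {q - ob - m..q - ob})"
    by (intro card_mono) (auto simp: U_def B_def)
  also have "\<dots> \<le> (\<Sum>q\<in>U. card {q - ob - m..q - ob})"
    by (intro card_UN_le) (auto simp: U_def B_def)
  also have "\<dots> \<le> (\<Sum>q\<in>U. m + 1)"
    by (intro sum_mono) auto
  also have "\<dots> \<le> m * (m + 1)" using U mult_right_mono[OF U, of "m + 1"] by simp
  finally show ?thesis .
qed

text \<open>If \<open>ob\<close> precedes the run, take the smallest start \<open>j\<close> in the
  window: later starts push \<open>ob\<close> to the right, into the image of the run. If
  \<open>ob\<close> follows the run, take the largest. Only starts within \<open>m\<close> of
  \<open>j\<close> escape, which adds \<open>m + 1\<close> to the bound
  \<open>m * (m + 1)\<close>.\<close>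

lemma card_starts_window:
  assumes ob': "ob + 1 = \<rho> \<or> ob = \<rho> + h" and hm: "m < h"
  shows "card (J \<inter> {y..<y + (h - m)}) \<le> (m + 1)\<^sup>2"
proof (cases "J \<inter> {y..<y + (h - m)} = {}")
  case False
  define A where "A = J \<inter> {y..<y + (h - m)}"
  have fA: "finite A" "A \<noteq> {}" using False by (auto simp: A_def)
  obtain j :: nat and I where j: "j \<in> A" and I: "card I \<le> m + 1" "finite I"
    and sub: "A \<subseteq> I \<union> {j' \<in> J. j + \<rho> + m \<le> j' + ob \<and> j' + ob + m < j + \<rho> + h}"
    using ob'
  proof
    assume o: "ob + 1 = \<rho>"
    have m: "Min A \<in> A" "\<forall>a\<in>A. Min A \<le> a" using fA by auto
    show thesis
    proof (rule that[of "Min A" "{Min A..Min A + m}"])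
      show "A \<subseteq> {Min A..Min A + m} \<union> {j' \<in> J. Min A + \<rho> + m \<le> j' + ob \<and> j' + ob + m < Min A + \<rho> + h}"
      proof
        fix x assume x: "x \<in> A"
        then have "x < Min A + (h - m)" using m by (auto simp: A_def)
        then show "x \<in> {Min A..Min A + m} \<union> {j' \<in> J. Min A + \<rho> + m \<le> j' + ob \<and> j' + ob + m < Min A + \<rho> + h}"
          using x m o hm by (auto simp: A_def)
      qed
    qed (use m in auto)
  next
    assume o: "ob = \<rho> + h"
    have m: "Max A \<in> A" "\<forall>a\<in>A. a \<le> Max A" using fA by auto
    show thesis
    proof (rule that[of "Max A" "{Max A - m..Max A}"])
      show "A \<subseteq> {Max A - m..Max A} \<union> {j' \<in> J. Max A + \<rho> + m \<le> j' + ob \<and> j' + ob + m < Max A + \<rho> + h}"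
      proof
        fix x assume x: "x \<in> A"
        then have "Max A < x + (h - m)" using m by (auto simp: A_def)
        then show "x \<in> {Max A - m..Max A} \<union> {j' \<in> J. Max A + \<rho> + m \<le> j' + ob \<and> j' + ob + m < Max A + \<rho> + h}"
          using x m o hm by (auto simp: A_def)
      qed
    qed (use m in auto)
  qed
  have "card A \<le> card (I \<union> {j' \<in> J. j + \<rho> + m \<le> j' + ob \<and> j' + ob + m < j + \<rho> + h})"
    using sub I J by (intro card_mono) auto
  also have "\<dots> \<le> card I + card {j' \<in> J. j + \<rho> + m \<le> j' + ob \<and> j' + ob + m < j + \<rho> + h}"
    by (rule card_Un_le)
  also have "\<dots> \<le> (m + 1) + m * (m + 1)"
    using I card_starts_in_run[of j] j by (intro add_mono) (auto simp: A_def)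
  also have "\<dots> = (m + 1)\<^sup>2" by (simp add: power2_eq_square)
  finally show ?thesis by (simp add: A_def)
qed auto

end

text \<open>Maximality yields both additional properties: a neighbour of the run with the same
  letter would prolong it, and no run has \<open>h + 1\<close> letters. A neighbour exists because
  \<open>v\<close> is not constant.\<close>

lemma longest_run:
  fixes v :: "'a list"
  assumes nc: "i0 < length v" "j0 < length v" "v ! i0 \<noteq> v ! j0"
  obtains \<rho> h c ob where "\<forall>i. \<rho> \<le> i \<longrightarrow> i < \<rho> + h \<longrightarrow> v ! i = c" "\<rho> + h \<le> length v" "h > 0"
    "ob < length v" "v ! ob \<noteq> c" "ob + 1 = \<rho> \<or> ob = \<rho> + h"
    "\<forall>i. i + h < length v \<longrightarrow> (\<exists>j\<le>h. v ! (i + j) \<noteq> v ! i)"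
proof -
  define P where "P h \<longleftrightarrow> (\<exists>i. i + h \<le> length v \<and> (\<forall>j<h. v ! (i + j) = v ! i))" for h
  have P1: "P 1" unfolding P_def using nc by (intro exI[of _ 0]) auto
  have bnd: "h \<le> length v" if "P h" for h using that by (auto simp: P_def)
  define h where "h = (GREATEST h. P h)"
  have Ph: "P h" unfolding h_def by (rule GreatestI_nat[where P = P and k = 1 and b = "length v"]) (use bnd P1 in auto)
  have hmax: "h' \<le> h" if "P h'" for h'
    unfolding h_def by (rule Greatest_le_nat[where P = P and b = "length v"]) (use bnd that in auto)
  have h0: "h > 0" using hmax[OF P1] by simp
  obtain \<rho> where \<rho>: "\<rho> + h \<le> length v" "\<forall>j<h. v ! (\<rho> + j) = v ! \<rho>" using Ph by (auto simp: P_def)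
  have run: "v ! i = v ! \<rho>" if "\<rho> \<le> i" "i < \<rho> + h" for i
    using \<rho>(2)[rule_format, of "i - \<rho>"] that by auto
  have noP: "\<not> P (Suc h)" using hmax[of "Suc h"] by auto
  have runs: "\<exists>j\<le>h. v ! (i + j) \<noteq> v ! i" if "i + h < length v" for i
    using noP that unfolding P_def by (auto simp: less_Suc_eq_le Suc_le_eq)
  have "\<exists>ob. ob < length v \<and> v ! ob \<noteq> v ! \<rho> \<and> (ob + 1 = \<rho> \<or> ob = \<rho> + h)"
  proof (cases "\<rho> = 0")
    case True
    have "h < length v"
    proof (rule ccontr)
      assume "\<not> h < length v"
      then show False using run[of i0] run[of j0] nc True by auto
    qed
    moreover have "v ! h \<noteq> v ! 0"
    proof
      assume "v ! h = v ! 0"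
      then show False using runs[of 0] run True \<open>h < length v\<close> by (auto simp: le_less)
    qed
    ultimately show ?thesis using True by auto
  next
    case False
    have "v ! (\<rho> - 1) \<noteq> v ! \<rho>"
    proof
      assume e: "v ! (\<rho> - 1) = v ! \<rho>"
      have "\<exists>j\<le>h. v ! (\<rho> - 1 + j) \<noteq> v ! (\<rho> - 1)" using runs[of "\<rho> - 1"] False \<rho> by auto
      then obtain j where j: "j \<le> h" "v ! (\<rho> - 1 + j) \<noteq> v ! (\<rho> - 1)" by blast
      then have "j \<noteq> 0" by (intro notI) auto
      then show False using run[of "\<rho> - 1 + j"] e j False by auto
    qed
    then show ?thesis using False \<rho> h0 by (intro exI[of _ "\<rho> - 1"]) auto
  qed
  then show thesis using that[of \<rho> h "v ! \<rho>"] run \<rho> h0 runs by blast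
qed

text \<open>
  Let \<open>h\<close> be the length of a longest run of \<open>v\<close>. A letter next to that run cannot be matched inside the image of
  the run under another embedding, so in every window of length \<open>h - m\<close> at most \<open>(m + 1)\<^sup>2\<close> positions start
  an embedding, while each position starts \<open>O(h |v| ^ (m - 1))\<close> of them. In the product \<open>h\<close> cancels.
\<close>

lemma sum_starts_le:
  fixes v :: "'a list"
  assumes nc: "i0 < length v" "j0 < length v" "v ! i0 \<noteq> v ! j0"
  shows "(\<Sum>j\<in>{lo..<lo + L}. starts v (drop j t) (Suc m)) \<le> 3 * (m + 2)\<^sup>2 * (L + length v) * length v ^ m"
proof -
  obtain \<rho> h c ob where run: "\<forall>i. \<rho> \<le> i \<longrightarrow> i < \<rho> + h \<longrightarrow> v ! i = c" "\<rho> + h \<le> length v" "h > 0"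
    and ob: "ob < length v" "v ! ob \<noteq> c" "ob + 1 = \<rho> \<or> ob = \<rho> + h"
    and runs: "\<forall>i. i + h < length v \<longrightarrow> (\<exists>j\<le>h. v ! (i + j) \<noteq> v ! i)"
    by (rule longest_run[OF nc])
  define J where "J = {j \<in> {lo..<lo + L}. starts v (drop j t) (Suc m) > 0}"
  have "(\<Sum>j\<in>{lo..<lo + L}. starts v (drop j t) (Suc m)) = (\<Sum>j\<in>J. starts v (drop j t) (Suc m))"
    by (rule sum.mono_neutral_right) (auto simp: J_def)
  also have "\<dots> \<le> (\<Sum>j\<in>J. length v ^ m * Suc h)"
    by (intro sum_mono starts_le_runs) (use runs in auto)
  also have "\<dots> = card J * Suc h * length v ^ m" by (simp add: algebra_simps)
  also have "card J * Suc h \<le> 3 * (m + 2)\<^sup>2 * (L + length v)"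
  \<comment> \<open>If \<open>h\<close> is below a constant that depends on \<open>m\<close>,
    counting all \<open>L\<close> positions is good enough. Otherwise the sparse windows have length
    \<open>g = h - Suc m\<close>, and \<open>Suc h \<le> 3 * g\<close> lets the number of windows
    cancel \<open>h\<close>.\<close>
  proof (cases "h < 2 * (m + 1)")
    case True
    have "card J \<le> card {lo..<lo + L}" by (intro card_mono) (auto simp: J_def)
    then have "card J * Suc h \<le> L * (2 * (m + 1))" using True by (intro mult_mono) auto
    also have "\<dots> \<le> (L + length v) * (3 * (m + 2)\<^sup>2)"
      by (intro mult_mono) (auto simp: power2_eq_square)
    finally show ?thesis by (simp add: mult_ac)
  next
    case False
    define g where "g = h - Suc m"
    have g: "g > 0" "Suc h \<le> 3 * g" "g \<le> length v" using False run by (auto simp: g_def)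
    define k where "k = L div g + 1"
    have kg: "L \<le> k * g"
    proof -
      have "L = L div g * g + L mod g" by simp
      moreover have "L mod g < g" using g by simp
      moreover have "k * g = L div g * g + g" by (simp add: k_def)
      ultimately show ?thesis by linarith
    qed
    have "J \<subseteq> J \<inter> {lo..<lo + k * g}" using kg by (auto simp: J_def)
    then have "card J \<le> card (J \<inter> {lo..<lo + k * g})" by (intro card_mono) (auto simp: J_def)
    also have "\<dots> \<le> k * (m + 2)\<^sup>2"
    proof (rule card_window_sparse)
      show "card (J \<inter> {y..<y + g}) \<le> (m + 2)\<^sup>2" for y
      proof -
        have "card (J \<inter> {y..<y + (h - Suc m)}) \<le> (Suc m + 1)\<^sup>2"
        proof (rule card_starts_window[where v = v and t = t])
          show "Suc m < h" using False by simp
          show "finite J" by (simp add: J_def)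
          show "starts v (drop j t) (Suc m) > 0" if "j \<in> J" for j using that by (simp add: J_def)
          show "v ! i = c" if "\<rho> \<le> i" "i < \<rho> + h" for i using run(1) that by blast
        qed (fact run ob)+
        then show ?thesis by (simp add: g_def)
      qed
    qed (auto simp: J_def)
    finally have "card J * Suc h \<le> (k * (m + 2)\<^sup>2) * (3 * g)" using g by (intro mult_mono) auto
    also have "\<dots> = 3 * (m + 2)\<^sup>2 * (k * g)" by simp
    also have "k * g \<le> L + length v"
    proof -
      have "k * g = L div g * g + g" by (simp add: k_def)
      then show ?thesis using g(3) div_times_less_eq_dividend[of L g] by linarith
    qed
    finally show ?thesis by simp
  qed
  finally show ?thesis by simp
qed

section \<open>Exact occurrences and periods\<close>

lemma starts_0: "v \<noteq> [] \<Longrightarrow>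
  starts v (drop j t) 0 = of_bool (j + length v \<le> length t \<and> (\<forall>i<length v. t ! (j + i) = v ! i))"
proof (induction j arbitrary: t)
  case 0
  have *: "(\<forall>i<Suc n. P i) \<longleftrightarrow> P 0 \<and> (\<forall>i<n. P (Suc i))" for P n
    using less_Suc_eq_0_disj by auto
  show ?case using 0 by (cases v; cases t) (auto simp: gaps_0 *)
next
  case (Suc j)
  then show ?case by (cases t) auto
qed

definition aperiodic_upto :: "nat \<Rightarrow> 'a list \<Rightarrow> bool" where
  "aperiodic_upto Q v \<longleftrightarrow> (\<forall>e\<in>{1..Q}. \<exists>i. i + e < length v \<and> v ! i \<noteq> v ! (i + e))"

text \<open>Two exact occurrences at distance \<open>e\<close> make \<open>e\<close> a period of
  \<open>v\<close>. The condition on \<open>L\<close> keeps all distances in the window at most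
  \<open>Q\<close>.\<close>

lemma sum_starts_0_le:
  assumes a: "aperiodic_upto Q v" "L \<le> Suc Q" and "v \<noteq> []"
  shows "(\<Sum>j\<in>{lo..<lo + L}. starts v (drop j t) 0) \<le> 1"
proof -
  define J where "J = {j \<in> {lo..<lo + L}. j + length v \<le> length t \<and> (\<forall>i<length v. t ! (j + i) = v ! i)}"
  have "j = j'" if "j \<in> J" "j' \<in> J" "j \<le> j'" for j j'
  proof (rule ccontr)
    assume "j \<noteq> j'"
    then have e: "j' - j \<in> {1..Q}" using that a by (auto simp: J_def)
    then obtain i where i: "i + (j' - j) < length v" "v ! i \<noteq> v ! (i + (j' - j))"
      using a unfolding aperiodic_upto_def by blast
    have "v ! i = t ! (j' + i)" using that i by (auto simp: J_def)
    also have "j' + i = j + (i + (j' - j))" using that by simp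
    also have "t ! \<dots> = v ! (i + (j' - j))" using that i unfolding J_def by blast
    finally show False using i by simp
  qed
  then have "\<forall>j\<in>J. \<forall>j'\<in>J. j = j'" by (metis nat_le_linear)
  then have "card J \<le> 1" by (subst card_le_Suc0_iff_eq[unfolded One_nat_def[symmetric]]) (auto simp: J_def)
  moreover have "(\<Sum>j\<in>{lo..<lo + L}. starts v (drop j t) 0) = card J"
    using assms(3) by (simp add: starts_0 J_def sum.If_cases of_bool_def Int_def conj_ac)
  ultimately show ?thesis by simp
qed

subsection \<open>Weighted embeddings in a random trace\<close>

lemma deletion_channel_Nil [simp]: "deletion_channel \<delta> [] = return_pmf []"
  by (simp add: deletion_channel_def)

lemma deletion_channel_Cons:
  "deletion_channel \<delta> (a # x) = bind_pmf (bernoulli_pmf \<delta>)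
     (\<lambda>d. map_pmf (\<lambda>t. if d then t else a # t) (deletion_channel \<delta> x))"
proof -
  have 1: "{..<length (a # x)} = insert 0 (Suc ` {..<length x})"
    by (auto simp: lessThan_Suc_eq_insert_0)
  have 2: "Pi_pmf {..<length x} False (\<lambda>_. bernoulli_pmf \<delta>)
     = map_pmf (\<lambda>g. g \<circ> Suc) (Pi_pmf (Suc ` {..<length x}) False (\<lambda>_. bernoulli_pmf \<delta>))"
    by (rule Pi_pmf_bij_betw) (auto simp: bij_betw_def)
  show ?thesis
    unfolding deletion_channel_def 1 2
    by (subst Pi_pmf_insert)
      (auto simp: pmf.map_comp o_def pair_pmf_def map_bind_pmf bind_map_pmf map_pmf_def[symmetric] bind_return_pmf
        case_prod_unfold bind_assoc_pmf nths_Cons intro!: bind_pmf_cong map_pmf_cong)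
qed

abbreviation E_del :: "real \<Rightarrow> bool list \<Rightarrow> (bool list \<Rightarrow> real) \<Rightarrow> real" where
  "E_del \<delta> x \<equiv> measure_pmf.expectation (deletion_channel \<delta> x)"

lemma length_deletion_channel: "t \<in> set_pmf (deletion_channel \<delta> x) \<Longrightarrow> length t \<le> length x"
proof -
  have "length (nths x A) \<le> length x" for A
    using card_mono[of "{..<length x}" "{i. i < length x \<and> i \<in> A}"] by (auto simp: length_nths)
  then show "t \<in> set_pmf (deletion_channel \<delta> x) \<Longrightarrow> length t \<le> length x"
    unfolding deletion_channel_def by auto
qed

lemma finite_set_deletion_channel [simp]: "finite (set_pmf (deletion_channel \<delta> x))"
  by (rule finite_subset[OF _ finite_lists_length_le[of UNIV "length x"]])
    (auto simp: length_deletion_channel)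

lemma integrable_deletion_channel [simp]:
  "integrable (measure_pmf (deletion_channel \<delta> x)) (f :: _ \<Rightarrow> real)"
  by (rule integrable_measure_pmf_finite) simp

lemma E_del_Cons:
  assumes "0 \<le> \<delta>" "\<delta> \<le> 1"
  shows "E_del \<delta> (a # x) f = \<delta> * E_del \<delta> x f + (1 - \<delta>) * E_del \<delta> x (\<lambda>t. f (a # t))"
  unfolding deletion_channel_Cons
  by (subst pmf_expectation_bind[of UNIV]) (use assms in \<open>auto simp: UNIV_bool\<close>)

lemma gaps_eq_0: "length t < m \<Longrightarrow> gaps v t m = 0"
  by (induction v t m rule: gaps.induct) auto

text \<open>The generating function of the number of skips, at \<beta>. Stopping at
  \<open>length t\<close> loses nothing, by \<open>gaps_eq_0\<close>.\<close>

definition wgaps :: "real \<Rightarrow> 'a list \<Rightarrow> 'a list \<Rightarrow> real" where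
  "wgaps \<beta> v t = (\<Sum>m\<le>length t. \<beta> ^ m * real (gaps v t m))"

definition wstarts :: "real \<Rightarrow> 'a list \<Rightarrow> 'a list \<Rightarrow> real" where
  "wstarts \<beta> v t = (\<Sum>m\<le>length t. \<beta> ^ m * real (starts v t m))"

lemma wgaps_simps [simp]:
  "wgaps \<beta> [] t = 1" "wgaps \<beta> (b # v) [] = 0"
  "wgaps \<beta> (b # v) (c # t) = (if b = c then wgaps \<beta> v t else 0) + \<beta> * wgaps \<beta> (b # v) t"
proof -
  have "(\<Sum>m\<le>k. \<beta> ^ m * of_bool (m = 0)) = (1 :: real)" for k
    by (induction k) auto
  then show "wgaps \<beta> [] t = 1" by (simp add: wgaps_def)
  show "wgaps \<beta> (b # v) [] = 0" by (simp add: wgaps_def)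
  have "wgaps \<beta> v t = (\<Sum>m\<le>Suc (length t). \<beta> ^ m * real (gaps v t m))"
    by (simp add: wgaps_def gaps_eq_0)
  also have "\<dots> = real (gaps v t 0) + (\<Sum>m\<le>length t. \<beta> ^ Suc m * real (gaps v t (Suc m)))"
    by (subst sum.atMost_Suc_shift) simp
  finally show "wgaps \<beta> (b # v) (c # t) = (if b = c then wgaps \<beta> v t else 0) + \<beta> * wgaps \<beta> (b # v) t"
    by (simp add: wgaps_def[of _ "b # v"] sum.atMost_Suc_shift sum.distrib algebra_simps sum_distrib_left
        del: sum.atMost_Suc)
qed

lemma wstarts_simps [simp]:
  "wstarts \<beta> v [] = 0"
  "wstarts \<beta> (b # v) (c # t) = (if b = c then wgaps \<beta> v t else 0)"
  by (auto simp: wstarts_def wgaps_def gaps_eq_0)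

context
  fixes \<delta> \<beta> :: real
  assumes \<delta>: "0 < \<delta>" "\<delta> < 1" and \<beta>: "\<beta> = - \<delta> / (1 - \<delta>)"
begin

lemma E_wgaps:
  "E_del \<delta> x (wgaps \<beta> v) = (1 - \<delta>) ^ length v * of_bool (take (length v) x = v)"
proof (induction x arbitrary: v)
  case Nil
  then show ?case by (cases v) auto
next
  case (Cons a x)
  show ?case
  proof (cases v)
    case [simp]: (Cons b v')
    have "E_del \<delta> (a # x) (wgaps \<beta> v) = (\<delta> + (1 - \<delta>) * \<beta>) * E_del \<delta> x (wgaps \<beta> v)
        + (1 - \<delta>) * (if b = a then E_del \<delta> x (wgaps \<beta> v') else 0)"
      using \<delta> by (subst E_del_Cons) (auto simp: algebra_simps)
    also have "\<delta> + (1 - \<delta>) * \<beta> = 0" using \<delta> by (simp add: \<beta> field_simps)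
    finally show ?thesis using Cons.IH[of v'] by auto
  qed (use \<delta> in \<open>auto simp: E_del_Cons Cons.IH\<close>)
qed

end

text \<open>The expectation of \<open>\<phi>\<close> under the binomial distribution with parameters \<open>k\<close> and \<open>1 - \<delta>\<close>\<close>

fun bexp :: "real \<Rightarrow> (nat \<Rightarrow> real) \<Rightarrow> nat \<Rightarrow> real" where
  "bexp \<delta> \<phi> 0 = \<phi> 0"
| "bexp \<delta> \<phi> (Suc k) = \<delta> * bexp \<delta> \<phi> k + (1 - \<delta>) * bexp \<delta> (\<lambda>j. \<phi> (Suc j)) k"

definition loc_sum :: "real \<Rightarrow> (nat \<Rightarrow> real) \<Rightarrow> 'a list \<Rightarrow> 'a list \<Rightarrow> real" where
  "loc_sum \<beta> \<phi> v t = (\<Sum>j<length t. \<phi> j * wstarts \<beta> v (drop j t))"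

lemma loc_sum_simps [simp]:
  "loc_sum \<beta> \<phi> v [] = 0"
  "loc_sum \<beta> \<phi> v (a # t) = \<phi> 0 * wstarts \<beta> v (a # t) + loc_sum \<beta> (\<lambda>j. \<phi> (Suc j)) v t"
  unfolding loc_sum_def by (simp_all add: sum.lessThan_Suc_shift del: sum.lessThan_Suc)

text \<open>Induction on \<open>x\<close> with \<phi> arbitrary: a deleted first letter leaves the
  positions in the rest of the trace as they are, a surviving one shifts them by one. This is the
  recursion of \<open>bexp\<close>, and only the occurrence at 0 is new in each step;
  \<open>E_wgaps\<close> evaluates it.\<close>

lemma E_loc_sum:
  fixes \<delta> \<beta> :: real
  assumes \<delta>: "0 < \<delta>" "\<delta> < 1" and \<beta>: "\<beta> = - \<delta> / (1 - \<delta>)" and v: "v \<noteq> []"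
  shows "E_del \<delta> x (loc_sum \<beta> \<phi> v) =
    (1 - \<delta>) ^ length v * (\<Sum>k<length x. bexp \<delta> \<phi> k * of_bool (take (length v) (drop k x) = v))"
proof (induction x arbitrary: \<phi>)
  case (Cons a x)
  obtain b v' where [simp]: "v = b # v'" using v by (cases v) auto
  define A where "A = E_del \<delta> x (loc_sum \<beta> \<phi> v)"
  define A' where "A' = E_del \<delta> x (loc_sum \<beta> (\<lambda>j. \<phi> (Suc j)) v)"
  have "E_del \<delta> (a # x) (loc_sum \<beta> \<phi> v) = \<delta> * A + (1 - \<delta>) *
     E_del \<delta> x (\<lambda>t. \<phi> 0 * wstarts \<beta> v (a # t) + loc_sum \<beta> (\<lambda>j. \<phi> (Suc j)) v t)"
    using \<delta> by (subst E_del_Cons) (auto simp: A_def simp del: wstarts_simps)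
  also have "E_del \<delta> x (\<lambda>t. \<phi> 0 * wstarts \<beta> v (a # t) + loc_sum \<beta> (\<lambda>j. \<phi> (Suc j)) v t)
     = \<phi> 0 * (if b = a then E_del \<delta> x (wgaps \<beta> v') else 0) + A'"
    by (simp add: A'_def)
  also have "E_del \<delta> x (wgaps \<beta> v') = (1 - \<delta>) ^ length v' * of_bool (take (length v') x = v')"
    by (rule E_wgaps[OF \<delta> \<beta>])
  also have "\<delta> * A + (1 - \<delta>) * (\<phi> 0 * (if b = a then (1 - \<delta>) ^ length v' * of_bool (take (length v') x = v') else 0) + A')
    = (1 - \<delta>) ^ length v * (\<phi> 0 * of_bool (take (length v) (a # x) = v)) + (\<delta> * A + (1 - \<delta>) * A')"
    by (auto simp: algebra_simps)
  also have "\<delta> * A + (1 - \<delta>) * A' = (1 - \<delta>) ^ length v *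
       (\<Sum>k<length x. (\<delta> * bexp \<delta> \<phi> k + (1 - \<delta>) * bexp \<delta> (\<lambda>j. \<phi> (Suc j)) k) * of_bool (take (length v) (drop k x) = v))"
  proof -
    define P where "P \<phi> = (\<Sum>k<length x. bexp \<delta> \<phi> k * of_bool (take (length v) (drop k x) = v))" for \<phi>
    have "(\<Sum>k<length x. (\<delta> * bexp \<delta> \<phi> k + (1 - \<delta>) * bexp \<delta> (\<lambda>j. \<phi> (Suc j)) k) * of_bool (take (length v) (drop k x) = v))
      = \<delta> * P \<phi> + (1 - \<delta>) * P (\<lambda>j. \<phi> (Suc j))"
      unfolding P_def sum_distrib_left sum.distrib[symmetric] by (intro sum.cong) (auto simp: algebra_simps)
    moreover have "A = (1 - \<delta>) ^ length v * P \<phi>" "A' = (1 - \<delta>) ^ length v * P (\<lambda>j. \<phi> (Suc j))"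
      unfolding A_def A'_def P_def by (rule Cons.IH)+
    ultimately show ?thesis by (simp only:) (simp add: algebra_simps)
  qed
  also have "(1 - \<delta>) ^ length v * (\<phi> 0 * of_bool (take (length v) (a # x) = v)) + (1 - \<delta>) ^ length v *
       (\<Sum>k<length x. (\<delta> * bexp \<delta> \<phi> k + (1 - \<delta>) * bexp \<delta> (\<lambda>j. \<phi> (Suc j)) k) * of_bool (take (length v) (drop k x) = v))
     = (1 - \<delta>) ^ length v * (\<phi> 0 * of_bool (take (length v) (a # x) = v) +
       (\<Sum>k<length x. (\<delta> * bexp \<delta> \<phi> k + (1 - \<delta>) * bexp \<delta> (\<lambda>j. \<phi> (Suc j)) k) * of_bool (take (length v) (drop k x) = v)))"
    by (rule distrib_left[symmetric])
  also have "\<phi> 0 * of_bool (take (length v) (a # x) = v)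
       + (\<Sum>k<length x. (\<delta> * bexp \<delta> \<phi> k + (1 - \<delta>) * bexp \<delta> (\<lambda>j. \<phi> (Suc j)) k) * of_bool (take (length v) (drop k x) = v))
     = (\<Sum>k<length (a # x). bexp \<delta> \<phi> k * of_bool (take (length v) (drop k (a # x)) = v))"
    by (simp add: sum.lessThan_Suc_shift del: sum.lessThan_Suc \<open>v = b # v'\<close>)
  finally show ?case .
qed auto

section \<open>Moments and tails of the binomial distribution\<close>

lemma E_del_length:
  assumes "0 \<le> \<delta>" "\<delta> \<le> 1"
  shows "E_del \<delta> x (\<lambda>t. \<phi> (length t)) = bexp \<delta> \<phi> (length x)"
proof (induction x arbitrary: \<phi>)
  case (Cons a x)
  then show ?case by (simp add: E_del_Cons[OF assms] Cons.IH[of "\<lambda>j. \<phi> (Suc j)"])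
qed auto

lemma bexp_lincomb: "bexp \<delta> (\<lambda>j. a * \<phi> j + b * \<psi> j) k = a * bexp \<delta> \<phi> k + b * bexp \<delta> \<psi> k"
  by (induction k arbitrary: \<phi> \<psi>) (auto simp: algebra_simps)

lemma bexp_cmult: "bexp \<delta> (\<lambda>j. a * \<phi> j) k = a * bexp \<delta> \<phi> k"
  using bexp_lincomb[of \<delta> a \<phi> 0 "\<lambda>_. 0" k] by simp

lemma bexp_add: "bexp \<delta> (\<lambda>j. \<phi> j + \<psi> j) k = bexp \<delta> \<phi> k + bexp \<delta> \<psi> k"
  using bexp_lincomb[of \<delta> 1 \<phi> 1 \<psi> k] by simp

lemma bexp_mono:
  assumes "0 \<le> \<delta>" "\<delta> \<le> 1" "\<And>j. j \<le> k \<Longrightarrow> \<phi> j \<le> \<psi> j"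
  shows "bexp \<delta> \<phi> k \<le> bexp \<delta> \<psi> k"
  using assms(3)
proof (induction k arbitrary: \<phi> \<psi>)
  case (Suc k)
  have "bexp \<delta> \<phi> k \<le> bexp \<delta> \<psi> k" "bexp \<delta> (\<lambda>j. \<phi> (Suc j)) k \<le> bexp \<delta> (\<lambda>j. \<psi> (Suc j)) k"
    using Suc.prems by (auto intro!: Suc.IH)
  then show ?case using assms by (auto intro!: add_mono mult_left_mono)
qed auto

lemma bexp_const [simp]: "bexp \<delta> (\<lambda>_. c) k = c"
  by (induction k) (auto simp: algebra_simps)

lemma bexp_mean: "bexp \<delta> real k = (1 - \<delta>) * real k"
proof -
  \<comment> \<open>The additive constant makes the claim stable under the shift
    \<open>\<phi> (Suc j)\<close> in the recursion.\<close>
  have "bexp \<delta> (\<lambda>j. real j + c) k = (1 - \<delta>) * real k + c" for c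
  proof (induction k arbitrary: c)
    case (Suc k)
    have e: "(\<lambda>j. real (Suc j) + c) = (\<lambda>j. real j + (1 + c))" by auto
    show ?case unfolding bexp.simps e Suc by (simp add: algebra_simps)
  qed auto
  from this[of 0] show ?thesis by simp
qed

lemma bexp_square: "bexp \<delta> (\<lambda>j. (real j - c)\<^sup>2) k = real k * \<delta> * (1 - \<delta>) + ((1 - \<delta>) * real k - c)\<^sup>2"
proof (induction k arbitrary: c)
  case (Suc k)
  have e: "(\<lambda>j. (real (Suc j) - c)\<^sup>2) = (\<lambda>j. (real j - (c - 1))\<^sup>2)" by (auto simp: algebra_simps)
  show ?case unfolding bexp.simps e Suc by (simp add: algebra_simps power2_eq_square)
qed auto

lemma bexp_exp: "bexp \<delta> (\<lambda>j. exp (l * real j)) k = (\<delta> + (1 - \<delta>) * exp l) ^ k"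
proof (induction k)
  case (Suc k)
  have "(\<lambda>j. exp (l * real (Suc j))) = (\<lambda>j. exp l * exp (l * real j))"
    by (auto simp: algebra_simps exp_add)
  then show ?case by (simp add: Suc bexp_cmult algebra_simps)
qed auto

lemma exp_le_quadratic:
  fixes y :: real
  assumes "\<bar>y\<bar> \<le> 1"
  shows "exp y \<le> 1 + y + y\<^sup>2"
proof (cases "y \<ge> 0")
  case True
  then show ?thesis using exp_bound[of y] assms by simp
next
  case False
  define z where "z = - y"
  have z: "0 \<le> z" "z \<le> 1" using False assms by (auto simp: z_def)
  \<comment> \<open>The claim for \<open>y = - z\<close> amounts to
    \<open>1 \<le> (1 - z + z^2) exp z\<close>, so a lower Taylor bound for \<open>exp z\<close>
    suffices.\<close>
  have "1 \<le> (1 - z + z\<^sup>2) * (1 + z + z\<^sup>2 / 2)"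
  proof -
    have "(1 - z + z\<^sup>2) * (1 + z + z\<^sup>2 / 2) = 1 + z\<^sup>2 / 2 + z ^ 3 / 2 + z ^ 4 / 2"
      by (simp add: field_simps power2_eq_square power3_eq_cube power4_eq_xxxx)
    then show ?thesis using z by simp
  qed
  also have "\<dots> \<le> (1 - z + z\<^sup>2) * exp z"
    using z exp_lower_Taylor_quadratic[of z] by (intro mult_left_mono) auto
  finally have "exp (- z) \<le> 1 - z + z\<^sup>2"
    by (simp add: exp_minus field_simps)
  then show ?thesis by (simp add: z_def)
qed

text \<open>The factor \<delta> in the exponent is essential: it comes from the variance
  \<open>\<delta> (1-\<delta>)\<close> of a coin. A bound through the range of the coins alone would
  give deviations of order \<open>n^(1/2)\<close> instead of \<open>n^(1/3-\<epsilon>/2)\<close>,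
  too large for windows of length \<open>R\<close>.\<close>

lemma bexp_exp_centered:
  assumes \<delta>: "0 \<le> \<delta>" "\<delta> \<le> 1" and l: "\<bar>l\<bar> \<le> 1"
  shows "bexp \<delta> (\<lambda>j. exp (l * (real j - (1 - \<delta>) * real k))) k \<le> exp (real k * \<delta> * l\<^sup>2)"
proof -
  have "(\<lambda>j. exp (l * (real j - (1 - \<delta>) * real k))) = (\<lambda>j. exp (- l * (1 - \<delta>)) ^ k * exp (l * real j))"
    by (auto simp: exp_of_nat_mult[symmetric] exp_add[symmetric] algebra_simps)
  then have "bexp \<delta> (\<lambda>j. exp (l * (real j - (1 - \<delta>) * real k))) k
    = (exp (- l * (1 - \<delta>)) * (\<delta> + (1 - \<delta>) * exp l)) ^ k"
    by (simp add: bexp_cmult bexp_exp power_mult_distrib)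
  also have "exp (- l * (1 - \<delta>)) * (\<delta> + (1 - \<delta>) * exp l)
      = \<delta> * exp (- l * (1 - \<delta>)) + (1 - \<delta>) * exp (l * \<delta>)"
    by (simp add: algebra_simps exp_add[symmetric])
  also have "(\<delta> * exp (- l * (1 - \<delta>)) + (1 - \<delta>) * exp (l * \<delta>)) ^ k \<le> exp (\<delta> * l\<^sup>2) ^ k"
  proof (rule power_mono)
    have a: "\<bar>- l * (1 - \<delta>)\<bar> \<le> 1" "\<bar>l * \<delta>\<bar> \<le> 1"
      using l \<delta> by (auto simp: abs_mult intro!: mult_le_one)
    have "\<delta> * exp (- l * (1 - \<delta>)) + (1 - \<delta>) * exp (l * \<delta>)
       \<le> \<delta> * (1 + (- l * (1 - \<delta>)) + (- l * (1 - \<delta>))\<^sup>2) + (1 - \<delta>) * (1 + l * \<delta> + (l * \<delta>)\<^sup>2)"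
      using exp_le_quadratic[OF a(1)] exp_le_quadratic[OF a(2)] \<delta> by (intro add_mono mult_left_mono) auto
    also have "\<dots> = 1 + \<delta> * (1 - \<delta>) * l\<^sup>2"
      by (simp add: algebra_simps power2_eq_square)
    also have "\<dots> \<le> 1 + \<delta> * 1 * l\<^sup>2"
      using \<delta> by (intro add_left_mono mult_right_mono mult_left_mono) auto
    also have "\<dots> \<le> exp (\<delta> * l\<^sup>2)" using exp_ge_add_one_self[of "\<delta> * l\<^sup>2"] by simp
    finally show "\<delta> * exp (- l * (1 - \<delta>)) + (1 - \<delta>) * exp (l * \<delta>) \<le> exp (\<delta> * l\<^sup>2)" .
  qed (use \<delta> in auto)
  also have "\<dots> = exp (real k * \<delta> * l\<^sup>2)"
    by (simp add: exp_of_nat_mult[symmetric] mult_ac)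
  finally show ?thesis .
qed

text \<open>Chernoff's method for both sides at once. The parameter \<open>l\<close> stays free; it
  is chosen later, about the reciprocal of the standard deviation when \<epsilon> is small.\<close>

lemma bexp_tail:
  assumes \<delta>: "0 \<le> \<delta>" "\<delta> \<le> 1" and l: "0 \<le> l" "l \<le> 1" and k: "k \<le> n"
  shows "bexp \<delta> (\<lambda>j. of_bool (\<bar>real j - (1 - \<delta>) * real k\<bar> \<ge> \<tau>)) k \<le> 2 * exp (real n * \<delta> * l\<^sup>2 - l * \<tau>)"
proof -
  let ?D = "\<lambda>j. real j - (1 - \<delta>) * real k"
  have "bexp \<delta> (\<lambda>j. of_bool (\<bar>?D j\<bar> \<ge> \<tau>)) k
     \<le> bexp \<delta> (\<lambda>j. exp (- l * \<tau>) * exp (l * ?D j) + exp (- l * \<tau>) * exp (- l * ?D j)) k"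
  proof (rule bexp_mono[OF \<delta>])
    fix j
    show "of_bool (\<bar>?D j\<bar> \<ge> \<tau>) \<le> exp (- l * \<tau>) * exp (l * ?D j) + exp (- l * \<tau>) * exp (- l * ?D j)"
    proof (cases "\<bar>?D j\<bar> \<ge> \<tau>")
      case True
      then have "?D j \<ge> \<tau> \<or> - ?D j \<ge> \<tau>" by linarith
      then have "1 \<le> exp (l * (?D j - \<tau>)) \<or> 1 \<le> exp (l * (- ?D j - \<tau>))"
        using l by auto
      then have "1 \<le> exp (l * (?D j - \<tau>)) + exp (l * (- ?D j - \<tau>))"
        by (metis add_increasing add_increasing2 exp_ge_zero)
      then show ?thesis using True by (simp add: exp_add[symmetric] algebra_simps)
    qed auto
  qed
  also have "\<dots> = exp (- l * \<tau>) * bexp \<delta> (\<lambda>j. exp (l * ?D j)) k + exp (- l * \<tau>) * bexp \<delta> (\<lambda>j. exp (- l * ?D j)) k"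
    by (simp only: bexp_add bexp_cmult)
  also have "\<dots> \<le> exp (- l * \<tau>) * exp (real k * \<delta> * l\<^sup>2) + exp (- l * \<tau>) * exp (real k * \<delta> * (- l)\<^sup>2)"
    using l by (intro add_mono mult_left_mono bexp_exp_centered[OF \<delta>]) auto
  also have "\<dots> = 2 * exp (real k * \<delta> * l\<^sup>2 - l * \<tau>)"
    by (simp add: exp_add[symmetric] algebra_simps)
  also have "\<dots> \<le> 2 * exp (real n * \<delta> * l\<^sup>2 - l * \<tau>)"
    using k \<delta> by (auto intro!: mult_right_mono)
  finally show ?thesis .
qed

subsection \<open>The truncated statistic\<close>

lemma starts_weight_le:
  fixes B :: real
  assumes B: "0 \<le> B" "B < 1"
  shows "(\<Sum>m\<le>M. B ^ m * real (starts v t m)) \<le> (1 / (1 - B)) ^ length v"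
proof (cases "\<exists>b v' t'. v = b # v' \<and> t = b # t'")
  case True
  then obtain b v' t' where [simp]: "v = b # v'" "t = b # t'" by auto
  have "(\<Sum>m\<le>M. B ^ m * real (starts v t m)) \<le> (1 / (1 - B)) ^ length v'"
    using gaps_weight_le[OF B, of v' t' M] by (simp add: mult.commute)
  also have "\<dots> \<le> (1 / (1 - B)) ^ length v"
    using B by (intro power_increasing) auto
  finally show ?thesis .
next
  case False
  then have "starts v t m = 0" for m
    by (cases v; cases t) auto
  then show ?thesis using B by simp
qed

text \<open>This fixes the comparison weight: with \<open>B = 1 / (2 (M + 1))\<close> the bound of
  \<open>gaps_weight_le\<close> is at most 2 for all words of up to \<open>M\<close>
  letters.\<close>

lemma weight_inverse_le_2:
  assumes "L \<le> M"
  shows "(1 / (1 - 1 / (2 * real (Suc M)))) ^ L \<le> 2"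
proof -
  have "1 - real L * (1 / (2 * real (Suc M))) \<le> (1 - 1 / (2 * real (Suc M))) ^ L"
    using Bernoulli_inequality[of "- 1 / (2 * real (Suc M))" L] by (simp add: field_simps)
  moreover have "real L * (1 / (2 * real (Suc M))) \<le> 1 / 2"
    using assms by (simp add: field_simps)
  ultimately have "1 / 2 \<le> (1 - 1 / (2 * real (Suc M))) ^ L" by linarith
  then have "1 / (1 - 1 / (2 * real (Suc M))) ^ L \<le> 1 / (1 / 2)"
    by (intro divide_left_mono) auto
  then show ?thesis by (simp add: power_divide)
qed

definition stat :: "nat \<Rightarrow> real \<Rightarrow> real \<Rightarrow> nat set \<Rightarrow> 'a list \<Rightarrow> 'a list \<Rightarrow> real" where
  "stat K \<beta> c S v t =
     (\<Sum>j\<in>S. (c + 1 / 2 - real j) * (\<Sum>m\<le>K. \<beta> ^ m * real (starts v (drop j t) m)))"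

text \<open>With \<open>b = \<bar>\<beta>\<bar>\<close>, the statistic without its signs and its
  linear weight. It controls the size of \<open>stat\<close> as well as its dependence on
  \<open>c\<close>.\<close>

definition mass :: "nat \<Rightarrow> real \<Rightarrow> nat set \<Rightarrow> 'a list \<Rightarrow> 'a list \<Rightarrow> real" where
  "mass K b S v t = (\<Sum>j\<in>S. \<Sum>m\<le>K. b ^ m * real (starts v (drop j t) m))"

text \<open>Compare with a larger weight \<open>B\<close> for which the full sum is still bounded:
  beyond \<open>K\<close> every term gains the factor
  \<open>(\<bar>\<beta>\<bar> / B) ^ Suc K\<close>. With \<open>B\<close> of order
  \<open>1/R\<close> the ratio is a negative power of \<open>n\<close>, so a constant
  \<open>K\<close> can be enough.\<close>

lemma wstarts_trunc:
  fixes \<beta> B :: real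
  assumes B: "0 < B" "B < 1" "\<bar>\<beta>\<bar> \<le> B"
  shows "\<bar>wstarts \<beta> v t - (\<Sum>m\<le>K. \<beta> ^ m * real (starts v t m))\<bar>
    \<le> (\<bar>\<beta>\<bar> / B) ^ Suc K * (1 / (1 - B)) ^ length v"
proof -
  define M where "M = max K (length t)"
  have z: "starts v t m = 0" if "m > length t" for m
    using that by (cases v; cases t) (auto simp: gaps_eq_0)
  have "wstarts \<beta> v t = (\<Sum>m\<le>M. \<beta> ^ m * real (starts v t m))"
    unfolding wstarts_def by (rule sum.mono_neutral_left) (auto simp: M_def z)
  also have "\<dots> = (\<Sum>m\<le>K. \<beta> ^ m * real (starts v t m)) + (\<Sum>m\<in>{K<..M}. \<beta> ^ m * real (starts v t m))"
    by (subst sum.union_disjoint[symmetric]) (auto intro!: sum.cong simp: M_def)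
  finally have "\<bar>wstarts \<beta> v t - (\<Sum>m\<le>K. \<beta> ^ m * real (starts v t m))\<bar>
      = \<bar>\<Sum>m\<in>{K<..M}. \<beta> ^ m * real (starts v t m)\<bar>" by simp
  also have "\<dots> \<le> (\<Sum>m\<in>{K<..M}. \<bar>\<beta> ^ m * real (starts v t m)\<bar>)" by (rule sum_abs)
  also have "\<dots> \<le> (\<Sum>m\<in>{K<..M}. (\<bar>\<beta>\<bar> / B) ^ Suc K * (B ^ m * real (starts v t m)))"
  proof (intro sum_mono)
    fix m assume m: "m \<in> {K<..M}"
    have "\<bar>\<beta>\<bar> ^ m = (\<bar>\<beta>\<bar> / B) ^ m * B ^ m" using B by (simp add: power_divide)
    also have "(\<bar>\<beta>\<bar> / B) ^ m \<le> (\<bar>\<beta>\<bar> / B) ^ Suc K"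
      using B m by (intro power_decreasing) auto
    finally have "\<bar>\<beta>\<bar> ^ m \<le> (\<bar>\<beta>\<bar> / B) ^ Suc K * B ^ m" using B by simp
    then show "\<bar>\<beta> ^ m * real (starts v t m)\<bar> \<le> (\<bar>\<beta>\<bar> / B) ^ Suc K * (B ^ m * real (starts v t m))"
      by (simp add: abs_mult power_abs mult_right_mono mult.assoc[symmetric] del: power_Suc)
  qed
  also have "\<dots> \<le> (\<Sum>m\<le>M. (\<bar>\<beta>\<bar> / B) ^ Suc K * (B ^ m * real (starts v t m)))"
    using B by (intro sum_mono2) auto
  also have "\<dots> = (\<bar>\<beta>\<bar> / B) ^ Suc K * (\<Sum>m\<le>M. B ^ m * real (starts v t m))"
    by (simp add: sum_distrib_left)
  also have "\<dots> \<le> (\<bar>\<beta>\<bar> / B) ^ Suc K * (1 / (1 - B)) ^ length v"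
    using B by (intro mult_left_mono starts_weight_le) auto
  finally show ?thesis .
qed

lemma stat_trunc:
  fixes \<beta> B :: real
  assumes B: "0 < B" "B < 1" "\<bar>\<beta>\<bar> \<le> B" and S: "finite S" "\<And>j. j \<in> S \<Longrightarrow> \<bar>c + 1 / 2 - real j\<bar> \<le> A"
  shows "\<bar>stat K \<beta> c S v t - loc_sum \<beta> (\<lambda>j. (c + 1 / 2 - real j) * of_bool (j \<in> S)) v t\<bar>
    \<le> real (card S) * A * ((\<bar>\<beta>\<bar> / B) ^ Suc K * (1 / (1 - B)) ^ length v)"
proof -
  \<comment> \<open>The two statistics range over different positions. Outside \<open>S\<close> the
    weight vanishes and past the end of \<open>t\<close> the factor \<open>wstarts\<close> does, so
    both sums extend to the union.\<close>
  have "loc_sum \<beta> (\<lambda>j. (c + 1 / 2 - real j) * of_bool (j \<in> S)) v t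
    = (\<Sum>j\<in>{..<length t} \<union> S. (c + 1 / 2 - real j) * of_bool (j \<in> S) * wstarts \<beta> v (drop j t))"
    unfolding loc_sum_def by (rule sum.mono_neutral_left) (auto simp: S)
  also have "\<dots> = (\<Sum>j\<in>S. (c + 1 / 2 - real j) * wstarts \<beta> v (drop j t))"
    by (rule sum.mono_neutral_cong_right) (auto simp: S)
  finally have "stat K \<beta> c S v t - loc_sum \<beta> (\<lambda>j. (c + 1 / 2 - real j) * of_bool (j \<in> S)) v t
     = (\<Sum>j\<in>S. (c + 1 / 2 - real j) * ((\<Sum>m\<le>K. \<beta> ^ m * real (starts v (drop j t) m)) - wstarts \<beta> v (drop j t)))"
    by (simp add: stat_def sum_subtractf right_diff_distrib)
  also have "\<bar>\<dots>\<bar> \<le> (\<Sum>j\<in>S. A * ((\<bar>\<beta>\<bar> / B) ^ Suc K * (1 / (1 - B)) ^ length v))"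
  proof (intro order.trans[OF sum_abs] sum_mono)
    fix j assume "j \<in> S"
    have "\<bar>(\<Sum>m\<le>K. \<beta> ^ m * real (starts v (drop j t) m)) - wstarts \<beta> v (drop j t)\<bar>
        \<le> (\<bar>\<beta>\<bar> / B) ^ Suc K * (1 / (1 - B)) ^ length v"
      using wstarts_trunc[OF B, of v "drop j t" K] by (simp add: abs_minus_commute)
    then show "\<bar>(c + 1 / 2 - real j) * ((\<Sum>m\<le>K. \<beta> ^ m * real (starts v (drop j t) m)) - wstarts \<beta> v (drop j t))\<bar>
        \<le> A * ((\<bar>\<beta>\<bar> / B) ^ Suc K * (1 / (1 - B)) ^ length v)"
      unfolding abs_mult using S(2)[OF \<open>j \<in> S\<close>] by (intro mult_mono) auto
  qed
  finally show ?thesis by simp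
qed

text \<open>The term \<open>m = 0\<close> is at most 1 by aperiodicity. A term with
  \<open>m \<ge> 1\<close> is of order \<open>b^m (L + |v|) |v|^(m-1)\<close> by
  \<open>sum_starts_le\<close>, which \<open>b |v| \<le> 1\<close> reduces to
  \<open>b (L + |v|)\<close>. This makes the statistic of one trace \<open>O(R)\<close>; bounding
  the contribution of every position in the window separately would give only
  \<open>O(R^2)\<close>.\<close>

lemma mass_le:
  fixes b :: real
  assumes v: "aperiodic_upto Q v" "Q > 0" "L \<le> Suc Q" and b: "0 \<le> b" "b * real (length v) \<le> 1"
  shows "mass K b {lo..<lo + L} v t \<le> 1 + real K * (3 * (real K + 1)\<^sup>2 * (b * real (L + length v)))"
proof -
  let ?S = "{lo..<lo + L}"
  \<comment> \<open>Since 1 is not a period, \<open>v\<close> is not constant, as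
    \<open>sum_starts_le\<close> demands.\<close>
  from v obtain i where i: "i + 1 < length v" "v ! i \<noteq> v ! (i + 1)"
    unfolding aperiodic_upto_def by (auto dest!: bspec[of _ _ 1])
  have "mass K b ?S v t = (\<Sum>m\<le>K. b ^ m * real (\<Sum>j\<in>?S. starts v (drop j t) m))"
    unfolding mass_def by (subst sum.swap) (simp add: sum_distrib_left)
  also have "\<dots> = real (\<Sum>j\<in>?S. starts v (drop j t) 0)
      + (\<Sum>m<K. b ^ Suc m * real (\<Sum>j\<in>?S. starts v (drop j t) (Suc m)))"
    by (simp add: lessThan_Suc_atMost[symmetric] sum.lessThan_Suc_shift del: sum.lessThan_Suc of_nat_sum)
  also have "\<dots> \<le> 1 + (\<Sum>m<K. 3 * (real K + 1)\<^sup>2 * (b * real (L + length v)))"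
  proof (intro add_mono sum_mono)
    show "real (\<Sum>j\<in>?S. starts v (drop j t) 0) \<le> 1"
    proof -
      have "v \<noteq> []" using i by auto
      then show ?thesis
        using of_nat_mono[OF sum_starts_0_le[OF v(1,3) \<open>v \<noteq> []\<close>, where lo = lo and t = t], where 'a = real]
        by (simp only: of_nat_1 simp_thms)
    qed
  next
    fix m assume m: "m \<in> {..<K}"
    have "b ^ Suc m * real (\<Sum>j\<in>?S. starts v (drop j t) (Suc m))
       \<le> b ^ Suc m * real (3 * (m + 2)\<^sup>2 * (L + length v) * length v ^ m)"
      using b sum_starts_le[of i v "i + 1", where lo = lo and L = L and t = t and m = m] i
      by (intro mult_left_mono iffD2[OF of_nat_le_iff]) auto
    also have "\<dots> = 3 * (real m + 2)\<^sup>2 * (b * real (L + length v)) * (b * real (length v)) ^ m"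
      by (simp add: power_mult_distrib)
    also have "\<dots> \<le> 3 * (real m + 2)\<^sup>2 * (b * real (L + length v)) * 1"
      using b by (intro mult_left_mono power_le_one) auto
    also have "\<dots> \<le> 3 * (real K + 1)\<^sup>2 * (b * real (L + length v))"
      using b m by (auto intro!: mult_right_mono mult_left_mono power_mono)
    finally show "b ^ Suc m * real (\<Sum>j\<in>?S. starts v (drop j t) (Suc m)) \<le> \<dots>" .
  qed
  finally show ?thesis by simp
qed

lemma abs_stat_le:
  assumes "finite S" "\<And>j. j \<in> S \<Longrightarrow> \<bar>c + 1 / 2 - real j\<bar> \<le> A"
  shows "\<bar>stat K \<beta> c S v t\<bar> \<le> A * mass K (abs \<beta>) S v t"
proof -
  have "\<bar>stat K \<beta> c S v t\<bar> \<le> (\<Sum>j\<in>S. A * (\<Sum>m\<le>K. \<bar>\<beta>\<bar> ^ m * real (starts v (drop j t) m)))"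
    unfolding stat_def
  proof (intro order.trans[OF sum_abs] sum_mono)
    fix j assume "j \<in> S"
    have "\<bar>\<Sum>m\<le>K. \<beta> ^ m * real (starts v (drop j t) m)\<bar> \<le> (\<Sum>m\<le>K. \<bar>\<beta>\<bar> ^ m * real (starts v (drop j t) m))"
      by (intro order.trans[OF sum_abs] sum_mono) (auto simp: abs_mult power_abs)
    then show "\<bar>(c + 1 / 2 - real j) * (\<Sum>m\<le>K. \<beta> ^ m * real (starts v (drop j t) m))\<bar>
       \<le> A * (\<Sum>m\<le>K. \<bar>\<beta>\<bar> ^ m * real (starts v (drop j t) m))"
      unfolding abs_mult using assms(2)[OF \<open>j \<in> S\<close>] by (intro mult_mono) auto
  qed
  then show ?thesis by (simp add: mass_def sum_distrib_left)
qed

text \<open>The derivative of the \<open>m\<close>-th power brings in a factor \<open>m\<close>. It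
  is absorbed by \<open>2^(m-1)\<close>, which is why both bases must stay below
  \<open>B / 2\<close>.\<close>

lemma power_diff_le:
  fixes \<beta> \<beta>' B :: real
  assumes "2 * \<bar>\<beta>\<bar> \<le> B" "2 * \<bar>\<beta>'\<bar> \<le> B" "B > 0"
  shows "\<bar>\<beta> ^ m - \<beta>' ^ m\<bar> \<le> \<bar>\<beta> - \<beta>'\<bar> / B * B ^ m"
proof (cases m)
  case (Suc k)
  have "\<bar>\<beta> ^ Suc k - \<beta>' ^ Suc k\<bar> \<le> real (Suc k) * (B / 2) ^ k * \<bar>\<beta> - \<beta>'\<bar>"
  proof (induction k)
    case (Suc k)
    have "\<beta> ^ Suc (Suc k) - \<beta>' ^ Suc (Suc k) = \<beta> * (\<beta> ^ Suc k - \<beta>' ^ Suc k) + (\<beta> - \<beta>') * \<beta>' ^ Suc k"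
      by (simp add: algebra_simps)
    then have "\<bar>\<beta> ^ Suc (Suc k) - \<beta>' ^ Suc (Suc k)\<bar> \<le> \<bar>\<beta>\<bar> * \<bar>\<beta> ^ Suc k - \<beta>' ^ Suc k\<bar> + \<bar>\<beta> - \<beta>'\<bar> * \<bar>\<beta>'\<bar> ^ Suc k"
      by (metis abs_mult abs_triangle_ineq power_abs)
    also have "\<dots> \<le> (B / 2) * (real (Suc k) * (B / 2) ^ k * \<bar>\<beta> - \<beta>'\<bar>) + \<bar>\<beta> - \<beta>'\<bar> * (B / 2) ^ Suc k"
      using Suc assms by (intro add_mono mult_mono mult_left_mono power_mono) auto
    also have "\<dots> = real (Suc (Suc k)) * (B / 2) ^ Suc k * \<bar>\<beta> - \<beta>'\<bar>"
      by (simp add: algebra_simps)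
    finally show ?case .
  qed auto
  also have "real (Suc k) * (B / 2) ^ k * \<bar>\<beta> - \<beta>'\<bar> \<le> B ^ k * \<bar>\<beta> - \<beta>'\<bar>"
  proof (rule mult_right_mono)
    have "real (Suc k) \<le> 2 ^ k" by (induction k) auto
    then have "real (Suc k) * (B / 2) ^ k \<le> 2 ^ k * (B / 2) ^ k" using assms by (intro mult_right_mono) auto
    then show "real (Suc k) * (B / 2) ^ k \<le> B ^ k" by (simp add: power_divide)
  qed auto
  finally show ?thesis using assms Suc by (simp add: field_simps)
qed (use assms in auto)

text \<open>The program has estimates of \<open>c\<close> and \<beta>. An error in \<open>c\<close>
  is multiplied by the small quantity \<open>mass\<close>. An error in \<beta> is treated crudely,
  with the factor \<open>A * card S\<close> of order \<open>R^2\<close>; this is affordable because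
  that error is of order \<open>1/n\<close>.\<close>

lemma stat_perturb:
  fixes \<beta> \<beta>' B :: real
  assumes B: "2 * \<bar>\<beta>\<bar> \<le> B" "2 * \<bar>\<beta>'\<bar> \<le> B" "B > 0" "B < 1"
    and S: "finite S" "\<And>j. j \<in> S \<Longrightarrow> \<bar>c' + 1 / 2 - real j\<bar> \<le> A"
  shows "\<bar>stat K \<beta>' c' S v t - stat K \<beta> c S v t\<bar> \<le> \<bar>c' - c\<bar> * mass K (abs \<beta>) S v t
     + A * real (card S) * (\<bar>\<beta> - \<beta>'\<bar> / B * (1 / (1 - B)) ^ length v)"
proof -
  define F where "F \<beta> j = (\<Sum>m\<le>K. \<beta> ^ m * real (starts v (drop j t) m))" for \<beta> :: real and j
  have eq: "stat K \<beta>' c' S v t - stat K \<beta> c S v t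
    = (\<Sum>j\<in>S. (c' - c) * F \<beta> j) + (\<Sum>j\<in>S. (c' + 1 / 2 - real j) * (F \<beta>' j - F \<beta> j))"
    unfolding stat_def F_def[symmetric] sum_subtractf[symmetric] sum.distrib[symmetric]
    by (intro sum.cong) (auto simp: algebra_simps)
  have "\<bar>stat K \<beta>' c' S v t - stat K \<beta> c S v t\<bar>
     \<le> \<bar>\<Sum>j\<in>S. (c' - c) * F \<beta> j\<bar> + \<bar>\<Sum>j\<in>S. (c' + 1 / 2 - real j) * (F \<beta>' j - F \<beta> j)\<bar>"
    unfolding eq by (rule abs_triangle_ineq)
  also have "\<dots> \<le> (\<Sum>j\<in>S. abs (c' - c) * F (abs \<beta>) j) + (\<Sum>j\<in>S. A * (abs (\<beta> - \<beta>') / B * (1 / (1 - B)) ^ length v))"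
  proof (rule add_mono)
    have "\<bar>F \<beta> j\<bar> \<le> F (abs \<beta>) j" for j
      unfolding F_def by (rule order.trans[OF sum_abs]) (simp add: abs_mult power_abs)
    then have 1: "\<bar>(c' - c) * F \<beta> j\<bar> \<le> abs (c' - c) * F (abs \<beta>) j" for j
      by (simp add: abs_mult mult_left_mono)
    show "\<bar>\<Sum>j\<in>S. (c' - c) * F \<beta> j\<bar> \<le> (\<Sum>j\<in>S. abs (c' - c) * F (abs \<beta>) j)"
      by (rule order.trans[OF sum_abs]) (rule sum_mono, rule 1)
    have 2: "\<bar>F \<beta>' j - F \<beta> j\<bar> \<le> abs (\<beta> - \<beta>') / B * (1 / (1 - B)) ^ length v" for j
    proof -
      have "\<bar>F \<beta>' j - F \<beta> j\<bar> = \<bar>\<Sum>m\<le>K. (\<beta>' ^ m - \<beta> ^ m) * real (starts v (drop j t) m)\<bar>"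
        by (simp add: F_def sum_subtractf left_diff_distrib)
      also have "\<dots> \<le> (\<Sum>m\<le>K. \<bar>(\<beta>' ^ m - \<beta> ^ m) * real (starts v (drop j t) m)\<bar>)" by (rule sum_abs)
      also have "\<dots> \<le> (\<Sum>m\<le>K. abs (\<beta> - \<beta>') / B * (B ^ m * real (starts v (drop j t) m)))"
      proof (rule sum_mono)
        fix m
        have "\<bar>\<beta>' ^ m - \<beta> ^ m\<bar> \<le> abs (\<beta> - \<beta>') / B * B ^ m"
          using power_diff_le[OF B(1-3), of m] by (simp add: abs_minus_commute)
        then show "\<bar>(\<beta>' ^ m - \<beta> ^ m) * real (starts v (drop j t) m)\<bar> \<le> abs (\<beta> - \<beta>') / B * (B ^ m * real (starts v (drop j t) m))"
          unfolding abs_mult mult.assoc[symmetric] by (intro mult_mono) auto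
      qed
      also have "\<dots> = abs (\<beta> - \<beta>') / B * (\<Sum>m\<le>K. B ^ m * real (starts v (drop j t) m))"
        by (simp add: sum_distrib_left)
      also have "\<dots> \<le> abs (\<beta> - \<beta>') / B * (1 / (1 - B)) ^ length v"
        using B by (intro mult_left_mono starts_weight_le) auto
      finally show ?thesis .
    qed
    have 3: "\<bar>(c' + 1 / 2 - real j) * (F \<beta>' j - F \<beta> j)\<bar> \<le> A * (abs (\<beta> - \<beta>') / B * (1 / (1 - B)) ^ length v)"
      if "j \<in> S" for j
      unfolding abs_mult using S(2)[OF that] 2[of j] by (intro mult_mono) auto
    show "\<bar>\<Sum>j\<in>S. (c' + 1 / 2 - real j) * (F \<beta>' j - F \<beta> j)\<bar>
        \<le> (\<Sum>j\<in>S. A * (abs (\<beta> - \<beta>') / B * (1 / (1 - B)) ^ length v))"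
      by (rule order.trans[OF sum_abs]) (rule sum_mono, rule 3)
  qed
  also have "\<dots> = abs (c' - c) * mass K (abs \<beta>) S v t + A * real (card S) * (abs (\<beta> - \<beta>') / B * (1 / (1 - B)) ^ length v)"
    by (simp add: mass_def F_def sum_distrib_left)
  finally show ?thesis .
qed

subsection \<open>Locating the occurrences of a word\<close>

lemma take_drop_eq_iff:
  "k \<le> length x \<Longrightarrow> take (length v) (drop k x) = v \<longleftrightarrow>
    k + length v \<le> length x \<and> (\<forall>i<length v. x ! (k + i) = v ! i)"
  by (auto simp: list_eq_iff_nth_eq)

abbreviation win :: "nat \<Rightarrow> nat \<Rightarrow> nat set" where
  "win cc R \<equiv> {cc - R..cc + R}"

abbreviation phi :: "real \<Rightarrow> nat \<Rightarrow> nat \<Rightarrow> nat \<Rightarrow> real" where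
  "phi c cc R j \<equiv> (c + 1 / 2 - real j) * of_bool (j \<in> win cc R)"

context
  fixes \<delta> c \<psi> :: real and n cc R k0 :: nat
  assumes \<delta>: "0 < \<delta>" "\<delta> \<le> 1 / 2"
    and tail: "\<And>k. k \<le> n \<Longrightarrow> bexp \<delta> (\<lambda>j. of_bool (\<bar>real j - (1 - \<delta>) * real k\<bar> \<ge> real R / 4)) k \<le> \<psi>"
    and c: "c = (1 - \<delta>) * real k0" and k0: "k0 \<le> n"
    and cc: "\<bar>real cc - c\<bar> \<le> 2" and R: "8 \<le> R" "R + 2 \<le> n"
begin

lemma c_bounds: "0 \<le> c" "c \<le> real n"
proof -
  show "0 \<le> c" using c \<delta> by simp
  have "(1 - \<delta>) * real k0 \<le> 1 * real n" using \<delta> k0 by (intro mult_mono) auto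
  then show "c \<le> real n" using c by simp
qed

lemma psi_nonneg: "0 \<le> \<psi>"
proof -
  have "0 \<le> bexp \<delta> (\<lambda>j. of_bool (\<bar>real j - (1 - \<delta>) * real 0\<bar> \<ge> real R / 4)) 0" by simp
  also have "\<dots> \<le> \<psi>" by (rule tail) simp
  finally show ?thesis .
qed

lemma notin_win: "j \<notin> win cc R \<Longrightarrow> real R - 2 \<le> \<bar>real j - c\<bar>"
proof -
  assume "j \<notin> win cc R"
  then have "j + R < cc \<or> cc + R < j" by auto
  then have "real j + real R < real cc \<or> real cc + real R < real j" by linarith
  then show ?thesis using cc by linarith
qed

lemma in_win: "j \<in> win cc R \<Longrightarrow> \<bar>c + 1 / 2 - real j\<bar> \<le> real R + 3"
proof -
  assume "j \<in> win cc R"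
  then have "cc \<le> j + R" "j \<le> cc + R" by auto
  then have "real cc \<le> real j + real R" "real j \<le> real cc + real R" by linarith+
  then show ?thesis using cc by (simp add: abs_le_iff)
qed

lemma bexp_le_tail:
  assumes "\<And>j. j \<le> k \<Longrightarrow> \<phi> j \<le> a + b * of_bool (\<bar>real j - (1 - \<delta>) * real k\<bar> \<ge> real R / 4)"
    "k \<le> n" "b \<ge> 0"
  shows "bexp \<delta> \<phi> k \<le> a + b * \<psi>"
proof -
  have "bexp \<delta> \<phi> k \<le> bexp \<delta> (\<lambda>j. a + b * of_bool (\<bar>real j - (1 - \<delta>) * real k\<bar> \<ge> real R / 4)) k"
    using \<delta> assms(1) by (intro bexp_mono) auto
  also have "\<dots> = a + b * bexp \<delta> (\<lambda>j. of_bool (\<bar>real j - (1 - \<delta>) * real k\<bar> \<ge> real R / 4)) k"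
    by (simp only: bexp_add bexp_cmult bexp_const)
  also have "\<dots> \<le> a + b * \<psi>" using tail[of k] assms by (intro add_left_mono mult_left_mono) auto
  finally show ?thesis .
qed

text \<open>\<open>c\<close> is the mean position of letter \<open>k0\<close>, so without the window
  the value would be exactly 1/2 by linearity. The window alters the weight only at positions far
  from the mean, and there by at most \<open>n + 1\<close>.\<close>

lemma bexp_phi_center: "\<bar>bexp \<delta> (phi c cc R) k0 - 1 / 2\<bar> \<le> (real n + 1) * \<psi>"
proof -
  have m: "bexp \<delta> (\<lambda>j. phi c cc R j - (c + 1 / 2 - real j)) k0 = bexp \<delta> (phi c cc R) k0 - 1 / 2"
    "bexp \<delta> (\<lambda>j. (c + 1 / 2 - real j) - phi c cc R j) k0 = 1 / 2 - bexp \<delta> (phi c cc R) k0"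
  proof -
    have "bexp \<delta> (\<lambda>j. phi c cc R j + (- (c + 1 / 2) + real j)) k0 = bexp \<delta> (phi c cc R) k0 + (- (c + 1 / 2) + (1 - \<delta>) * real k0)"
      by (simp only: bexp_add bexp_const bexp_mean)
    then show 1: "bexp \<delta> (\<lambda>j. phi c cc R j - (c + 1 / 2 - real j)) k0 = bexp \<delta> (phi c cc R) k0 - 1 / 2"
      by (simp add: c algebra_simps)
    show "bexp \<delta> (\<lambda>j. (c + 1 / 2 - real j) - phi c cc R j) k0 = 1 / 2 - bexp \<delta> (phi c cc R) k0"
      using bexp_cmult[of \<delta> "- 1" "\<lambda>j. phi c cc R j - (c + 1 / 2 - real j)" k0] unfolding 1 by simp
  qed
  have b: "\<bar>phi c cc R j - (c + 1 / 2 - real j)\<bar> \<le> (real n + 1) * of_bool (\<bar>real j - (1 - \<delta>) * real k0\<bar> \<ge> real R / 4)"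
    if "j \<le> k0" for j
  proof (cases "j \<in> win cc R")
    case False
    have "\<bar>real j - (1 - \<delta>) * real k0\<bar> \<ge> real R / 4"
      using notin_win[OF False] R by (simp add: c[symmetric])
    moreover have "\<bar>c + 1 / 2 - real j\<bar> \<le> real n + 1" using c_bounds that k0 by (simp add: abs_le_iff)
    ultimately show ?thesis using False by (simp add: abs_minus_commute)
  qed auto
  have "bexp \<delta> (\<lambda>j. phi c cc R j - (c + 1 / 2 - real j)) k0 \<le> 0 + (real n + 1) * \<psi>"
    by (rule bexp_le_tail) (use b k0 in \<open>auto simp: abs_le_iff\<close>)
  moreover have "bexp \<delta> (\<lambda>j. (c + 1 / 2 - real j) - phi c cc R j) k0 \<le> 0 + (real n + 1) * \<psi>"
    by (rule bexp_le_tail) (use b k0 in \<open>auto simp: abs_le_iff\<close>)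
  ultimately show ?thesis unfolding m by (simp add: abs_le_iff)
qed

text \<open>As \<open>1-\<delta>\<close> is at least 1/2, the mean position of letter
  \<open>k\<close> is at least \<open>2 * R\<close> away from \<open>c\<close>; the whole window
  then lies in the tail of its distribution.\<close>

lemma bexp_phi_far:
  assumes k: "k \<le> n" "k + 4 * R < k0 \<or> k0 + 4 * R < k"
  shows "\<bar>bexp \<delta> (phi c cc R) k\<bar> \<le> (real n + 1) * \<psi>"
proof -
  have d: "2 * real R \<le> \<bar>(1 - \<delta>) * real k - c\<bar>"
  proof -
    have "4 * real R \<le> \<bar>real k - real k0\<bar>" using k(2) by linarith
    then have "(1 / 2) * (4 * real R) \<le> (1 - \<delta>) * \<bar>real k - real k0\<bar>" using \<delta> by (intro mult_mono) auto
    also have "\<dots> = \<bar>(1 - \<delta>) * (real k - real k0)\<bar>" using \<delta> by (simp add: abs_mult)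
    also have "\<dots> = \<bar>(1 - \<delta>) * real k - c\<bar>" by (simp add: c right_diff_distrib)
    finally show ?thesis by simp
  qed
  have b: "\<bar>phi c cc R j\<bar> \<le> (real n + 1) * of_bool (\<bar>real j - (1 - \<delta>) * real k\<bar> \<ge> real R / 4)" for j
  proof (cases "j \<in> win cc R")
    case True
    have "\<bar>real j - (1 - \<delta>) * real k\<bar> \<ge> real R / 4" using in_win[OF True] d R by linarith
    moreover have "\<bar>c + 1 / 2 - real j\<bar> \<le> real n + 1" using in_win[OF True] R by linarith
    ultimately show ?thesis using True by simp
  qed auto
  have "bexp \<delta> (phi c cc R) k \<le> 0 + (real n + 1) * \<psi>"
    by (rule bexp_le_tail) (use b k in \<open>auto simp: abs_le_iff\<close>)
  moreover have "bexp \<delta> (\<lambda>j. - 1 * phi c cc R j) k \<le> 0 + (real n + 1) * \<psi>"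
    by (rule bexp_le_tail) (use b k in \<open>auto simp: abs_le_iff\<close>)
  ultimately show ?thesis unfolding bexp_cmult by (simp add: abs_le_iff)
qed

text \<open>If the mean \<mu> is near \<open>c\<close>, the truncated weight may be replaced by the
  full linear one, whose mean \<open>c + 1/2 - \<mu>\<close> is at most 0 because
  \<open>(1-\<delta>) (k - k0)\<close> is at least 1/2. If \<mu> is farther to the right, the weight
  is positive only at positions that are far from \<mu>.\<close>

lemma bexp_phi_right:
  assumes k: "k \<le> n" "k0 < k"
  shows "bexp \<delta> (phi c cc R) k \<le> (real n + 1) * \<psi>"
proof -
  define \<mu> where "\<mu> = (1 - \<delta>) * real k"
  show ?thesis
  proof (cases "\<mu> \<le> c + real R / 2")
    case True
    have b: "phi c cc R j \<le> (c + 1 / 2 - real j) + (real n + 1) * of_bool (\<bar>real j - (1 - \<delta>) * real k\<bar> \<ge> real R / 4)"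
      if j: "j \<le> k" for j
    proof (cases "j \<in> win cc R")
      case False
      \<comment> \<open>As \<mu> lies between \<open>c\<close> and \<open>c + R/2\<close>, a point
        outside the window is at least \<open>R/2 - 2\<close> away from it. Here
        \<open>8 \<le> R\<close> turns this into \<open>R/4\<close>.\<close>
      have "(1 - \<delta>) * (real k0 + 1) \<le> \<mu>" unfolding \<mu>_def using k \<delta> by (intro mult_left_mono) auto
      then have "c \<le> \<mu>" using \<delta> unfolding c by (simp add: algebra_simps)
      then have "\<bar>real j - (1 - \<delta>) * real k\<bar> \<ge> real R / 4"
        using notin_win[OF False] True R unfolding \<mu>_def[symmetric] by linarith
      moreover have "0 \<le> c + 1 / 2 - real j + (real n + 1)" using c_bounds j k by linarith
      ultimately show ?thesis using False by simp
    qed auto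
    have "bexp \<delta> (phi c cc R) k \<le>
       bexp \<delta> (\<lambda>j. (c + 1 / 2) + (- 1 * real j + (real n + 1) * of_bool (\<bar>real j - (1 - \<delta>) * real k\<bar> \<ge> real R / 4))) k"
    proof (rule bexp_mono)
      fix j assume "j \<le> k"
      from b[OF this] show "phi c cc R j \<le> (c + 1 / 2) + (- 1 * real j + (real n + 1) * of_bool (\<bar>real j - (1 - \<delta>) * real k\<bar> \<ge> real R / 4))"
        by linarith
    qed (use \<delta> in auto)
    also have "\<dots> = (c + 1 / 2) + (- 1 * ((1 - \<delta>) * real k) + (real n + 1) * bexp \<delta> (\<lambda>j. of_bool (\<bar>real j - (1 - \<delta>) * real k\<bar> \<ge> real R / 4)) k)"
      by (simp only: bexp_add bexp_cmult bexp_const bexp_mean)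
    also have "\<dots> \<le> (c + 1 / 2) + (- 1 * ((1 - \<delta>) * real k) + (real n + 1) * \<psi>)"
      using tail[OF k(1)] by (intro add_left_mono mult_left_mono) auto
    also have "(1 - \<delta>) * real k \<ge> c + 1 / 2"
    proof -
      have "(1 - \<delta>) * (real k0 + 1) \<le> (1 - \<delta>) * real k" using k \<delta> by (intro mult_left_mono) auto
      then show ?thesis using \<delta> unfolding c by (simp add: algebra_simps)
    qed
    finally show ?thesis by simp
  next
    case False
    have "bexp \<delta> (phi c cc R) k \<le> 0 + (real n + 1) * \<psi>"
    proof (rule bexp_le_tail)
      fix j
      show "phi c cc R j \<le> 0 + (real n + 1) * of_bool (\<bar>real j - (1 - \<delta>) * real k\<bar> \<ge> real R / 4)"
      proof (cases "j \<in> win cc R \<and> c + 1 / 2 - real j > 0")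
        case True
        then have "\<bar>real j - (1 - \<delta>) * real k\<bar> \<ge> real R / 4"
          using False R unfolding \<mu>_def by linarith
        moreover have "c + 1 / 2 - real j \<le> real n + 1" using in_win[of j] True R by linarith
        ultimately show ?thesis using True by simp
      next
        case False
        then show ?thesis by (cases "j \<in> win cc R") auto
      qed
    qed (use k in auto)
    then show ?thesis by simp
  qed
qed

lemma sum_occurrences:
  assumes x: "length x = n" and v: "length v = Suc W" "aperiodic_upto (4 * R) v"
    and u: "\<And>i. i < W \<Longrightarrow> x ! (k0 + i) = v ! i" and p: "k0 + W < n"
  defines "s \<equiv> (\<Sum>k<n. bexp \<delta> (phi c cc R) k * of_bool (take (length v) (drop k x) = v))"
  shows "x ! (k0 + W) = v ! W \<Longrightarrow> 1 / 2 - real n * (real n + 1) * \<psi> \<le> s"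
    and "x ! (k0 + W) \<noteq> v ! W \<Longrightarrow> s \<le> real n * (real n + 1) * \<psi>"
proof -
  define occ where "occ k \<longleftrightarrow> take (length v) (drop k x) = v" for k
  have occ: "occ k \<longleftrightarrow> k + length v \<le> n \<and> (\<forall>i<length v. x ! (k + i) = v ! i)" if "k < n" for k
    unfolding occ_def using take_drop_eq_iff[of k x v] x that by auto
  \<comment> \<open>Only indices of \<open>x\<close> below \<open>k0 + W\<close> are compared, so
    this holds whatever the bit at \<open>k0 + W\<close> is.\<close>
  have left: "k + 4 * R < k0" if k: "occ k" "k < k0" "k < n" for k
  proof (rule ccontr)
    assume "\<not> k + 4 * R < k0"
    then have "k0 - k \<in> {1..4 * R}" using k by auto
    then obtain i where i: "i + (k0 - k) < length v" "v ! i \<noteq> v ! (i + (k0 - k))"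
      using v(2) unfolding aperiodic_upto_def by blast
    have "v ! (i + (k0 - k)) = x ! (k + (i + (k0 - k)))" using k i occ by auto
    also have "k + (i + (k0 - k)) = k0 + i" using k by simp
    also have "x ! (k0 + i) = v ! i" by (rule u) (use i k v in auto)
    finally show False using i by simp
  qed
  \<comment> \<open>On this side the comparison can reach the index \<open>k0 + W\<close>, so the
    bit there has to agree with \<open>v\<close>. If it does not, occurrences shortly to the right
    are possible and \<open>bexp_phi_right\<close> takes care of them.\<close>
  have right: "k0 + 4 * R < k" if k: "occ k" "k0 < k" "k < n" "x ! (k0 + W) = v ! W" for k
  proof (rule ccontr)
    assume "\<not> k0 + 4 * R < k"
    then have "k - k0 \<in> {1..4 * R}" using k by auto
    then obtain i where i: "i + (k - k0) < length v" "v ! i \<noteq> v ! (i + (k - k0))"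
      using v(2) unfolding aperiodic_upto_def by blast
    have "v ! i = x ! (k + i)" using k i occ by auto
    also have "k + i = k0 + (i + (k - k0))" using k by simp
    also have "x ! \<dots> = v ! (i + (k - k0))" using u k(4) i v by (cases "i + (k - k0) = W") auto
    finally show False using i by simp
  qed
  have k0n: "k0 < n" using p by simp
  have sum_n: "(\<Sum>k<n. (real n + 1) * \<psi>) = real n * (real n + 1) * \<psi>" by simp
  {
    assume t: "x ! (k0 + W) = v ! W"
    have o: "occ k0" using occ[OF k0n] u t p v by (auto simp: less_Suc_eq)
    have "s = bexp \<delta> (phi c cc R) k0 + (\<Sum>k\<in>{..<n} - {k0}. bexp \<delta> (phi c cc R) k * of_bool (occ k))"
      unfolding s_def occ_def[symmetric] using o k0n by (subst sum.remove[of _ k0]) auto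
    moreover have "(\<Sum>k\<in>{..<n} - {k0}. - ((real n + 1) * \<psi>)) \<le> (\<Sum>k\<in>{..<n} - {k0}. bexp \<delta> (phi c cc R) k * of_bool (occ k))"
    proof (rule sum_mono)
      fix k assume k: "k \<in> {..<n} - {k0}"
      show "- ((real n + 1) * \<psi>) \<le> bexp \<delta> (phi c cc R) k * of_bool (occ k)"
      proof (cases "occ k")
        case True
        then have "\<bar>bexp \<delta> (phi c cc R) k\<bar> \<le> (real n + 1) * \<psi>"
          using k left[of k] right[of k] t by (intro bexp_phi_far) (auto simp: neq_iff)
        then show ?thesis using True by (simp add: abs_le_iff)
      qed (use psi_nonneg in auto)
    qed
    moreover have "(\<Sum>k\<in>{..<n} - {k0}. - ((real n + 1) * \<psi>)) = - ((real n - 1) * ((real n + 1) * \<psi>))"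
      using k0n by (simp add: of_nat_diff)
    moreover have "- ((real n + 1) * \<psi>) + 1 / 2 \<le> bexp \<delta> (phi c cc R) k0"
      using bexp_phi_center by (simp add: abs_le_iff)
    ultimately have "1 / 2 - ((real n + 1) * \<psi>) - (real n - 1) * ((real n + 1) * \<psi>) \<le> s" by linarith
    then show "1 / 2 - real n * (real n + 1) * \<psi> \<le> s" by (simp add: algebra_simps)
  next
    assume t: "x ! (k0 + W) \<noteq> v ! W"
    have o: "\<not> occ k0" using occ[OF k0n] t v by auto
    have "s \<le> (\<Sum>k<n. (real n + 1) * \<psi>)"
      unfolding s_def occ_def[symmetric]
    proof (rule sum_mono)
      fix k assume k: "k \<in> {..<n}"
      show "bexp \<delta> (phi c cc R) k * of_bool (occ k) \<le> (real n + 1) * \<psi>"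
      proof (cases "occ k")
        case True
        then have "k \<noteq> k0" using o by auto
        then consider "k < k0" | "k0 < k" by linarith
        then have "bexp \<delta> (phi c cc R) k \<le> (real n + 1) * \<psi>"
        proof cases
          case 1
          then have "\<bar>bexp \<delta> (phi c cc R) k\<bar> \<le> (real n + 1) * \<psi>"
            using k left[of k] True by (intro bexp_phi_far) auto
          then show ?thesis by (simp add: abs_le_iff)
        next
          case 2
          then show ?thesis using k by (intro bexp_phi_right) auto
        qed
        then show ?thesis using True by simp
      qed (use psi_nonneg in auto)
    qed
    then show "s \<le> real n * (real n + 1) * \<psi>" unfolding sum_n .
  }
qed

end

lemma bexp_at_0: "bexp \<delta> (\<lambda>j. a * of_bool (j = 0)) k = a * \<delta> ^ k"
proof (induction k)
  case (Suc k)
  have "bexp \<delta> (\<lambda>j. a * of_bool (Suc j = 0)) k = 0" by simp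
  then show ?case using Suc by simp
qed auto

text \<open>The first bits have no full-length word before them. The window is then the single
  position 0, which an occurrence at \<open>k\<close> reaches only if all \<open>k\<close> letters
  before it are deleted; this has probability \<open>\<delta>^k\<close>.\<close>

lemma sum_occurrences_init:
  assumes \<delta>: "0 < \<delta>" "\<delta> \<le> 1 / 2" and n: "n > 0" "length x = n" "length v \<le> n"
  defines "s \<equiv> (\<Sum>k<n. bexp \<delta> (phi 0 0 0) k * of_bool (take (length v) (drop k x) = v))"
  shows "take (length v) x = v \<Longrightarrow> 1 / 2 \<le> s" and "take (length v) x \<noteq> v \<Longrightarrow> s \<le> \<delta>"
proof -
  have "phi 0 0 0 = (\<lambda>j. 1 / 2 * of_bool (j = 0))" by auto
  then have b: "bexp \<delta> (phi 0 0 0) k = 1 / 2 * \<delta> ^ k" for k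
    by (simp only: bexp_at_0)
  obtain n' where n': "n = Suc n'" using n by (cases n) auto
  have s: "s = 1 / 2 * of_bool (take (length v) x = v)
     + (\<Sum>k<n'. \<delta> / 2 * \<delta> ^ k * of_bool (take (length v) (drop (Suc k) x) = v))"
    unfolding s_def b n' by (simp add: sum.lessThan_Suc_shift del: sum.lessThan_Suc)
  have "0 \<le> (\<Sum>k<n'. \<delta> / 2 * \<delta> ^ k * of_bool (take (length v) (drop (Suc k) x) = v))"
    using \<delta> by (intro sum_nonneg) simp
  then show "take (length v) x = v \<Longrightarrow> 1 / 2 \<le> s"
    unfolding s by simp
  have "(\<Sum>k<n'. \<delta> / 2 * \<delta> ^ k * of_bool (take (length v) (drop (Suc k) x) = v))
     \<le> (\<Sum>k<n'. \<delta> / 2 * \<delta> ^ k)"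
    using \<delta> by (intro sum_mono) simp
  also have "\<dots> = \<delta> / 2 * (\<Sum>k<n'. \<delta> ^ k)"
    by (simp add: sum_distrib_left)
  also have "(\<Sum>k<n'. \<delta> ^ k) = (1 - \<delta> ^ n') / (1 - \<delta>)"
    using \<delta> by (subst sum_gp_strict) auto
  also have "(1 - \<delta> ^ n') / (1 - \<delta>) \<le> 1 / (1 / 2)" using \<delta> by (intro frac_le) auto
  finally show "take (length v) x \<noteq> v \<Longrightarrow> s \<le> \<delta>" unfolding s using \<delta> by simp
qed

subsection \<open>The reconstruction procedure\<close>

fun dp :: "(nat \<Rightarrow> nat) \<Rightarrow> (nat \<Rightarrow> nat) \<Rightarrow> nat \<Rightarrow> nat \<Rightarrow> nat" where
  "dp y v 0 s = of_bool (s = 0 \<and> y 0 = v 0)"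
| "dp y v (Suc h) s = (if y (Suc h + s) = v (Suc h) then \<Sum>s'\<le>s. dp y v h s' else 0)"

lemma starts_snoc:
  assumes "v \<noteq> []"
  shows "starts (v @ [b]) t m =
     (if length v + m < length t \<and> t ! (length v + m) = b then \<Sum>i\<le>m. starts v t i else 0)"
proof -
  obtain c v' where "v = c # v'" using assms by (cases v) auto
  then show ?thesis by (cases t) (auto simp: gaps_snoc)
qed

text \<open>The padding value 2 differs from both letters, so a comparison past the end of
  \<open>t\<close> fails as it should. The induction step is \<open>starts_snoc\<close>.\<close>

lemma dp_eq_starts:
  assumes "w < length v"
    and "\<And>d. d \<le> w + s \<Longrightarrow> y d = (if d < length t then of_bool (t ! d) else 2)"
    and "\<And>h. h \<le> w \<Longrightarrow> u h = of_bool (v ! h)"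
  shows "dp y u w s = starts (take (Suc w) v) t s"
  using assms
proof (induction w arbitrary: s)
  case 0
  then have v: "take (Suc 0) v = [v ! 0]" by (cases v) auto
  show ?case using 0(2)[of 0] 0(3)[of 0] unfolding v by (cases t) (auto simp: of_bool_def split: if_splits)
next
  case (Suc w)
  have v: "take (Suc (Suc w)) v = take (Suc w) v @ [v ! Suc w]"
    using Suc.prems(1) by (simp add: take_Suc_conv_app_nth)
  have IH: "dp y u w s' = starts (take (Suc w) v) t s'" if "s' \<le> s" for s'
    using Suc.prems that by (intro Suc.IH) auto
  have "y (Suc w + s) = u (Suc w) \<longleftrightarrow> Suc w + s < length t \<and> t ! (Suc w + s) = v ! Suc w"
    using Suc.prems(2)[of "Suc w + s"] Suc.prems(3)[of "Suc w"] by (auto simp: of_bool_def split: if_splits)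
  moreover have "length (take (Suc w) v) = Suc w" using Suc.prems by simp
  ultimately show ?case unfolding v using Suc.prems IH
    by (subst starts_snoc) (auto simp del: take_Suc)
qed

text \<open>
  The word \<open>out a, \<dots>, out (a + w - 1)\<close> extended by this bit has no period up to \<open>q\<close>, provided that
  \<open>2 * q \<le> w\<close>: any two periods up to \<open>w / 2\<close> predict the same next bit, which is the one avoided here.
\<close>

fun bcand :: "(nat \<Rightarrow> nat) \<Rightarrow> nat \<Rightarrow> nat \<Rightarrow> nat \<Rightarrow> nat" where
  "bcand out a w 0 = 1"
| "bcand out a w (Suc q) =
     (if \<forall>i<w - Suc q. out (a + i) = out (a + i + Suc q) then 1 - out (a + w - Suc q) else bcand out a w q)"

lemma bcand_cong:
  assumes "\<And>i. i < a + w \<Longrightarrow> out i = out' i" "q \<le> w"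
  shows "bcand out a w q = bcand out' a w q"
  using assms(2)
proof (induction q)
  case (Suc q)
  have 1: "(\<forall>i<w - Suc q. out (a + i) = out (a + i + Suc q)) \<longleftrightarrow> (\<forall>i<w - Suc q. out' (a + i) = out' (a + i + Suc q))"
    using assms(1) by auto
  have 2: "out (a + w - Suc q) = out' (a + w - Suc q)" using Suc assms(1) by simp
  have 3: "bcand out a w q = bcand out' a w q" using Suc by simp
  show ?case unfolding bcand.simps by (simp only: 1 2 3)
qed auto

lemma bcand_le_1: "bcand out a w q \<le> 1"
  by (induction q) auto

text \<open>The easy case of the theorem of Fine and Wilf: from the next position, steps back by
  \<open>e\<close> and by \<open>Suc q\<close> in either order lead to the same index
  \<open>k\<close>, which still lies in the word since \<open>e + Suc q \<le> w\<close>. So both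
  periods predict the same letter.\<close>

lemma bcand_period:
  assumes "1 \<le> e" "e \<le> q" "\<forall>i<w - e. out (a + i) = out (a + i + e)" "2 * q \<le> w"
  shows "bcand out a w q = 1 - out (a + w - e)"
  using assms
proof (induction q)
  case (Suc q)
  show ?case
  proof (cases "\<forall>i<w - Suc q. out (a + i) = out (a + i + Suc q)")
    case True
    define k where "k = w - Suc q - e"
    have k: "k + Suc q + e = w" using Suc.prems by (simp add: k_def)
    have "out (a + w - Suc q) = out (a + (k + e))" using k by (intro arg_cong[where f = out]) linarith
    also have "a + (k + e) = a + k + e" by simp
    also have "out (a + k + e) = out (a + k)" using Suc.prems(3) k by (metis add.commute less_add_same_cancel1 less_diff_conv zero_less_Suc add.assoc)
    also have "\<dots> = out (a + k + Suc q)" using True k Suc.prems by simp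
    also have "a + k + Suc q = a + w - e" using k by simp
    finally show ?thesis using True by simp
  next
    case False
    then have "e \<le> q" using Suc.prems by (metis le_SucE)
    then have "bcand out a w q = 1 - out (a + w - e)" using Suc by simp
    then show ?thesis by (subst bcand.simps, subst if_not_P[OF False])
  qed
qed auto

locale reconstruct =
  fixes n N K R :: nat
begin

text \<open>Twice the largest period \<open>4 * R\<close> to be excluded, as
  \<open>bcand_period\<close> requires. The range \<open>4 * R\<close> is large enough because an
  occurrence farther than that from \<open>a\<close> has its mean trace position at distance at
  least \<open>2 * R\<close> from \<open>c\<close>, outside the window.\<close>

definition W where "W = 8 * R"
definition wd where "wd p = min p W"
definition st where "st p = p - W"
text \<open>For \<open>p \<le> W\<close> the word is the whole prefix before \<open>p\<close>; the
  window shrinks to one position and no period is excluded.\<close>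

definition Rp where "Rp p = (if p \<le> W then 0 else R)"
definition Qp where "Qp p = (if p \<le> W then 0 else 4 * R)"

lemma wd_st: "st p + wd p = p" by (auto simp: wd_def st_def)

definition cand :: "(nat \<Rightarrow> nat) \<Rightarrow> nat \<Rightarrow> nat" where
  "cand out p = bcand out (st p) (wd p) (Qp p)"

definition center :: "nat \<Rightarrow> nat \<Rightarrow> nat" where
  "center L p = L * st p div (n * N)"

text \<open>For \<open>m \<le> K\<close> this is the absolute value of the estimate of
  \<open>\<beta>^m\<close>, times \<open>L^K\<close>, so that no division remains.\<close>

definition weight :: "nat \<Rightarrow> nat \<Rightarrow> nat" where
  "weight L m = (n * N - L) ^ m * L ^ (K - m)"

text \<open>
  The program has only natural numbers. With \<open>L\<close> the total length of the \<open>N\<close> traces, \<open>\<beta>\<close> is replaced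
  by \<open>- (n * N - L) / L\<close>, the statistic is scaled by \<open>2 * n * N * L ^ K\<close>, and its positive and negative terms are
  summed separately. Subtraction truncates, so at most one of \<open>above\<close> and \<open>below\<close> is nonzero.
\<close>

definition above :: "nat \<Rightarrow> nat \<Rightarrow> nat \<Rightarrow> nat" where
  "above L p j = 2 * (L * st p) + n * N - 2 * (n * N) * j"

definition below :: "nat \<Rightarrow> nat \<Rightarrow> nat \<Rightarrow> nat" where
  "below L p j = 2 * (n * N) * j - (2 * (L * st p) + n * N)"

definition cnt :: "(nat \<Rightarrow> nat) \<Rightarrow> (nat \<Rightarrow> nat) \<Rightarrow> nat \<Rightarrow> nat \<Rightarrow> nat \<Rightarrow> nat \<Rightarrow> nat" where
  "cnt y v p i j m = dp (\<lambda>d. y (i * (2 * n) + j + d)) (\<lambda>h. v (st p + h)) (wd p) m"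

definition plus :: "(nat \<Rightarrow> nat) \<Rightarrow> nat \<Rightarrow> (nat \<Rightarrow> nat) \<Rightarrow> nat \<Rightarrow> nat" where
  "plus y L v p = (\<Sum>i<N. \<Sum>j\<in>win (center L p) (Rp p). \<Sum>m\<le>K. cnt y v p i j m * weight L m *
      (if even m then above L p j else below L p j))"

definition minus :: "(nat \<Rightarrow> nat) \<Rightarrow> nat \<Rightarrow> (nat \<Rightarrow> nat) \<Rightarrow> nat \<Rightarrow> nat" where
  "minus y L v p = (\<Sum>i<N. \<Sum>j\<in>win (center L p) (Rp p). \<Sum>m\<le>K. cnt y v p i j m * weight L m *
      (if even m then below L p j else above L p j))"

text \<open>In the scale \<open>2 * n * N * L ^ K\<close> the threshold \<open>N / 4\<close> for the
  sum over all traces is \<open>n * N * N * L ^ K / 2\<close>; both sides are doubled to keep it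
  integral.\<close>

definition nextbit :: "(nat \<Rightarrow> nat) \<Rightarrow> nat \<Rightarrow> (nat \<Rightarrow> nat) \<Rightarrow> nat \<Rightarrow> nat" where
  "nextbit y L out p = (let b = cand out p; v = out(p := b) in
     if 2 * plus y L v p < 2 * minus y L v p + n * N * N * L ^ K then 1 - b else b)"

primrec recon :: "(nat \<Rightarrow> nat) \<Rightarrow> nat \<Rightarrow> nat \<Rightarrow> nat \<Rightarrow> nat" where
  "recon y L 0 = (\<lambda>_. 0)"
| "recon y L (Suc p) = (recon y L p)(p := nextbit y L (recon y L p) p)"

definition word :: "bool list \<Rightarrow> nat \<Rightarrow> bool list" where
  "word x p = take (wd p) (drop (st p) x) @ [cand (\<lambda>i. of_bool (x ! i)) p = 1]"

text \<open>
  Row \<open>i\<close> of the memory holds trace \<open>i\<close>, padded with \<open>2\<close> to length \<open>2 * n\<close>; the padding lets the windows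
  run over the end of the trace.
\<close>

definition mem :: "(nat \<Rightarrow> bool list) \<Rightarrow> nat \<Rightarrow> nat" where
  "mem \<omega> q = (let t = \<omega> (q div (2 * n)); j = q mod (2 * n) in
     if q < N * (2 * n) then (if j < length t then of_bool (t ! j) else 2) else 0)"

definition total :: "(nat \<Rightarrow> bool list) \<Rightarrow> nat" where
  "total \<omega> = (\<Sum>i<N. min (2 * n) (length (\<omega> i)))"

end

section \<open>Correctness under explicit inequalities between the parameters\<close>

locale reconstruct_params = reconstruct n N K R for n N K R :: nat +
  fixes \<delta> \<psi> \<beta> :: real and x :: "bool list"
  assumes \<delta>: "0 < \<delta>" "\<delta> \<le> 1 / 100" and \<beta>: "\<beta> = - \<delta> / (1 - \<delta>)"
    and R: "8 \<le> R" and len: "length x = n" and n: "16 * R + K \<le> n" and N: "N > 0"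
    and tail: "\<And>k. k \<le> n \<Longrightarrow> bexp \<delta> (\<lambda>j. of_bool (\<bar>real j - (1 - \<delta>) * real k\<bar> \<ge> real R / 4)) k \<le> \<psi>"
    and psi: "real n * (real n + 1) * \<psi> \<le> 1 / 100"
    and retain: "9 / 10 \<le> (1 - \<delta>) ^ (8 * R + 1)"
    and beta_small: "4 * \<bar>\<beta>\<bar> * (2 * real (8 * R + 2)) \<le> 1"
    and trunc_small: "real (2 * R + 1) * (real R + 3) * ((\<bar>\<beta>\<bar> * (2 * real (8 * R + 2))) ^ Suc K * 2) \<le> 1 / 100"
    and mass_small: "real K * (3 * (real K + 1)\<^sup>2 * (\<bar>\<beta>\<bar> * real (10 * R + 2))) \<le> 1"
    and perturb_small: "(real R + 3) * real (2 * R + 1) * (1 / (50 * real n) * (2 * real (8 * R + 2)) * 2) \<le> 1 / 100"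
begin

definition cp where "cp p = (1 - \<delta>) * real (st p)"

abbreviation "xo \<equiv> (\<lambda>i. of_bool (x ! i) :: nat)"

definition good_center :: "nat \<Rightarrow> nat \<Rightarrow> bool" where
  "good_center p cc \<longleftrightarrow> \<bar>real cc - cp p\<bar> \<le> 2 \<and> (p \<le> W \<longrightarrow> cc = 0)"

lemma n_pos: "n > 0" using n R by simp

lemma length_word: "p < n \<Longrightarrow> length (word x p) = Suc (wd p)"
  using wd_st[of p] len by (simp add: word_def)

lemma word_nth:
  assumes "p < n"
  shows "i < wd p \<Longrightarrow> word x p ! i = x ! (st p + i)" "word x p ! wd p = (cand xo p = 1)"
  using wd_st[of p] len assms by (auto simp: word_def nth_append)

text \<open>If the letters before \<open>p\<close> already violate the period \<open>e\<close>, so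
  does the word; otherwise its last letter was chosen against \<open>e\<close>.\<close>

lemma word_aperiodic:
  assumes p: "p < n" "p > W"
  shows "aperiodic_upto (4 * R) (word x p)"
  unfolding aperiodic_upto_def
proof
  fix e assume e: "e \<in> {1..4 * R}"
  have w: "wd p = 8 * R" using p by (simp add: wd_def W_def)
  show "\<exists>i. i + e < length (word x p) \<and> word x p ! i \<noteq> word x p ! (i + e)"
  proof (cases "\<forall>i<wd p - e. xo (st p + i) = xo (st p + i + e)")
    case True
    have "cand xo p = 1 - xo (st p + wd p - e)"
      unfolding cand_def using p w True e by (intro bcand_period) (auto simp: Qp_def)
    moreover have "st p + wd p - e = st p + (wd p - e)" using e w by simp
    ultimately have c: "cand xo p = 1 - xo (st p + (wd p - e))" by (simp only:)
    have "word x p ! (wd p - e) = x ! (st p + (wd p - e))"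
      by (rule word_nth(1)[OF p(1)]) (use e w in auto)
    then have "word x p ! wd p \<noteq> word x p ! (wd p - e)"
      unfolding word_nth(2)[OF p(1)] c by (cases "x ! (st p + (wd p - e))") auto
    then show ?thesis using e w p length_word by (intro exI[of _ "wd p - e"]) auto
  next
    case False
    then obtain i where i: "i < wd p - e" "xo (st p + i) \<noteq> xo (st p + i + e)" by blast
    from i(2) have "x ! (st p + i) \<noteq> x ! (st p + i + e)" by (rule contrapos_nn) simp
    with i(1) show ?thesis using p length_word word_nth(1)[OF p(1)]
      by (intro exI[of _ i]) (auto simp: add.assoc)
  qed
qed

lemma wd_le: "wd p \<le> 8 * R" by (simp add: wd_def W_def)

text \<open>The weight of \<open>weight_inverse_le_2\<close> for words of up to
  \<open>8 * R + 1\<close> letters. Twice the estimate of \<beta> must stay below it too, hence the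
  factor 4 in \<open>beta_small\<close>.\<close>

definition BB :: real where "BB = 1 / (2 * real (8 * R + 2))"

lemma BB: "0 < BB" "BB < 1" "4 * \<bar>\<beta>\<bar> \<le> BB"
  using beta_small R by (auto simp: BB_def field_simps)

lemma BB_weight: "p < n \<Longrightarrow> (1 / (1 - BB)) ^ length (word x p) \<le> 2"
  using weight_inverse_le_2[of "Suc (wd p)" "8 * R + 1"] wd_le[of p] by (simp add: length_word BB_def)

lemma win_bound:
  assumes "good_center p cc" "j \<in> win cc (Rp p)"
  shows "\<bar>cp p + 1 / 2 - real j\<bar> \<le> real R + 5 / 2"
proof -
  have "cc \<le> j + Rp p" "j \<le> cc + Rp p" "Rp p \<le> R" using assms by (auto simp: Rp_def)
  then have "real cc \<le> real j + real R" "real j \<le> real cc + real R" by linarith+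
  then show ?thesis using assms(1) unfolding good_center_def by (simp add: abs_le_iff)
qed

lemma card_win: "card (win cc (Rp p)) \<le> 2 * R + 1"
  by (auto simp: Rp_def)

text \<open>A short prefix need not be aperiodic, but for it the window has a single start position,
  and the weighted count of embeddings from one position is at most 2.\<close>

lemma mass_word_le:
  assumes p: "p < n" and cc: "good_center p cc"
  shows "mass K (abs \<beta>) (win cc (Rp p)) (word x p) t \<le> 2"
proof (cases "p \<le> W")
  case True
  then have "win cc (Rp p) = {0}" using cc by (auto simp: good_center_def Rp_def)
  then have "mass K (abs \<beta>) (win cc (Rp p)) (word x p) t = (\<Sum>m\<le>K. abs \<beta> ^ m * real (starts (word x p) t m))"
    by (simp add: mass_def)
  also have "\<dots> \<le> (\<Sum>m\<le>K. BB ^ m * real (starts (word x p) t m))"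
    using BB by (intro sum_mono mult_right_mono power_mono) auto
  also have "\<dots> \<le> 2" using starts_weight_le[where B = BB and M = K and v = "word x p" and t = t] BB BB_weight[OF p] by simp
  finally show ?thesis .
next
  case False
  define lo where "lo = cc - R"
  define L where "L = cc + R + 1 - lo"
  have S: "win cc (Rp p) = {lo..<lo + L}" "L \<le> 2 * R + 1" using False by (auto simp: Rp_def lo_def L_def)
  have w: "length (word x p) = 8 * R + 1" using False length_word[OF p] by (simp add: wd_def W_def)
  have "mass K (abs \<beta>) {lo..<lo + L} (word x p) t \<le>
     1 + real K * (3 * (real K + 1)\<^sup>2 * (abs \<beta> * real (L + length (word x p))))"
  proof (rule mass_le[OF word_aperiodic])
    show "abs \<beta> * real (length (word x p)) \<le> 1"
      using beta_small unfolding w by (simp add: algebra_simps)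
  qed (use False p S R in auto)
  also have "\<dots> \<le> 1 + real K * (3 * (real K + 1)\<^sup>2 * (abs \<beta> * real (10 * R + 2)))"
    using S w by (intro add_left_mono mult_left_mono) auto
  also have "\<dots> \<le> 2" using mass_small by simp
  finally show ?thesis using S by simp
qed

lemma abs_stat_word_le:
  assumes p: "p < n" and cc: "good_center p cc"
  shows "\<bar>stat K \<beta> (cp p) (win cc (Rp p)) (word x p) t\<bar> \<le> 2 * (real R + 3)"
proof -
  have "\<bar>stat K \<beta> (cp p) (win cc (Rp p)) (word x p) t\<bar> \<le> (real R + 3) * mass K (abs \<beta>) (win cc (Rp p)) (word x p) t"
    using win_bound[OF cc] by (intro abs_stat_le) force+
  also have "\<dots> \<le> (real R + 3) * 2" using mass_word_le[OF p cc] by (intro mult_left_mono) auto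
  finally show ?thesis by simp
qed

lemma retain_word: "p < n \<Longrightarrow> 9 / 10 \<le> (1 - \<delta>) ^ length (word x p)" "(1 - \<delta>) ^ k \<le> 1"
proof -
  assume p: "p < n"
  have "(1 - \<delta>) ^ (8 * R + 1) \<le> (1 - \<delta>) ^ length (word x p)"
    using \<delta> wd_le[of p] length_word[OF p] by (intro power_decreasing) auto
  then show "9 / 10 \<le> (1 - \<delta>) ^ length (word x p)" using retain by simp
next
  show "(1 - \<delta>) ^ k \<le> 1" using \<delta> by (intro power_le_one) auto
qed

text \<open>The sum over occurrences is 1/2 or at most 0 up to 1/100, survival of the word costs a
  factor of at least 9/10, and the cut at \<open>K\<close> another 1/100. This leaves
  \<open>9/10 * 49/100 - 1/100 > 2/5\<close> against \<open>1/100 + 1/100 < 1/10\<close>.\<close>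

lemma E_stat_word:
  assumes p: "p < n" and cc: "good_center p cc"
  defines "E \<equiv> E_del \<delta> x (stat K \<beta> (cp p) (win cc (Rp p)) (word x p))"
  shows "x ! p = (cand xo p = 1) \<Longrightarrow> 2 / 5 \<le> E" and "x ! p \<noteq> (cand xo p = 1) \<Longrightarrow> E \<le> 1 / 10"
proof -
  define v where "v = word x p"
  define S where "S = win cc (Rp p)"
  define s where "s = (\<Sum>k<n. bexp \<delta> (phi (cp p) cc (Rp p)) k * of_bool (take (length v) (drop k x) = v))"
  have v: "v \<noteq> []" by (simp add: v_def word_def)
  have "\<bar>stat K \<beta> (cp p) S v t - loc_sum \<beta> (phi (cp p) cc (Rp p)) v t\<bar> \<le> 1 / 100" for t
  proof -
    have "\<bar>stat K \<beta> (cp p) S v t - loc_sum \<beta> (phi (cp p) cc (Rp p)) v t\<bar>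
      \<le> real (card S) * (real R + 3) * ((\<bar>\<beta>\<bar> / BB) ^ Suc K * (1 / (1 - BB)) ^ length v)"
      unfolding S_def using BB win_bound[OF cc] by (intro stat_trunc) (auto, force+)
    also have "\<dots> \<le> real (2 * R + 1) * (real R + 3) * ((\<bar>\<beta>\<bar> * (2 * real (8 * R + 2))) ^ Suc K * 2)"
    proof (intro mult_mono)
      show "real (card S) \<le> real (2 * R + 1)" unfolding S_def of_nat_le_iff by (rule card_win)
      show "(1 / (1 - BB)) ^ length v \<le> 2" using BB_weight[OF p] by (simp add: v_def)
    qed (use BB in \<open>auto simp: BB_def\<close>)
    also have "\<dots> \<le> 1 / 100" by (rule trunc_small)
    finally show ?thesis .
  qed
  then have "\<bar>E_del \<delta> x (\<lambda>t. stat K \<beta> (cp p) S v t - loc_sum \<beta> (phi (cp p) cc (Rp p)) v t)\<bar> \<le> 1 / 100"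
    by (intro order.trans[OF integral_abs_bound] measure_pmf.integral_le_const) auto
  moreover have "E_del \<delta> x (\<lambda>t. stat K \<beta> (cp p) S v t - loc_sum \<beta> (phi (cp p) cc (Rp p)) v t)
     = E - (1 - \<delta>) ^ length v * s"
  proof -
    have "E_del \<delta> x (loc_sum \<beta> (phi (cp p) cc (Rp p)) v) = (1 - \<delta>) ^ length v * s"
      unfolding s_def len[symmetric] by (rule E_loc_sum[OF _ _ \<beta> v]) (use \<delta> in auto)
    then show ?thesis unfolding E_def S_def[symmetric] v_def[symmetric]
      by (subst Bochner_Integration.integral_diff) (rule integrable_deletion_channel, rule integrable_deletion_channel, simp only:)
  qed
  ultimately have E: "\<bar>E - (1 - \<delta>) ^ length v * s\<bar> \<le> 1 / 100" by simp
  have f: "9 / 10 \<le> (1 - \<delta>) ^ length v" "(1 - \<delta>) ^ length v \<le> 1"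
    using retain_word p by (auto simp: v_def)
  have s: "(x ! p = (cand xo p = 1) \<longrightarrow> 49 / 100 \<le> s) \<and> (x ! p \<noteq> (cand xo p = 1) \<longrightarrow> s \<le> 1 / 100)"
  proof (cases "p \<le> W")
    case True
    then have [simp]: "cc = 0" "Rp p = 0" "st p = 0" "cp p = 0" "wd p = p"
      using cc by (auto simp: good_center_def Rp_def st_def cp_def wd_def)
    have "take (length v) x = v \<longleftrightarrow> x ! p = (cand xo p = 1)"
      using p len by (auto simp: v_def word_def take_Suc_conv_app_nth)
    then show ?thesis
      using sum_occurrences_init[of \<delta> n x v] \<delta> n_pos len p length_word[OF p] unfolding s_def by (auto simp: v_def)
  next
    case False
    have k0: "st p + wd p = p" by (rule wd_st)
    have psi': "real n * (real n + 1) * \<psi> \<le> 1 / 100" by (rule psi)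
    have c: "\<bar>real cc - cp p\<bar> \<le> 2" using cc by (simp add: good_center_def)
    have Rp: "Rp p = R" using False by (simp add: Rp_def)
    have lv: "length v = Suc (wd p)" using length_word[OF p] by (simp add: v_def)
    have u: "x ! (st p + i) = v ! i" if "i < wd p" for i using word_nth(1)[OF p that] by (simp add: v_def)
    have vl: "v ! wd p = (cand xo p = 1)" using word_nth(2)[OF p] by (simp add: v_def)
    have ap: "aperiodic_upto (4 * R) v" using word_aperiodic p False by (simp add: v_def)
    have d: "\<delta> \<le> 1 / 2" "st p \<le> n" "R + 2 \<le> n" "st p + wd p < n" using \<delta> p n R k0 by auto
    note occ = sum_occurrences[OF \<delta>(1) d(1) tail cp_def d(2) c R d(3) len lv ap u d(4)]
    show ?thesis
      using occ psi unfolding s_def Rp k0 vl by fastforce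
  qed
  show "2 / 5 \<le> E" if "x ! p = (cand xo p = 1)"
  proof -
    have "9 / 10 * (49 / 100) \<le> (1 - \<delta>) ^ length v * s" using f s that by (intro mult_mono) auto
    then show ?thesis using E by linarith
  qed
  show "E \<le> 1 / 10" if "x ! p \<noteq> (cand xo p = 1)"
  proof -
    have "(1 - \<delta>) ^ length v * s \<le> (1 - \<delta>) ^ length v * (1 / 100)" using f s that by (intro mult_left_mono) auto
    also have "\<dots> \<le> 1 * (1 / 100)" using f by (intro mult_right_mono) auto
    finally show ?thesis using E by linarith
  qed
qed

end

context reconstruct_params
begin

lemma cand_le_1: "cand out p \<le> 1"
  unfolding cand_def by (rule bcand_le_1)

lemma cand_cong: "(\<And>i. i < p \<Longrightarrow> out i = out' i) \<Longrightarrow> cand out p = cand out' p"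
  unfolding cand_def using wd_st[of p]
  by (intro bcand_cong) (auto simp: Qp_def wd_def W_def)

text \<open>The memory is one array, so reads for trace \<open>i\<close> must not run into the next
  row. The last one is at \<open>j + wd p + m\<close>; this may exceed \<open>n\<close> by about
  \<open>R + K\<close>, and rows of length \<open>2 * n\<close> leave room for it.\<close>

lemma cnt_eq_starts:
  assumes p: "p < n" and out: "\<And>i. i < p \<Longrightarrow> out i = xo i" and cc: "good_center p cc"
    and j: "j \<in> win cc (Rp p)" and m: "m \<le> K" and i: "i < N"
  shows "cnt (mem \<omega>) (out(p := cand out p)) p i j m = starts (word x p) (drop j (\<omega> i)) m"
proof -
  let ?w = "word x p" and ?t = "\<omega> i"
  have jm: "j + wd p + m < 2 * n"
  proof (cases "p \<le> W")
    case True
    then show ?thesis using cc j m n R by (auto simp: good_center_def Rp_def wd_def W_def)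
  next
    case False
    have "real cc \<le> cp p + 2" using cc unfolding good_center_def by linarith
    also have "cp p \<le> 1 * real (st p)" unfolding cp_def using \<delta> by (intro mult_right_mono) auto
    finally have "cc \<le> st p + 2" by linarith
    then show ?thesis using False j m n R p by (auto simp: Rp_def wd_def W_def st_def)
  qed
  have "dp (\<lambda>d. mem \<omega> (i * (2 * n) + j + d)) (\<lambda>h. (out(p := cand out p)) (st p + h)) (wd p) m
     = starts (take (Suc (wd p)) ?w) (drop j ?t) m"
  proof (rule dp_eq_starts)
    show "wd p < length ?w" using length_word[OF p] by simp
  next
    fix d assume d: "d \<le> wd p + m"
    have lt: "j + d < 2 * n" using d jm by simp
    have e: "i * (2 * n) + j + d = (j + d) + (2 * n) * i" by simp
    have "(i * (2 * n) + j + d) div (2 * n) = i" "(i * (2 * n) + j + d) mod (2 * n) = j + d"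
      unfolding e using lt by auto
    moreover have "i * (2 * n) + j + d < N * (2 * n)"
    proof -
      have "(i + 1) * (2 * n) \<le> N * (2 * n)" using i by (intro mult_right_mono) auto
      then show ?thesis using lt by simp
    qed
    ultimately show "mem \<omega> (i * (2 * n) + j + d) = (if d < length (drop j ?t) then of_bool (drop j ?t ! d) else 2)"
      by (auto simp: mem_def Let_def)
  next
    fix h assume h: "h \<le> wd p"
    show "(out(p := cand out p)) (st p + h) = of_bool (?w ! h)"
    proof (cases "h = wd p")
      case True
      have "cand out p = cand xo p" by (rule cand_cong) (rule out)
      then show ?thesis using True wd_st[of p] word_nth(2)[OF p] cand_le_1[of xo p]
        by (auto simp: of_bool_def)
    next
      case False
      then have "h < wd p" using h by simp
      then show ?thesis using word_nth(1)[OF p] wd_st[of p] out[of "st p + h"] by auto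
    qed
  qed
  also have "take (Suc (wd p)) ?w = ?w" using length_word[OF p] by simp
  finally show ?thesis by (simp add: cnt_def)
qed

text \<open>Deterministic once the two events hold. The estimates of \<open>c\<close> and \<beta>
  cost 1/16 for each trace and sampling another 1/16; the total of 1/8 is less than the distance
  3/20 of both 2/5 and 1/10 from the threshold 1/4.\<close>

lemma nextbit_correct:
  assumes p: "p < n" and out: "\<And>i. i < p \<Longrightarrow> out i = xo i"
    and lens: "\<And>i. i < N \<Longrightarrow> length (\<omega> i) \<le> n"
    and dens: "\<bar>real (total \<omega>) / (real n * real N) - (1 - \<delta>)\<bar> \<le> 1 / (100 * real n)"
    and conc: "\<And>cc. good_center p cc \<Longrightarrow>
      \<bar>(\<Sum>i<N. stat K \<beta> (cp p) (win cc (Rp p)) (word x p) (\<omega> i))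
        - real N * E_del \<delta> x (stat K \<beta> (cp p) (win cc (Rp p)) (word x p))\<bar> \<le> real N / 16"
  shows "nextbit (mem \<omega>) (total \<omega>) out p = xo p"
proof -
  define L where "L = total \<omega>"
  define M where "M = n * N"
  define q where "q = real L / real M"
  define D where "D = M - L"
  define ch where "ch = q * real (st p)"
  define cc where "cc = center L p"
  define \<beta>' where "\<beta>' = - (real D / real L)"
  define S where "S = win cc (Rp p)"
  define v where "v = word x p"
  define b where "b = cand out p"
  define E where "E = E_del \<delta> x (stat K \<beta> (cp p) S v)"
  define T where "T i = stat K \<beta>' ch S v (\<omega> i)" for i
  have M: "M > 0" using n_pos N by (simp add: M_def)
  have q: "\<bar>q - (1 - \<delta>)\<bar> \<le> 1 / (100 * real n)"
    using dens by (simp add: q_def L_def M_def)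
  have n1: "1 / (100 * real n) \<le> 1 / 100" using n_pos by (simp add: field_simps)
  have q': "98 / 100 \<le> q" using q n1 \<delta> by (simp add: abs_le_iff)
  have L: "L > 0" using q' by (intro gr0I) (simp add: q_def)
  have LM: "L \<le> M"
  proof -
    have "L \<le> (\<Sum>i<N. n)" unfolding L_def total_def by (intro sum_mono) (use lens in force)
    then show ?thesis by (simp add: M_def mult.commute)
  qed
  have D: "real D = real M - real L" using LM by (simp add: D_def of_nat_diff)
  have ch: "\<bar>ch - cp p\<bar> \<le> 1 / 100"
  proof -
    have "\<bar>ch - cp p\<bar> = \<bar>q - (1 - \<delta>)\<bar> * real (st p)" unfolding ch_def cp_def
      by (simp add: left_diff_distrib[symmetric] abs_mult)
    also have "\<dots> \<le> 1 / (100 * real n) * real n"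
      using q p by (intro mult_mono) (auto simp: st_def)
    also have "\<dots> = 1 / 100" using n_pos by simp
    finally show ?thesis .
  qed
  have chq: "ch = real (L * st p) / real M" by (simp add: ch_def q_def)
  have fl: "real cc \<le> ch" "ch \<le> real cc + 1"
  proof -
    have e: "L * st p = cc * M + L * st p mod M"
      unfolding cc_def center_def M_def by (rule div_mult_mod_eq[symmetric])
    have "L * st p mod M < M" using M by simp
    then have "cc * M \<le> L * st p" "L * st p \<le> (cc + 1) * M" using e by (auto simp: algebra_simps)
    then have "real (cc * M) \<le> real (L * st p)" "real (L * st p) \<le> real ((cc + 1) * M)"
      unfolding of_nat_le_iff .
    then have "real cc * real M \<le> real (L * st p)" "real (L * st p) \<le> (real cc + 1) * real M"
      unfolding of_nat_mult of_nat_add of_nat_1 .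
    then show "real cc \<le> ch" "ch \<le> real cc + 1"
      using M unfolding chq by (simp_all add: pos_le_divide_eq pos_divide_le_eq)
  qed
  have good: "good_center p cc"
    unfolding good_center_def
  proof (intro conjI impI)
    show "\<bar>real cc - cp p\<bar> \<le> 2" using fl ch by linarith
    show "cc = 0" if "p \<le> W" using that by (simp add: cc_def center_def st_def)
  qed
  have finS: "finite S" by (simp add: S_def)
  have bxo: "b = cand xo p" unfolding b_def by (rule cand_cong) (rule out)
  have b1: "b \<le> 1" unfolding b_def by (rule cand_le_1)

  have trm: "real (cnt (mem \<omega>) (out(p := b)) p i j m * weight L m * (if even m then above L p j else below L p j))
      - real (cnt (mem \<omega>) (out(p := b)) p i j m * weight L m * (if even m then below L p j else above L p j))
      = 2 * real M * real L ^ K * ((ch + 1 / 2 - real j) * (\<beta>' ^ m * real (starts v (drop j (\<omega> i)) m)))"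
    if "i < N" "j \<in> S" "m \<le> K" for i j m
  proof -
    have c: "cnt (mem \<omega>) (out(p := b)) p i j m = starts v (drop j (\<omega> i)) m"
      unfolding b_def v_def using cnt_eq_starts[OF p out good _ \<open>m \<le> K\<close> \<open>i < N\<close>] that by (simp add: S_def)
    have ab: "real (above L p j) - real (below L p j) = 2 * real M * (ch + 1 / 2 - real j)"
    proof -
      have "real (a - b) - real (b - a) = real a - real b" for a b :: nat by linarith
      then have "real (above L p j) - real (below L p j) = real (2 * (L * st p) + M) - real (2 * M * j)"
        by (simp add: above_def below_def M_def)
      also have "\<dots> = 2 * real M * (ch + 1 / 2 - real j)"
        using M by (simp add: ch_def q_def field_simps)
      finally show ?thesis .
    qed
    have w: "real (weight L m) * (- 1) ^ m = real L ^ K * \<beta>' ^ m"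
    proof -
      have "real L ^ K = real L ^ m * real L ^ (K - m)" using \<open>m \<le> K\<close> by (simp flip: power_add)
      moreover have "\<beta>' ^ m = (- 1) ^ m * (real D ^ m / real L ^ m)"
        by (simp add: \<beta>'_def power_divide power_minus[of "real D / real L"])
      ultimately show ?thesis using L by (simp add: weight_def D_def M_def)
    qed
    have "real (cnt (mem \<omega>) (out(p := b)) p i j m * weight L m * (if even m then above L p j else below L p j))
      - real (cnt (mem \<omega>) (out(p := b)) p i j m * weight L m * (if even m then below L p j else above L p j))
      = real (starts v (drop j (\<omega> i)) m) * (real (weight L m) * (- 1) ^ m) * (real (above L p j) - real (below L p j))"
      unfolding c by (cases "even m") (auto simp: algebra_simps)
    also have "\<dots> = 2 * real M * real L ^ K * ((ch + 1 / 2 - real j) * (\<beta>' ^ m * real (starts v (drop j (\<omega> i)) m)))"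
      unfolding w ab by (simp add: algebra_simps)
    finally show ?thesis .
  qed
  have diff: "real (plus (mem \<omega>) L (out(p := b)) p) - real (minus (mem \<omega>) L (out(p := b)) p)
     = 2 * real M * real L ^ K * (\<Sum>i<N. T i)"
  proof -
    have "real (plus (mem \<omega>) L (out(p := b)) p) - real (minus (mem \<omega>) L (out(p := b)) p)
      = (\<Sum>i<N. \<Sum>j\<in>S. \<Sum>m\<le>K.
          real (cnt (mem \<omega>) (out(p := b)) p i j m * weight L m * (if even m then above L p j else below L p j))
          - real (cnt (mem \<omega>) (out(p := b)) p i j m * weight L m * (if even m then below L p j else above L p j)))"
      unfolding plus_def minus_def cc_def[symmetric] S_def[symmetric] of_nat_sum sum_subtractf ..
    also have "\<dots> = (\<Sum>i<N. \<Sum>j\<in>S. \<Sum>m\<le>K.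
        2 * real M * real L ^ K * ((ch + 1 / 2 - real j) * (\<beta>' ^ m * real (starts v (drop j (\<omega> i)) m))))"
      by (intro sum.cong refl trm) auto
    also have "\<dots> = 2 * real M * real L ^ K * (\<Sum>i<N. T i)"
      unfolding T_def stat_def sum_distrib_left ..
    finally show ?thesis .
  qed
  have dec: "2 * plus (mem \<omega>) L (out(p := b)) p < 2 * minus (mem \<omega>) L (out(p := b)) p + n * N * N * L ^ K
     \<longleftrightarrow> (\<Sum>i<N. T i) < real N / 4"
  proof -
    have "2 * plus (mem \<omega>) L (out(p := b)) p < 2 * minus (mem \<omega>) L (out(p := b)) p + n * N * N * L ^ K
      \<longleftrightarrow> real (2 * plus (mem \<omega>) L (out(p := b)) p) < real (2 * minus (mem \<omega>) L (out(p := b)) p + n * N * N * L ^ K)"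
      by (simp only: of_nat_less_iff)
    also have "\<dots> \<longleftrightarrow> 2 * (real (plus (mem \<omega>) L (out(p := b)) p) - real (minus (mem \<omega>) L (out(p := b)) p)) < real M * real N * real L ^ K"
      by (simp add: M_def algebra_simps)
    also have "\<dots> \<longleftrightarrow> (real M * real L ^ K) * (4 * (\<Sum>i<N. T i)) < (real M * real L ^ K) * real N"
      unfolding diff by (simp add: algebra_simps)
    also have "\<dots> \<longleftrightarrow> 4 * (\<Sum>i<N. T i) < real N"
      using M L by (subst mult_less_cancel_left_pos) auto
    finally show ?thesis by auto
  qed
  have \<beta>\<beta>': "\<bar>\<beta> - \<beta>'\<bar> \<le> 1 / (50 * real n)"
  proof -
    \<comment> \<open>Both numbers have the form \<open>1 - 1/q\<close>, with \<open>q\<close> the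
      survival probability or its estimate, so the error of \<beta> is at most about that of
      \<open>q\<close>.\<close>
    have 1: "\<beta> = 1 - 1 / (1 - \<delta>)" using \<delta> by (simp add: \<beta> field_simps)
    have 2: "\<beta>' = 1 - 1 / q" unfolding \<beta>'_def D q_def using M L by (simp add: field_simps)
    have "\<beta> - \<beta>' = ((1 - \<delta>) - q) / (q * (1 - \<delta>))"
      unfolding 1 2 using q' \<delta> by (simp add: field_simps)
    then have "\<bar>\<beta> - \<beta>'\<bar> = \<bar>q - (1 - \<delta>)\<bar> / (q * (1 - \<delta>))"
      using q' \<delta> by (simp add: abs_mult abs_minus_commute)
    also have "\<dots> \<le> (1 / (100 * real n)) / (1 / 2)"
    proof (rule frac_le)
      have "98 / 100 * (99 / 100) \<le> q * (1 - \<delta>)" using q' \<delta> by (intro mult_mono) auto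
      then show "1 / 2 \<le> q * (1 - \<delta>)" by simp
    qed (use q n_pos in auto)
    finally show ?thesis by simp
  qed
  have near: "\<bar>T i - stat K \<beta> (cp p) S v (\<omega> i)\<bar> \<le> 1 / 16" for i
  proof -
    have BB': "2 * abs \<beta>' \<le> BB"
    proof -
      have "1 / (50 * real n) \<le> BB / 4"
        unfolding BB_def using n R by (simp add: field_simps)
      then show ?thesis using \<beta>\<beta>' BB by linarith
    qed
    have BB2: "2 * abs \<beta> \<le> BB" using BB by linarith
    have A: "\<bar>ch + 1 / 2 - real j\<bar> \<le> real R + 3" if "j \<in> S" for j
      using win_bound[OF good, of j] that ch unfolding S_def by linarith
    have "\<bar>T i - stat K \<beta> (cp p) S v (\<omega> i)\<bar> \<le> abs (ch - cp p) * mass K (abs \<beta>) S v (\<omega> i)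
       + (real R + 3) * real (card S) * (abs (\<beta> - \<beta>') / BB * (1 / (1 - BB)) ^ length v)"
      unfolding T_def by (rule stat_perturb[OF BB2 BB' BB(1,2) finS A])
    also have "\<dots> \<le> 1 / 100 * 2 + (real R + 3) * real (2 * R + 1) * (1 / (50 * real n) * (2 * real (8 * R + 2)) * 2)"
    proof (intro add_mono mult_mono)
      show "mass K (abs \<beta>) S v (\<omega> i) \<le> 2" unfolding S_def v_def by (rule mass_word_le[OF p good])
      show "real (card S) \<le> real (2 * R + 1)" unfolding S_def of_nat_le_iff by (rule card_win)
      show "abs (\<beta> - \<beta>') / BB \<le> 1 / (50 * real n) * (2 * real (8 * R + 2))"
        unfolding BB_def divide_divide_eq_right div_by_1 by (rule mult_right_mono[OF \<beta>\<beta>']) simp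
      show "(1 / (1 - BB)) ^ length v \<le> 2" unfolding v_def by (rule BB_weight[OF p])
      show "0 \<le> mass K (abs \<beta>) S v (\<omega> i)" by (simp add: mass_def sum_nonneg)
    qed (use ch BB in auto)
    also have "\<dots> \<le> 1 / 16" using perturb_small by simp
    finally show ?thesis .
  qed
  have "\<bar>(\<Sum>i<N. T i) - (\<Sum>i<N. stat K \<beta> (cp p) S v (\<omega> i))\<bar> \<le> (\<Sum>i<N. 1 / 16)"
    unfolding sum_subtractf[symmetric] by (rule order.trans[OF sum_abs sum_mono]) (rule near)
  then have "\<bar>(\<Sum>i<N. T i) - (\<Sum>i<N. stat K \<beta> (cp p) S v (\<omega> i))\<bar> \<le> real N / 16" by simp
  moreover have "\<bar>(\<Sum>i<N. stat K \<beta> (cp p) S v (\<omega> i)) - real N * E\<bar> \<le> real N / 16"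
    using conc[OF good] unfolding E_def S_def v_def .
  ultimately have TE: "\<bar>(\<Sum>i<N. T i) - real N * E\<bar> \<le> real N / 8" by linarith
  have N0: "real N > 0" using N by simp
  show ?thesis
  proof (cases "x ! p = (b = 1)")
    case True
    then have "2 / 5 \<le> E" using E_stat_word(1)[OF p good] unfolding E_def S_def v_def bxo by blast
    then have "real N * (2 / 5) \<le> real N * E" using N0 by (intro mult_left_mono) auto
    then have "\<not> (\<Sum>i<N. T i) < real N / 4" using TE N0 by linarith
    then show ?thesis using dec True b1 unfolding nextbit_def Let_def b_def[symmetric] L_def[symmetric]
      by (auto simp: of_bool_def)
  next
    case False
    then have "E \<le> 1 / 10" using E_stat_word(2)[OF p good] unfolding E_def S_def v_def bxo by blast
    then have "real N * E \<le> real N * (1 / 10)" using N0 by (intro mult_left_mono) auto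
    then have "(\<Sum>i<N. T i) < real N / 4" using TE N0 by linarith
    then show ?thesis using dec False b1 unfolding nextbit_def Let_def b_def[symmetric] L_def[symmetric]
      by (cases "x ! p") (auto simp: of_bool_def)
  qed
qed

text \<open>\<open>conc\<close> speaks of the words of \<open>x\<close> itself, one fixed word for
  each position, while the program builds its words from its own output and uses the same traces
  throughout. As long as the output is right the two agree, so no independence between positions is
  required.\<close>

lemma recon_correct:
  assumes lens: "\<And>i. i < N \<Longrightarrow> length (\<omega> i) \<le> n"
    and dens: "\<bar>real (total \<omega>) / (real n * real N) - (1 - \<delta>)\<bar> \<le> 1 / (100 * real n)"
    and conc: "\<And>p cc. p < n \<Longrightarrow> good_center p cc \<Longrightarrow>
      \<bar>(\<Sum>i<N. stat K \<beta> (cp p) (win cc (Rp p)) (word x p) (\<omega> i))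
        - real N * E_del \<delta> x (stat K \<beta> (cp p) (win cc (Rp p)) (word x p))\<bar> \<le> real N / 16"
    and "p \<le> n" "i < p"
  shows "recon (mem \<omega>) (total \<omega>) p i = xo i"
  using assms(4,5)
proof (induction p arbitrary: i)
  case (Suc p)
  have "nextbit (mem \<omega>) (total \<omega>) (recon (mem \<omega>) (total \<omega>) p) p = xo p"
    using Suc lens dens conc by (intro nextbit_correct) auto
  then show ?case using Suc by (auto simp: less_Suc_eq)
qed auto

end

subsection \<open>Independent traces\<close>

locale pmf_samples =
  fixes D :: "'a pmf"
begin

sublocale prob_space "\<Pi>\<^sub>M i\<in>(UNIV :: nat set). measure_pmf D"
  by (intro prob_space_PiM measure_pmf.prob_space_axioms)

abbreviation PM where "PM \<equiv> \<Pi>\<^sub>M i\<in>(UNIV :: nat set). measure_pmf D"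

lemma measurable_sample [measurable]: "(\<lambda>\<omega>. f (\<omega> i)) \<in> borel_measurable PM"
  by (rule measurable_compose[OF measurable_component_singleton]) auto

lemma distr_sample: "distr PM (measure_pmf D) (\<lambda>\<omega>. \<omega> i) = measure_pmf D"
  using distr_PiM_component[of "UNIV :: nat set" "\<lambda>_. measure_pmf D" i]
  by (simp add: measure_pmf.prob_space_axioms)

lemma expectation_sample:
  fixes f :: "'a \<Rightarrow> real"
  shows "expectation (\<lambda>\<omega>. f (\<omega> i)) = measure_pmf.expectation D f"
proof -
  have "measure_pmf.expectation D f = integral\<^sup>L (distr PM (measure_pmf D) (\<lambda>\<omega>. \<omega> i)) f"
    by (simp add: distr_sample)
  also have "\<dots> = expectation (\<lambda>\<omega>. f (\<omega> i))"
    by (rule integral_distr) auto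
  finally show ?thesis ..
qed

lemma integrable_sample:
  fixes f :: "'a \<Rightarrow> real"
  assumes "integrable (measure_pmf D) f"
  shows "integrable PM (\<lambda>\<omega>. f (\<omega> i))"
proof -
  have "integrable (distr PM (measure_pmf D) (\<lambda>\<omega>. \<omega> i)) f" using assms by (simp add: distr_sample)
  then show ?thesis by (rule integrable_distr[rotated]) auto
qed

lemma AE_sample: "AE \<omega> in PM. \<omega> i \<in> set_pmf D"
  by (rule AE_PiM_component) (auto simp: measure_pmf.prob_space_axioms AE_measure_pmf)

lemma indep_samples:
  fixes f :: "'a \<Rightarrow> real"
  shows "indep_vars (\<lambda>_. borel) (\<lambda>i \<omega>. f (\<omega> i)) I"
proof -
  have "indep_vars (\<lambda>_. measure_pmf D) (\<lambda>i \<omega>. \<omega> i) (UNIV :: nat set)"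
    by (subst indep_vars_iff_distr_eq_PiM) (auto simp: distr_sample restrict_def distr_id2)
  then have "indep_vars (\<lambda>_. borel) (\<lambda>i \<omega>. f (\<omega> i)) UNIV"
    by (rule indep_vars_compose2) auto
  then show ?thesis by (rule indep_vars_subset) auto
qed

lemma Hoeffding_samples:
  fixes f :: "'a \<Rightarrow> real"
  assumes b: "\<And>y. \<bar>f y\<bar> \<le> b" "b > 0" and "N > 0" "\<eta> \<ge> 0"
  shows "prob {\<omega> \<in> space PM. \<bar>(\<Sum>i<N. f (\<omega> i)) - real N * measure_pmf.expectation D f\<bar> \<ge> \<eta>}
    \<le> 2 * exp (- \<eta>\<^sup>2 / (2 * real N * b\<^sup>2))"
proof -
  interpret Hoeffding_ineq PM "{..<N}" "\<lambda>i \<omega>. f (\<omega> i)" "\<lambda>_. - b" "\<lambda>_. b" "\<Sum>i<N. expectation (\<lambda>\<omega>. f (\<omega> i))"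
  proof unfold_locales
    show "indep_vars (\<lambda>_. borel) (\<lambda>i \<omega>. f (\<omega> i)) {..<N}" by (rule indep_samples)
    show "AE x in PM. f (x i) \<in> {- b..b}" for i using b by (auto simp: abs_le_iff minus_le_iff)
  qed auto
  have "prob {x \<in> space PM. \<eta> \<le> \<bar>(\<Sum>i<N. f (x i)) - (\<Sum>i<N. expectation (\<lambda>\<omega>. f (\<omega> i)))\<bar>}
    \<le> 2 * exp (-2 * \<eta>\<^sup>2 / (\<Sum>i<N. (b - - b)\<^sup>2))"
    by (rule Hoeffding_ineq_abs_ge) (use assms in \<open>auto intro!: mult_pos_pos\<close>)
  also have "-2 * \<eta>\<^sup>2 / (\<Sum>i<N. (b - - b)\<^sup>2) = - \<eta>\<^sup>2 / (2 * real N * b\<^sup>2)"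
    using assms by (simp add: field_simps power2_eq_square)
  finally show ?thesis by (simp add: expectation_sample)
qed

text \<open>Used for the total trace length. Hoeffding's inequality would see only the range
  \<open>n\<close> of a length; the variance, at most \<open>n \<delta>\<close>, is so small that
  already the second moment suffices.\<close>

lemma Chebyshev_samples:
  fixes f :: "'a \<Rightarrow> real"
  assumes fin: "finite (set_pmf D)" and \<eta>: "\<eta> > 0"
  defines "\<mu> \<equiv> measure_pmf.expectation D f"
  shows "prob {\<omega> \<in> space PM. \<bar>(\<Sum>i<N. f (\<omega> i)) - real N * \<mu>\<bar> \<ge> \<eta>}
    \<le> real N * measure_pmf.expectation D (\<lambda>y. (f y - \<mu>)\<^sup>2) / \<eta>\<^sup>2"
proof -
  have int: "integrable (measure_pmf D) g" for g :: "'a \<Rightarrow> real"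
    by (rule integrable_measure_pmf_finite[OF fin])
  define X where "X i \<omega> = f (\<omega> i) - \<mu>" for i :: nat and \<omega>
  define S where "S \<omega> = (\<Sum>i<N. X i \<omega>)" for \<omega>
  have X0: "expectation (X i) = 0" for i
    unfolding X_def using expectation_sample[of "\<lambda>y. f y - \<mu>" i] int by (simp add: \<mu>_def)
  have XX: "expectation (\<lambda>\<omega>. X i \<omega> * X j \<omega>) = (if i = j then measure_pmf.expectation D (\<lambda>y. (f y - \<mu>)\<^sup>2) else 0)
      \<and> integrable PM (\<lambda>\<omega>. X i \<omega> * X j \<omega>)" for i j
  proof (cases "i = j")
    case True
    then show ?thesis
      using expectation_sample[of "\<lambda>y. (f y - \<mu>)\<^sup>2" i] integrable_sample[OF int, of "\<lambda>y. (f y - \<mu>)\<^sup>2" i]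
      by (simp add: X_def power2_eq_square)
  next
    case False
    have ind: "indep_vars (\<lambda>_. borel) X {i, j}"
      unfolding X_def using indep_samples[of "\<lambda>y. f y - \<mu>" "{i, j}"] by simp
    have intX: "integrable PM (X k)" for k
      unfolding X_def using integrable_sample[OF int, of "\<lambda>y. f y - \<mu>" k] .
    show ?thesis
      using indep_vars_lebesgue_integral[OF _ ind] indep_vars_integrable[OF _ ind] intX False X0
      by simp
  qed
  have S2: "S \<omega> ^ 2 = (\<Sum>i<N. \<Sum>j<N. X i \<omega> * X j \<omega>)" for \<omega>
    by (simp add: S_def power2_eq_square sum_product)
  have E2: "expectation (\<lambda>\<omega>. S \<omega> ^ 2) = real N * measure_pmf.expectation D (\<lambda>y. (f y - \<mu>)\<^sup>2)"
    unfolding S2 using XX by (simp add: Bochner_Integration.integral_sum)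
  have int2: "integrable PM (\<lambda>\<omega>. S \<omega> ^ 2)"
    unfolding S2 using XX by auto
  have [measurable]: "S \<in> borel_measurable PM"
    unfolding S_def X_def by measurable
  have ES: "expectation S = 0"
  proof -
    have "integrable PM (X k)" for k
      unfolding X_def using integrable_sample[OF int, of "\<lambda>y. f y - \<mu>" k] .
    then show ?thesis unfolding S_def by (simp add: X0)
  qed
  have "prob {\<omega> \<in> space PM. \<bar>S \<omega> - expectation S\<bar> \<ge> \<eta>} \<le> variance S / \<eta>\<^sup>2"
    by (rule Chebyshev_inequality) (use int2 \<eta> in auto)
  then show ?thesis unfolding ES using E2 by (simp add: S_def X_def sum_subtractf)
qed

end

text \<open>An event about the first \<open>N\<close> samples is a union of cylinders, and there are
  only countably many lists of \<open>N\<close> samples. No continuity or recursion of the event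
  itself enters.\<close>

lemma measurable_prefix_event:
  fixes D :: "'a :: countable pmf"
  assumes "\<And>\<omega> \<omega>' :: nat \<Rightarrow> 'a. (\<And>i. i < N \<Longrightarrow> \<omega> i = \<omega>' i) \<Longrightarrow> Q \<omega> \<longleftrightarrow> Q \<omega>'"
  shows "{\<omega> \<in> space (\<Pi>\<^sub>M i\<in>(UNIV :: nat set). measure_pmf D). Q \<omega>} \<in> sets (\<Pi>\<^sub>M i\<in>(UNIV :: nat set). measure_pmf D)"
proof -
  let ?M = "\<Pi>\<^sub>M i\<in>(UNIV :: nat set). measure_pmf D"
  have eq: "{\<omega> \<in> space ?M. Q \<omega>} = (\<Union>l\<in>{l. length l = N \<and> Q (\<lambda>i. l ! i)}. \<Inter>i\<in>{..<N}. {\<omega> \<in> space ?M. \<omega> i = l ! i}) \<inter> space ?M"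
    (is "_ = ?R")
  proof (rule set_eqI)
    fix \<omega>
    have "Q \<omega> \<longleftrightarrow> (\<exists>l. length l = N \<and> Q (\<lambda>i. l ! i) \<and> (\<forall>i<N. \<omega> i = l ! i))"
    proof
      assume "Q \<omega>"
      moreover have "Q \<omega> \<longleftrightarrow> Q (\<lambda>i. map \<omega> [0..<N] ! i)" by (rule assms) simp
      ultimately show "\<exists>l. length l = N \<and> Q (\<lambda>i. l ! i) \<and> (\<forall>i<N. \<omega> i = l ! i)"
        by (intro exI[of _ "map \<omega> [0..<N]"]) simp
    next
      assume "\<exists>l. length l = N \<and> Q (\<lambda>i. l ! i) \<and> (\<forall>i<N. \<omega> i = l ! i)"
      then obtain l where "length l = N" "Q (\<lambda>i. l ! i)" "\<forall>i<N. \<omega> i = l ! i" by blast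
      then show "Q \<omega>" using assms[of \<omega> "\<lambda>i. l ! i"] by simp
    qed
    then show "\<omega> \<in> {\<omega> \<in> space ?M. Q \<omega>} \<longleftrightarrow> \<omega> \<in> ?R" by (auto simp: space_PiM)
  qed
  have 1: "{\<omega> \<in> space ?M. \<omega> i = a} \<in> sets ?M" for i :: nat and a
  proof -
    have "(\<lambda>\<omega>. \<omega> i) -` {a} \<inter> space ?M \<in> sets ?M"
      by (rule measurable_sets[OF measurable_component_singleton]) auto
    also have "(\<lambda>\<omega>. \<omega> i) -` {a} \<inter> space ?M = {\<omega> \<in> space ?M. \<omega> i = a}" by auto
    finally show ?thesis .
  qed
  show ?thesis
  proof (cases "N = 0")
    case True
    then have "{\<omega> \<in> space ?M. Q \<omega>} = (if Q (\<lambda>_. undefined) then space ?M else {})"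
      using assms[of _ "\<lambda>_. undefined"] by auto
    then show ?thesis by auto
  next
    case False
    then show ?thesis unfolding eq
      by (intro sets.Int sets.top sets.countable_UN'' countableI_type sets.finite_INT 1) auto
  qed
qed

lemma (in reconstruct) mem_cong:
  assumes "\<And>i. i < N \<Longrightarrow> \<omega> i = \<omega>' i"
  shows "mem \<omega> = mem \<omega>'"
proof
  fix q
  have "q div (2 * n) < N" if "q < N * (2 * n)"
    using that by (simp add: less_mult_imp_div_less)
  then show "mem \<omega> q = mem \<omega>' q" using assms by (auto simp: mem_def Let_def)
qed

lemma (in reconstruct) total_cong:
  assumes "\<And>i. i < N \<Longrightarrow> \<omega> i = \<omega>' i"
  shows "total \<omega> = total \<omega>'"
  using assms by (simp add: total_def)

section \<open>The failure probability of the reconstruction\<close>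

context reconstruct_params
begin

lemma E_del_moments:
  shows "E_del \<delta> x (\<lambda>t. real (length t)) = (1 - \<delta>) * real n"
    and "E_del \<delta> x (\<lambda>t. (real (length t) - (1 - \<delta>) * real n)\<^sup>2) \<le> real n * \<delta>"
proof -
  have d: "0 \<le> \<delta>" "\<delta> \<le> 1" using \<delta> by auto
  show "E_del \<delta> x (\<lambda>t. real (length t)) = (1 - \<delta>) * real n"
    using E_del_length[OF d, of x real] by (simp add: bexp_mean len)
  have "real n * \<delta> * (1 - \<delta>) \<le> real n * \<delta> * 1" using d by (intro mult_left_mono) auto
  then show "E_del \<delta> x (\<lambda>t. (real (length t) - (1 - \<delta>) * real n)\<^sup>2) \<le> real n * \<delta>"
    using E_del_length[OF d, of x "\<lambda>l. (real l - (1 - \<delta>) * real n)\<^sup>2"] by (simp add: bexp_square len)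
qed

lemma recon_prob:
  defines "P \<equiv> \<Pi>\<^sub>M i\<in>(UNIV :: nat set). measure_pmf (deletion_channel \<delta> x)"
  shows "measure P {\<omega> \<in> space P. \<forall>i<n. recon (mem \<omega>) (total \<omega>) n i = xo i} \<ge>
    1 - (real n * real (n + 3) * (2 * exp (- real N / (2048 * (real R + 3)\<^sup>2))) + 10000 * (real n * \<delta>) / real N)"
proof -
  interpret pmf_samples "deletion_channel \<delta> x" .
  let ?f = "\<lambda>p cc. stat K \<beta> (cp p) (win cc (Rp p)) (word x p)"
  \<comment> \<open>With \<open>good_center\<close> inside the event, \<open>A p cc\<close> is empty
    for all other centres, and the union below can run over a plain range of
    \<open>cc\<close>.\<close>
  define A where "A p cc = {\<omega> \<in> space PM. good_center p cc \<and>
     real N / 16 \<le> \<bar>(\<Sum>i<N. ?f p cc (\<omega> i)) - real N * E_del \<delta> x (?f p cc)\<bar>}" for p cc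
  define B where "B = {\<omega> \<in> space PM. real N / 100 \<le> \<bar>(\<Sum>i<N. real (length (\<omega> i))) - real N * ((1 - \<delta>) * real n)\<bar>}"
  define F where "F = (\<Union>p\<in>{..<n}. \<Union>cc\<in>{..<n + 3}. A p cc)"
  define G where "G = {\<omega> \<in> space PM. \<forall>i<n. recon (mem \<omega>) (total \<omega>) n i = xo i}"
  have N0: "real N > 0" using N by simp
  have A_meas: "A p cc \<in> events" for p cc unfolding A_def by measurable
  have B_meas: "B \<in> events" unfolding B_def by measurable
  have G_meas: "G \<in> events" unfolding G_def
  proof (rule measurable_prefix_event[where N = N])
    fix \<omega> \<omega>' :: "nat \<Rightarrow> bool list" assume "\<And>i. i < N \<Longrightarrow> \<omega> i = \<omega>' i"
    then have "mem \<omega> = mem \<omega>'" "total \<omega> = total \<omega>'" using mem_cong total_cong by blast+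
    then show "(\<forall>i<n. recon (mem \<omega>) (total \<omega>) n i = xo i) \<longleftrightarrow> (\<forall>i<n. recon (mem \<omega>') (total \<omega>') n i = xo i)"
      by simp
  qed
  have A_prob: "prob (A p cc) \<le> 2 * exp (- real N / (2048 * (real R + 3)\<^sup>2))" if p: "p < n" for p cc
  proof (cases "good_center p cc")
    case True
    have "prob (A p cc) \<le> 2 * exp (- (real N / 16)\<^sup>2 / (2 * real N * (2 * (real R + 3))\<^sup>2))"
      unfolding A_def using True
      by (simp only: simp_thms) (rule Hoeffding_samples, use abs_stat_word_le[OF p True] N in auto)
    \<comment> \<open>Deviation \<open>N / 16\<close> and statistics bounded by
      \<open>2 (R + 3)\<close>: 2048 is \<open>16^2 * 2 * 2^2\<close>.\<close>
    also have "- (real N / 16)\<^sup>2 / (2 * real N * (2 * (real R + 3))\<^sup>2) = - real N / (2048 * (real R + 3)\<^sup>2)"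
    proof -
      have "- (a / 16)\<^sup>2 / (2 * a * (2 * y)\<^sup>2) = - a / (2048 * y\<^sup>2)" if "a > 0" "y > 0" for a y :: real
        using that by (simp add: field_simps power2_eq_square)
      from this[OF N0, of "real R + 3"] show ?thesis by (simp only: of_nat_0_le_iff add_nonneg_pos zero_less_numeral simp_thms)
    qed
    finally show ?thesis .
  qed (simp add: A_def)
  have B_prob: "prob B \<le> 10000 * (real n * \<delta>) / real N"
  proof -
    have "prob B \<le> real N * E_del \<delta> x (\<lambda>t. (real (length t) - (1 - \<delta>) * real n)\<^sup>2) / (real N / 100)\<^sup>2"
      using Chebyshev_samples[of "real N / 100" "\<lambda>t. real (length t)" N] N0
      unfolding B_def E_del_moments(1) by simp
    also have "\<dots> \<le> real N * (real n * \<delta>) / (real N / 100)\<^sup>2"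
      using E_del_moments(2) by (intro divide_right_mono mult_left_mono) auto
    also have "\<dots> = 10000 * (real n * \<delta>) / real N"
      using N0 by (simp add: field_simps power2_eq_square)
    finally show ?thesis .
  qed
  have F_meas: "F \<in> events" unfolding F_def using A_meas by auto
  have F_prob: "prob F \<le> real n * real (n + 3) * (2 * exp (- real N / (2048 * (real R + 3)\<^sup>2)))"
  proof -
    have "prob F \<le> (\<Sum>p<n. prob (\<Union>cc\<in>{..<n + 3}. A p cc))"
      unfolding F_def using A_meas by (intro measure_UNION_le) auto
    also have "\<dots> \<le> (\<Sum>p<n. \<Sum>cc<n + 3. prob (A p cc))"
      using A_meas by (intro sum_mono measure_UNION_le) auto
    also have "\<dots> \<le> (\<Sum>p<n. \<Sum>cc<n + 3. 2 * exp (- real N / (2048 * (real R + 3)\<^sup>2)))"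
      by (intro sum_mono A_prob) auto
    finally show ?thesis by (simp add: mult_ac)
  qed
  \<comment> \<open>The product space also contains sequences of lists that are no traces of
    \<open>x\<close>; the bound \<open>n\<close> on the lengths holds almost surely.\<close>
  have "AE \<omega> in PM. \<forall>i. \<omega> i \<in> set_pmf (deletion_channel \<delta> x)"
    unfolding AE_all_countable using AE_sample by blast
  then have "AE \<omega> in PM. \<omega> \<in> space PM - (F \<union> B) \<longrightarrow> \<omega> \<in> G"
  proof (rule eventually_mono, intro impI)
    fix \<omega>
    assume supp: "\<forall>i. \<omega> i \<in> set_pmf (deletion_channel \<delta> x)" and \<omega>: "\<omega> \<in> space PM - (F \<union> B)"
    have lens: "length (\<omega> i) \<le> n" for i using supp length_deletion_channel len by blast
    have tot: "real (total \<omega>) = (\<Sum>i<N. real (length (\<omega> i)))"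
    proof -
      have "min (2 * n) (length (\<omega> i)) = length (\<omega> i)" for i using lens[of i] by simp
      then show ?thesis by (simp add: total_def)
    qed
    have dens: "\<bar>real (total \<omega>) / (real n * real N) - (1 - \<delta>)\<bar> \<le> 1 / (100 * real n)"
    proof -
      have "real (total \<omega>) / (real n * real N) - (1 - \<delta>) = (real (total \<omega>) - real N * ((1 - \<delta>) * real n)) / (real n * real N)"
        using N0 n_pos by (simp add: field_simps)
      then have "\<bar>real (total \<omega>) / (real n * real N) - (1 - \<delta>)\<bar> = \<bar>real (total \<omega>) - real N * ((1 - \<delta>) * real n)\<bar> / (real n * real N)"
        by simp
      also have "\<dots> \<le> (real N / 100) / (real n * real N)"
        using \<omega> unfolding B_def tot by (intro divide_right_mono) auto
      finally show ?thesis using N0 by simp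
    qed
    have conc: "\<bar>(\<Sum>i<N. ?f p cc (\<omega> i)) - real N * E_del \<delta> x (?f p cc)\<bar> \<le> real N / 16"
      if p: "p < n" and g: "good_center p cc" for p cc
    proof -
      \<comment> \<open>A good centre is at most \<open>n + 2\<close>, whence the range
        \<open>n + 3\<close> in the union bound.\<close>
      have "cp p \<le> 1 * real n" unfolding cp_def st_def using \<delta> p by (intro mult_mono) auto
      then have "real cc \<le> real n + 2" using g unfolding good_center_def by linarith
      then have "cc < n + 3" by linarith
      then have "\<omega> \<notin> A p cc" using \<omega> p by (auto simp: F_def)
      then show ?thesis using g \<omega> by (auto simp: A_def)
    qed
    show "\<omega> \<in> G" unfolding G_def using recon_correct[OF lens dens conc order.refl] \<omega> by blast
  qed
  then have "prob (space PM - (F \<union> B)) \<le> prob G"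
    by (rule finite_measure_mono_AE) (rule G_meas)
  moreover have "prob (space PM - (F \<union> B)) = 1 - prob (F \<union> B)"
    using F_meas B_meas by (intro prob_compl) auto
  moreover have "prob (F \<union> B) \<le> prob F + prob B"
    using F_meas B_meas by (rule measure_Un_le)
  ultimately show ?thesis using F_prob B_prob unfolding G_def P_def by linarith
qed

end

subsection \<open>Choice of the parameters\<close>

lemma powr_third_cube:
  fixes a :: real
  assumes "a \<ge> 0"
  shows "(a ^ 3) powr (1 / 3) = a" "(a powr (1 / 3)) ^ 3 = a"
proof -
  have "a = 0 \<or> a > 0" using assms by auto
  then show "(a ^ 3) powr (1 / 3) = a"
  proof
    assume "a > 0"
    then have "(a ^ 3) powr (1 / 3) = (a powr real 3) powr (1 / 3)" by (simp only: powr_realpow)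
    also have "\<dots> = a powr (real 3 * (1 / 3))" by (rule powr_powr)
    finally show ?thesis using \<open>a > 0\<close> by simp
  qed simp
  have "a = 0 \<or> a > 0" using assms by auto
  then show "(a powr (1 / 3)) ^ 3 = a"
  proof
    assume "a > 0"
    then have "(a powr (1 / 3)) ^ 3 = (a powr (1 / 3)) powr real 3" by (subst powr_realpow) auto
    also have "\<dots> = a powr (1 / 3 * real 3)" by (rule powr_powr)
    finally show ?thesis using \<open>a > 0\<close> by simp
  qed simp
qed

lemma cuberoot_bounds:
  fixes r n :: nat
  assumes "r ^ 3 \<le> n" "n < (r + 1) ^ 3"
  shows "real r \<le> real n powr (1 / 3)" "real n powr (1 / 3) \<le> real r + 1"
proof -
  note c = powr_third_cube(1)
  have "real r ^ 3 \<le> real n" using assms(1) by (metis of_nat_le_iff of_nat_power)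
  then have "(real r ^ 3) powr (1 / 3) \<le> real n powr (1 / 3)" by (intro powr_mono2) auto
  then show "real r \<le> real n powr (1 / 3)" by (simp add: c)
  have "n \<le> (r + 1) ^ 3" using assms(2) by simp
  then have "real n \<le> (real r + 1) ^ 3" by (metis of_nat_le_iff of_nat_power of_nat_add of_nat_1)
  then have "real n powr (1 / 3) \<le> ((real r + 1) ^ 3) powr (1 / 3)" by (intro powr_mono2) auto
  then show "real n powr (1 / 3) \<le> real r + 1" by (simp add: c)
qed

lemma floorlog_log_bounds:
  assumes "n \<ge> 2"
  shows "log 2 (real n) \<le> real (floorlog 2 n)" "real (floorlog 2 n) \<le> log 2 (real n) + 1"
proof -
  have "0 \<le> log 2 (real n)" using assms by simp
  then have e: "real (floorlog 2 n) = real_of_int \<lfloor>log 2 (real n)\<rfloor> + 1"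
    using assms by (simp add: floorlog_def)
  then show "log 2 (real n) \<le> real (floorlog 2 n)" "real (floorlog 2 n) \<le> log 2 (real n) + 1"
    by linarith+
qed

text \<open>Everything is expressed through the integer cube root \<open>r\<close>, which the
  program can compute; real powers of \<open>n\<close> occur only in the estimates. The two summands
  of the error probability get 1/20 each.\<close>

lemma eventually_reconstruct_params:
  fixes \<epsilon> :: real
  assumes \<epsilon>: "\<epsilon> > 0"
  obtains K :: nat where "\<forall>\<^sub>F n in sequentially. \<forall>r R N x. r ^ 3 \<le> n \<longrightarrow> n < (r + 1) ^ 3 \<longrightarrow>
      N = r ^ 2 \<longrightarrow> R = r div floorlog 2 n \<longrightarrow> length x = n \<longrightarrow>
      (\<exists>\<psi> \<beta>. reconstruct_params n N K R (real n powr (- (1/3 + \<epsilon>))) \<psi> \<beta> x) \<and>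
      real n * real (n + 3) * (2 * exp (- real N / (2048 * (real R + 3)\<^sup>2)))
        + 10000 * (real n * real n powr (- (1/3 + \<epsilon>))) / real N \<le> 1 / 10"
proof -
  \<comment> \<open>Capping \<epsilon> at 2/3 makes \<open>n powr (e / 2 - 1 / 3)\<close> at most 1,
    as \<open>bexp_tail\<close> demands of its parameter.\<close>
  define e where "e = min \<epsilon> (2 / 3)"
  have e: "0 < e" "e \<le> \<epsilon>" "e \<le> 2 / 3" using \<epsilon> by (auto simp: e_def)
  \<comment> \<open>Each factor \<open>\<bar>\<beta>\<bar> / BB\<close> is of order
    \<open>n^(-\<epsilon>)\<close>, so \<open>K + 1\<close> of them are of order \<open>1/n\<close>.
    Against window length times weight, of order \<open>n^(2/3)\<close>, this is small.\<close>
  define K where "K = nat \<lceil>1 / \<epsilon>\<rceil>"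
  have K: "1 \<le> \<epsilon> * real (K + 1)"
  proof -
    have "1 / \<epsilon> \<le> real (K + 1)" unfolding K_def using \<epsilon> by simp linarith
    then show ?thesis using \<epsilon> by (simp add: field_simps)
  qed
  define \<delta> where "\<delta> n = real n powr (- (1/3 + \<epsilon>))" for n :: nat
  define X where "X n = real n powr (1 / 3)" for n :: nat
  define lg where "lg n = log 2 (real n)" for n :: nat
  have sm: "\<forall>\<^sub>F n in sequentially. f n \<le> c" if "(f \<longlongrightarrow> 0) sequentially" "c > 0" for f :: "nat \<Rightarrow> real" and c
    using order_tendstoD(2)[OF that] by (rule eventually_mono) simp
  have ev1: "\<forall>\<^sub>F n in sequentially. \<delta> n \<le> 1 / 100"
    by (rule sm) (unfold \<delta>_def, use \<epsilon> in real_asymp, simp)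
  have ev2: "\<forall>\<^sub>F n in sequentially. 8 \<le> (X n - 1) / (lg n + 1) - 1"
    unfolding X_def lg_def by real_asymp
  have ev3: "\<forall>\<^sub>F n in sequentially. 16 * X n + real K \<le> real n"
    unfolding X_def by real_asymp
  \<comment> \<open>The tail exponent grows like \<open>n^(e/2) / log n\<close>, a positive power of
    \<open>n\<close> up to the logarithm, and so beats the polynomial factor.\<close>
  have ev4: "\<forall>\<^sub>F n in sequentially. real n * (real n + 1) *
     (2 * exp (1 - real n powr (e / 2 - 1 / 3) * ((X n - 1) / (lg n + 1) - 1) / 4)) \<le> 1 / 100"
    by (rule sm) (unfold X_def lg_def, use e in real_asymp, simp)
  have ev5: "\<forall>\<^sub>F n in sequentially. \<delta> n * (8 * X n + 1) \<le> 1 / 10"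
    by (rule sm) (unfold X_def \<delta>_def, use \<epsilon> in real_asymp, simp)
  have ev6: "\<forall>\<^sub>F n in sequentially. 8 * \<delta> n * (2 * (8 * X n + 2)) \<le> 1"
    by (rule sm) (unfold X_def \<delta>_def, use \<epsilon> in real_asymp, simp)
  have ev7: "\<forall>\<^sub>F n in sequentially. 12 * 40 ^ Suc K * (X n ^ 2 * (1 / real n)) \<le> 1 / 100"
  proof (rule sm)
    have "((\<lambda>n. X n ^ 2 * (1 / real n)) \<longlonglongrightarrow> 0)" unfolding X_def by real_asymp
    then have "((\<lambda>n. 12 * 40 ^ Suc K * (X n ^ 2 * (1 / real n))) \<longlonglongrightarrow> 12 * 40 ^ Suc K * 0)"
      by (intro tendsto_mult tendsto_const)
    then show "((\<lambda>n. 12 * 40 ^ Suc K * (X n ^ 2 * (1 / real n))) \<longlonglongrightarrow> 0)" by simp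
  qed simp
  have ev8: "\<forall>\<^sub>F n in sequentially. real K * (3 * (real K + 1)\<^sup>2 * (2 * \<delta> n * (10 * X n + 2))) \<le> 1"
  proof (rule sm)
    have "((\<lambda>n. 2 * \<delta> n * (10 * X n + 2)) \<longlongrightarrow> 0) sequentially"
      unfolding X_def \<delta>_def using \<epsilon> by real_asymp
    then have "((\<lambda>n. real K * (3 * (real K + 1)\<^sup>2 * (2 * \<delta> n * (10 * X n + 2)))) \<longlongrightarrow> real K * (3 * (real K + 1)\<^sup>2 * 0)) sequentially"
      by (intro tendsto_mult tendsto_const)
    then show "((\<lambda>n. real K * (3 * (real K + 1)\<^sup>2 * (2 * \<delta> n * (10 * X n + 2)))) \<longlongrightarrow> 0) sequentially" by simp
  qed simp
  \<comment> \<open>Since \<open>R \<le> X n / lg n\<close>, this bounds the perturbation error of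
    order \<open>R^3 / n\<close>.\<close>
  have ev9: "\<forall>\<^sub>F n in sequentially. 5 / lg n ^ 3 \<le> 1 / 100"
    by (rule sm) (unfold lg_def, real_asymp, simp)
  \<comment> \<open>32768 is \<open>2048 * 16\<close>, where 16 comes from
    \<open>(R + 3)^2 lg^2 \<le> 16 N\<close>. The square of the logarithm in the exponent outweighs
    the union bound of order \<open>n^2\<close>.\<close>
  have ev10: "\<forall>\<^sub>F n in sequentially. real n * (real n + 3) * (2 * exp (- (lg n ^ 2 / 32768))) \<le> 1 / 20"
    by (rule sm) (unfold lg_def, real_asymp, simp)
  \<comment> \<open>The factor 4 relative to the error term 10000 stems from
    \<open>X^2 / 4 \<le> N\<close>.\<close>
  have ev11: "\<forall>\<^sub>F n in sequentially. 40000 * (real n * \<delta> n) / X n ^ 2 \<le> 1 / 20"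
    by (rule sm) (unfold X_def \<delta>_def, use \<epsilon> in real_asymp, simp)
  have ev12: "\<forall>\<^sub>F n in sequentially. 2 \<le> X n \<and> 1 \<le> lg n \<and> 8 \<le> real n"
    unfolding X_def lg_def by (intro eventually_conj) real_asymp+
  have "\<forall>\<^sub>F n in sequentially. \<forall>r R N x. r ^ 3 \<le> n \<longrightarrow> n < (r + 1) ^ 3 \<longrightarrow>
      N = r ^ 2 \<longrightarrow> R = r div floorlog 2 n \<longrightarrow> length x = n \<longrightarrow>
      (\<exists>\<psi> \<beta>. reconstruct_params n N K R (\<delta> n) \<psi> \<beta> x) \<and>
      real n * real (n + 3) * (2 * exp (- real N / (2048 * (real R + 3)\<^sup>2)))
        + 10000 * (real n * \<delta> n) / real N \<le> 1 / 10"
    using ev1 ev2 ev3 ev4 ev5 ev6 ev7 ev8 ev9 ev10 ev11 ev12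
  proof (eventually_elim, intro allI impI)
    case (elim n)
    fix r R N :: nat and x :: "bool list"
    assume r: "r ^ 3 \<le> n" "n < (r + 1) ^ 3" and N: "N = r ^ 2" and Rd: "R = r div floorlog 2 n" and len: "length x = n"
    have n2: "n \<ge> 2" using elim(12) by linarith
    note rX = cuberoot_bounds[OF r, folded X_def]
    note fl = floorlog_log_bounds[OF n2, folded lg_def]
    have lg1: "1 \<le> lg n" and X2: "2 \<le> X n" using elim(12) by auto
    define f where "f = floorlog 2 n"
    have f1: "real f \<ge> 1" using fl lg1 by (simp add: f_def)
    have Rf: "real R * real f \<le> real r" "real r \<le> (real R + 1) * real f"
    proof -
      have q: "r = R * f + r mod f" unfolding Rd f_def by (rule div_mult_mod_eq[symmetric])
      have "r mod f < f" using f1 by simp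
      then have "R * f \<le> r" "r \<le> (R + 1) * f" using q by (auto simp: algebra_simps)
      then have "real (R * f) \<le> real r" "real r \<le> real ((R + 1) * f)" unfolding of_nat_le_iff .
      then show "real R * real f \<le> real r" "real r \<le> (real R + 1) * real f"
        unfolding of_nat_mult of_nat_add of_nat_1 .
    qed
    have Rl: "real R * lg n \<le> X n"
    proof -
      have "real R * lg n \<le> real R * real f" using fl by (intro mult_left_mono) (auto simp: f_def)
      then show ?thesis using Rf rX by linarith
    qed
    have RX: "real R \<le> X n"
    proof -
      have "real R * 1 \<le> real R * lg n" using lg1 by (intro mult_left_mono) auto
      then show ?thesis using Rl by simp
    qed
    have Rlow: "(X n - 1) / (lg n + 1) - 1 \<le> real R"
    proof -
      have "X n - 1 \<le> (real R + 1) * real f" using Rf rX by linarith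
      also have "\<dots> \<le> (real R + 1) * (lg n + 1)" using fl by (intro mult_left_mono) (auto simp: f_def)
      finally show ?thesis using lg1 by (simp add: field_simps)
    qed
    have R8: "8 \<le> real R" using Rlow elim(2) by linarith
    have N1: "X n ^ 2 / 4 \<le> real N"
    proof -
      have "X n / 2 \<le> real r" using rX X2 by linarith
      then have "(X n / 2) ^ 2 \<le> real r ^ 2" using X2 by (intro power_mono) auto
      then show ?thesis by (simp add: N power_divide)
    qed
    have X0: "X n > 0" using X2 by linarith
    have N0: "real N > 0"
    proof -
      have "0 < X n ^ 2 / 4" using X0 by simp
      then show ?thesis using N1 by linarith
    qed
    have \<delta>0: "0 < \<delta> n" using n2 by (simp add: \<delta>_def)
    have \<delta>1: "\<delta> n \<le> 1 / 100" by (rule elim)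
    have npos: "real n > 0" using n2 by simp
    define \<beta> where "\<beta> = - \<delta> n / (1 - \<delta> n)"
    have b: "\<bar>\<beta>\<bar> \<le> 2 * \<delta> n"
    proof -
      have "\<bar>\<beta>\<bar> = \<delta> n / (1 - \<delta> n)" using \<delta>0 \<delta>1 by (simp add: \<beta>_def)
      also have "\<dots> \<le> \<delta> n / (1 / 2)" using \<delta>0 \<delta>1 by (intro divide_left_mono) auto
      finally show ?thesis by simp
    qed
    define l where "l = real n powr (e / 2 - 1 / 3)"
    have l: "0 \<le> l" "l \<le> 1"
    proof -
      show "0 \<le> l" by (simp add: l_def)
      have "l \<le> real n powr 0" unfolding l_def using n2 e by (intro powr_mono) auto
      then show "l \<le> 1" using n2 by simp
    qed
    define \<psi> where "\<psi> = 2 * exp (real n * \<delta> n * l\<^sup>2 - l * (real R / 4))"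
    \<comment> \<open>The power of \<open>n\<close> on the left has exponent
      \<open>e - \<epsilon>\<close>.\<close>
    have "real n * \<delta> n * l\<^sup>2 \<le> 1"
    proof -
      have "l\<^sup>2 = real n powr (e - 2 / 3)"
        by (simp add: l_def power2_eq_square powr_add[symmetric])
      then have "real n * \<delta> n * l\<^sup>2 = real n powr (1 + (- (1/3 + \<epsilon>)) + (e - 2 / 3))"
        unfolding powr_add \<delta>_def using npos by simp
      also have "\<dots> \<le> real n powr 0" using n2 e by (intro powr_mono) auto
      finally show ?thesis using n2 by simp
    qed
moreover have "l * ((X n - 1) / (lg n + 1) - 1) \<le> l * real R"
      using Rlow l(1) by (rule mult_left_mono)
    moreover have "A - l * (r / 4) \<le> 1 - l * Y / 4" if "A \<le> 1" "l * Y \<le> l * r" for A Y r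
      using that by (simp only: times_divide_eq_right)
    ultimately have "real n * \<delta> n * l\<^sup>2 - l * (real R / 4) \<le> 1 - l * ((X n - 1) / (lg n + 1) - 1) / 4"
      by blast
    then have "\<psi> \<le> 2 * exp (1 - l * ((X n - 1) / (lg n + 1) - 1) / 4)"
      unfolding \<psi>_def by simp
    then have psi: "real n * (real n + 1) * \<psi> \<le> 1 / 100"
      using elim(4) unfolding l_def[symmetric] by (intro order.trans[OF mult_left_mono elim(4)[folded l_def]]) auto
    have bX: "\<bar>\<beta>\<bar> * (2 * real (8 * R + 2)) \<le> 40 * real n powr (- \<epsilon>)"
    proof -
      have "\<bar>\<beta>\<bar> * (2 * real (8 * R + 2)) \<le> (2 * \<delta> n) * (2 * (10 * X n))"
        using b RX R8 \<delta>0 by (intro mult_mono) auto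
      also have "\<delta> n * X n = real n powr (- \<epsilon>)"
        by (simp add: \<delta>_def X_def powr_add[symmetric])
      then have "(2 * \<delta> n) * (2 * (10 * X n)) = 40 * real n powr (- \<epsilon>)" by simp
      finally show ?thesis .
    qed
    have "reconstruct_params n N K R (\<delta> n) \<psi> \<beta> x"
    proof unfold_locales
      show "0 < \<delta> n" "\<delta> n \<le> 1 / 100" "\<beta> = - \<delta> n / (1 - \<delta> n)" "length x = n"
        using \<delta>0 \<delta>1 len by (auto simp: \<beta>_def)
      show "8 \<le> R" using R8 by linarith
      show "16 * R + K \<le> n" using RX elim(3) by linarith
      show "N > 0" using N0 by simp
      show "bexp (\<delta> n) (\<lambda>j. of_bool (real R / 4 \<le> \<bar>real j - (1 - \<delta> n) * real k\<bar>)) k \<le> \<psi>" if "k \<le> n" for k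
        unfolding \<psi>_def using \<delta>0 \<delta>1 l that by (intro bexp_tail) auto
      show "real n * (real n + 1) * \<psi> \<le> 1 / 100" by (rule psi)
      show "9 / 10 \<le> (1 - \<delta> n) ^ (8 * R + 1)"
      proof -
        have "1 - real (8 * R + 1) * \<delta> n \<le> (1 - \<delta> n) ^ (8 * R + 1)"
          using Bernoulli_inequality[of "- \<delta> n" "8 * R + 1"] \<delta>1 by simp
        moreover have "\<delta> n * real (8 * R + 1) \<le> \<delta> n * (8 * X n + 1)"
          using RX \<delta>0 by (intro mult_left_mono) auto
        ultimately show ?thesis using elim(5) by (simp add: mult.commute)
      qed
      show "4 * \<bar>\<beta>\<bar> * (2 * real (8 * R + 2)) \<le> 1"
      proof -
        have "4 * \<bar>\<beta>\<bar> * (2 * real (8 * R + 2)) \<le> 4 * (2 * \<delta> n) * (2 * (8 * X n + 2))"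
          using b RX \<delta>0 by (intro mult_mono) auto
        then show ?thesis using elim(6) by simp
      qed
      show "real (2 * R + 1) * (real R + 3) * ((\<bar>\<beta>\<bar> * (2 * real (8 * R + 2))) ^ Suc K * 2) \<le> 1 / 100"
      proof -
        have "real (2 * R + 1) * (real R + 3) * ((\<bar>\<beta>\<bar> * (2 * real (8 * R + 2))) ^ Suc K * 2)
          \<le> (3 * X n) * (2 * X n) * ((40 * real n powr (- \<epsilon>)) ^ Suc K * 2)"
        proof (rule mult_mono)
          show "real (2 * R + 1) * (real R + 3) \<le> (3 * X n) * (2 * X n)"
            using RX R8 by (intro mult_mono) auto
          show "(\<bar>\<beta>\<bar> * (2 * real (8 * R + 2))) ^ Suc K * 2 \<le> (40 * real n powr (- \<epsilon>)) ^ Suc K * 2"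
            by (rule mult_right_mono[OF power_mono[OF bX]]) auto
        qed (use X0 in auto)
        also have "(40 * real n powr (- \<epsilon>)) ^ Suc K = 40 ^ Suc K * real n powr (- (\<epsilon> * real (K + 1)))"
        proof -
          have "(real n powr (- \<epsilon>)) ^ Suc K = (real n powr (- \<epsilon>)) powr real (Suc K)"
            using npos by (subst powr_realpow) auto
          then show ?thesis by (simp only: power_mult_distrib powr_powr) (simp add: algebra_simps)
        qed
        also have "(3 * X n) * (2 * X n) * ((40 ^ Suc K * real n powr (- (\<epsilon> * real (K + 1)))) * 2)
           \<le> (3 * X n) * (2 * X n) * ((40 ^ Suc K * real n powr (- 1)) * 2)"
        proof -
          have "real n powr (- (\<epsilon> * real (K + 1))) \<le> real n powr (- 1)"
            using K n2 by (intro powr_mono) auto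
          then show ?thesis using X0 by (intro mult_left_mono mult_right_mono) auto
        qed
        also have "\<dots> = 12 * 40 ^ Suc K * (X n ^ 2 * (1 / real n))"
          using npos by (simp add: powr_minus_divide power2_eq_square)
        finally show ?thesis using elim(7) by linarith
      qed
      show "real K * (3 * (real K + 1)\<^sup>2 * (\<bar>\<beta>\<bar> * real (10 * R + 2))) \<le> 1"
      proof -
        have "\<bar>\<beta>\<bar> * real (10 * R + 2) \<le> 2 * \<delta> n * (10 * X n + 2)"
          using b RX \<delta>0 by (intro mult_mono) auto
        then have "real K * (3 * (real K + 1)\<^sup>2 * (\<bar>\<beta>\<bar> * real (10 * R + 2))) \<le> real K * (3 * (real K + 1)\<^sup>2 * (2 * \<delta> n * (10 * X n + 2)))"
          by (intro mult_left_mono) auto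
        then show ?thesis using elim(8) by linarith
      qed
      show "(real R + 3) * real (2 * R + 1) * (1 / (50 * real n) * (2 * real (8 * R + 2)) * 2) \<le> 1 / 100"
      proof -
        have "(real R + 3) * real (2 * R + 1) * (1 / (50 * real n) * (2 * real (8 * R + 2)) * 2)
          \<le> (2 * real R) * (3 * real R) * (1 / (50 * real n) * (2 * (10 * real R)) * 2)"
          using R8 by (intro mult_mono mult_left_mono mult_right_mono mult_nonneg_nonneg) auto
        also have "\<dots> \<le> 5 * real R ^ 3 / real n"
          using npos by (simp add: field_simps power3_eq_cube)
        also have "\<dots> \<le> 5 / lg n ^ 3"
        proof -
          have "(real R * lg n) ^ 3 \<le> X n ^ 3" using Rl lg1 by (intro power_mono) auto
          also have "X n ^ 3 = real n" unfolding X_def by (rule powr_third_cube(2)) simp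
          finally show ?thesis using npos lg1 by (simp add: field_simps power_mult_distrib)
        qed
        finally show ?thesis using elim(9) by linarith
      qed
    qed
    moreover have "real n * real (n + 3) * (2 * exp (- real N / (2048 * (real R + 3)\<^sup>2))) \<le> 1 / 20"
    proof -
      have "(real R + 3)\<^sup>2 \<le> (2 * real R)\<^sup>2" using R8 by (intro power_mono) auto
      then have "(real R + 3)\<^sup>2 * lg n ^ 2 \<le> (2 * real R)\<^sup>2 * lg n ^ 2" by (intro mult_right_mono) auto
      also have "\<dots> = 4 * (real R * lg n)\<^sup>2" by (simp add: power_mult_distrib)
      also have "\<dots> \<le> 4 * (X n)\<^sup>2" using Rl lg1 by (intro mult_left_mono power_mono) auto
      also have "\<dots> \<le> 16 * real N" using N1 by simp
      finally have "(real R + 3)\<^sup>2 * lg n ^ 2 \<le> 16 * real N" .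
      moreover have "(real R + 3)\<^sup>2 > 0" by (simp add: add_nonneg_pos)
      ultimately have "lg n ^ 2 / 32768 \<le> real N / (2048 * (real R + 3)\<^sup>2)"
        by (simp add: field_simps)
      then have "real n * real (n + 3) * (2 * exp (- real N / (2048 * (real R + 3)\<^sup>2)))
         \<le> real n * real (n + 3) * (2 * exp (- (lg n ^ 2 / 32768)))"
        by (intro mult_left_mono) auto
      then show ?thesis using elim(10) by simp
    qed
    moreover have "10000 * (real n * \<delta> n) / real N \<le> 1 / 20"
    proof -
      have "10000 * (real n * \<delta> n) / real N \<le> 10000 * (real n * \<delta> n) / (X n ^ 2 / 4)"
        using N1 N0 X0 \<delta>0 by (intro divide_left_mono) auto
      then show ?thesis using elim(11) by simp
    qed
    ultimately show "(\<exists>\<psi> \<beta>. reconstruct_params n N K R (\<delta> n) \<psi> \<beta> x) \<and>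
      real n * real (n + 3) * (2 * exp (- real N / (2048 * (real R + 3)\<^sup>2)))
        + 10000 * (real n * \<delta> n) / real N \<le> 1 / 10" by (intro conjI) (blast, linarith)
  qed
  then show thesis by (rule that[unfolded \<delta>_def[symmetric]])
qed

subsection \<open>Timed execution of programs\<close>

lemma big_step_drawn_mono: "big_step w \<omega> c s t s' \<Longrightarrow> drawn s \<le> drawn s'"
  by (induction rule: big_step.induct) auto

text \<open>A run depends only on the traces that it has drawn. With a bound on their number,
  success becomes an event about finitely many traces.\<close>

lemma big_step_cong:
  assumes "big_step w \<omega> c s t s'" "\<And>i. i < drawn s' \<Longrightarrow> \<omega> i = \<omega>' i"
  shows "big_step w \<omega>' c s t s'"
  using assms
proof (induction rule: big_step.induct)
  case (Seq c1 s t1 s1 c2 t2 s2)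
  then show ?case using big_step_drawn_mono[OF Seq.hyps(2)] by (intro big_step.Seq[of _ _ _ _ t1 s1]) auto
next
  case (WhileTrue b s c t1 s1 t2 s2)
  have "drawn s1 \<le> drawn s2" by (rule big_step_drawn_mono) (rule WhileTrue.hyps)
  then have "big_step w \<omega>' c s t1 s1" "big_step w \<omega>' (While b c) s1 t2 s2"
    using WhileTrue by auto
  then show ?case using WhileTrue.hyps(1) by (intro big_step.WhileTrue)
next
  case (Draw s)
  then have "\<omega> (drawn s) = \<omega>' (drawn s)" by simp
  then show ?case using big_step.Draw[of w \<omega>' s] by simp
next
  case (ReadBit s b bs v)
  then show ?case by (intro big_step.ReadBit)
qed (auto intro: big_step.intros simp del: One_nat_def)

text \<open>Termination, time bound and postcondition in one existential statement; by
  \<open>big_step_deterministic\<close> the run found is the only one.\<close>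

definition reaches :: "nat \<Rightarrow> (nat \<Rightarrow> bool list) \<Rightarrow> com \<Rightarrow> state \<Rightarrow> nat \<Rightarrow> (state \<Rightarrow> bool) \<Rightarrow> bool" where
  "reaches w \<omega> c s T Q \<longleftrightarrow> (\<exists>t s'. big_step w \<omega> c s t s' \<and> t \<le> T \<and> Q s')"

lemma reaches_mono:
  assumes "reaches w \<omega> c s T Q" "T \<le> T'" "\<And>s'. Q s' \<Longrightarrow> Q' s'"
  shows "reaches w \<omega> c s T' Q'"
  using assms unfolding reaches_def by (meson order.trans)

lemma reaches_Skip: "Q s \<Longrightarrow> 1 \<le> T \<Longrightarrow> reaches w \<omega> Skip s T Q"
  unfolding reaches_def by (blast intro: big_step.Skip)

lemma reaches_Assign:
  "eval w e s = x \<Longrightarrow> 1 + cost e \<le> T \<Longrightarrow> Q (s\<lparr>var := (var s)(v := x)\<rparr>) \<Longrightarrow> reaches w \<omega> (Assign v e) s T Q"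
  unfolding reaches_def using big_step.Assign[of w \<omega> v e s] by blast

lemma reaches_Store:
  "eval w i s = j \<Longrightarrow> eval w e s = x \<Longrightarrow> 1 + cost i + cost e \<le> T
    \<Longrightarrow> Q (s\<lparr>arr := (arr s)(a := (arr s a)(j := x))\<rparr>) \<Longrightarrow> reaches w \<omega> (Store a i e) s T Q"
  unfolding reaches_def using big_step.Store[of w \<omega> a i e s] by blast

lemma reaches_Draw:
  "1 \<le> T \<Longrightarrow> Q (s\<lparr>rest := \<omega> (drawn s), drawn := Suc (drawn s)\<rparr>) \<Longrightarrow> reaches w \<omega> Draw s T Q"
  unfolding reaches_def using big_step.Draw[of w \<omega> s] by blast

lemma reaches_Read:
  "1 \<le> T \<Longrightarrow> Q (s\<lparr>var := (var s)(v := case rest s of [] \<Rightarrow> 2 | b # bs \<Rightarrow> of_bool b), rest := tl (rest s)\<rparr>)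
    \<Longrightarrow> reaches w \<omega> (Read v) s T Q"
proof (cases "rest s")
  case Nil
  assume T: "1 \<le> T"
    and Q: "Q (s\<lparr>var := (var s)(v := case rest s of [] \<Rightarrow> 2 | b # bs \<Rightarrow> of_bool b), rest := tl (rest s)\<rparr>)"
  have "s\<lparr>var := (var s)(v := case rest s of [] \<Rightarrow> 2 | b # bs \<Rightarrow> of_bool b), rest := tl (rest s)\<rparr>
     = s\<lparr>var := (var s)(v := 2)\<rparr>" using Nil by simp
  then show ?thesis using big_step.ReadEnd[OF Nil, of w \<omega> v] Q T unfolding reaches_def by metis
next
  case (Cons b bs)
  assume T: "1 \<le> T"
    and Q: "Q (s\<lparr>var := (var s)(v := case rest s of [] \<Rightarrow> 2 | b # bs \<Rightarrow> of_bool b), rest := tl (rest s)\<rparr>)"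
  then show ?thesis using big_step.ReadBit[OF Cons, of w \<omega> v] unfolding reaches_def by (auto simp: Cons)
qed

lemma reaches_Seq:
  assumes "reaches w \<omega> c1 s Ta (\<lambda>s1. reaches w \<omega> c2 s1 Tb Q)" "Ta + Tb \<le> T"
  shows "reaches w \<omega> (Seq c1 c2) s T Q"
proof -
  obtain t1 s1 t2 s2 where 1: "big_step w \<omega> c1 s t1 s1" "t1 \<le> Ta"
    and 2: "big_step w \<omega> c2 s1 t2 s2" "t2 \<le> Tb" and Q: "Q s2"
    using assms(1) unfolding reaches_def by blast
  have "big_step w \<omega> (Seq c1 c2) s (t1 + t2) s2" using 1 2 by (intro big_step.Seq)
  then show ?thesis using 1 2 Q assms(2) unfolding reaches_def by (meson add_mono order.trans)
qed

lemma reaches_Assign_Seq: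
  assumes "eval w e s = x" "1 + cost e \<le> T"
    "reaches w \<omega> c (s\<lparr>var := (var s)(v := x)\<rparr>) (T - (1 + cost e)) Q"
  shows "reaches w \<omega> (Seq (Assign v e) c) s T Q"
  by (rule reaches_Seq[where Ta = "1 + cost e"], rule reaches_Assign) (use assms in auto)

lemma reaches_Store_Seq:
  assumes "eval w i s = j" "eval w e s = x" "1 + cost i + cost e \<le> T"
    "reaches w \<omega> c (s\<lparr>arr := (arr s)(a := (arr s a)(j := x))\<rparr>) (T - (1 + cost i + cost e)) Q"
  shows "reaches w \<omega> (Seq (Store a i e) c) s T Q"
  by (rule reaches_Seq[where Ta = "1 + cost i + cost e"], rule reaches_Store) (use assms in auto)

lemma reaches_Cond:
  assumes "eval w b s = x" "1 + cost b + T' \<le> T"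
    "x \<noteq> 0 \<Longrightarrow> reaches w \<omega> c1 s T' Q" "x = 0 \<Longrightarrow> reaches w \<omega> c2 s T' Q"
  shows "reaches w \<omega> (Cond b c1 c2) s T Q"
proof (cases "x = 0")
  case True
  then obtain t s' where "big_step w \<omega> c2 s t s'" "t \<le> T'" "Q s'" using assms(4) unfolding reaches_def by blast
  then show ?thesis using big_step.CondFalse[of w b s \<omega> c2 t s' c1] assms(1,2) True
    unfolding reaches_def by (meson add_left_mono order.trans)
next
  case False
  then obtain t s' where "big_step w \<omega> c1 s t s'" "t \<le> T'" "Q s'" using assms(3) unfolding reaches_def by blast
  then show ?thesis using big_step.CondTrue[of w b s \<omega> c1 t s' c2] assms(1,2) False
    unfolding reaches_def by (meson add_left_mono order.trans)
qed

text \<open>Only variables and arrays are confined. \<open>rest\<close> and \<open>drawn\<close> may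
  change freely; where the number of draws matters, it is part of the postcondition.\<close>

definition frame :: "vname set \<Rightarrow> vname set \<Rightarrow> state \<Rightarrow> state \<Rightarrow> bool" where
  "frame V A s s' \<longleftrightarrow> (\<forall>v. v \<notin> V \<longrightarrow> var s' v = var s v) \<and> (\<forall>a. a \<notin> A \<longrightarrow> arr s' a = arr s a)"

lemma frame_trans: "frame V A s s' \<Longrightarrow> frame V' A' s' s'' \<Longrightarrow> V \<subseteq> V'' \<Longrightarrow> V' \<subseteq> V'' \<Longrightarrow> A \<subseteq> A'' \<Longrightarrow> A' \<subseteq> A''
    \<Longrightarrow> frame V'' A'' s s''"
  unfolding frame_def by (metis subset_iff)

lemma frame_var: "frame V A s s' \<Longrightarrow> v \<notin> V \<Longrightarrow> var s' v = var s v"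
  and frame_arr: "frame V A s s' \<Longrightarrow> a \<notin> A \<Longrightarrow> arr s' a = arr s a"
  by (auto simp: frame_def)

definition For :: "vname \<Rightarrow> exp \<Rightarrow> exp \<Rightarrow> com \<Rightarrow> com" where
  "For v lo hi c = Seq (Assign v lo) (While (Bin Less (Var v) hi) (Seq c (Assign v (Bin Add (Var v) (Const 1)))))"

text \<open>The bound \<open>hi\<close> is evaluated anew in every round, so its value must persist
  in all states within the frame. The increment after the body changes \<open>v\<close>, hence
  \<open>J\<close> must not depend on \<open>v\<close>. A round costs \<open>3 + cost hi\<close> for
  the test and 4 for the increment.\<close>

lemma reaches_While_count:
  assumes hi: "\<And>s. frame V A s0 s \<Longrightarrow> eval w hi s = H" and H: "H < 2 ^ w" and v: "v \<in> V"
    and body: "\<And>i s. i < H \<Longrightarrow> l \<le> i \<Longrightarrow> frame V A s0 s \<Longrightarrow> var s v = i \<Longrightarrow> J i s \<Longrightarrow>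
      reaches w \<omega> c s Tb (\<lambda>s'. frame (V - {v}) A s s' \<and> J (Suc i) s')"
    and J: "\<And>i s x. J i s \<Longrightarrow> J i (s\<lparr>var := (var s)(v := x)\<rparr>)"
    and s: "frame V A s0 s" "var s v = i" "J i s" "l \<le> i" "i \<le> H"
  shows "reaches w \<omega> (While (Bin Less (Var v) hi) (Seq c (Assign v (Bin Add (Var v) (Const 1))))) s
     ((H - i) * (7 + cost hi + Tb) + 3 + cost hi) (\<lambda>s'. frame V A s0 s' \<and> J H s' \<and> var s' v = H)"
  using s
proof (induction "H - i" arbitrary: i s)
  case 0
  then have i: "i = H" by simp
  have "eval w (Bin Less (Var v) hi) s = 0" using hi[OF 0(2)] 0 i by simp
  then have "big_step w \<omega> (While (Bin Less (Var v) hi) (Seq c (Assign v (Bin Add (Var v) (Const 1))))) s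
     (1 + cost (Bin Less (Var v) hi)) s" by (rule big_step.WhileFalse)
  then show ?case using 0 i unfolding reaches_def by (intro exI[of _ "1 + cost (Bin Less (Var v) hi)"] exI[of _ s]) auto
next
  case (Suc k)
  let ?W = "While (Bin Less (Var v) hi) (Seq c (Assign v (Bin Add (Var v) (Const 1))))"
  have i: "i < H" using Suc by simp
  have w: "w > 0" using H i by (cases w) auto
  have w1: "(1 :: nat) < 2 ^ w" using w by (intro one_less_power) auto
  have g: "eval w (Bin Less (Var v) hi) s \<noteq> 0" using hi[OF Suc(3)] Suc i w by simp
  obtain t1 s1 where 1: "big_step w \<omega> c s t1 s1" "t1 \<le> Tb" "frame (V - {v}) A s s1" "J (Suc i) s1"
    using body[OF i Suc(6) Suc(3) Suc(4) Suc(5)] unfolding reaches_def by blast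
  have v1: "var s1 v = i" using frame_var[OF 1(3), of v] Suc(4) by simp
  define s2 where "s2 = s1\<lparr>var := (var s1)(v := Suc i)\<rparr>"
  have e: "eval w (Bin Add (Var v) (Const 1)) s1 = Suc i" using v1 w i H by simp
  have "1 + cost (Bin Add (Var v) (Const 1)) = 4" by simp
  then have 2: "big_step w \<omega> (Assign v (Bin Add (Var v) (Const 1))) s1 4 s2"
    using big_step.Assign[of w \<omega> v "Bin Add (Var v) (Const 1)" s1] unfolding s2_def e by (simp only:)
  have f1: "frame V A s0 s1" using Suc(3) 1(3) by (rule frame_trans) auto
  have f2: "frame V A s0 s2" using f1 v by (auto simp: frame_def s2_def)
  have v2: "var s2 v = Suc i" by (simp add: s2_def)
  have J2: "J (Suc i) s2" unfolding s2_def by (rule J) (rule 1)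
  have "reaches w \<omega> ?W s2 ((H - Suc i) * (7 + cost hi + Tb) + 3 + cost hi) (\<lambda>s'. frame V A s0 s' \<and> J H s' \<and> var s' v = H)"
    using Suc(2,6) i by (intro Suc(1) f2 v2 J2) auto
  then obtain t3 s3 where 3: "big_step w \<omega> ?W s2 t3 s3" "t3 \<le> (H - Suc i) * (7 + cost hi + Tb) + 3 + cost hi"
    "frame V A s0 s3" "J H s3" "var s3 v = H" unfolding reaches_def by blast
  have big: "big_step w \<omega> ?W s (1 + cost (Bin Less (Var v) hi) + (t1 + 4) + t3) s3"
    using g 1(1) 2 3(1) by (intro big_step.WhileTrue big_step.Seq)
  have "H - i = Suc (H - Suc i)" using i by simp
  then have "1 + cost (Bin Less (Var v) hi) + (t1 + 4) + t3 \<le> (H - i) * (7 + cost hi + Tb) + 3 + cost hi"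
    using 1(2) 3(2) by simp
  then show ?case unfolding reaches_def using big 3 by blast
qed

lemma reaches_For:
  assumes lo: "eval w lo s0 = l" and le: "l \<le> H" and H: "H < 2 ^ w"
    and hi: "\<And>s. frame V A s0 s \<Longrightarrow> eval w hi s = H" and v: "v \<in> V"
    and init: "J l (s0\<lparr>var := (var s0)(v := l)\<rparr>)"
    and J: "\<And>i s x. J i s \<Longrightarrow> J i (s\<lparr>var := (var s)(v := x)\<rparr>)"
    and body: "\<And>i s. i < H \<Longrightarrow> l \<le> i \<Longrightarrow> frame V A s0 s \<Longrightarrow> var s v = i \<Longrightarrow> J i s \<Longrightarrow>
      reaches w \<omega> c s Tb (\<lambda>s'. frame (V - {v}) A s s' \<and> J (Suc i) s')"
    and T: "(H - l) * (7 + cost hi + Tb) + 4 + cost hi + cost lo \<le> T"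
  shows "reaches w \<omega> (For v lo hi c) s0 T (\<lambda>s'. frame V A s0 s' \<and> J H s' \<and> var s' v = H)"
  unfolding For_def
proof (rule reaches_Seq[where Ta = "1 + cost lo"], rule reaches_Assign[OF lo])
  show "reaches w \<omega> (While (Bin Less (Var v) hi) (Seq c (Assign v (Bin Add (Var v) (Const 1)))))
     (s0\<lparr>var := (var s0)(v := l)\<rparr>) ((H - l) * (7 + cost hi + Tb) + 3 + cost hi) (\<lambda>s'. frame V A s0 s' \<and> J H s' \<and> var s' v = H)"
    by (rule reaches_While_count[where J = J, OF hi H v body J]) (use init v le in \<open>auto simp: frame_def\<close>)
qed (use T in auto)

lemma reaches_SeqI:
  assumes "reaches w \<omega> c1 s Ta P" "\<And>s1. P s1 \<Longrightarrow> reaches w \<omega> c2 s1 Tb Q" "Ta + Tb \<le> T"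
  shows "reaches w \<omega> (Seq c1 c2) s T Q"
  using reaches_Seq[OF reaches_mono[OF assms(1) order.refl assms(2)] assms(3)] .

text \<open>As rewrite rules these remove the modulus and leave the absence of overflow as a
  condition, which the size bounds of each program part discharge.\<close>

lemma eval_Const: "c < 2 ^ w \<Longrightarrow> eval w (Const c) s = c" by simp
lemma eval_Add: "eval w a s + eval w b s < 2 ^ w \<Longrightarrow> eval w (Bin Add a b) s = eval w a s + eval w b s" by simp
lemma eval_Mul: "eval w a s * eval w b s < 2 ^ w \<Longrightarrow> eval w (Bin Mul a b) s = eval w a s * eval w b s" by simp
lemma eval_Sub: "eval w a s < 2 ^ w \<Longrightarrow> eval w (Bin Sub a b) s = eval w a s - eval w b s" by simp
lemma eval_Div: "eval w a s < 2 ^ w \<Longrightarrow> eval w (Bin Div a b) s = eval w a s div eval w b s"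
  by (simp add: le_less_trans[OF div_le_dividend])
lemma eval_Mod: "eval w a s < 2 ^ w \<Longrightarrow> eval w (Bin Mod a b) s = eval w a s mod eval w b s"
  by (simp add: le_less_trans[OF mod_less_eq_dividend])
lemma eval_Less: "1 < (2 :: nat) ^ w \<Longrightarrow> eval w (Bin Less a b) s = of_bool (eval w a s < eval w b s)" by simp
lemma eval_Eq: "1 < (2 :: nat) ^ w \<Longrightarrow> eval w (Bin Eq a b) s = of_bool (eval w a s = eval w b s)" by simp

lemma eval_Var: "eval w (Var v) s = var s v" by simp
lemma eval_Index: "eval w (Index a e) s = arr s a (eval w e s)" by simp

lemmas evals = eval_Const eval_Add eval_Mul eval_Sub eval_Div eval_Mod eval_Less eval_Eq eval_Var eval_Index

declare eval.simps [simp del]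

abbreviation (input) exp_add (infixl "[+]" 65) where "a [+] b \<equiv> Bin Add a b"
abbreviation (input) exp_sub (infixl "[-]" 65) where "a [-] b \<equiv> Bin Sub a b"
abbreviation (input) exp_mul (infixl "[*]" 70) where "a [*] b \<equiv> Bin Mul a b"
abbreviation (input) exp_div (infixl "[div]" 70) where "a [div] b \<equiv> Bin Div a b"
abbreviation (input) exp_mod (infixl "[mod]" 70) where "a [mod] b \<equiv> Bin Mod a b"
abbreviation (input) exp_less (infix "[<]" 50) where "a [<] b \<equiv> Bin Less a b"
abbreviation (input) exp_eq (infix "[=]" 50) where "a [=] b \<equiv> Bin Eq a b"
abbreviation (input) com_seq (infixr ";;" 30) where "c ;; d \<equiv> Seq c d"
abbreviation (input) com_assign (infix "::=" 40) where "v ::= e \<equiv> Assign v e"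

subsection \<open>The dynamic program\<close>

lemma sum_powers_le: "(\<Sum>i\<le>s. (a :: nat) ^ i) \<le> (a + 1) ^ s"
proof (induction s)
  case (Suc s)
  have "a * a ^ s \<le> a * (a + 1) ^ s" by (intro mult_left_mono power_mono) auto
  from add_mono[OF Suc this] show ?case
    by (simp only: sum.atMost_Suc power_Suc distrib_right mult_1 add.commute)
qed auto

text \<open>Crude, but polynomial in the word length for fixed \<open>s\<close>, so the counts fit
  into words of \<open>O(log n)\<close> bits.\<close>

lemma dp_le: "dp y u h s \<le> (h + 1) ^ s"
proof (induction h arbitrary: s)
  case (Suc h)
  have "(\<Sum>s'\<le>s. dp y u h s') \<le> (\<Sum>s'\<le>s. (h + 1) ^ s')" by (intro sum_mono Suc)
  also have "\<dots> \<le> (Suc h + 1) ^ s" using sum_powers_le[of "h + 1" s] by simp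
  finally show ?case by simp
qed auto

lemma sum_dp_le: "(\<Sum>s'\<le>s. dp y u h s') \<le> (h + 2) ^ s"
proof -
  have "(\<Sum>s'\<le>s. dp y u h s') \<le> (\<Sum>s'\<le>s. (h + 1) ^ s')" by (intro sum_mono dp_le)
  also have "\<dots> \<le> (h + 2) ^ s" using sum_powers_le[of "h + 1" s] by simp
  finally show ?thesis .
qed

text \<open>The row is updated in place: \<open>acc\<close> takes in the old entry
  \<open>A[s]\<close> before it is overwritten, so it always holds a prefix sum of the old
  row.\<close>

definition dp_row :: "nat \<Rightarrow> com" where
  "dp_row K =
     (''acc'' ::= Const 0 ;;
      For ''s'' (Const 0) (Const (Suc K))
       (''acc'' ::= Var ''acc'' [+] Index ''A'' (Var ''s'') ;;
        Cond (Index ''y'' (Var ''off'' [+] Var ''h'' [+] Const 1 [+] Var ''s'') [=] Index ''out'' (Var ''a'' [+] Var ''h'' [+] Const 1))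
          (Store ''A'' (Var ''s'') (Var ''acc''))
          (Store ''A'' (Var ''s'') (Const 0))))"

definition dp_com :: "nat \<Rightarrow> com" where
  "dp_com K =
     (For ''s'' (Const 0) (Const (Suc K)) (Store ''A'' (Var ''s'') (Const 0)) ;;
      Cond (Index ''y'' (Var ''off'') [=] Index ''out'' (Var ''a'')) (Store ''A'' (Const 0) (Const 1)) Skip ;;
      For ''h'' (Const 0) (Var ''w'') (dp_row K))"

lemma dp_row:
  assumes B: "1 < (2::nat) ^ w" "Suc K < 2 ^ w" "b + h + 1 + K < 2 ^ w" "a + h + 1 < 2 ^ w" "(h + 2) ^ K < 2 ^ w"
    and s: "var s ''off'' = b" "var s ''a'' = a" "var s ''h'' = h" "arr s ''y'' = y" "arr s ''out'' = u"
    and A: "\<And>m. m \<le> K \<Longrightarrow> arr s ''A'' m = dp (\<lambda>d. y (b + d)) (\<lambda>h. u (a + h)) h m"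
  shows "reaches w \<omega> (dp_row K) s (40 * (K + 1) + 10) (\<lambda>s'. frame {''s'', ''acc''} {''A''} s s' \<and>
    (\<forall>m\<le>K. arr s' ''A'' m = dp (\<lambda>d. y (b + d)) (\<lambda>h. u (a + h)) (Suc h) m) \<and> drawn s' = drawn s)"
proof -
  let ?dp = "dp (\<lambda>d. y (b + d)) (\<lambda>h. u (a + h))"
  define s1 where "s1 = s\<lparr>var := (var s)(''acc'' := 0)\<rparr>"
  define J where "J i s' \<longleftrightarrow> var s' ''acc'' = (\<Sum>m<i. ?dp h m) \<and> drawn s' = drawn s \<and>
    (\<forall>m\<le>K. arr s' ''A'' m = (if m < i then ?dp (Suc h) m else ?dp h m))" for i and s' :: state
  have acc_le: "(\<Sum>m\<le>i. ?dp h m) < 2 ^ w" if "i \<le> K" for i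
  proof -
    have "(\<Sum>m\<le>i. ?dp h m) \<le> (h + 2) ^ i" by (rule sum_dp_le)
    also have "\<dots> \<le> (h + 2) ^ K" using that by (intro power_increasing) auto
    finally show ?thesis using B by simp
  qed
  have "reaches w \<omega> (For ''s'' (Const 0) (Const (Suc K))
       (''acc'' ::= Var ''acc'' [+] Index ''A'' (Var ''s'') ;;
        Cond (Index ''y'' (Var ''off'' [+] Var ''h'' [+] Const 1 [+] Var ''s'') [=] Index ''out'' (Var ''a'' [+] Var ''h'' [+] Const 1))
          (Store ''A'' (Var ''s'') (Var ''acc''))
          (Store ''A'' (Var ''s'') (Const 0)))) s1 (40 * (K + 1) + 8)
     (\<lambda>s'. frame {''s'', ''acc''} {''A''} s1 s' \<and> J (Suc K) s' \<and> var s' ''s'' = Suc K)"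
  proof (rule reaches_For[where l = 0 and Tb = 30])
    show "J 0 (s1\<lparr>var := (var s1)(''s'' := 0)\<rparr>)" using A by (simp add: J_def s1_def)
    show "J i (s\<lparr>var := (var s)(''s'' := x)\<rparr>)" if "J i s" for i x and s :: state using that by (simp add: J_def)
  next
    fix i and s' :: state
    assume i: "i < Suc K" and f: "frame {''s'', ''acc''} {''A''} s1 s'" and vi: "var s' ''s'' = i" and J: "J i s'"
    have v: "var s' ''off'' = b" "var s' ''a'' = a" "var s' ''h'' = h" "arr s' ''y'' = y" "arr s' ''out'' = u"
      using frame_var[OF f] frame_arr[OF f] s by (simp_all add: s1_def)
    have acc: "var s' ''acc'' + arr s' ''A'' i = (\<Sum>m\<le>i. ?dp h m)"
      using J i by (simp add: J_def lessThan_Suc_atMost[symmetric])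
    have ii: "b + h + Suc i < 2 ^ w" "b + h < 2 ^ w" "b + h + 1 < 2 ^ w" "a + h < 2 ^ w" using B i by simp_all
    show "reaches w \<omega> (''acc'' ::= Var ''acc'' [+] Index ''A'' (Var ''s'') ;;
        Cond (Index ''y'' (Var ''off'' [+] Var ''h'' [+] Const 1 [+] Var ''s'') [=] Index ''out'' (Var ''a'' [+] Var ''h'' [+] Const 1))
          (Store ''A'' (Var ''s'') (Var ''acc''))
          (Store ''A'' (Var ''s'') (Const 0))) s' 30
      (\<lambda>s''. frame ({''s'', ''acc''} - {''s''}) {''A''} s' s'' \<and> J (Suc i) s'')"
    proof (rule reaches_Assign_Seq)
      show "eval w (Var ''acc'' [+] Index ''A'' (Var ''s'')) s' = (\<Sum>m\<le>i. ?dp h m)"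
        using acc acc_le[of i] i vi by (simp add: evals)
      let ?s = "s'\<lparr>var := (var s')(''acc'' := \<Sum>m\<le>i. ?dp h m)\<rparr>"
      show "reaches w \<omega> (Cond (Index ''y'' (Var ''off'' [+] Var ''h'' [+] Const 1 [+] Var ''s'') [=] Index ''out'' (Var ''a'' [+] Var ''h'' [+] Const 1))
          (Store ''A'' (Var ''s'') (Var ''acc''))
          (Store ''A'' (Var ''s'') (Const 0))) ?s (30 - (1 + cost (Var ''acc'' [+] Index ''A'' (Var ''s''))))
         (\<lambda>s''. frame ({''s'', ''acc''} - {''s''}) {''A''} s' s'' \<and> J (Suc i) s'')"
      proof (rule reaches_Cond[where T' = 5])
        show "eval w (Index ''y'' (Var ''off'' [+] Var ''h'' [+] Const 1 [+] Var ''s'') [=] Index ''out'' (Var ''a'' [+] Var ''h'' [+] Const 1)) ?s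
          = of_bool (y (b + (Suc h + i)) = u (a + Suc h))"
          using v vi ii B by (simp add: evals add_ac)
      next
        assume "of_bool (y (b + (Suc h + i)) = u (a + Suc h)) \<noteq> (0 :: nat)"
        then show "reaches w \<omega> (Store ''A'' (Var ''s'') (Var ''acc'')) ?s 5
          (\<lambda>s''. frame ({''s'', ''acc''} - {''s''}) {''A''} s' s'' \<and> J (Suc i) s'')"
          using J vi i by (intro reaches_Store[OF refl refl])
            (auto simp: evals frame_def J_def lessThan_Suc_atMost less_Suc_eq)
      next
        assume "of_bool (y (b + (Suc h + i)) = u (a + Suc h)) = (0 :: nat)"
        then show "reaches w \<omega> (Store ''A'' (Var ''s'') (Const 0)) ?s 5
          (\<lambda>s''. frame ({''s'', ''acc''} - {''s''}) {''A''} s' s'' \<and> J (Suc i) s'')"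
          using J vi i by (intro reaches_Store[OF refl refl])
            (auto simp: evals frame_def J_def lessThan_Suc_atMost less_Suc_eq)
      qed simp
    qed simp
  qed (use B in \<open>auto simp: evals\<close>)
  then show ?thesis unfolding dp_row_def
    by (intro reaches_Assign_Seq[where x = 0], unfold s1_def[symmetric])
      (simp add: evals, simp, erule reaches_mono, auto simp: J_def s1_def frame_def)
qed

lemma dp_com:
  assumes B: "1 < (2::nat) ^ w" "Suc K < 2 ^ w" "b + wd + K < 2 ^ w" "a + wd < 2 ^ w" "(wd + 1) ^ K < 2 ^ w" "wd < 2 ^ w"
    and s: "var s ''off'' = b" "var s ''a'' = a" "var s ''w'' = wd" "arr s ''y'' = y" "arr s ''out'' = u"
  shows "reaches w \<omega> (dp_com K) s (60 * (K + 1) * (wd + 1) + 30) (\<lambda>s'. frame {''s'', ''h'', ''acc''} {''A''} s s' \<and>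
    (\<forall>m\<le>K. arr s' ''A'' m = dp (\<lambda>d. y (b + d)) (\<lambda>h. u (a + h)) wd m) \<and> drawn s' = drawn s)"
proof -
  let ?dp = "dp (\<lambda>d. y (b + d)) (\<lambda>h. u (a + h))"
  let ?c2 = "Cond (Index ''y'' (Var ''off'') [=] Index ''out'' (Var ''a'')) (Store ''A'' (Const 0) (Const 1)) Skip"
  let ?c3 = "For ''h'' (Const 0) (Var ''w'') (dp_row K)"
  show ?thesis unfolding dp_com_def
  proof (rule reaches_SeqI[where Ta = "11 * (K + 1) + 6" and Tb = "20 + (wd * (40 * (K + 1) + 18) + 6)"])
    show "reaches w \<omega> (For ''s'' (Const 0) (Const (Suc K)) (Store ''A'' (Var ''s'') (Const 0))) s (11 * (K + 1) + 6)
      (\<lambda>s'. frame {''s''} {''A''} s s' \<and> ((\<forall>m<Suc K. arr s' ''A'' m = 0) \<and> drawn s' = drawn s) \<and> var s' ''s'' = Suc K)"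
    proof (rule reaches_For[where l = 0 and Tb = 3 and J = "\<lambda>i s'. (\<forall>m<i. arr s' ''A'' m = 0) \<and> drawn s' = drawn s"])
      fix i and s' :: state
      assume "var s' ''s'' = i" "(\<forall>m<i. arr s' ''A'' m = 0) \<and> drawn s' = drawn s"
      then show "reaches w \<omega> (Store ''A'' (Var ''s'') (Const 0)) s' 3
        (\<lambda>s''. frame ({''s''} - {''s''}) {''A''} s' s'' \<and> (\<forall>m<Suc i. arr s'' ''A'' m = 0) \<and> drawn s'' = drawn s)"
        by (intro reaches_Store[OF refl refl]) (auto simp: evals frame_def less_Suc_eq)
    qed (use B in \<open>auto simp: evals\<close>)
  next
    fix s1 :: state
    assume 1: "frame {''s''} {''A''} s s1 \<and> ((\<forall>m<Suc K. arr s1 ''A'' m = 0) \<and> drawn s1 = drawn s) \<and> var s1 ''s'' = Suc K"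
    then have f1: "frame {''s''} {''A''} s s1" by simp
    have v1: "var s1 ''off'' = b" "var s1 ''a'' = a" "var s1 ''w'' = wd" "arr s1 ''y'' = y" "arr s1 ''out'' = u"
      using frame_var[OF f1] frame_arr[OF f1] s by simp_all
    show "reaches w \<omega> (?c2 ;; ?c3) s1 (20 + (wd * (40 * (K + 1) + 18) + 6))
      (\<lambda>s'. frame {''s'', ''h'', ''acc''} {''A''} s s' \<and> (\<forall>m\<le>K. arr s' ''A'' m = ?dp wd m) \<and> drawn s' = drawn s)"
    proof (rule reaches_SeqI)
      show "reaches w \<omega> ?c2 s1 20 (\<lambda>s'. frame {} {''A''} s1 s' \<and> (\<forall>m\<le>K. arr s' ''A'' m = ?dp 0 m) \<and> drawn s' = drawn s)"
      proof (rule reaches_Cond[where T' = 5])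
        show "eval w (Index ''y'' (Var ''off'') [=] Index ''out'' (Var ''a'')) s1 = of_bool (y b = u a)"
          using v1 B by (simp add: evals)
      next
        assume "of_bool (y b = u a) \<noteq> (0 :: nat)"
        then show "reaches w \<omega> (Store ''A'' (Const 0) (Const 1)) s1 5
          (\<lambda>s'. frame {} {''A''} s1 s' \<and> (\<forall>m\<le>K. arr s' ''A'' m = ?dp 0 m) \<and> drawn s' = drawn s)"
          using 1 B by (intro reaches_Store[of w "Const 0" _ 0 "Const 1" 1]) (auto simp: evals frame_def)
      next
        assume "of_bool (y b = u a) = (0 :: nat)"
        then show "reaches w \<omega> Skip s1 5
          (\<lambda>s'. frame {} {''A''} s1 s' \<and> (\<forall>m\<le>K. arr s' ''A'' m = ?dp 0 m) \<and> drawn s' = drawn s)"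
          using 1 by (intro reaches_Skip) (auto simp: frame_def)
      qed simp
    next
      fix s2 :: state
      assume 2: "frame {} {''A''} s1 s2 \<and> (\<forall>m\<le>K. arr s2 ''A'' m = ?dp 0 m) \<and> drawn s2 = drawn s"
      then have f2: "frame {} {''A''} s1 s2" by simp
      have v2: "var s2 ''off'' = b" "var s2 ''a'' = a" "var s2 ''w'' = wd" "arr s2 ''y'' = y" "arr s2 ''out'' = u"
        using frame_var[OF f2] frame_arr[OF f2] v1 by simp_all
      have "reaches w \<omega> ?c3 s2 (wd * (40 * (K + 1) + 18) + 6)
        (\<lambda>s'. frame {''s'', ''h'', ''acc''} {''A''} s2 s' \<and> ((\<forall>m\<le>K. arr s' ''A'' m = ?dp wd m) \<and> drawn s' = drawn s) \<and> var s' ''h'' = wd)"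
      proof (rule reaches_For[where l = 0 and Tb = "40 * (K + 1) + 10"
            and J = "\<lambda>h s'. (\<forall>m\<le>K. arr s' ''A'' m = ?dp h m) \<and> drawn s' = drawn s"])
        fix h and s' :: state
        assume h: "h < wd" and f: "frame {''s'', ''h'', ''acc''} {''A''} s2 s'" and vh: "var s' ''h'' = h"
          and J: "(\<forall>m\<le>K. arr s' ''A'' m = ?dp h m) \<and> drawn s' = drawn s"
        have pw: "(h + 2) ^ K \<le> (wd + 1) ^ K" using h by (intro power_mono) auto
        show "reaches w \<omega> (dp_row K) s' (40 * (K + 1) + 10) (\<lambda>s''. frame ({''s'', ''h'', ''acc''} - {''h''}) {''A''} s' s'' \<and>
            (\<forall>m\<le>K. arr s'' ''A'' m = ?dp (Suc h) m) \<and> drawn s'' = drawn s)"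
          by (rule reaches_mono[OF dp_row[where b = b and h = h and a = a and y = y and u = u]])
            (use B h pw vh J v2 frame_var[OF f] frame_arr[OF f] in \<open>auto simp: frame_def\<close>)
      next
        show "eval w (Var ''w'') s' = wd" if "frame {''s'', ''h'', ''acc''} {''A''} s2 s'" for s'
          using frame_var[OF that] v2 by (simp add: evals)
      qed (use B 2 in \<open>auto simp: evals\<close>)
      then show "reaches w \<omega> ?c3 s2 (wd * (40 * (K + 1) + 18) + 6)
        (\<lambda>s'. frame {''s'', ''h'', ''acc''} {''A''} s s' \<and> (\<forall>m\<le>K. arr s' ''A'' m = ?dp wd m) \<and> drawn s' = drawn s)"
        by (rule reaches_mono) (use f1 f2 in \<open>auto simp: frame_def\<close>)
    qed simp
  next
    show "11 * (K + 1) + 6 + (20 + (wd * (40 * (K + 1) + 18) + 6)) \<le> 60 * (K + 1) * (wd + 1) + 30"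
      by (simp add: algebra_simps)
  qed
qed

subsection \<open>Evaluation of the statistic\<close>

text \<open>The sign of \<open>\<beta>^m\<close> alternates with \<open>m\<close>, so an odd
  \<open>m\<close> exchanges the roles of the two accumulators.\<close>

definition accumulate_com :: "nat \<Rightarrow> com" where
  "accumulate_com K = For ''m'' (Const 0) (Const (Suc K))
     (''z'' ::= Index ''A'' (Var ''m'') [*] Index ''PW'' (Var ''m'') ;;
      Cond (Var ''m'' [mod] Const 2 [=] Const 0)
        (''P'' ::= Var ''P'' [+] Var ''z'' [*] Var ''above'' ;; ''Q'' ::= Var ''Q'' [+] Var ''z'' [*] Var ''below'')
        (''P'' ::= Var ''P'' [+] Var ''z'' [*] Var ''below'' ;; ''Q'' ::= Var ''Q'' [+] Var ''z'' [*] Var ''above''))"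

definition window_com :: "nat \<Rightarrow> com" where
  "window_com K = For ''j'' (Var ''cc'' [-] Var ''rp'') (Var ''cc'' [+] Var ''rp'' [+] Const 1)
     (''off'' ::= Var ''i'' [*] Var ''S'' [+] Var ''j'' ;;
      ''above'' ::= Var ''base'' [-] Var ''M2'' [*] Var ''j'' ;;
      ''below'' ::= Var ''M2'' [*] Var ''j'' [-] Var ''base'' ;;
      dp_com K ;;
      accumulate_com K)"

definition stat_com :: "nat \<Rightarrow> com" where
  "stat_com K = For ''i'' (Const 0) (Var ''N'') (window_com K)"

lemma accumulate_com:
  assumes B: "2 < (2::nat) ^ w" "Suc K < 2 ^ w" "\<And>m. m \<le> K \<Longrightarrow> c m * d m < 2 ^ w"
      "P + (\<Sum>m\<le>K. c m * d m * (if even m then ab else be)) < 2 ^ w"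
      "Q + (\<Sum>m\<le>K. c m * d m * (if even m then be else ab)) < 2 ^ w"
    and s: "var s ''above'' = ab" "var s ''below'' = be" "var s ''P'' = P" "var s ''Q'' = Q"
      "\<And>m. m \<le> K \<Longrightarrow> arr s ''A'' m = c m" "\<And>m. m \<le> K \<Longrightarrow> arr s ''PW'' m = d m"
  shows "reaches w \<omega> (accumulate_com K) s (40 * (K + 1) + 10) (\<lambda>s'. frame {''m'', ''z'', ''P'', ''Q''} {} s s' \<and>
    var s' ''P'' = P + (\<Sum>m\<le>K. c m * d m * (if even m then ab else be)) \<and>
    var s' ''Q'' = Q + (\<Sum>m\<le>K. c m * d m * (if even m then be else ab)) \<and> drawn s' = drawn s)"
proof -
  define f where "f i = P + (\<Sum>m<i. c m * d m * (if even m then ab else be))" for i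
  define g where "g i = Q + (\<Sum>m<i. c m * d m * (if even m then be else ab))" for i
  define J where "J i s' \<longleftrightarrow> var s' ''P'' = f i \<and> var s' ''Q'' = g i \<and> drawn s' = drawn s" for i and s' :: state
  have fg: "f i < 2 ^ w" "g i < 2 ^ w" if "i \<le> Suc K" for i
  proof -
    have "f i \<le> f (Suc K)" "g i \<le> g (Suc K)"
      unfolding f_def g_def using that by (intro add_left_mono sum_mono2; auto)+
    then show "f i < 2 ^ w" "g i < 2 ^ w" using B(4,5) by (simp_all add: f_def g_def lessThan_Suc_atMost)
  qed
  have "reaches w \<omega> (accumulate_com K) s (40 * (K + 1) + 10) (\<lambda>s'. frame {''m'', ''z'', ''P'', ''Q''} {} s s' \<and> J (Suc K) s' \<and> var s' ''m'' = Suc K)"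
    unfolding accumulate_com_def
  proof (rule reaches_For[where l = 0 and Tb = 30])
    show "J 0 (s\<lparr>var := (var s)(''m'' := 0)\<rparr>)" using s by (simp add: J_def f_def g_def)
    show "J i (s\<lparr>var := (var s)(''m'' := x)\<rparr>)" if "J i s" for i x and s :: state using that by (simp add: J_def)
  next
    fix i and s' :: state
    assume i: "i < Suc K" and f: "frame {''m'', ''z'', ''P'', ''Q''} {} s s'" and vi: "var s' ''m'' = i" and J: "J i s'"
    have v: "var s' ''above'' = ab" "var s' ''below'' = be" "arr s' ''A'' i = c i" "arr s' ''PW'' i = d i"
      using frame_var[OF f] frame_arr[OF f] s i by simp_all
    have cd: "c i * d i < 2 ^ w" using B i by simp
    have i2: "i < 2 ^ w" using B i by simp
    have step: "f (Suc i) = f i + c i * d i * (if even i then ab else be)" "g (Suc i) = g i + c i * d i * (if even i then be else ab)"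
      by (simp_all add: f_def g_def)
    have lim: "f i + c i * d i * (if even i then ab else be) < 2 ^ w" "g i + c i * d i * (if even i then be else ab) < 2 ^ w"
      using fg[of "Suc i"] i unfolding step by simp_all
    have lim': "c i * d i * (if even i then ab else be) < 2 ^ w" "c i * d i * (if even i then be else ab) < 2 ^ w"
      using lim by linarith+
    let ?s = "s'\<lparr>var := (var s')(''z'' := c i * d i)\<rparr>"
    show "reaches w \<omega> (''z'' ::= Index ''A'' (Var ''m'') [*] Index ''PW'' (Var ''m'') ;;
      Cond (Var ''m'' [mod] Const 2 [=] Const 0)
        (''P'' ::= Var ''P'' [+] Var ''z'' [*] Var ''above'' ;; ''Q'' ::= Var ''Q'' [+] Var ''z'' [*] Var ''below'')
        (''P'' ::= Var ''P'' [+] Var ''z'' [*] Var ''below'' ;; ''Q'' ::= Var ''Q'' [+] Var ''z'' [*] Var ''above''))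
      s' 30 (\<lambda>s''. frame ({''m'', ''z'', ''P'', ''Q''} - {''m''}) {} s' s'' \<and> J (Suc i) s'')"
    proof (rule reaches_Assign_Seq[where x = "c i * d i"])
      show "eval w (Index ''A'' (Var ''m'') [*] Index ''PW'' (Var ''m'')) s' = c i * d i"
        using v vi cd by (simp add: evals)
      show "reaches w \<omega> (Cond (Var ''m'' [mod] Const 2 [=] Const 0)
        (''P'' ::= Var ''P'' [+] Var ''z'' [*] Var ''above'' ;; ''Q'' ::= Var ''Q'' [+] Var ''z'' [*] Var ''below'')
        (''P'' ::= Var ''P'' [+] Var ''z'' [*] Var ''below'' ;; ''Q'' ::= Var ''Q'' [+] Var ''z'' [*] Var ''above''))
        ?s (30 - (1 + cost (Index ''A'' (Var ''m'') [*] Index ''PW'' (Var ''m''))))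
        (\<lambda>s''. frame ({''m'', ''z'', ''P'', ''Q''} - {''m''}) {} s' s'' \<and> J (Suc i) s'')"
      proof (rule reaches_Cond[where T' = 15])
        show "eval w (Var ''m'' [mod] Const 2 [=] Const 0) ?s = of_bool (even i)"
          using B vi i2 by (simp add: evals even_iff_mod_2_eq_zero)
      next
        assume "of_bool (even i) \<noteq> (0 :: nat)"
        then have e: "even i" by simp
        show "reaches w \<omega> (''P'' ::= Var ''P'' [+] Var ''z'' [*] Var ''above'' ;; ''Q'' ::= Var ''Q'' [+] Var ''z'' [*] Var ''below'')
           ?s 15 (\<lambda>s''. frame ({''m'', ''z'', ''P'', ''Q''} - {''m''}) {} s' s'' \<and> J (Suc i) s'')"
          by (rule reaches_Assign_Seq[where x = "f (Suc i)"], use v vi J lim lim' e step in \<open>simp add: evals J_def\<close>, simp,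
              rule reaches_Assign[where x = "g (Suc i)"], use v vi J lim lim' e step in \<open>simp add: evals J_def\<close>, simp,
              use J in \<open>simp add: frame_def J_def\<close>)
      next
        assume "of_bool (even i) = (0 :: nat)"
        then have e: "odd i" by simp
        show "reaches w \<omega> (''P'' ::= Var ''P'' [+] Var ''z'' [*] Var ''below'' ;; ''Q'' ::= Var ''Q'' [+] Var ''z'' [*] Var ''above'')
           ?s 15 (\<lambda>s''. frame ({''m'', ''z'', ''P'', ''Q''} - {''m''}) {} s' s'' \<and> J (Suc i) s'')"
          by (rule reaches_Assign_Seq[where x = "f (Suc i)"], use v vi J lim lim' e step in \<open>simp add: evals J_def\<close>, simp,
              rule reaches_Assign[where x = "g (Suc i)"], use v vi J lim lim' e step in \<open>simp add: evals J_def\<close>, simp,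
              use J in \<open>simp add: frame_def J_def\<close>)
      qed simp
    qed simp
  qed (use B in \<open>auto simp: evals\<close>)
  then show ?thesis
    by (rule reaches_mono) (auto simp: J_def f_def g_def lessThan_Suc_atMost)
qed

section \<open>Word size and magnitude of the intermediate values\<close>

locale ram_setup = reconstruct n N K R for n N K R :: nat +
  fixes w L :: nat
  assumes n2: "2 \<le> n" and N: "1 \<le> N" "N \<le> n" and RK: "8 * R + K + 1 \<le> n" and L: "L \<le> 2 * n * N"
    and w: "n ^ (5 * K + 20) \<le> 2 ^ w"
begin

text \<open>Overflow conditions are reduced to powers of \<open>n\<close>. The largest exponent that
  arises is \<open>4 * K + 11\<close>, in the final comparison of a step: counts give
  \<open>K\<close>, weights \<open>3 * K\<close>, and the remaining factors a constant.\<close>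

lemma lt_lim: "x \<le> n ^ e \<Longrightarrow> e \<le> 5 * K + 19 \<Longrightarrow> x < 2 ^ w"
proof -
  assume x: "x \<le> n ^ e" "e \<le> 5 * K + 19"
  then have "n ^ e < n ^ (5 * K + 20)" using n2 by (intro power_strict_increasing) auto
  then show ?thesis using x w by simp
qed

lemma mult_pow_le: "x \<le> n ^ a \<Longrightarrow> y \<le> n ^ b \<Longrightarrow> x * y \<le> n ^ (a + b)"
  unfolding power_add by (rule mult_mono) auto

lemma add_pow_le: "x \<le> n ^ a \<Longrightarrow> y \<le> n ^ a \<Longrightarrow> x + y \<le> n ^ (a + 1)"
proof -
  assume "x \<le> n ^ a" "y \<le> n ^ a"
  then have "x + y \<le> 2 * n ^ a" by simp
  also have "\<dots> \<le> n * n ^ a" using n2 by (intro mult_right_mono) auto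
  finally show ?thesis by simp
qed

lemma pow_mono: "x \<le> n ^ a \<Longrightarrow> a \<le> b \<Longrightarrow> x \<le> n ^ b"
  using power_increasing[of a b n] n2 by (meson order.trans one_le_numeral)

lemma le_pow:
  "K \<le> n ^ 1" "K + 1 \<le> n ^ 1" "R \<le> n ^ 1" "2 * R + 1 \<le> n ^ 1" "N \<le> n ^ 1" "wd p \<le> n ^ 1" "wd p + 1 \<le> n ^ 1" "Rp p \<le> n ^ 1"
  "L \<le> n ^ 3" "n * N \<le> n ^ 2" "2 * n \<le> n ^ 2" "2 * (n * N) \<le> n ^ 3"
  using n2 N RK L
  by (auto simp: wd_def W_def Rp_def power2_eq_square power3_eq_cube intro: order.trans mult_mono)

lemma cnt_le: "m \<le> K \<Longrightarrow> cnt y u p i j m \<le> n ^ K"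
proof -
  assume m: "m \<le> K"
  have "cnt y u p i j m \<le> (wd p + 1) ^ m" unfolding cnt_def by (rule dp_le)
  also have "\<dots> \<le> (wd p + 1) ^ K" using m by (intro power_increasing) auto
  also have "\<dots> \<le> n ^ K" using le_pow(7)[of p] by (intro power_mono) auto
  finally show ?thesis .
qed

lemma weight_le: "m \<le> K \<Longrightarrow> weight L m \<le> n ^ (3 * K)"
proof -
  assume m: "m \<le> K"
  have "n * N - L \<le> n ^ 3" using pow_mono[OF le_pow(10), of 3] by simp
  then have "weight L m \<le> (n ^ 3) ^ m * (n ^ 3) ^ (K - m)"
    unfolding weight_def using le_pow(9) by (intro mult_mono power_mono) auto
  also have "\<dots> = (n ^ 3) ^ K" using m by (simp flip: power_add)
  finally show ?thesis by (simp add: power_mult)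
qed

lemma st_le: "p < n \<Longrightarrow> st p \<le> n ^ 1"
  by (simp add: st_def)

lemma center_le: "p < n \<Longrightarrow> center L p \<le> 2 * n"
proof -
  assume p: "p < n"
  have "center L p \<le> (2 * n * N) * n div (n * N)"
    unfolding center_def using L st_le[OF p] by (intro div_le_mono mult_mono) auto
  also have "(2 * n * N) * n = 2 * n * (n * N)" by simp
  also have "2 * n * (n * N) div (n * N) = 2 * n" using n2 N by (intro nonzero_mult_div_cancel_right) auto
  finally show ?thesis .
qed

lemma win_le: "p < n \<Longrightarrow> j \<le> center L p + Rp p \<Longrightarrow> j + 1 \<le> n ^ 3"
proof -
  assume p: "p < n" "j \<le> center L p + Rp p"
  have "j + 1 \<le> 2 * n + (Rp p + 1)" using center_le[OF p(1)] p by simp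
  also have "Rp p + 1 \<le> n ^ 2" using RK pow_mono[of n 1 2] n2 by (auto simp: Rp_def intro!: pow_mono[of _ 1 2])
  also have "2 * n + n ^ 2 \<le> n ^ (2 + 1)" by (rule add_pow_le) (auto simp: le_pow)
  finally show ?thesis by simp
qed

lemma Lst_le: "p < n \<Longrightarrow> L * st p \<le> n ^ 4"
  using mult_pow_le[OF le_pow(9) st_le, of p] by simp

lemma base_le: "p < n \<Longrightarrow> 2 * (L * st p) + n * N \<le> n ^ 6"
proof -
  assume p: "p < n"
  have "2 * (L * st p) \<le> n ^ (1 + 4)" by (rule mult_pow_le[OF _ Lst_le[OF p]]) (use n2 in simp)
  moreover have "n * N \<le> n ^ (1 + 4)" by (rule pow_mono[OF le_pow(10)]) simp
  ultimately show ?thesis using add_pow_le[of "2 * (L * st p)" "1 + 4" "n * N"] by simp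
qed

lemma M2j_le: "p < n \<Longrightarrow> j \<le> center L p + Rp p \<Longrightarrow> 2 * (n * N) * j \<le> n ^ 6"
  using mult_pow_le[OF le_pow(12), of j 3] win_le[of p j] by simp

lemma above_below_le:
  assumes "p < n" "j \<le> center L p + Rp p"
  shows "above L p j \<le> n ^ 6" "below L p j \<le> n ^ 6"
  unfolding above_def below_def using base_le[OF assms(1)] M2j_le[OF assms] by linarith+

text \<open>The flag \<open>e\<close> selects the parity that goes with \<open>above\<close>, so
  \<open>plus\<close> and \<open>minus\<close> share their bounds.\<close>

definition summand :: "(nat \<Rightarrow> nat) \<Rightarrow> (nat \<Rightarrow> nat) \<Rightarrow> nat \<Rightarrow> nat \<Rightarrow> nat \<Rightarrow> bool \<Rightarrow> nat" where
  "summand y u p i j e = (\<Sum>m\<le>K. cnt y u p i j m * weight L m * (if even m = e then above L p j else below L p j))"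

lemma plus_eq: "plus y L u p = (\<Sum>i<N. \<Sum>j\<in>win (center L p) (Rp p). summand y u p i j True)"
  and minus_eq: "minus y L u p = (\<Sum>i<N. \<Sum>j\<in>win (center L p) (Rp p). summand y u p i j False)"
  unfolding plus_def minus_def summand_def by (auto intro!: sum.cong)

lemma summand_le:
  assumes "p < n" "j \<le> center L p + Rp p"
  shows "summand y u p i j e \<le> n ^ (4 * K + 7)"
proof -
  have "summand y u p i j e \<le> (\<Sum>m\<le>K. n ^ K * n ^ (3 * K) * n ^ 6)"
    unfolding summand_def
    by (intro sum_mono mult_mono) (auto simp: cnt_le weight_le above_below_le[OF assms])
  also have "\<dots> = (K + 1) * (n ^ K * n ^ (3 * K) * n ^ 6)" by simp
  also have "\<dots> \<le> n ^ (1 + (K + 3 * K + 6))"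
    by (rule mult_pow_le[OF le_pow(2)]) (simp only: power_add)
  also have "1 + (K + 3 * K + 6) = 4 * K + 7" by simp
  finally show ?thesis .
qed

lemma sum_summand_le:
  assumes "p < n" "I \<subseteq> {..<N}" "X \<subseteq> win (center L p) (Rp p)"
  shows "(\<Sum>i\<in>I. \<Sum>j\<in>X. summand y u p i j e) \<le> n ^ (4 * K + 9)"
proof -
  have "(\<Sum>i\<in>I. \<Sum>j\<in>X. summand y u p i j e) \<le> (\<Sum>i<N. \<Sum>j\<in>win (center L p) (Rp p). summand y u p i j e)"
    using assms by (intro order.trans[OF sum_mono2 sum_mono] sum_mono2) auto
  also have "\<dots> \<le> (\<Sum>i<N. \<Sum>j\<in>win (center L p) (Rp p). n ^ (4 * K + 7))"
    using assms(1) by (intro sum_mono summand_le) auto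
  also have "\<dots> = N * (card (win (center L p) (Rp p)) * n ^ (4 * K + 7))" by simp
  also have "\<dots> \<le> n ^ (1 + (1 + (4 * K + 7)))"
  proof (intro mult_pow_le le_pow)
    have "card (win (center L p) (Rp p)) \<le> 2 * R + 1" by (auto simp: Rp_def)
    then show "card (win (center L p) (Rp p)) \<le> n ^ 1" using le_pow(4) by linarith
  qed simp
  finally show ?thesis by (simp add: add_ac)
qed

definition env :: "(nat \<Rightarrow> nat) \<Rightarrow> state \<Rightarrow> bool" where
  "env y s \<longleftrightarrow> var s ''n'' = n \<and> var s ''N'' = N \<and> var s ''S'' = 2 * n \<and> var s ''M'' = n * N \<and>
    var s ''M2'' = 2 * (n * N) \<and> var s ''lam'' = L \<and> var s ''W'' = W \<and> var s ''R'' = R \<and>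
    (\<forall>m\<le>K. arr s ''PW'' m = weight L m) \<and> arr s ''y'' = y"

lemma env_frame:
  "frame V A s s' \<Longrightarrow> env y s \<Longrightarrow> {''n'', ''N'', ''S'', ''M'', ''M2'', ''lam'', ''W'', ''R''} \<inter> V = {} \<Longrightarrow>
    {''PW'', ''y''} \<inter> A = {} \<Longrightarrow> env y s'"
  unfolding env_def by (auto simp: frame_var frame_arr)

text \<open>\<open>env\<close> is preserved by the whole main loop, \<open>penv\<close> only during
  the evaluation for one position \<open>p\<close>.\<close>

definition penv :: "(nat \<Rightarrow> nat) \<Rightarrow> (nat \<Rightarrow> nat) \<Rightarrow> nat \<Rightarrow> state \<Rightarrow> bool" where
  "penv y u p s \<longleftrightarrow> env y s \<and> var s ''a'' = st p \<and> var s ''w'' = wd p \<and> var s ''rp'' = Rp p \<and>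
    var s ''cc'' = center L p \<and> var s ''base'' = 2 * (L * st p) + n * N \<and> arr s ''out'' = u"

lemma penv_frame:
  assumes "frame V A s s'" "penv y u p s"
    "{''n'', ''N'', ''S'', ''M'', ''M2'', ''lam'', ''W'', ''R'', ''a'', ''w'', ''rp'', ''cc'', ''base''} \<inter> V = {}"
    "{''PW'', ''y'', ''out''} \<inter> A = {}"
  shows "penv y u p s'"
  using assms env_frame[OF assms(1), of y] unfolding penv_def by (auto simp: frame_var frame_arr)

definition time_window :: nat where
  "time_window = (2 * R + 1) * (100 * (K + 1) * (8 * R + 1) + 80) + 20"

abbreviation (input) "VW \<equiv> {''j'', ''off'', ''above'', ''below'', ''s'', ''h'', ''acc'', ''m'', ''z'', ''P'', ''Q''}"

lemma window_com:
  assumes p: "p < n" and i: "i < N" and e: "penv y u p s" and vi: "var s ''i'' = i"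
    and P: "var s ''P'' + (\<Sum>j\<in>win (center L p) (Rp p). summand y u p i j True) < 2 ^ w"
    and Q: "var s ''Q'' + (\<Sum>j\<in>win (center L p) (Rp p). summand y u p i j False) < 2 ^ w"
  shows "reaches w \<omega> (window_com K) s time_window (\<lambda>s'. frame VW {''A''} s s' \<and>
    var s' ''P'' = var s ''P'' + (\<Sum>j\<in>win (center L p) (Rp p). summand y u p i j True) \<and>
    var s' ''Q'' = var s ''Q'' + (\<Sum>j\<in>win (center L p) (Rp p). summand y u p i j False) \<and> drawn s' = drawn s)"
proof -
  define lo where "lo = center L p - Rp p"
  define H where "H = center L p + Rp p + 1"
  define Pf where "Pf k = var s ''P'' + (\<Sum>j\<in>{lo..<k}. summand y u p i j True)" for k
  define Qf where "Qf k = var s ''Q'' + (\<Sum>j\<in>{lo..<k}. summand y u p i j False)" for k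
  define J where "J k s' \<longleftrightarrow> var s' ''P'' = Pf k \<and> var s' ''Q'' = Qf k \<and> drawn s' = drawn s" for k and s' :: state
  have win: "win (center L p) (Rp p) = {lo..<H}" by (auto simp: lo_def H_def)
  have PQ: "Pf k < 2 ^ w" "Qf k < 2 ^ w" if "k \<le> H" for k
  proof -
    have "Pf k \<le> Pf H" "Qf k \<le> Qf H"
      unfolding Pf_def Qf_def using that by (intro add_left_mono sum_mono2; auto)+
    then show "Pf k < 2 ^ w" "Qf k < 2 ^ w" using P Q unfolding win Pf_def Qf_def by linarith+
  qed
  have two: "2 < (2 :: nat) ^ w" by (rule lt_lim[of _ 2]) (use n2 in \<open>auto simp: power2_eq_square intro: order.trans[OF _ mult_mono[of 2 n 2 n]]\<close>)
  have cR: "center L p + Rp p + 1 \<le> n ^ 3" by (rule win_le[OF p]) simp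
  have H3: "H < 2 ^ w" by (rule lt_lim[of _ 3]) (use cR in \<open>auto simp: H_def\<close>)
  have T: "(H - lo) * (7 + cost (Var ''cc'' [+] Var ''rp'' [+] Const 1) + (100 * (K + 1) * (8 * R + 1) + 68)) + 4
      + cost (Var ''cc'' [+] Var ''rp'' [+] Const 1) + cost (Var ''cc'' [-] Var ''rp'') \<le> time_window"
  proof -
    have "H - lo \<le> 2 * R + 1" by (auto simp: H_def lo_def Rp_def)
    then have "(H - lo) * (100 * (K + 1) * (8 * R + 1) + 80) \<le> (2 * R + 1) * (100 * (K + 1) * (8 * R + 1) + 80)"
      by (rule mult_right_mono) simp
    then show ?thesis by (simp add: time_window_def)
  qed
  have "reaches w \<omega> (window_com K) s time_window (\<lambda>s'. frame VW {''A''} s s' \<and> J H s' \<and> var s' ''j'' = H)"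
    unfolding window_com_def
  proof (rule reaches_For[where l = lo, OF _ _ H3 _ _ _ _ _ T])
    show "eval w (Var ''cc'' [-] Var ''rp'') s = lo"
      using e cR lt_lim[of "center L p" 3] by (simp add: evals penv_def lo_def)
    show "lo \<le> H" by (simp add: lo_def H_def)
    show "eval w (Var ''cc'' [+] Var ''rp'' [+] Const 1) s' = H" if "frame VW {''A''} s s'" for s'
      using penv_frame[OF that e] H3 two by (simp add: evals penv_def H_def)
    show "J lo (s\<lparr>var := (var s)(''j'' := lo)\<rparr>)" by (simp add: J_def Pf_def Qf_def)
    show "J k (s\<lparr>var := (var s)(''j'' := x)\<rparr>)" if "J k s" for k x and s :: state using that by (simp add: J_def)
  next
    fix j and s1 :: state
    assume j: "j < H" "lo \<le> j" and f: "frame VW {''A''} s s1" and vj: "var s1 ''j'' = j" and J: "J j s1"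
    have e1: "penv y u p s1" by (rule penv_frame[OF f e]) auto
    then have v1: "var s1 ''S'' = 2 * n" "var s1 ''M2'' = 2 * (n * N)" "var s1 ''base'' = 2 * (L * st p) + n * N"
      "var s1 ''a'' = st p" "var s1 ''w'' = wd p" "arr s1 ''y'' = y" "arr s1 ''out'' = u"
      "\<And>m. m \<le> K \<Longrightarrow> arr s1 ''PW'' m = weight L m"
      by (auto simp: penv_def env_def)
    have i1: "var s1 ''i'' = i" using frame_var[OF f] vi by simp
    have jc: "j \<le> center L p + Rp p" using j by (simp add: H_def)
    have iS: "i * (2 * n) \<le> n ^ 3" 
    proof -
      have "i \<le> n ^ 1" using i N by simp
      from mult_pow_le[OF this le_pow(11)] show ?thesis by (simp only: one_plus_numeral semiring_norm)
    qed
    have j3: "j \<le> n ^ 3" using win_le[OF p jc] by simp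
    have off4: "i * (2 * n) + j \<le> n ^ 4" using add_pow_le[OF iS j3] by simp
    have off_lim: "i * (2 * n) + j < 2 ^ w" "i * (2 * n) < 2 ^ w"
      by (rule lt_lim[OF off4], simp, rule lt_lim[OF iS], simp)
    have M2j: "2 * (n * N) * j < 2 ^ w" by (rule lt_lim[OF M2j_le[OF p jc]]) simp
    have base: "2 * (L * st p) + n * N < 2 ^ w" by (rule lt_lim[OF base_le[OF p]]) simp
    let ?s2 = "s1\<lparr>var := (var s1)(''off'' := i * (2 * n) + j)\<rparr>"
    let ?s3 = "?s2\<lparr>var := (var ?s2)(''above'' := above L p j)\<rparr>"
    let ?s4 = "?s3\<lparr>var := (var ?s3)(''below'' := below L p j)\<rparr>"
    have PWs: "(\<And>m. m \<le> K \<Longrightarrow> cnt y u p i j m * weight L m < 2 ^ w)"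
    proof -
      fix m assume "m \<le> K"
      then have "cnt y u p i j m * weight L m \<le> n ^ (K + 3 * K)" by (intro mult_pow_le cnt_le weight_le)
      then show "cnt y u p i j m * weight L m < 2 ^ w" by (rule lt_lim) simp
    qed
    have f4: "frame (VW - {''j''}) {''A''} s1 ?s4" by (auto simp: frame_def)
    show "reaches w \<omega> (''off'' ::= Var ''i'' [*] Var ''S'' [+] Var ''j'' ;;
      ''above'' ::= Var ''base'' [-] Var ''M2'' [*] Var ''j'' ;;
      ''below'' ::= Var ''M2'' [*] Var ''j'' [-] Var ''base'' ;;
      dp_com K ;; accumulate_com K) s1 (100 * (K + 1) * (8 * R + 1) + 68)
      (\<lambda>s'. frame (VW - {''j''}) {''A''} s1 s' \<and> J (Suc j) s')"
    proof (rule reaches_Assign_Seq[where x = "i * (2 * n) + j"])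
      show "eval w (Var ''i'' [*] Var ''S'' [+] Var ''j'') s1 = i * (2 * n) + j"
        using v1 i1 vj off_lim by (simp add: evals)
    next
      show "reaches w \<omega> (''above'' ::= Var ''base'' [-] Var ''M2'' [*] Var ''j'' ;;
        ''below'' ::= Var ''M2'' [*] Var ''j'' [-] Var ''base'' ;; dp_com K ;; accumulate_com K) ?s2
        (100 * (K + 1) * (8 * R + 1) + 68 - (1 + cost (Var ''i'' [*] Var ''S'' [+] Var ''j'')))
        (\<lambda>s'. frame (VW - {''j''}) {''A''} s1 s' \<and> J (Suc j) s')"
      proof (rule reaches_Assign_Seq[where x = "above L p j"])
        show "eval w (Var ''base'' [-] Var ''M2'' [*] Var ''j'') ?s2 = above L p j"
          using v1 vj M2j base by (simp add: evals above_def)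
      next
        show "reaches w \<omega> (''below'' ::= Var ''M2'' [*] Var ''j'' [-] Var ''base'' ;; dp_com K ;; accumulate_com K) ?s3
          (100 * (K + 1) * (8 * R + 1) + 68 - (1 + cost (Var ''i'' [*] Var ''S'' [+] Var ''j''))
            - (1 + cost (Var ''base'' [-] Var ''M2'' [*] Var ''j'')))
          (\<lambda>s'. frame (VW - {''j''}) {''A''} s1 s' \<and> J (Suc j) s')"
        proof (rule reaches_Assign_Seq[where x = "below L p j"])
          show "eval w (Var ''M2'' [*] Var ''j'' [-] Var ''base'') ?s3 = below L p j"
            using v1 vj M2j base by (simp add: evals below_def)
        next
          show "reaches w \<omega> (dp_com K ;; accumulate_com K) ?s4
            (100 * (K + 1) * (8 * R + 1) + 68 - (1 + cost (Var ''i'' [*] Var ''S'' [+] Var ''j''))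
              - (1 + cost (Var ''base'' [-] Var ''M2'' [*] Var ''j'')) - (1 + cost (Var ''M2'' [*] Var ''j'' [-] Var ''base'')))
            (\<lambda>s'. frame (VW - {''j''}) {''A''} s1 s' \<and> J (Suc j) s')"
          proof (rule reaches_SeqI)
            show "reaches w \<omega> (dp_com K) ?s4 (60 * (K + 1) * (wd p + 1) + 30)
              (\<lambda>s'. frame {''s'', ''h'', ''acc''} {''A''} ?s4 s' \<and>
                (\<forall>m\<le>K. arr s' ''A'' m = dp (\<lambda>d. y (i * (2 * n) + j + d)) (\<lambda>h. u (st p + h)) (wd p) m) \<and> drawn s' = drawn ?s4)"
            proof (rule dp_com)
              show "1 < (2 :: nat) ^ w" using two by simp
              show "Suc K < 2 ^ w" using lt_lim[OF le_pow(2)] by simp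
              show "wd p < 2 ^ w" using lt_lim[OF le_pow(6)] by simp
              have "wd p + K \<le> n ^ 2" using add_pow_le[OF le_pow(6) le_pow(1)] by (simp add: numeral_2_eq_2)
              then have "wd p + K \<le> n ^ 4" by (rule pow_mono) simp
              from add_pow_le[OF off4 this] have "i * (2 * n) + j + (wd p + K) \<le> n ^ 5" by simp
              then show "i * (2 * n) + j + wd p + K < 2 ^ w" using lt_lim[of _ 5] by (simp add: add.assoc)
              have "st p + wd p \<le> n ^ 1" using wd_st[of p] p by simp
              then show "st p + wd p < 2 ^ w" by (rule lt_lim) simp
              have "(wd p + 1) ^ K \<le> n ^ K" using le_pow(7)[of p] by (intro power_mono) auto
              then show "(wd p + 1) ^ K < 2 ^ w" by (rule lt_lim) simp
            qed (use v1 in auto)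
          next
            fix s5 :: state
            assume 5: "frame {''s'', ''h'', ''acc''} {''A''} ?s4 s5 \<and>
                (\<forall>m\<le>K. arr s5 ''A'' m = dp (\<lambda>d. y (i * (2 * n) + j + d)) (\<lambda>h. u (st p + h)) (wd p) m) \<and> drawn s5 = drawn ?s4"
            then have f5: "frame {''s'', ''h'', ''acc''} {''A''} ?s4 s5" by blast
            have PQ5: "var s5 ''P'' = Pf j" "var s5 ''Q'' = Qf j" "drawn s5 = drawn s"
              using frame_var[OF f5] J 5 by (auto simp: J_def)
            have PQS: "Pf (Suc j) = Pf j + summand y u p i j True" "Qf (Suc j) = Qf j + summand y u p i j False"
              using j by (simp_all add: Pf_def Qf_def)
            have lims: "Pf j + summand y u p i j True < 2 ^ w" "Qf j + summand y u p i j False < 2 ^ w"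
              using PQ[of "Suc j"] j PQS by auto
            have "reaches w \<omega> (accumulate_com K) s5 (40 * (K + 1) + 10) (\<lambda>s'. frame {''m'', ''z'', ''P'', ''Q''} {} s5 s' \<and>
               var s' ''P'' = Pf j + (\<Sum>m\<le>K. cnt y u p i j m * weight L m * (if even m then above L p j else below L p j)) \<and>
               var s' ''Q'' = Qf j + (\<Sum>m\<le>K. cnt y u p i j m * weight L m * (if even m then below L p j else above L p j)) \<and> drawn s' = drawn s5)"
            proof (rule accumulate_com[OF two _ PWs])
              show "Suc K < 2 ^ w" using lt_lim[OF le_pow(2)] by simp
              show "Pf j + (\<Sum>m\<le>K. cnt y u p i j m * weight L m * (if even m then above L p j else below L p j)) < 2 ^ w"
                using lims(1) by (simp add: summand_def)
              have "(\<Sum>m\<le>K. cnt y u p i j m * weight L m * (if even m then below L p j else above L p j)) = summand y u p i j False"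
                unfolding summand_def by (intro sum.cong) auto
              then show "Qf j + (\<Sum>m\<le>K. cnt y u p i j m * weight L m * (if even m then below L p j else above L p j)) < 2 ^ w"
                using lims(2) by simp
              show "arr s5 ''A'' m = cnt y u p i j m" if "m \<le> K" for m using 5 that by (simp add: cnt_def)
              show "arr s5 ''PW'' m = weight L m" if "m \<le> K" for m using frame_arr[OF f5] v1(8)[OF that] by simp
            qed (use frame_var[OF f5] PQ5 in auto)
            moreover have "(\<Sum>m\<le>K. cnt y u p i j m * weight L m * (if even m then above L p j else below L p j)) = summand y u p i j True"
              "(\<Sum>m\<le>K. cnt y u p i j m * weight L m * (if even m then below L p j else above L p j)) = summand y u p i j False"
              unfolding summand_def by (intro sum.cong; auto)+
            ultimately have *: "reaches w \<omega> (accumulate_com K) s5 (40 * (K + 1) + 10) (\<lambda>s'. frame {''m'', ''z'', ''P'', ''Q''} {} s5 s' \<and>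
               var s' ''P'' = Pf (Suc j) \<and> var s' ''Q'' = Qf (Suc j) \<and> drawn s' = drawn s5)"
              by (simp only: PQS)
            show "reaches w \<omega> (accumulate_com K) s5 (40 * (K + 1) + 10)
               (\<lambda>s'. frame (VW - {''j''}) {''A''} s1 s' \<and> J (Suc j) s')"
            proof (rule reaches_mono[OF * order.refl], intro conjI)
              fix s6 assume 6: "frame {''m'', ''z'', ''P'', ''Q''} {} s5 s6 \<and> var s6 ''P'' = Pf (Suc j) \<and> var s6 ''Q'' = Qf (Suc j) \<and> drawn s6 = drawn s5"
              show "J (Suc j) s6" using 6 PQ5 by (simp add: J_def)
              have "frame (VW - {''j''}) {''A''} s1 s5" using f4 f5 by (rule frame_trans) auto
              then show "frame (VW - {''j''}) {''A''} s1 s6" by (rule frame_trans[of _ _ _ _ "{''m'', ''z'', ''P'', ''Q''}" "{}"]) (use 6 in auto)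
            qed
          next
            have "(K + 1) * (wd p + 1) \<le> (K + 1) * (8 * R + 1)" by (intro mult_left_mono) (auto simp: wd_def W_def)
            moreover have "(K + 1) * 1 \<le> (K + 1) * (8 * R + 1)" by (intro mult_left_mono) auto
            ultimately show "60 * (K + 1) * (wd p + 1) + 30 + (40 * (K + 1) + 10)
              \<le> 100 * (K + 1) * (8 * R + 1) + 68 - (1 + cost (Var ''i'' [*] Var ''S'' [+] Var ''j''))
              - (1 + cost (Var ''base'' [-] Var ''M2'' [*] Var ''j'')) - (1 + cost (Var ''M2'' [*] Var ''j'' [-] Var ''base''))"
              by (simp only: cost.simps mult.assoc)
          qed
        qed simp
      qed simp
    qed simp
  qed simp
  then show ?thesis
    by (rule reaches_mono) (auto simp: J_def Pf_def Qf_def win)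
qed

end

subsection \<open>One step of the reconstruction\<close>

definition period_com :: com where
  "period_com = For ''i'' (Const 0) (Var ''w'' [-] Var ''q'')
     (Cond (Index ''out'' (Var ''a'' [+] Var ''i'') [=] Index ''out'' (Var ''a'' [+] Var ''i'' [+] Var ''q''))
        Skip (''ok'' ::= Const 0))"

text \<open>\<open>q\<close> increases and a later period overwrites \<open>b\<close>, in accordance
  with \<open>bcand\<close>, where the largest period takes precedence. Testing each period naively
  costs \<open>O(R^2)\<close> for each position, below the cost of the statistic.\<close>

definition cand_com :: com where
  "cand_com =
     (''b'' ::= Const 1 ;;
      For ''q1'' (Const 0) (Var ''qp'')
       (''q'' ::= Var ''q1'' [+] Const 1 ;;
        ''ok'' ::= Const 1 ;;
        period_com ;;
        Cond (Var ''ok'') (''b'' ::= Const 1 [-] Index ''out'' (Var ''a'' [+] Var ''w'' [-] Var ''q'')) Skip))"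

text \<open>The candidate is stored in \<open>out\<close> before the statistic is evaluated, because
  the dynamic program reads the word from there; it is flipped afterwards if the test rejects
  it.\<close>

definition step_com :: "nat \<Rightarrow> com" where
  "step_com K =
     (''a'' ::= Var ''p'' [-] Var ''W'' ;;
      ''w'' ::= Var ''p'' [-] Var ''a'' ;;
      Cond (Var ''W'' [<] Var ''p'')
        (''rp'' ::= Var ''R'' ;; ''qp'' ::= Const 4 [*] Var ''R'')
        (''rp'' ::= Const 0 ;; ''qp'' ::= Const 0) ;;
      cand_com ;;
      Store ''out'' (Var ''p'') (Var ''b'') ;;
      ''cc'' ::= Var ''lam'' [*] Var ''a'' [div] Var ''M'' ;;
      ''base'' ::= Const 2 [*] (Var ''lam'' [*] Var ''a'') [+] Var ''M'' ;;
      ''P'' ::= Const 0 ;;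
      ''Q'' ::= Const 0 ;;
      stat_com K ;;
      Cond (Const 2 [*] Var ''P'' [<] Const 2 [*] Var ''Q'' [+] Var ''M'' [*] Var ''N'' [*] Index ''PW'' (Const 0))
        (Store ''out'' (Var ''p'') (Const 1 [-] Var ''b''))
        Skip)"

definition main_com :: "nat \<Rightarrow> com" where
  "main_com K = For ''p'' (Const 0) (Var ''n'') (step_com K)"

lemma period_com:
  assumes B: "1 < (2 :: nat) ^ w" "a + wd < 2 ^ w" "q \<ge> 1"
    and s: "var s ''a'' = a" "var s ''w'' = wd" "var s ''q'' = q" "var s ''ok'' = 1" "arr s ''out'' = u"
  shows "reaches w \<omega> period_com s (24 * wd + 12) (\<lambda>s'. frame {''i'', ''ok''} {} s s' \<and>
    var s' ''ok'' = of_bool (\<forall>i<wd - q. u (a + i) = u (a + i + q)) \<and> drawn s' = drawn s)"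
proof -
  define J where "J k s' \<longleftrightarrow> var s' ''ok'' = of_bool (\<forall>i<k. u (a + i) = u (a + i + q)) \<and> drawn s' = drawn s"
    for k and s' :: state
  have "(wd - q) * 24 \<le> wd * 24" by (intro mult_right_mono) auto
  then have T: "(wd - q - 0) * (7 + cost (Var ''w'' [-] Var ''q'') + 14) + 4 + cost (Var ''w'' [-] Var ''q'') + cost (Const 0) \<le> 24 * wd + 12"
    by simp
  have "reaches w \<omega> period_com s (24 * wd + 12) (\<lambda>s'. frame {''i'', ''ok''} {} s s' \<and> J (wd - q) s' \<and> var s' ''i'' = wd - q)"
    unfolding period_com_def
  proof (rule reaches_For[where l = 0, OF _ _ _ _ _ _ _ _ T])
    show "wd - q < 2 ^ w" using B by simp
    show "eval w (Var ''w'' [-] Var ''q'') s' = wd - q" if "frame {''i'', ''ok''} {} s s'" for s'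
      using frame_var[OF that] s B by (simp add: evals)
    show "J 0 (s\<lparr>var := (var s)(''i'' := 0)\<rparr>)" using s by (simp add: J_def)
    show "J k (s\<lparr>var := (var s)(''i'' := x)\<rparr>)" if "J k s" for k x and s :: state using that by (simp add: J_def)
  next
    fix i and s' :: state
    assume i: "i < wd - q" and f: "frame {''i'', ''ok''} {} s s'" and vi: "var s' ''i'' = i" and J: "J i s'"
    have v: "var s' ''a'' = a" "var s' ''w'' = wd" "var s' ''q'' = q" "arr s' ''out'' = u"
      using frame_var[OF f] frame_arr[OF f] s by simp_all
    show "reaches w \<omega> (Cond (Index ''out'' (Var ''a'' [+] Var ''i'') [=] Index ''out'' (Var ''a'' [+] Var ''i'' [+] Var ''q''))
        Skip (''ok'' ::= Const 0)) s' 14 (\<lambda>s''. frame ({''i'', ''ok''} - {''i''}) {} s' s'' \<and> J (Suc i) s'')"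
    proof (rule reaches_Cond[where T' = 2])
      show "eval w (Index ''out'' (Var ''a'' [+] Var ''i'') [=] Index ''out'' (Var ''a'' [+] Var ''i'' [+] Var ''q'')) s'
        = of_bool (u (a + i) = u (a + i + q))"
        using v vi i B by (simp add: evals)
    qed (use J in \<open>auto intro!: reaches_Skip reaches_Assign simp: evals frame_def J_def less_Suc_eq\<close>)
  qed (use B in \<open>auto simp: evals\<close>)
  then show ?thesis by (rule reaches_mono) (auto simp: J_def)
qed

lemma cand_com:
  assumes B: "1 < (2 :: nat) ^ w" "a + wd < 2 ^ w" "qp \<le> wd"
    and s: "var s ''a'' = a" "var s ''w'' = wd" "var s ''qp'' = qp" "arr s ''out'' = u"
  shows "reaches w \<omega> cand_com s (qp * (24 * wd + 50) + 10) (\<lambda>s'. frame {''i'', ''ok'', ''q'', ''q1'', ''b''} {} s s' \<and>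
    var s' ''b'' = bcand u a wd qp \<and> drawn s' = drawn s)"
proof -
  define J where "J k s' \<longleftrightarrow> var s' ''b'' = bcand u a wd k \<and> drawn s' = drawn s" for k and s' :: state
  define s1 where "s1 = s\<lparr>var := (var s)(''b'' := 1)\<rparr>"
  have s1: "var s1 ''a'' = a" "var s1 ''w'' = wd" "var s1 ''qp'' = qp" "arr s1 ''out'' = u" "drawn s1 = drawn s"
    using s by (simp_all add: s1_def)
  let ?body = "''q'' ::= Var ''q1'' [+] Const 1 ;; ''ok'' ::= Const 1 ;; period_com ;;
        Cond (Var ''ok'') (''b'' ::= Const 1 [-] Index ''out'' (Var ''a'' [+] Var ''w'' [-] Var ''q'')) Skip"
  have "reaches w \<omega> (For ''q1'' (Const 0) (Var ''qp'') ?body) s1 (qp * (24 * wd + 50) + 8)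
    (\<lambda>s'. frame {''i'', ''ok'', ''q'', ''q1'', ''b''} {} s1 s' \<and> J qp s' \<and> var s' ''q1'' = qp)"
  proof (rule reaches_For[where l = 0 and Tb = "24 * wd + 42"])
    show "qp < 2 ^ w" using B by simp
    show "eval w (Var ''qp'') s' = qp" if "frame {''i'', ''ok'', ''q'', ''q1'', ''b''} {} s1 s'" for s'
      using frame_var[OF that] s1 by (simp add: evals)
    show "J 0 (s1\<lparr>var := (var s1)(''q1'' := 0)\<rparr>)" using s1 by (simp add: J_def s1_def)
    show "J k (s\<lparr>var := (var s)(''q1'' := x)\<rparr>)" if "J k s" for k x and s :: state using that by (simp add: J_def)
  next
    fix k and s' :: state
    assume k: "k < qp" and f: "frame {''i'', ''ok'', ''q'', ''q1'', ''b''} {} s1 s'" and vk: "var s' ''q1'' = k" and J: "J k s'"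
    have v: "var s' ''a'' = a" "var s' ''w'' = wd" "arr s' ''out'' = u"
      using frame_var[OF f] frame_arr[OF f] s1 by simp_all
    let ?s2 = "s'\<lparr>var := (var s')(''q'' := Suc k)\<rparr>"
    let ?s3 = "?s2\<lparr>var := (var ?s2)(''ok'' := 1)\<rparr>"
    show "reaches w \<omega> ?body s' (24 * wd + 42)
      (\<lambda>s''. frame ({''i'', ''ok'', ''q'', ''q1'', ''b''} - {''q1''}) {} s' s'' \<and> J (Suc k) s'')"
    proof (rule reaches_Assign_Seq[where x = "Suc k"])
      show "eval w (Var ''q1'' [+] Const 1) s' = Suc k" using vk k B by (simp add: evals)
      show "reaches w \<omega> (''ok'' ::= Const 1 ;; period_com ;;
        Cond (Var ''ok'') (''b'' ::= Const 1 [-] Index ''out'' (Var ''a'' [+] Var ''w'' [-] Var ''q'')) Skip) ?s2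
        (24 * wd + 42 - (1 + cost (Var ''q1'' [+] Const 1)))
        (\<lambda>s''. frame ({''i'', ''ok'', ''q'', ''q1'', ''b''} - {''q1''}) {} s' s'' \<and> J (Suc k) s'')"
      proof (rule reaches_Assign_Seq[where x = 1])
        show "eval w (Const 1) ?s2 = 1" using B by (simp add: evals)
        show "reaches w \<omega> (period_com ;;
          Cond (Var ''ok'') (''b'' ::= Const 1 [-] Index ''out'' (Var ''a'' [+] Var ''w'' [-] Var ''q'')) Skip) ?s3
          (24 * wd + 42 - (1 + cost (Var ''q1'' [+] Const 1)) - (1 + cost (Const 1)))
          (\<lambda>s''. frame ({''i'', ''ok'', ''q'', ''q1'', ''b''} - {''q1''}) {} s' s'' \<and> J (Suc k) s'')"
        proof (rule reaches_SeqI[where Tb = 14])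
          show "reaches w \<omega> period_com ?s3 (24 * wd + 12) (\<lambda>s''. frame {''i'', ''ok''} {} ?s3 s'' \<and>
            var s'' ''ok'' = of_bool (\<forall>i<wd - Suc k. u (a + i) = u (a + i + Suc k)) \<and> drawn s'' = drawn ?s3)"
            by (rule period_com) (use B v in auto)
        next
          fix s4 :: state
          assume 4: "frame {''i'', ''ok''} {} ?s3 s4 \<and>
            var s4 ''ok'' = of_bool (\<forall>i<wd - Suc k. u (a + i) = u (a + i + Suc k)) \<and> drawn s4 = drawn ?s3"
          then have f4: "frame {''i'', ''ok''} {} ?s3 s4" by blast
          have v4: "var s4 ''a'' = a" "var s4 ''w'' = wd" "arr s4 ''out'' = u" "var s4 ''q'' = Suc k" "var s4 ''b'' = bcand u a wd k" "drawn s4 = drawn s"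
            using frame_var[OF f4] frame_arr[OF f4] v J 4 by (simp_all add: J_def)
          have f': "frame ({''i'', ''ok'', ''q'', ''q1'', ''b''} - {''q1''}) {} s' s4"
            using frame_var[OF f4] frame_arr[OF f4] by (auto simp: frame_def)
          show "reaches w \<omega> (Cond (Var ''ok'') (''b'' ::= Const 1 [-] Index ''out'' (Var ''a'' [+] Var ''w'' [-] Var ''q'')) Skip) s4 14
            (\<lambda>s''. frame ({''i'', ''ok'', ''q'', ''q1'', ''b''} - {''q1''}) {} s' s'' \<and> J (Suc k) s'')"
          proof (rule reaches_Cond[where T' = 10])
            show "eval w (Var ''ok'') s4 = of_bool (\<forall>i<wd - Suc k. u (a + i) = u (a + i + Suc k))"
              using 4 by (simp add: evals)
          next
            assume "of_bool (\<forall>i<wd - Suc k. u (a + i) = u (a + i + Suc k)) \<noteq> (0 :: nat)"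
            then have t: "\<forall>i<wd - Suc k. u (a + i) = u (a + i + Suc k)" by simp
            have bb: "bcand u a wd (Suc k) = 1 - u (a + wd - Suc k)"
              by (subst bcand.simps, subst if_P[OF t]) (rule refl)
            show "reaches w \<omega> (''b'' ::= Const 1 [-] Index ''out'' (Var ''a'' [+] Var ''w'' [-] Var ''q'')) s4 10
              (\<lambda>s''. frame ({''i'', ''ok'', ''q'', ''q1'', ''b''} - {''q1''}) {} s' s'' \<and> J (Suc k) s'')"
            proof (rule reaches_Assign[where x = "1 - u (a + wd - Suc k)"])
              show "eval w (Const 1 [-] Index ''out'' (Var ''a'' [+] Var ''w'' [-] Var ''q'')) s4 = 1 - u (a + wd - Suc k)"
                using v4 B by (simp add: evals)
            qed (use f' v4 bb in \<open>auto simp: frame_def J_def simp del: bcand.simps\<close>)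
          next
            assume "of_bool (\<forall>i<wd - Suc k. u (a + i) = u (a + i + Suc k)) = (0 :: nat)"
            then have t: "\<not> (\<forall>i<wd - Suc k. u (a + i) = u (a + i + Suc k))" by simp
            have bb: "bcand u a wd (Suc k) = bcand u a wd k"
              by (subst bcand.simps, subst if_not_P[OF t]) (rule refl)
            show "reaches w \<omega> Skip s4 10
              (\<lambda>s''. frame ({''i'', ''ok'', ''q'', ''q1'', ''b''} - {''q1''}) {} s' s'' \<and> J (Suc k) s'')"
              by (rule reaches_Skip) (use f' v4 bb in \<open>auto simp: J_def simp del: bcand.simps\<close>)
          qed simp
        qed simp
      qed simp
    qed simp
  qed (use B in \<open>auto simp: evals algebra_simps\<close>)
  then show ?thesis unfolding cand_com_def
    by (intro reaches_Assign_Seq[where x = 1], unfold s1_def[symmetric])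
      (use B in \<open>simp add: evals\<close>, simp, erule reaches_mono, auto simp: J_def s1_def frame_def)
qed

context ram_setup
begin

lemma two_lim: "2 < (2 :: nat) ^ w"
  by (rule lt_lim[of _ 2]) (use n2 in \<open>auto simp: power2_eq_square intro: order.trans[OF _ mult_mono[of 2 n 2 n]]\<close>)

abbreviation (input) "VI \<equiv> insert ''i'' VW"

lemma stat_com:
  assumes p: "p < n" and e: "penv y u p s" and PQ: "var s ''P'' = 0" "var s ''Q'' = 0"
  shows "reaches w \<omega> (stat_com K) s (N * (8 + time_window) + 6) (\<lambda>s'. frame VI {''A''} s s' \<and>
    var s' ''P'' = plus y L u p \<and> var s' ''Q'' = minus y L u p \<and> drawn s' = drawn s)"
proof -
  define X where "X i = (\<Sum>j\<in>win (center L p) (Rp p). summand y u p i j True)" for i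
  define Y where "Y i = (\<Sum>j\<in>win (center L p) (Rp p). summand y u p i j False)" for i
  define J where "J k s' \<longleftrightarrow> var s' ''P'' = (\<Sum>i<k. X i) \<and> var s' ''Q'' = (\<Sum>i<k. Y i) \<and> drawn s' = drawn s" for k and s' :: state
  have XY: "(\<Sum>i<k. X i) < 2 ^ w" "(\<Sum>i<k. Y i) < 2 ^ w" if "k \<le> N" for k
  proof -
    have "{..<k} \<subseteq> {..<N}" using that by auto
    from lt_lim[OF sum_summand_le[OF p this order.refl, of y u]] show "(\<Sum>i<k. X i) < 2 ^ w" "(\<Sum>i<k. Y i) < 2 ^ w"
      unfolding X_def Y_def by simp_all
  qed
  have "reaches w \<omega> (stat_com K) s (N * (8 + time_window) + 6) (\<lambda>s'. frame VI {''A''} s s' \<and> J N s' \<and> var s' ''i'' = N)"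
    unfolding stat_com_def
  proof (rule reaches_For[where l = 0 and Tb = time_window])
    show "N < 2 ^ w" using lt_lim[OF le_pow(5)] by simp
    show "eval w (Var ''N'') s' = N" if "frame VI {''A''} s s'" for s'
      using penv_frame[OF that e] by (simp add: evals penv_def env_def)
    show "J 0 (s\<lparr>var := (var s)(''i'' := 0)\<rparr>)" using PQ by (simp add: J_def)
    show "J k (s\<lparr>var := (var s)(''i'' := x)\<rparr>)" if "J k s" for k x and s :: state using that by (simp add: J_def)
  next
    fix i and s' :: state
    assume i: "i < N" and f: "frame VI {''A''} s s'" and vi: "var s' ''i'' = i" and J: "J i s'"
    have e': "penv y u p s'" by (rule penv_frame[OF f e]) auto
    have l: "var s' ''P'' + X i < 2 ^ w" "var s' ''Q'' + Y i < 2 ^ w"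
      using XY[of "Suc i"] i J by (simp_all add: J_def)
    show "reaches w \<omega> (window_com K) s' time_window (\<lambda>s''. frame (VI - {''i''}) {''A''} s' s'' \<and> J (Suc i) s'')"
      by (rule reaches_mono[OF window_com[OF p i e' vi l[unfolded X_def Y_def]]])
        (use J in \<open>auto simp: J_def X_def Y_def frame_def\<close>)
  qed (auto simp: evals)
  then show ?thesis
    by (rule reaches_mono) (auto simp: J_def plus_eq minus_eq X_def Y_def)
qed

definition time_step :: nat where
  "time_step = N * (8 + time_window) + (4 * R) * (24 * (8 * R) + 50) + 200"

abbreviation (input) "VS \<equiv> {''a'', ''w'', ''rp'', ''qp'', ''ok'', ''q'', ''q1'', ''b'', ''cc'', ''base''} \<union> VI"

lemma step_com:
  assumes p: "p < n" and e: "env y s" and vp: "var s ''p'' = p" and out: "arr s ''out'' = out"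
  shows "reaches w \<omega> (step_com K) s time_step (\<lambda>s'. frame VS {''A'', ''out''} s s' \<and>
    arr s' ''out'' = out(p := nextbit y L out p) \<and> drawn s' = drawn s)"
proof -
  have one: "1 < (2 :: nat) ^ w" using two_lim by simp
  have ev: "var s ''n'' = n" "var s ''N'' = N" "var s ''M'' = n * N" "var s ''lam'' = L" "var s ''W'' = W" "var s ''R'' = R"
    "arr s ''PW'' 0 = weight L 0"
    using e by (simp_all add: env_def)
  have p_lim: "p < 2 ^ w" by (rule lt_lim[of _ 1]) (use p in auto)
  define b where "b = cand out p"
  have b1: "b \<le> 1" unfolding b_def cand_def by (rule bcand_le_1)
  define s1 where "s1 = s\<lparr>var := (var s)(''a'' := st p)\<rparr>"
  define s2 where "s2 = s1\<lparr>var := (var s1)(''w'' := wd p)\<rparr>"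
  define s3 where "s3 = s2\<lparr>var := (var s2)(''rp'' := Rp p, ''qp'' := Qp p)\<rparr>"
  define C3 where "C3 = Cond (Var ''W'' [<] Var ''p'')
        (''rp'' ::= Var ''R'' ;; ''qp'' ::= Const 4 [*] Var ''R'')
        (''rp'' ::= Const 0 ;; ''qp'' ::= Const 0)"
  define C9 where "C9 = Cond (Const 2 [*] Var ''P'' [<] Const 2 [*] Var ''Q'' [+] Var ''M'' [*] Var ''N'' [*] Index ''PW'' (Const 0))
        (Store ''out'' (Var ''p'') (Const 1 [-] Var ''b'')) Skip"
  have R4: "4 * R < 2 ^ w" using lt_lim[of "4 * R" 1] RK by simp
  have C3: "reaches w \<omega> C3 s2 15 (\<lambda>s'. s' = s3)"
    unfolding C3_def
  proof (rule reaches_Cond[where T' = 10])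
    show "eval w (Var ''W'' [<] Var ''p'') s2 = of_bool (W < p)"
      using ev vp one by (simp add: evals s1_def s2_def)
    show "reaches w \<omega> (''rp'' ::= Var ''R'' ;; ''qp'' ::= Const 4 [*] Var ''R'') s2 10 (\<lambda>s'. s' = s3)"
      if "of_bool (W < p) \<noteq> (0 :: nat)"
    proof -
      \<comment> \<open>If the constant 4 does not fit into a word then \<open>R = 0\<close>, and
        the product is right all the same.\<close>
      have "4 < (2 :: nat) ^ w \<or> R = 0" using R4 by (cases R) auto
      then have "eval w (Const 4 [*] Var ''R'') (s2\<lparr>var := (var s2)(''rp'' := R)\<rparr>) = 4 * R"
        using R4 ev by (auto simp: evals s1_def s2_def eval.simps)
      then show ?thesis using that ev
        by (intro reaches_Assign_Seq[where x = R] reaches_Assign[where x = "4 * R"])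
          (auto simp: evals s1_def s2_def s3_def Rp_def Qp_def)
    qed
    show "reaches w \<omega> (''rp'' ::= Const 0 ;; ''qp'' ::= Const 0) s2 10 (\<lambda>s'. s' = s3)"
      if "of_bool (W < p) = (0 :: nat)"
      using that by (intro reaches_Assign_Seq[where x = 0] reaches_Assign[where x = 0])
          (auto simp: evals s1_def s2_def s3_def Rp_def Qp_def)
  qed simp
  have env3: "env y s3" by (rule env_frame[OF _ e, of "{''a'', ''w'', ''rp'', ''qp''}" "{}"]) (auto simp: frame_def s1_def s2_def s3_def)
  have T_cand: "Qp p * (24 * wd p + 50) + 10 \<le> (4 * R) * (24 * (8 * R) + 50) + 10"
    by (intro add_mono mult_mono) (auto simp: Qp_def wd_def W_def)
  show ?thesis unfolding step_com_def C3_def[symmetric] C9_def[symmetric]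
  proof (rule reaches_Assign_Seq[where x = "st p"])
    show "eval w (Var ''p'' [-] Var ''W'') s = st p"
      using vp ev p_lim by (simp add: evals st_def)
    show "reaches w \<omega> (''w'' ::= Var ''p'' [-] Var ''a'' ;; C3 ;; cand_com ;; Store ''out'' (Var ''p'') (Var ''b'') ;;
      ''cc'' ::= Var ''lam'' [*] Var ''a'' [div] Var ''M'' ;;
      ''base'' ::= Const 2 [*] (Var ''lam'' [*] Var ''a'') [+] Var ''M'' ;;
      ''P'' ::= Const 0 ;; ''Q'' ::= Const 0 ;; stat_com K ;; C9) (s\<lparr>var := (var s)(''a'' := st p)\<rparr>)
      (time_step - (1 + cost (Var ''p'' [-] Var ''W'')))
      (\<lambda>s'. frame VS {''A'', ''out''} s s' \<and> arr s' ''out'' = out(p := nextbit y L out p) \<and> drawn s' = drawn s)"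
      unfolding s1_def[symmetric]
    proof (rule reaches_Assign_Seq[where x = "wd p"])
      show "eval w (Var ''p'' [-] Var ''a'') s1 = wd p"
        using vp p_lim by (simp add: evals st_def s1_def wd_def)
      show "reaches w \<omega> (C3 ;; cand_com ;; Store ''out'' (Var ''p'') (Var ''b'') ;;
        ''cc'' ::= Var ''lam'' [*] Var ''a'' [div] Var ''M'' ;;
        ''base'' ::= Const 2 [*] (Var ''lam'' [*] Var ''a'') [+] Var ''M'' ;;
        ''P'' ::= Const 0 ;; ''Q'' ::= Const 0 ;; stat_com K ;; C9) (s1\<lparr>var := (var s1)(''w'' := wd p)\<rparr>)
        (time_step - (1 + cost (Var ''p'' [-] Var ''W'')) - (1 + cost (Var ''p'' [-] Var ''a'')))
        (\<lambda>s'. frame VS {''A'', ''out''} s s' \<and> arr s' ''out'' = out(p := nextbit y L out p) \<and> drawn s' = drawn s)"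
        unfolding s2_def[symmetric]
      proof (rule reaches_SeqI[OF C3, where Tb = "N * (8 + time_window) + (4 * R) * (24 * (8 * R) + 50) + 150"])
        fix s' assume "s' = s3"
        have "reaches w \<omega> (cand_com ;; Store ''out'' (Var ''p'') (Var ''b'') ;;
          ''cc'' ::= Var ''lam'' [*] Var ''a'' [div] Var ''M'' ;;
          ''base'' ::= Const 2 [*] (Var ''lam'' [*] Var ''a'') [+] Var ''M'' ;;
          ''P'' ::= Const 0 ;; ''Q'' ::= Const 0 ;; stat_com K ;; C9) s3
          (N * (8 + time_window) + (4 * R) * (24 * (8 * R) + 50) + 150)
          (\<lambda>s'. frame VS {''A'', ''out''} s s' \<and> arr s' ''out'' = out(p := nextbit y L out p) \<and> drawn s' = drawn s)"
        proof (rule reaches_SeqI[where Ta = "Qp p * (24 * wd p + 50) + 10" and Tb = "N * (8 + time_window) + 140"])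
          show "reaches w \<omega> cand_com s3 (Qp p * (24 * wd p + 50) + 10)
            (\<lambda>s'. frame {''i'', ''ok'', ''q'', ''q1'', ''b''} {} s3 s' \<and> var s' ''b'' = bcand out (st p) (wd p) (Qp p) \<and> drawn s' = drawn s3)"
          proof (rule cand_com[OF one])
            show "st p + wd p < 2 ^ w" using wd_st[of p] p_lim by simp
            show "Qp p \<le> wd p" by (auto simp: Qp_def wd_def W_def)
          qed (simp_all add: s3_def s2_def s1_def out)
        next
          fix s4 :: state
          assume 4: "frame {''i'', ''ok'', ''q'', ''q1'', ''b''} {} s3 s4 \<and> var s4 ''b'' = bcand out (st p) (wd p) (Qp p) \<and> drawn s4 = drawn s3"
          then have f4: "frame {''i'', ''ok'', ''q'', ''q1'', ''b''} {} s3 s4" by blast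
          have env4: "env y s4" by (rule env_frame[OF f4 env3]) auto
          have v4: "var s4 ''b'' = b" "var s4 ''p'' = p" "var s4 ''a'' = st p" "var s4 ''w'' = wd p" "var s4 ''rp'' = Rp p"
            "arr s4 ''out'' = out" "drawn s4 = drawn s"
            using 4 frame_var[OF f4] frame_arr[OF f4] vp out by (simp_all add: b_def cand_def s3_def s2_def s1_def)
          have f04: "frame VS {''A'', ''out''} s s4"
            using frame_var[OF f4] frame_arr[OF f4] by (auto simp: frame_def s1_def s2_def s3_def)
          define u where "u = out(p := b)"
          define s5 where "s5 = s4\<lparr>arr := (arr s4)(''out'' := u)\<rparr>"
          define s6 where "s6 = s5\<lparr>var := (var s5)(''cc'' := center L p)\<rparr>"
          define s7 where "s7 = s6\<lparr>var := (var s6)(''base'' := 2 * (L * st p) + n * N)\<rparr>"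
          define s8 where "s8 = s7\<lparr>var := (var s7)(''P'' := 0)\<rparr>"
          define s9 where "s9 = s8\<lparr>var := (var s8)(''Q'' := 0)\<rparr>"
          note sdefs = s5_def s6_def s7_def s8_def s9_def
          have ev4: "var s4 ''n'' = n" "var s4 ''N'' = N" "var s4 ''M'' = n * N" "var s4 ''lam'' = L"
            using env4 by (simp_all add: env_def)
          have Lst: "L * st p < 2 ^ w" "2 * (L * st p) < 2 ^ w" "2 * (L * st p) + n * N < 2 ^ w"
            using lt_lim[OF base_le[OF p]] by simp_all
          have penv9: "penv y u p s9"
          proof -
            have "env y s9" by (rule env_frame[OF _ env4, of "{''cc'', ''base'', ''P'', ''Q''}" "{''out''}"]) (auto simp: frame_def sdefs)
            then show ?thesis using v4 by (simp add: penv_def sdefs)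
          qed
          have f09: "frame VS {''A'', ''out''} s s9"
            using f04 by (auto simp: frame_def sdefs)
          have 9: "reaches w \<omega> (stat_com K ;; C9) s9 (N * (8 + time_window) + 100)
            (\<lambda>s'. frame VS {''A'', ''out''} s s' \<and> arr s' ''out'' = out(p := nextbit y L out p) \<and> drawn s' = drawn s)"
          proof (rule reaches_SeqI[OF stat_com[OF p penv9], where Tb = 90])
            show "var s9 ''P'' = 0" "var s9 ''Q'' = 0" by (simp_all add: sdefs)
          next
            fix s10 :: state
            assume 10: "frame VI {''A''} s9 s10 \<and> var s10 ''P'' = plus y L u p \<and> var s10 ''Q'' = minus y L u p \<and> drawn s10 = drawn s9"
            then have f10: "frame VI {''A''} s9 s10" by blast
            have penv10: "penv y u p s10" by (rule penv_frame[OF f10 penv9]) auto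
            have v10: "var s10 ''p'' = p" "var s10 ''b'' = b" "drawn s10 = drawn s"
              using frame_var[OF f10] 10 v4 by (simp_all add: sdefs)
            have e10: "var s10 ''M'' = n * N" "var s10 ''N'' = N" "arr s10 ''PW'' 0 = L ^ K" "arr s10 ''out'' = u"
              using penv10 by (simp_all add: penv_def env_def weight_def)
            have f010: "frame VS {''A'', ''out''} s s10" by (rule frame_trans[OF f09 f10]) auto
            have pm: "plus y L u p \<le> n ^ (4 * K + 9)" "minus y L u p \<le> n ^ (4 * K + 9)"
              unfolding plus_eq minus_eq by (rule sum_summand_le[OF p order.refl order.refl])+
            have LK: "L ^ K \<le> n ^ (3 * K)" using weight_le[of 0] by (simp add: weight_def)
            have a1: "n * N * N \<le> n ^ (2 + 1)" by (rule mult_pow_le[OF le_pow(10,5)])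
            have a2: "n * N * N * L ^ K \<le> n ^ (2 + 1 + 3 * K)" by (rule mult_pow_le[OF a1 LK])
            have a3: "2 * plus y L u p \<le> n ^ (1 + (4 * K + 9))" "2 * minus y L u p \<le> n ^ (1 + (4 * K + 9))"
              by (rule mult_pow_le, use n2 in simp, rule pm)+
            have a4: "2 * minus y L u p + n * N * N * L ^ K \<le> n ^ (1 + (4 * K + 9) + 1)"
              by (rule add_pow_le[OF a3(2)]) (rule pow_mono[OF a2], simp)
            have lims: "2 * plus y L u p < 2 ^ w" "2 * minus y L u p < 2 ^ w" "2 * minus y L u p + n * N * N * L ^ K < 2 ^ w"
              "n * N * N * L ^ K < 2 ^ w" "n * N * N < 2 ^ w"
              using lt_lim[OF a3(1)] lt_lim[OF a3(2)] lt_lim[OF a4] lt_lim[OF a2] lt_lim[OF a1] by simp_all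
            show "reaches w \<omega> C9 s10 90
              (\<lambda>s'. frame VS {''A'', ''out''} s s' \<and> arr s' ''out'' = out(p := nextbit y L out p) \<and> drawn s' = drawn s)"
              unfolding C9_def
            proof (rule reaches_Cond[where T' = 10])
              show "eval w (Const 2 [*] Var ''P'' [<] Const 2 [*] Var ''Q'' [+] Var ''M'' [*] Var ''N'' [*] Index ''PW'' (Const 0)) s10
                = of_bool (2 * plus y L u p < 2 * minus y L u p + n * N * N * L ^ K)"
                using lims two_lim 10 e10 by (simp add: evals)
            next
              assume "of_bool (2 * plus y L u p < 2 * minus y L u p + n * N * N * L ^ K) \<noteq> (0 :: nat)"
              then have nb: "nextbit y L out p = 1 - b"
                by (simp add: nextbit_def Let_def b_def[symmetric] u_def)
              have "eval w (Const 1 [-] Var ''b'') s10 = 1 - b" using one v10 by (simp add: evals)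
              then show "reaches w \<omega> (Store ''out'' (Var ''p'') (Const 1 [-] Var ''b'')) s10 10
                (\<lambda>s'. frame VS {''A'', ''out''} s s' \<and> arr s' ''out'' = out(p := nextbit y L out p) \<and> drawn s' = drawn s)"
                using f010 v10 e10 nb by (intro reaches_Store[OF refl refl]) (auto simp: evals frame_def u_def)
            next
              assume "of_bool (2 * plus y L u p < 2 * minus y L u p + n * N * N * L ^ K) = (0 :: nat)"
              then have nb: "nextbit y L out p = b"
                by (simp add: nextbit_def Let_def b_def[symmetric] u_def)
              show "reaches w \<omega> Skip s10 10
                (\<lambda>s'. frame VS {''A'', ''out''} s s' \<and> arr s' ''out'' = out(p := nextbit y L out p) \<and> drawn s' = drawn s)"
                using f010 v10 e10 nb by (intro reaches_Skip) (auto simp: u_def)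
            qed simp
          qed simp
          have s5eq: "s4\<lparr>arr := (arr s4)(''out'' := (arr s4 ''out'')(p := b))\<rparr> = s5" by (simp add: s5_def v4 u_def)
          show "reaches w \<omega> (Store ''out'' (Var ''p'') (Var ''b'') ;;
            ''cc'' ::= Var ''lam'' [*] Var ''a'' [div] Var ''M'' ;;
            ''base'' ::= Const 2 [*] (Var ''lam'' [*] Var ''a'') [+] Var ''M'' ;;
            ''P'' ::= Const 0 ;; ''Q'' ::= Const 0 ;; stat_com K ;; C9) s4 (N * (8 + time_window) + 140)
            (\<lambda>s'. frame VS {''A'', ''out''} s s' \<and> arr s' ''out'' = out(p := nextbit y L out p) \<and> drawn s' = drawn s)"
            apply (rule reaches_Store_Seq[where j = p and x = b])
               apply (simp add: evals v4)
              apply (simp add: evals v4)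
             apply simp
            unfolding s5eq
            apply (rule reaches_Assign_Seq[where x = "center L p"])
              apply (use Lst v4 ev4 in \<open>simp add: evals s5_def center_def\<close>)
             apply simp
            unfolding s6_def[symmetric]
            apply (rule reaches_Assign_Seq[where x = "2 * (L * st p) + n * N"])
              apply (use Lst v4 ev4 two_lim in \<open>simp add: evals s5_def s6_def\<close>)
             apply simp
            unfolding s7_def[symmetric]
            apply (rule reaches_Assign_Seq[where x = 0])
              apply (simp add: evals)
             apply simp
            unfolding s8_def[symmetric]
            apply (rule reaches_Assign_Seq[where x = 0])
              apply (simp add: evals)
             apply simp
            unfolding s9_def[symmetric]
            apply (rule reaches_mono[OF 9])
             apply simp
            apply blast
            done
        next
          show "Qp p * (24 * wd p + 50) + 10 + (N * (8 + time_window) + 140) \<le> N * (8 + time_window) + 4 * R * (24 * (8 * R) + 50) + 150"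
            using T_cand by linarith
        qed
        then show "reaches w \<omega> (cand_com ;; Store ''out'' (Var ''p'') (Var ''b'') ;;
          ''cc'' ::= Var ''lam'' [*] Var ''a'' [div] Var ''M'' ;;
          ''base'' ::= Const 2 [*] (Var ''lam'' [*] Var ''a'') [+] Var ''M'' ;;
          ''P'' ::= Const 0 ;; ''Q'' ::= Const 0 ;; stat_com K ;; C9) s'
          (N * (8 + time_window) + (4 * R) * (24 * (8 * R) + 50) + 150)
          (\<lambda>s'. frame VS {''A'', ''out''} s s' \<and> arr s' ''out'' = out(p := nextbit y L out p) \<and> drawn s' = drawn s)"
          unfolding \<open>s' = s3\<close> .
      qed (simp add: time_step_def)
    qed (simp add: time_step_def)
  qed (simp add: time_step_def)
qed

lemma main_com:
  assumes e: "env y s" and out: "arr s ''out'' = (\<lambda>_. 0)"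
  shows "reaches w \<omega> (main_com K) s (n * (8 + time_step) + 6) (\<lambda>s'. arr s' ''out'' = recon y L n \<and> drawn s' = drawn s)"
proof -
  define J where "J k s' \<longleftrightarrow> arr s' ''out'' = recon y L k \<and> drawn s' = drawn s" for k and s' :: state
  let ?V = "insert ''p'' VS"
  have "reaches w \<omega> (main_com K) s (n * (8 + time_step) + 6) (\<lambda>s'. frame ?V {''A'', ''out''} s s' \<and> J n s' \<and> var s' ''p'' = n)"
    unfolding main_com_def
  proof (rule reaches_For[where l = 0 and Tb = time_step])
    show "n < 2 ^ w" by (rule lt_lim[of _ 1]) auto
    show "eval w (Var ''n'') s' = n" if "frame ?V {''A'', ''out''} s s'" for s'
      using env_frame[OF that e] by (simp add: evals env_def)
    show "J 0 (s\<lparr>var := (var s)(''p'' := 0)\<rparr>)" using out by (simp add: J_def)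
    show "J k (s\<lparr>var := (var s)(''p'' := x)\<rparr>)" if "J k s" for k x and s :: state using that by (simp add: J_def)
  next
    fix p and s' :: state
    assume p: "p < n" and f: "frame ?V {''A'', ''out''} s s'" and vp: "var s' ''p'' = p" and J: "J p s'"
    have e': "env y s'" by (rule env_frame[OF f e]) auto
    have o: "arr s' ''out'' = recon y L p" using J by (simp add: J_def)
    show "reaches w \<omega> (step_com K) s' time_step (\<lambda>s''. frame (?V - {''p''}) {''A'', ''out''} s' s'' \<and> J (Suc p) s'')"
      by (rule reaches_mono[OF step_com[OF p e' vp o]]) (use J in \<open>auto simp: J_def frame_def\<close>)
  qed (auto simp: evals)
  then show ?thesis by (rule reaches_mono) (auto simp: J_def)
qed

end

subsection \<open>Initialisation\<close>

text \<open>At most one increment in each of \<open>n\<close> rounds. The search is linear in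
  \<open>n\<close>, negligible against the main loop.\<close>

definition cbrt_com :: com where
  "cbrt_com = For ''i'' (Const 0) (Var ''n'')
     (Cond ((Var ''r'' [+] Const 1) [*] (Var ''r'' [+] Const 1) [*] (Var ''r'' [+] Const 1) [<] Var ''n'' [+] Const 1)
       (''r'' ::= Var ''r'' [+] Const 1) Skip)"

definition log_com :: com where
  "log_com =
     (''x'' ::= Var ''n'' ;;
      For ''i'' (Const 0) (Var ''n'')
       (Cond (Const 0 [<] Var ''x'')
         (''x'' ::= Var ''x'' [div] Const 2 ;; ''l'' ::= Var ''l'' [+] Const 1) Skip))"

definition params_com :: com where
  "params_com =
     (''R'' ::= Var ''r'' [div] Var ''l'' ;;
      ''W'' ::= Const 8 [*] Var ''R'' ;;
      ''N'' ::= Var ''r'' [*] Var ''r'' ;;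
      ''S'' ::= Const 2 [*] Var ''n'' ;;
      ''M'' ::= Var ''n'' [*] Var ''N'' ;;
      ''M2'' ::= Const 2 [*] Var ''M'')"

text \<open>\<open>Read\<close> keeps delivering 2 after the end of a trace, so reading exactly
  \<open>2 * n\<close> symbols pads the row automatically, and \<open>lam\<close> counts the genuine
  bits.\<close>

definition read_row_com :: com where
  "read_row_com = For ''j'' (Const 0) (Var ''S'')
     (Read ''v'' ;;
      Store ''y'' (Var ''i'' [*] Var ''S'' [+] Var ''j'') (Var ''v'') ;;
      Cond (Var ''v'' [<] Const 2) (''lam'' ::= Var ''lam'' [+] Const 1) Skip)"

definition read_com :: com where
  "read_com = For ''i'' (Const 0) (Var ''N'') (Draw ;; read_row_com)"

definition weights_com :: "nat \<Rightarrow> com" where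
  "weights_com K =
     (''D'' ::= Var ''M'' [-] Var ''lam'' ;;
      For ''m'' (Const 0) (Const (Suc K))
       (''z'' ::= Const 1 ;;
        For ''i'' (Const 0) (Const K)
         (Cond (Var ''i'' [<] Var ''m'') (''z'' ::= Var ''z'' [*] Var ''D'') (''z'' ::= Var ''z'' [*] Var ''lam'')) ;;
        Store ''PW'' (Var ''m'') (Var ''z'')))"

definition long_com :: "nat \<Rightarrow> com" where
  "long_com K = (cbrt_com ;; log_com ;; params_com ;; read_com ;; weights_com K ;; main_com K)"

lemma cube_unique:
  fixes r r' n :: nat
  assumes "r ^ 3 \<le> n" "n < (r + 1) ^ 3" "r' ^ 3 \<le> n" "n < (r' + 1) ^ 3"
  shows "r = r'"
proof -
  have "r < r' + 1" "r' < r + 1"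
    using assms power_less_imp_less_base[of r 3 "r' + 1"] power_less_imp_less_base[of r' 3 "r + 1"] by simp_all
  then show ?thesis by simp
qed

lemma cbrt_com:
  assumes n2: "2 \<le> n" and w: "n ^ 7 \<le> 2 ^ w" and r: "r ^ 3 \<le> n" "n < (r + 1) ^ 3"
    and s: "var s ''n'' = n" "var s ''r'' = 0"
  shows "reaches w \<omega> cbrt_com s (n * 40 + 10) (\<lambda>s'. frame {''i'', ''r''} {} s s' \<and> var s' ''r'' = r \<and> drawn s' = drawn s)"
proof -
  \<comment> \<open>Either the root has been found, or \<open>r\<close> has grown in every round so
    far; the latter cannot last for \<open>n\<close> rounds, as \<open>n ^ 3 > n\<close>.\<close>
  define J where "J i s' \<longleftrightarrow> var s' ''r'' ^ 3 \<le> n \<and> (n < (var s' ''r'' + 1) ^ 3 \<or> var s' ''r'' = i) \<and> var s' ''r'' \<le> i \<and> drawn s' = drawn s"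
    for i and s' :: state
  have lim: "x < 2 ^ w" if "x \<le> n ^ 6" for x
  proof -
    have "n ^ 6 < n ^ 7" using n2 by (intro power_strict_increasing) auto
    then show ?thesis using that w by linarith
  qed
  have n1: "n + 1 \<le> n ^ 2"
  proof -
    have "n + 1 \<le> 2 * n" using n2 by simp
    also have "\<dots> \<le> n * n" using n2 by (intro mult_right_mono) auto
    finally show ?thesis by (simp add: power2_eq_square)
  qed
  have n16: "n ^ 2 \<le> n ^ 6" using n2 by (intro power_increasing) auto
  have cube: "(i + 1) * (i + 1) * (i + 1) \<le> n ^ 6" "(i + 1) * (i + 1) \<le> n ^ 6" "i + 1 \<le> n ^ 6" if "i < n" for i
  proof -
    have "i + 1 \<le> n ^ 2" using that n1 by simp
    then have "(i + 1) * (i + 1) * (i + 1) \<le> n ^ 2 * n ^ 2 * n ^ 2" by (intro mult_mono) auto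
    then show 1: "(i + 1) * (i + 1) * (i + 1) \<le> n ^ 6" by (simp flip: power_add)
    have "(i + 1) * (i + 1) * 1 \<le> (i + 1) * (i + 1) * (i + 1)" by (intro mult_left_mono) auto
    then show "(i + 1) * (i + 1) \<le> n ^ 6" using 1 by simp
    show "i + 1 \<le> n ^ 6" using that n1 n16 by linarith
  qed
  have one: "1 < (2 :: nat) ^ w" using lim[of "n + 1"] n1 n16 n2 by linarith
  have "reaches w \<omega> cbrt_com s (n * 40 + 10) (\<lambda>s'. frame {''i'', ''r''} {} s s' \<and> J n s' \<and> var s' ''i'' = n)"
    unfolding cbrt_com_def
  proof (rule reaches_For[where l = 0 and Tb = 30])
    show "n < 2 ^ w" using lim[of n] n1 n16 by linarith
    show "eval w (Var ''n'') s' = n" if "frame {''i'', ''r''} {} s s'" for s'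
      using frame_var[OF that] s by (simp add: evals)
    show "J 0 (s\<lparr>var := (var s)(''i'' := 0)\<rparr>)" using s by (simp add: J_def)
    show "J k (s\<lparr>var := (var s)(''i'' := x)\<rparr>)" if "J k s" for k x and s :: state using that by (simp add: J_def)
  next
    fix i and s' :: state
    assume i: "i < n" and f: "frame {''i'', ''r''} {} s s'" and vi: "var s' ''i'' = i" and J: "J i s'"
    have vn: "var s' ''n'' = n" using frame_var[OF f] s by simp
    define q where "q = var s' ''r''"
    have q: "q < n" "q \<le> i" using J i by (auto simp: J_def q_def)
    have lims: "(q + 1) * (q + 1) * (q + 1) < 2 ^ w" "(q + 1) * (q + 1) < 2 ^ w" "q + 1 < 2 ^ w" "n + 1 < 2 ^ w"
      using lim cube[OF q(1)] n1 n16 by (blast, blast, blast, auto intro: lim)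
    have c3: "(q + 1) * (q + 1) * (q + 1) = (q + 1) ^ 3" by (simp add: power3_eq_cube)
    show "reaches w \<omega> (Cond ((Var ''r'' [+] Const 1) [*] (Var ''r'' [+] Const 1) [*] (Var ''r'' [+] Const 1) [<] Var ''n'' [+] Const 1)
       (''r'' ::= Var ''r'' [+] Const 1) Skip) s' 30 (\<lambda>s''. frame ({''i'', ''r''} - {''i''}) {} s' s'' \<and> J (Suc i) s'')"
    proof (rule reaches_Cond[where T' = 5])
      show "eval w ((Var ''r'' [+] Const 1) [*] (Var ''r'' [+] Const 1) [*] (Var ''r'' [+] Const 1) [<] Var ''n'' [+] Const 1) s'
        = of_bool ((q + 1) ^ 3 \<le> n)"
        unfolding c3[symmetric] using lims one vn by (simp add: evals q_def[symmetric] less_Suc_eq_le)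
    next
      assume "of_bool ((q + 1) ^ 3 \<le> n) \<noteq> (0 :: nat)"
      then have "(q + 1) ^ 3 \<le> n" by simp
      moreover have "q = i" using calculation J by (auto simp: J_def q_def)
      ultimately show "reaches w \<omega> (''r'' ::= Var ''r'' [+] Const 1) s' 5 (\<lambda>s''. frame ({''i'', ''r''} - {''i''}) {} s' s'' \<and> J (Suc i) s'')"
        using lims one J by (intro reaches_Assign[where x = "q + 1"]) (auto simp: evals q_def J_def frame_def)
    next
      assume "of_bool ((q + 1) ^ 3 \<le> n) = (0 :: nat)"
      then have "n < (q + 1) ^ 3" by simp
      then show "reaches w \<omega> Skip s' 5 (\<lambda>s''. frame ({''i'', ''r''} - {''i''}) {} s' s'' \<and> J (Suc i) s'')"
        using J by (intro reaches_Skip) (auto simp: q_def J_def frame_def)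
    qed simp
  qed (auto simp: evals)
  then show ?thesis
  proof (rule reaches_mono[OF _ order.refl])
    fix s' assume s': "frame {''i'', ''r''} {} s s' \<and> J n s' \<and> var s' ''i'' = n"
    define q where "q = var s' ''r''"
    have "q \<noteq> n"
    proof
      assume "q = n"
      then have "n ^ 3 \<le> n" using s' by (simp add: J_def q_def)
      moreover have "n ^ 1 < n ^ 3" using n2 by (intro power_strict_increasing) auto
      ultimately show False by simp
    qed
    then have "q ^ 3 \<le> n" "n < (q + 1) ^ 3" using s' by (auto simp: J_def q_def)
    then have "q = r" using r by (rule cube_unique)
    then show "frame {''i'', ''r''} {} s s' \<and> var s' ''r'' = r \<and> drawn s' = drawn s" using s' by (simp add: J_def q_def)
  qed
qed

lemma log_com:
  assumes n2: "2 \<le> n" and w: "n < 2 ^ w" and s: "var s ''n'' = n" "var s ''l'' = 0"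
  shows "reaches w \<omega> log_com s (n * 40 + 20) (\<lambda>s'. frame {''i'', ''x'', ''l''} {} s s' \<and> var s' ''l'' = floorlog 2 n \<and> drawn s' = drawn s)"
proof -
  \<comment> \<open>Halving a positive \<open>x\<close> lowers it by at least 1, so
    \<open>x + i \<le> n\<close> persists until \<open>x\<close> is 0, and \<open>n\<close> rounds
    are enough.\<close>
  define J where "J i s' \<longleftrightarrow> floorlog 2 n = var s' ''l'' + floorlog 2 (var s' ''x'') \<and> (var s' ''x'' = 0 \<or> var s' ''x'' + i \<le> n) \<and>
      var s' ''x'' \<le> n \<and> var s' ''l'' \<le> i \<and> drawn s' = drawn s" for i and s' :: state
  have two: "2 < (2 :: nat) ^ w \<or> w = 1"
    using n2 w by (cases w) (auto simp: not_less numeral_2_eq_2)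
  define s1 where "s1 = s\<lparr>var := (var s)(''x'' := n)\<rparr>"
  have "(2 :: nat) < 2 ^ w" using n2 w by linarith
  have "reaches w \<omega> (For ''i'' (Const 0) (Var ''n'')
       (Cond (Const 0 [<] Var ''x'')
         (''x'' ::= Var ''x'' [div] Const 2 ;; ''l'' ::= Var ''l'' [+] Const 1) Skip)) s1 (n * 40 + 10)
    (\<lambda>s'. frame {''i'', ''x'', ''l''} {} s1 s' \<and> J n s' \<and> var s' ''i'' = n)"
  proof (rule reaches_For[where l = 0 and Tb = 30])
    show "n < 2 ^ w" by (rule w)
    show "eval w (Var ''n'') s' = n" if "frame {''i'', ''x'', ''l''} {} s1 s'" for s'
      using frame_var[OF that] s by (simp add: evals s1_def)
    show "J 0 (s1\<lparr>var := (var s1)(''i'' := 0)\<rparr>)" using s by (simp add: J_def s1_def)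
    show "J k (s\<lparr>var := (var s)(''i'' := x)\<rparr>)" if "J k s" for k x and s :: state using that by (simp add: J_def)
  next
    fix i and s' :: state
    assume i: "i < n" and f: "frame {''i'', ''x'', ''l''} {} s1 s'" and vi: "var s' ''i'' = i" and J: "J i s'"
    define x where "x = var s' ''x''"
    have lx: "var s' ''l'' + 1 < 2 ^ w" "x < 2 ^ w" using J i w by (auto simp: J_def x_def)
    show "reaches w \<omega> (Cond (Const 0 [<] Var ''x'')
         (''x'' ::= Var ''x'' [div] Const 2 ;; ''l'' ::= Var ''l'' [+] Const 1) Skip) s' 30
      (\<lambda>s''. frame ({''i'', ''x'', ''l''} - {''i''}) {} s' s'' \<and> J (Suc i) s'')"
    proof (rule reaches_Cond[where T' = 20])
      show "eval w (Const 0 [<] Var ''x'') s' = of_bool (0 < x)" using \<open>2 < 2 ^ w\<close> by (simp add: evals x_def)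
    next
      assume "of_bool (0 < x) \<noteq> (0 :: nat)"
      then have x: "0 < x" by simp
      have fl: "floorlog 2 x = floorlog 2 (x div 2) + 1" using x by (subst compute_floorlog) simp
      let ?s = "s'\<lparr>var := (var s')(''x'' := x div 2)\<rparr>"
      have "J (Suc i) (?s\<lparr>var := (var ?s)(''l'' := var s' ''l'' + 1)\<rparr>)"
        using J x fl by (auto simp: J_def x_def[symmetric])
      then show "reaches w \<omega> (''x'' ::= Var ''x'' [div] Const 2 ;; ''l'' ::= Var ''l'' [+] Const 1) s' 20
        (\<lambda>s''. frame ({''i'', ''x'', ''l''} - {''i''}) {} s' s'' \<and> J (Suc i) s'')"
        using lx \<open>2 < 2 ^ w\<close>
        by (intro reaches_Assign_Seq[where x = "x div 2"] reaches_Assign[where x = "var s' ''l'' + 1"])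
          (auto simp: evals x_def[symmetric] frame_def)
    next
      assume "of_bool (0 < x) = (0 :: nat)"
      then show "reaches w \<omega> Skip s' 20 (\<lambda>s''. frame ({''i'', ''x'', ''l''} - {''i''}) {} s' s'' \<and> J (Suc i) s'')"
        using J by (intro reaches_Skip) (auto simp: J_def x_def[symmetric] frame_def)
    qed simp
  qed (use n2 in \<open>auto simp: evals\<close>)
  moreover have "frame {''i'', ''x'', ''l''} {} s s' \<and> var s' ''l'' = floorlog 2 n \<and> drawn s' = drawn s"
    if "frame {''i'', ''x'', ''l''} {} s1 s' \<and> J n s' \<and> var s' ''i'' = n" for s'
    using that by (auto simp: J_def frame_def s1_def floorlog_def)
  ultimately show ?thesis unfolding log_com_def
    by (intro reaches_Assign_Seq[where x = n], unfold s1_def[symmetric])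
      (use s in \<open>simp add: evals\<close>, simp, erule reaches_mono, simp, blast)
qed

lemma params_com:
  assumes n2: "2 \<le> n" and w: "n ^ 7 \<le> 2 ^ w" and r: "r ^ 3 \<le> n"
    and s: "var s ''n'' = n" "var s ''r'' = r" "var s ''l'' = l" and R: "8 * (r div l) \<le> n"
  shows "reaches w \<omega> params_com s 60 (\<lambda>s'. frame {''R'', ''W'', ''N'', ''S'', ''M'', ''M2''} {} s s' \<and>
    var s' ''R'' = r div l \<and> var s' ''W'' = 8 * (r div l) \<and> var s' ''N'' = r ^ 2 \<and> var s' ''S'' = 2 * n \<and>
    var s' ''M'' = n * r ^ 2 \<and> var s' ''M2'' = 2 * (n * r ^ 2) \<and> drawn s' = drawn s)"
proof -
  have lim: "x < 2 ^ w" if "x \<le> n ^ 6" for x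
  proof -
    have "n ^ 6 < n ^ 7" using n2 by (intro power_strict_increasing) auto
    then show ?thesis using that w by linarith
  qed
  have n1: "n ^ 1 \<le> n ^ 6" "n ^ 2 \<le> n ^ 6" "n ^ 3 \<le> n ^ 6" using n2 by (intro power_increasing; auto)+
  have n8: "(2 :: nat) ^ 4 \<le> n ^ 4" using n2 by (intro power_mono) auto
  have "n ^ 4 \<le> n ^ 6" using n2 by (intro power_increasing) auto
  then have eight: "8 < (2 :: nat) ^ w" using lim[of 16] n8 by simp
  have r2: "r ^ 2 \<le> n"
  proof (cases "r = 0")
    case False
    then have "r ^ 2 \<le> r ^ 3" by (intro power_increasing) auto
    then show ?thesis using r by simp
  qed simp
  have rn: "r \<le> n"
  proof (cases "r = 0")
    case False
    then have "r ^ 1 \<le> r ^ 3" by (intro power_increasing) auto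
    then show ?thesis using r by simp
  qed simp
  have M2: "2 * (n * r ^ 2) \<le> n ^ 3"
  proof -
    have "2 * (n * r ^ 2) \<le> n * (n * n)" using n2 r2 by (intro mult_mono) auto
    then show ?thesis by (simp add: power3_eq_cube)
  qed
  have lims: "r < 2 ^ w" "8 * (r div l) < 2 ^ w" "r * r < 2 ^ w" "2 * n < 2 ^ w" "n * (r * r) < 2 ^ w" "2 * (n * (r * r)) < 2 ^ w"
  proof -
    show "r < 2 ^ w" "8 * (r div l) < 2 ^ w" "r * r < 2 ^ w"
      using rn R r2 n1(1) by (auto intro!: lim simp: power2_eq_square)
    have "2 * n \<le> n ^ 2" using n2 by (simp add: power2_eq_square)
    then show "2 * n < 2 ^ w" using n1 by (intro lim) simp
    show "n * (r * r) < 2 ^ w" "2 * (n * (r * r)) < 2 ^ w"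
      using M2 n1 by (auto intro!: lim simp: power2_eq_square)
  qed
  show ?thesis unfolding params_com_def
    apply (rule reaches_Assign_Seq[where x = "r div l"])
      apply (use s lims in \<open>simp add: evals\<close>)
     apply simp
    apply (rule reaches_Assign_Seq[where x = "8 * (r div l)"])
      apply (use s lims eight in \<open>simp add: evals\<close>)
     apply simp
    apply (rule reaches_Assign_Seq[where x = "r * r"])
      apply (use s lims in \<open>simp add: evals\<close>)
     apply simp
    apply (rule reaches_Assign_Seq[where x = "2 * n"])
      apply (use s lims eight in \<open>simp add: evals\<close>)
     apply simp
    apply (rule reaches_Assign_Seq[where x = "n * (r * r)"])
      apply (use s lims in \<open>simp add: evals\<close>)
     apply simp
    apply (rule reaches_Assign[where x = "2 * (n * (r * r))"])
      apply (use s lims eight in \<open>simp add: evals\<close>)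
     apply simp
    apply (simp add: frame_def power2_eq_square)
    done
qed

section \<open>Reading the traces into memory\<close>

context reconstruct
begin

lemma read_row_com:
  assumes n2: "2 \<le> n" and NN: "N \<le> n" and w: "n ^ 7 \<le> 2 ^ w" and i: "i < N" and L0: "L0 \<le> i * (2 * n)"
    and s: "var s ''i'' = i" "var s ''S'' = 2 * n" "rest s = \<omega> i" "var s ''lam'' = L0" "arr s ''y'' = y0"
  shows "reaches w \<omega> read_row_com s (60 * n + 10) (\<lambda>s'. frame {''j'', ''v'', ''lam''} {''y''} s s' \<and>
    arr s' ''y'' = (\<lambda>q. if i * (2 * n) \<le> q \<and> q < i * (2 * n) + 2 * n then mem \<omega> q else y0 q) \<and>
    var s' ''lam'' = L0 + min (2 * n) (length (\<omega> i)) \<and> drawn s' = drawn s)"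
proof -
  define J where "J j s' \<longleftrightarrow> rest s' = drop j (\<omega> i) \<and>
    arr s' ''y'' = (\<lambda>q. if i * (2 * n) \<le> q \<and> q < i * (2 * n) + j then mem \<omega> q else y0 q) \<and>
    var s' ''lam'' = L0 + min j (length (\<omega> i)) \<and> drawn s' = drawn s" for j and s' :: state
  have N3: "(i + 1) * (2 * n) + 2 < 2 ^ w"
  proof -
    have "(i + 1) * (2 * n) \<le> n * (n * n)" using i NN n2 by (intro mult_mono) auto
    moreover have "(2::nat) \<le> n ^ 3"
    proof -
      have "(2::nat) \<le> n ^ 1" using n2 by simp
      also have "\<dots> \<le> n ^ 3" using n2 by (intro power_increasing) auto
      finally show ?thesis .
    qed
    ultimately have "(i + 1) * (2 * n) + 2 \<le> 2 * n ^ 3" by (simp add: power3_eq_cube)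
    also have "\<dots> \<le> n * n ^ 3" using n2 by (intro mult_right_mono) auto
    also have "\<dots> = n ^ 4" by (simp add: power_Suc[symmetric] del: power_Suc)
    also have "\<dots> < n ^ 7" using n2 by (intro power_strict_increasing) auto
    finally show ?thesis using w by linarith
  qed
  then have two: "2 < (2 :: nat) ^ w" by linarith
  have "reaches w \<omega> read_row_com s (60 * n + 10)
    (\<lambda>s'. frame {''j'', ''v'', ''lam''} {''y''} s s' \<and> J (2 * n) s' \<and> var s' ''j'' = 2 * n)"
    unfolding read_row_com_def
  proof (rule reaches_For[where l = 0 and Tb = 20])
    show "2 * n < 2 ^ w" using N3 by simp
    show "eval w (Var ''S'') s' = 2 * n" if "frame {''j'', ''v'', ''lam''} {''y''} s s'" for s'
      using frame_var[OF that] s by (simp add: evals)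
    show "J 0 (s\<lparr>var := (var s)(''j'' := 0)\<rparr>)" using s by (auto simp: J_def)
    show "J k (s\<lparr>var := (var s)(''j'' := x)\<rparr>)" if "J k s" for k x and s :: state using that by (simp add: J_def)
  next
    fix j and s' :: state
    assume j: "j < 2 * n" and f: "frame {''j'', ''v'', ''lam''} {''y''} s s'" and vj: "var s' ''j'' = j" and J: "J j s'"
    have vi: "var s' ''i'' = i" "var s' ''S'' = 2 * n" using frame_var[OF f] s by simp_all
    define c where "c = mem \<omega> (i * (2 * n) + j)"
    have idx: "i * (2 * n) + j < 2 ^ w" "i * (2 * n) < 2 ^ w" using N3 j by simp_all
    have c: "c = (if j < length (\<omega> i) then of_bool (\<omega> i ! j) else 2)"
    proof -
      have e: "i * (2 * n) + j = j + (2 * n) * i" by simp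
      have "(i * (2 * n) + j) div (2 * n) = i" "(i * (2 * n) + j) mod (2 * n) = j"
        unfolding e using j by auto
      moreover have "i * (2 * n) + j < N * (2 * n)"
      proof -
        have "(i + 1) * (2 * n) \<le> N * (2 * n)" using i by (intro mult_right_mono) auto
        then show ?thesis using j by simp
      qed
      ultimately show ?thesis by (auto simp: c_def mem_def Let_def)
    qed
    have rc: "(case rest s' of [] \<Rightarrow> 2 | b # bs \<Rightarrow> of_bool b) = c" "tl (rest s') = drop (Suc j) (\<omega> i)"
    proof -
      have r: "rest s' = drop j (\<omega> i)" using J by (simp add: J_def)
      show "(case rest s' of [] \<Rightarrow> 2 | b # bs \<Rightarrow> of_bool b) = c"
        unfolding r c by (cases "j < length (\<omega> i)") (auto simp flip: Cons_nth_drop_Suc)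
      show "tl (rest s') = drop (Suc j) (\<omega> i)" unfolding r by (simp add: drop_Suc tl_drop)
    qed
    have cl: "c < 2 \<longleftrightarrow> j < length (\<omega> i)" unfolding c by (auto simp: of_bool_def)
    let ?s1 = "s'\<lparr>var := (var s')(''v'' := c), rest := drop (Suc j) (\<omega> i)\<rparr>"
    let ?s2 = "?s1\<lparr>arr := (arr ?s1)(''y'' := (arr ?s1 ''y'')(i * (2 * n) + j := c))\<rparr>"
    have y2: "(arr ?s1 ''y'')(i * (2 * n) + j := c)
       = (\<lambda>q. if i * (2 * n) \<le> q \<and> q < i * (2 * n) + Suc j then mem \<omega> q else y0 q)"
      using J by (auto simp: J_def c_def fun_eq_iff less_Suc_eq)
    have lam: "var s' ''lam'' = L0 + min j (length (\<omega> i))" using J by (simp add: J_def)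
    have lam_lim: "L0 + min j (length (\<omega> i)) + 1 < 2 ^ w" using N3 L0 j by (simp add: min_def split: if_splits)
    show "reaches w \<omega> (Read ''v'' ;;
      Store ''y'' (Var ''i'' [*] Var ''S'' [+] Var ''j'') (Var ''v'') ;;
      Cond (Var ''v'' [<] Const 2) (''lam'' ::= Var ''lam'' [+] Const 1) Skip) s' 20
      (\<lambda>s''. frame ({''j'', ''v'', ''lam''} - {''j''}) {''y''} s' s'' \<and> J (Suc j) s'')"
    proof (rule reaches_Seq[where Ta = 1 and Tb = 19], rule reaches_Read)
      show "reaches w \<omega> (Store ''y'' (Var ''i'' [*] Var ''S'' [+] Var ''j'') (Var ''v'') ;;
        Cond (Var ''v'' [<] Const 2) (''lam'' ::= Var ''lam'' [+] Const 1) Skip)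
        (s'\<lparr>var := (var s')(''v'' := case rest s' of [] \<Rightarrow> 2 | b # bs \<Rightarrow> of_bool b), rest := tl (rest s')\<rparr>) 19
        (\<lambda>s''. frame ({''j'', ''v'', ''lam''} - {''j''}) {''y''} s' s'' \<and> J (Suc j) s'')"
        unfolding rc
      proof (rule reaches_Store_Seq[where j = "i * (2 * n) + j" and x = c])
        show "eval w (Var ''i'' [*] Var ''S'' [+] Var ''j'') ?s1 = i * (2 * n) + j"
          using vi vj idx by (simp add: evals)
        show "eval w (Var ''v'') ?s1 = c" by (simp add: evals)
        show "reaches w \<omega> (Cond (Var ''v'' [<] Const 2) (''lam'' ::= Var ''lam'' [+] Const 1) Skip) ?s2
          (19 - (1 + cost (Var ''i'' [*] Var ''S'' [+] Var ''j'') + cost (Var ''v'')))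
          (\<lambda>s''. frame ({''j'', ''v'', ''lam''} - {''j''}) {''y''} s' s'' \<and> J (Suc j) s'')"
        proof (rule reaches_Cond[where T' = 4])
          show "eval w (Var ''v'' [<] Const 2) ?s2 = of_bool (j < length (\<omega> i))"
            using two cl by (simp add: evals)
        next
          assume "of_bool (j < length (\<omega> i)) \<noteq> (0 :: nat)"
          then have "min (Suc j) (length (\<omega> i)) = min j (length (\<omega> i)) + 1" by simp
          then show "reaches w \<omega> (''lam'' ::= Var ''lam'' [+] Const 1) ?s2 4
            (\<lambda>s''. frame ({''j'', ''v'', ''lam''} - {''j''}) {''y''} s' s'' \<and> J (Suc j) s'')"
            using lam lam_lim two y2 J
            by (intro reaches_Assign[where x = "L0 + min j (length (\<omega> i)) + 1"]) (auto simp: evals frame_def J_def)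
        next
          assume "of_bool (j < length (\<omega> i)) = (0 :: nat)"
          then have "min (Suc j) (length (\<omega> i)) = min j (length (\<omega> i))" by simp
          then show "reaches w \<omega> Skip ?s2 4
            (\<lambda>s''. frame ({''j'', ''v'', ''lam''} - {''j''}) {''y''} s' s'' \<and> J (Suc j) s'')"
            using lam y2 J by (intro reaches_Skip) (auto simp: frame_def J_def)
        qed simp
      qed simp
    qed simp_all
  qed (auto simp: evals)
  then show ?thesis by (rule reaches_mono) (auto simp: J_def)
qed

lemma read_com:
  assumes n2: "2 \<le> n" and NN: "N \<le> n" and w: "n ^ 7 \<le> 2 ^ w"
    and s: "var s ''N'' = N" "var s ''S'' = 2 * n" "var s ''lam'' = 0" "arr s ''y'' = (\<lambda>_. 0)" "drawn s = 0"
  shows "reaches w \<omega> read_com s (N * (60 * n + 20) + 10) (\<lambda>s'. frame {''i'', ''j'', ''v'', ''lam''} {''y''} s s' \<and>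
    arr s' ''y'' = mem \<omega> \<and> var s' ''lam'' = total \<omega> \<and> drawn s' = N)"
proof -
  define J where "J i s' \<longleftrightarrow> arr s' ''y'' = (\<lambda>q. if q < i * (2 * n) then mem \<omega> q else 0) \<and>
    var s' ''lam'' = (\<Sum>i'<i. min (2 * n) (length (\<omega> i'))) \<and> drawn s' = i" for i and s' :: state
  have nw: "n < 2 ^ w"
  proof -
    have "n ^ 1 < n ^ 7" using n2 by (intro power_strict_increasing) auto
    then show ?thesis using w by simp
  qed
  have "reaches w \<omega> read_com s (N * (60 * n + 20) + 10)
    (\<lambda>s'. frame {''i'', ''j'', ''v'', ''lam''} {''y''} s s' \<and> J N s' \<and> var s' ''i'' = N)"
    unfolding read_com_def
  proof (rule reaches_For[where l = 0 and Tb = "60 * n + 11"])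
    show "N < 2 ^ w" using nw NN by simp
    show "eval w (Var ''N'') s' = N" if "frame {''i'', ''j'', ''v'', ''lam''} {''y''} s s'" for s'
      using frame_var[OF that] s by (simp add: evals)
    show "J 0 (s\<lparr>var := (var s)(''i'' := 0)\<rparr>)" using s by (simp add: J_def)
    show "J k (s\<lparr>var := (var s)(''i'' := x)\<rparr>)" if "J k s" for k x and s :: state using that by (simp add: J_def)
  next
    fix i and s' :: state
    assume i: "i < N" and f: "frame {''i'', ''j'', ''v'', ''lam''} {''y''} s s'" and vi: "var s' ''i'' = i" and J: "J i s'"
    let ?s = "s'\<lparr>rest := \<omega> (drawn s'), drawn := Suc (drawn s')\<rparr>"
    have dr: "drawn s' = i" using J by (simp add: J_def)
    have Lb: "(\<Sum>i'<i. min (2 * n) (length (\<omega> i'))) \<le> i * (2 * n)"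
      using sum_bounded_above[of "{..<i}" "\<lambda>i'. min (2 * n) (length (\<omega> i'))" "2 * n"] by simp
    show "reaches w \<omega> (Draw ;; read_row_com) s' (60 * n + 11)
      (\<lambda>s''. frame ({''i'', ''j'', ''v'', ''lam''} - {''i''}) {''y''} s' s'' \<and> J (Suc i) s'')"
    proof (rule reaches_Seq[where Ta = 1 and Tb = "60 * n + 10"], rule reaches_Draw)
      have "reaches w \<omega> read_row_com ?s (60 * n + 10) (\<lambda>s''. frame {''j'', ''v'', ''lam''} {''y''} ?s s'' \<and>
        arr s'' ''y'' = (\<lambda>q. if i * (2 * n) \<le> q \<and> q < i * (2 * n) + 2 * n then mem \<omega> q else (if q < i * (2 * n) then mem \<omega> q else 0)) \<and>
        var s'' ''lam'' = (\<Sum>i'<i. min (2 * n) (length (\<omega> i'))) + min (2 * n) (length (\<omega> i)) \<and> drawn s'' = drawn ?s)"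
        by (rule read_row_com[OF n2 NN w i Lb]) (use vi J frame_var[OF f] s dr in \<open>auto simp: J_def\<close>)
      then show "reaches w \<omega> read_row_com ?s (60 * n + 10)
        (\<lambda>s''. frame ({''i'', ''j'', ''v'', ''lam''} - {''i''}) {''y''} s' s'' \<and> J (Suc i) s'')"
        by (rule reaches_mono) (auto simp: J_def dr frame_def fun_eq_iff)
    qed simp_all
  qed (auto simp: evals algebra_simps)
  then show ?thesis
    by (rule reaches_mono) (auto simp: J_def total_def mem_def fun_eq_iff)
qed

end

context ram_setup
begin

lemma pow_le_weight:
  assumes "a + b \<le> K"
  shows "(n * N - L) ^ a * L ^ b \<le> n ^ (3 * K)"
proof -
  have "n * N - L \<le> n ^ 3" using pow_mono[OF le_pow(10), of 3] by simp
  then have "(n * N - L) ^ a * L ^ b \<le> (n ^ 3) ^ a * (n ^ 3) ^ b"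
    using le_pow(9) by (intro mult_mono power_mono) auto
  also have "\<dots> = n ^ (3 * (a + b))" by (simp add: power_mult power_add)
  also have "\<dots> \<le> n ^ (3 * K)" using assms n2 by (intro power_increasing) auto
  finally show ?thesis .
qed

lemma weights_com:
  assumes s: "var s ''M'' = n * N" "var s ''lam'' = L"
  shows "reaches w \<omega> (weights_com K) s ((K + 1) * (K * 30 + 40) + 30) (\<lambda>s'. frame {''i'', ''m'', ''z'', ''D''} {''PW''} s s' \<and>
    (\<forall>m\<le>K. arr s' ''PW'' m = weight L m) \<and> drawn s' = drawn s)"
proof -
  define D where "D = n * N - L"
  define s1 where "s1 = s\<lparr>var := (var s)(''D'' := D)\<rparr>"
  define J where "J m s' \<longleftrightarrow> (\<forall>m'<m. arr s' ''PW'' m' = weight L m') \<and> drawn s' = drawn s" for m and s' :: state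
  let ?inner = "For ''i'' (Const 0) (Const K)
         (Cond (Var ''i'' [<] Var ''m'') (''z'' ::= Var ''z'' [*] Var ''D'') (''z'' ::= Var ''z'' [*] Var ''lam''))"
  have one: "1 < (2 :: nat) ^ w" by (rule lt_lim[of _ 1]) (use n2 in auto)
  have Kw: "Suc K < 2 ^ w" using lt_lim[OF le_pow(2)] by simp
  have Mw: "n * N < 2 ^ w" using lt_lim[OF le_pow(10)] by simp
  have "reaches w \<omega> (For ''m'' (Const 0) (Const (Suc K)) (''z'' ::= Const 1 ;; ?inner ;; Store ''PW'' (Var ''m'') (Var ''z''))) s1
    ((K + 1) * (K * 30 + 40) + 20) (\<lambda>s'. frame {''i'', ''m'', ''z''} {''PW''} s1 s' \<and> J (Suc K) s' \<and> var s' ''m'' = Suc K)"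
  proof (rule reaches_For[where l = 0 and Tb = "K * 30 + 20"])
    show "J 0 (s1\<lparr>var := (var s1)(''m'' := 0)\<rparr>)" by (simp add: J_def s1_def)
    show "J k (s\<lparr>var := (var s)(''m'' := x)\<rparr>)" if "J k s" for k x and s :: state using that by (simp add: J_def)
  next
    fix m and s' :: state
    assume m: "m < Suc K" and f: "frame {''i'', ''m'', ''z''} {''PW''} s1 s'" and vm: "var s' ''m'' = m" and J: "J m s'"
    have v: "var s' ''D'' = D" "var s' ''lam'' = L" using frame_var[OF f] s by (simp_all add: s1_def)
    define s2 where "s2 = s'\<lparr>var := (var s')(''z'' := 1)\<rparr>"
    \<comment> \<open>The first \<open>m\<close> of the \<open>K\<close> rounds multiply by
      \<open>D\<close>, the others by \<open>L\<close>; truncated subtraction covers both phases in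
      one formula.\<close>
    define I where "I i s'' \<longleftrightarrow> var s'' ''z'' = D ^ min i m * L ^ (i - m) \<and> drawn s'' = drawn s" for i and s'' :: state
    have "reaches w \<omega> ?inner s2 (K * 30 + 10) (\<lambda>s''. frame {''i'', ''z''} {} s2 s'' \<and> I K s'' \<and> var s'' ''i'' = K)"
    proof (rule reaches_For[where l = 0 and Tb = 20])
      show "I 0 (s2\<lparr>var := (var s2)(''i'' := 0)\<rparr>)" using J by (simp add: I_def s2_def J_def)
      show "I k (s\<lparr>var := (var s)(''i'' := x)\<rparr>)" if "I k s" for k x and s :: state using that by (simp add: I_def)
    next
      fix i and s3 :: state
      assume i: "i < K" and f3: "frame {''i'', ''z''} {} s2 s3" and vi: "var s3 ''i'' = i" and I: "I i s3"
      have v3: "var s3 ''D'' = D" "var s3 ''lam'' = L" "var s3 ''m'' = m" using frame_var[OF f3] v vm by (simp_all add: s2_def)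
      have lim: "D ^ min (Suc i) m * L ^ (Suc i - m) < 2 ^ w"
        unfolding D_def by (rule lt_lim[OF pow_le_weight]) (use i in auto)
      show "reaches w \<omega> (Cond (Var ''i'' [<] Var ''m'') (''z'' ::= Var ''z'' [*] Var ''D'') (''z'' ::= Var ''z'' [*] Var ''lam'')) s3 20
        (\<lambda>s''. frame ({''i'', ''z''} - {''i''}) {} s3 s'' \<and> I (Suc i) s'')"
      proof (rule reaches_Cond[where T' = 10])
        show "eval w (Var ''i'' [<] Var ''m'') s3 = of_bool (i < m)" using vi v3 one by (simp add: evals)
      next
        assume "of_bool (i < m) \<noteq> (0 :: nat)"
        then have im: "i < m" by simp
        then have e: "D ^ min i m * L ^ (i - m) * D = D ^ min (Suc i) m * L ^ (Suc i - m)" by (simp add: min_def)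
        show "reaches w \<omega> (''z'' ::= Var ''z'' [*] Var ''D'') s3 10 (\<lambda>s''. frame ({''i'', ''z''} - {''i''}) {} s3 s'' \<and> I (Suc i) s'')"
        proof (rule reaches_Assign[where x = "D ^ min (Suc i) m * L ^ (Suc i - m)"])
          have "eval w (Var ''z'' [*] Var ''D'') s3 = eval w (Var ''z'') s3 * eval w (Var ''D'') s3"
            by (rule eval_Mul) (use I v3 lim e in \<open>simp add: I_def eval_Var\<close>)
          then show "eval w (Var ''z'' [*] Var ''D'') s3 = D ^ min (Suc i) m * L ^ (Suc i - m)"
            using I v3 e by (simp add: I_def eval_Var)
        qed (use I in \<open>auto simp: frame_def I_def\<close>)
      next
        assume "of_bool (i < m) = (0 :: nat)"
        then have im: "m \<le> i" by simp
        then have e: "D ^ min i m * L ^ (i - m) * L = D ^ min (Suc i) m * L ^ (Suc i - m)"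
          by (simp add: min_def Suc_diff_le)
        show "reaches w \<omega> (''z'' ::= Var ''z'' [*] Var ''lam'') s3 10 (\<lambda>s''. frame ({''i'', ''z''} - {''i''}) {} s3 s'' \<and> I (Suc i) s'')"
        proof (rule reaches_Assign[where x = "D ^ min (Suc i) m * L ^ (Suc i - m)"])
          have "eval w (Var ''z'' [*] Var ''lam'') s3 = eval w (Var ''z'') s3 * eval w (Var ''lam'') s3"
            by (rule eval_Mul) (use I v3 lim e in \<open>simp add: I_def eval_Var\<close>)
          then show "eval w (Var ''z'' [*] Var ''lam'') s3 = D ^ min (Suc i) m * L ^ (Suc i - m)"
            using I v3 e by (simp add: I_def eval_Var)
        qed (use I in \<open>auto simp: frame_def I_def\<close>)
      qed simp
    qed (use Kw in \<open>auto simp: evals\<close>)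
    then have inner: "reaches w \<omega> ?inner s2 (K * 30 + 10) (\<lambda>s''. frame {''i'', ''z''} {} s2 s'' \<and> I K s'')"
      by (rule reaches_mono) auto
    have "reaches w \<omega> (?inner ;; Store ''PW'' (Var ''m'') (Var ''z'')) s2 (K * 30 + 18)
      (\<lambda>s''. frame ({''i'', ''m'', ''z''} - {''m''}) {''PW''} s' s'' \<and> J (Suc m) s'')"
    proof (rule reaches_SeqI[OF inner, where Tb = 5])
      fix s3 :: state
      assume 3: "frame {''i'', ''z''} {} s2 s3 \<and> I K s3"
      then have f3: "frame {''i'', ''z''} {} s2 s3" by blast
      have "min K m = m" using m by simp
      then have z: "var s3 ''z'' = weight L m" using 3 by (simp add: I_def weight_def D_def)
      have "var s3 ''m'' = m" "arr s3 ''PW'' = arr s' ''PW''" using frame_var[OF f3] frame_arr[OF f3] vm by (simp_all add: s2_def)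
      then show "reaches w \<omega> (Store ''PW'' (Var ''m'') (Var ''z'')) s3 5
        (\<lambda>s''. frame ({''i'', ''m'', ''z''} - {''m''}) {''PW''} s' s'' \<and> J (Suc m) s'')"
        using z J 3 f3 by (intro reaches_Store[where j = m and x = "weight L m"])
          (auto simp: evals J_def I_def frame_def s2_def less_Suc_eq)
    qed simp
    then show "reaches w \<omega> (''z'' ::= Const 1 ;; ?inner ;; Store ''PW'' (Var ''m'') (Var ''z'')) s' (K * 30 + 20)
      (\<lambda>s''. frame ({''i'', ''m'', ''z''} - {''m''}) {''PW''} s' s'' \<and> J (Suc m) s'')"
      by (intro reaches_Assign_Seq[where x = 1], unfold s2_def[symmetric])
        (use one in \<open>simp add: evals\<close>, simp, erule reaches_mono, simp, blast)
  qed (use Kw in \<open>auto simp: evals algebra_simps\<close>)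
  then show ?thesis unfolding weights_com_def
    by (intro reaches_Assign_Seq[where x = D], unfold s1_def[symmetric])
      (use s Mw in \<open>simp add: evals D_def\<close>, simp, erule reaches_mono, auto simp: J_def s1_def frame_def)
qed

text \<open>Nested like the sequence in \<open>long_com\<close>, so that each application of
  \<open>reaches_SeqI\<close> splits the time bound literally.\<close>

definition time_long :: nat where
  "time_long = (n * 40 + 10) + ((n * 40 + 20) + (60 + ((N * (60 * n + 20) + 10)
     + (((K + 1) * (K * 30 + 40) + 30) + (n * (8 + time_step) + 6)))))"

lemma long_com:
  assumes r: "r ^ 3 \<le> n" "n < (r + 1) ^ 3" and NR: "N = r ^ 2" "R = r div floorlog 2 n" and Lw: "L = total \<omega>"
  shows "reaches w \<omega> (long_com K) (init_state n) time_long (\<lambda>s'. arr s' ''out'' = recon (mem \<omega>) (total \<omega>) n \<and> drawn s' = N)"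
proof -
  have w7: "n ^ 7 \<le> 2 ^ w"
  proof -
    have "n ^ 7 \<le> n ^ (5 * K + 20)" using n2 by (intro power_increasing) auto
    then show ?thesis using w by linarith
  qed
  have nw: "n < 2 ^ w" by (rule lt_lim[of _ 1]) auto
  have W8: "W = 8 * (r div floorlog 2 n)" unfolding W_def using NR by simp
  have R8: "8 * (r div floorlog 2 n) \<le> n" using RK NR by simp
  define s0 where "s0 = init_state n"
  have s0: "var s0 ''n'' = n" "\<And>v. v \<noteq> ''n'' \<Longrightarrow> var s0 v = 0" "\<And>a. arr s0 a = (\<lambda>_. 0)" "drawn s0 = 0"
    by (simp_all add: s0_def init_state_def)
  show ?thesis unfolding long_com_def time_long_def s0_def[symmetric]
  proof (rule reaches_SeqI[OF _ _ order.refl, OF cbrt_com[OF n2 w7 r]], goal_cases)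
    case (3 s1)
    then have f1: "frame {''i'', ''r''} {} s0 s1" and v1: "var s1 ''r'' = r" "drawn s1 = 0" using s0 by auto
    show ?case
    proof (rule reaches_SeqI[OF _ _ order.refl, OF log_com[OF n2 nw]], goal_cases)
      case 1 show ?case using frame_var[OF f1] s0 by simp
    next
      case 2 show ?case using frame_var[OF f1] s0 by simp
    next
      case (3 s2)
      then have f2: "frame {''i'', ''x'', ''l''} {} s1 s2" and v2: "var s2 ''l'' = floorlog 2 n" "drawn s2 = 0" using v1 by auto
      show ?case
      proof (rule reaches_SeqI[OF _ _ order.refl, OF params_com[OF n2 w7 r(1) _ _ _ R8]], goal_cases)
        case 1 show ?case using frame_var[OF f2] frame_var[OF f1] s0 by simp
      next
        case 2 show ?case using frame_var[OF f2] v1 by simp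
      next
        case 3 show ?case by (rule v2)
      next
        case (4 s3)
        then have f3: "frame {''R'', ''W'', ''N'', ''S'', ''M'', ''M2''} {} s2 s3"
          and v3: "var s3 ''R'' = R" "var s3 ''W'' = W" "var s3 ''N'' = N" "var s3 ''S'' = 2 * n" "var s3 ''M'' = n * N"
            "var s3 ''M2'' = 2 * (n * N)" "drawn s3 = 0"
          using v2 NR W8 by auto
        have a3: "arr s3 a = (\<lambda>_. 0)" for a
          using frame_arr[OF f3] frame_arr[OF f2] frame_arr[OF f1] s0 by simp
        have n3: "var s3 ''n'' = n" "var s3 ''lam'' = 0"
          using frame_var[OF f3] frame_var[OF f2] frame_var[OF f1] s0 by simp_all
        show ?case
        proof (rule reaches_SeqI[OF _ _ order.refl, OF read_com[OF n2 N(2) w7]], goal_cases)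
          case (6 s4)
          then have f4: "frame {''i'', ''j'', ''v'', ''lam''} {''y''} s3 s4"
            and v4: "arr s4 ''y'' = mem \<omega>" "var s4 ''lam'' = L" "drawn s4 = N" using Lw by auto
          show ?case
          proof (rule reaches_SeqI[OF _ _ order.refl, OF weights_com], goal_cases)
            case 1 show ?case using frame_var[OF f4] v3 by simp
          next
            case 2 show ?case by (rule v4)
          next
            case (3 s5)
            then have f5: "frame {''i'', ''m'', ''z'', ''D''} {''PW''} s4 s5"
              and v5: "\<forall>m\<le>K. arr s5 ''PW'' m = weight L m" "drawn s5 = N" using v4 by auto
            have "env (mem \<omega>) s5"
              using v5 v4 v3 n3 frame_var[OF f5] frame_var[OF f4] frame_arr[OF f5] by (simp add: env_def)
            moreover have "arr s5 ''out'' = (\<lambda>_. 0)" using a3 frame_arr[OF f5] frame_arr[OF f4] by simp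
            ultimately show ?case
              by (rule reaches_mono[OF main_com]) (use v5 Lw in auto)
          qed
        qed (use v3 n3 a3 in auto)
      qed
    qed
  qed (use s0 in auto)
qed

end

subsection \<open>Small inputs\<close>

text \<open>After \<open>n\<close> reads the last symbol decides: it is 2 exactly if the trace has
  fewer than \<open>n\<close> bits. The number of rounds is fixed in advance, so the time bound
  holds for all answers; once \<open>flag\<close> is set, the remaining rounds keep the
  output.\<close>

definition small_com :: "nat \<Rightarrow> com" where
  "small_com M = For ''i'' (Const 0) (Const M)
     (Cond (Var ''flag'') Skip
       (Draw ;;
        For ''j'' (Const 0) (Var ''n'') (Read ''v'' ;; Store ''out'' (Var ''j'') (Var ''v'')) ;;
        Cond (Var ''v'' [<] Const 2) (''flag'' ::= Const 1) Skip))"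

lemma small_com:
  assumes n: "1 \<le> n" "n < 2 ^ w" and M: "M < 2 ^ w" and w: "2 < (2 :: nat) ^ w"
  shows "reaches w \<omega> (small_com M) (init_state n) (M * (n * 20 + 40) + 10) (\<lambda>s'. drawn s' \<le> M \<and>
    ((\<exists>i<M. n \<le> length (\<omega> i)) \<longrightarrow> (\<exists>i<M. n \<le> length (\<omega> i) \<and> (\<forall>j<n. arr s' ''out'' j = of_bool (\<omega> i ! j)))))"
proof -
  define s where "s = init_state n"
  have s: "var s ''n'' = n" "var s ''flag'' = 0" "drawn s = 0" by (simp_all add: s_def init_state_def)
  define J where "J i s' \<longleftrightarrow> drawn s' \<le> i \<and>
    (var s' ''flag'' = 0 \<and> drawn s' = i \<and> (\<forall>i'<i. length (\<omega> i') < n) \<or>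
     var s' ''flag'' = 1 \<and> (\<exists>i'<i. n \<le> length (\<omega> i') \<and> (\<forall>j<n. arr s' ''out'' j = of_bool (\<omega> i' ! j))))" for i and s' :: state
  let ?inner = "For ''j'' (Const 0) (Var ''n'') (Read ''v'' ;; Store ''out'' (Var ''j'') (Var ''v''))"
  let ?check = "Cond (Var ''v'' [<] Const 2) (''flag'' ::= Const 1) Skip"
  let ?V = "{''i'', ''j'', ''v'', ''flag''}"
  have "reaches w \<omega> (small_com M) s (M * (n * 20 + 40) + 10) (\<lambda>s'. frame ?V {''out''} s s' \<and> J M s' \<and> var s' ''i'' = M)"
    unfolding small_com_def
  proof (rule reaches_For[where l = 0 and Tb = "n * 20 + 30"])
    show "J 0 (s\<lparr>var := (var s)(''i'' := 0)\<rparr>)" using s by (simp add: J_def)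
    show "J k (s\<lparr>var := (var s)(''i'' := x)\<rparr>)" if "J k s" for k x and s :: state using that by (simp add: J_def)
  next
    fix i and s1 :: state
    assume i: "i < M" and f: "frame ?V {''out''} s s1" and vi: "var s1 ''i'' = i" and J: "J i s1"
    have vn: "var s1 ''n'' = n" using frame_var[OF f] s by simp
    show "reaches w \<omega> (Cond (Var ''flag'') Skip (Draw ;; ?inner ;; ?check)) s1 (n * 20 + 30)
      (\<lambda>s'. frame (?V - {''i''}) {''out''} s1 s' \<and> J (Suc i) s')"
    proof (rule reaches_Cond[where T' = "n * 20 + 25"])
      show "eval w (Var ''flag'') s1 = var s1 ''flag''" by (simp add: evals)
    next
      assume "var s1 ''flag'' \<noteq> 0"
      then show "reaches w \<omega> Skip s1 (n * 20 + 25) (\<lambda>s'. frame (?V - {''i''}) {''out''} s1 s' \<and> J (Suc i) s')"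
        using J by (intro reaches_Skip) (auto simp: J_def frame_def less_Suc_eq)
    next
      assume flag: "var s1 ''flag'' = 0"
      then have d: "drawn s1 = i" and short: "\<forall>i'<i. length (\<omega> i') < n" using J by (auto simp: J_def)
      let ?s = "s1\<lparr>rest := \<omega> (drawn s1), drawn := Suc (drawn s1)\<rparr>"
      define sym :: "nat \<Rightarrow> nat" where "sym j = (if j < length (\<omega> i) then of_bool (\<omega> i ! j) else 2)" for j
      define I where "I j s' \<longleftrightarrow> rest s' = drop j (\<omega> i) \<and> (\<forall>j'<j. arr s' ''out'' j' = sym j') \<and>
        (0 < j \<longrightarrow> var s' ''v'' = sym (j - 1)) \<and> drawn s' = Suc i" for j and s' :: state
      have inner: "reaches w \<omega> ?inner ?s (n * 20 + 10) (\<lambda>s'. frame {''j'', ''v''} {''out''} ?s s' \<and> I n s' \<and> var s' ''j'' = n)"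
      proof (rule reaches_For[where l = 0 and Tb = 10])
        show "eval w (Var ''n'') s' = n" if "frame {''j'', ''v''} {''out''} ?s s'" for s'
          using frame_var[OF that] vn by (simp add: evals)
        show "I 0 (?s\<lparr>var := (var ?s)(''j'' := 0)\<rparr>)" by (simp add: I_def d)
        show "I k (s\<lparr>var := (var s)(''j'' := x)\<rparr>)" if "I k s" for k x and s :: state using that by (simp add: I_def)
      next
        fix j and s2 :: state
        assume j: "j < n" and vj: "var s2 ''j'' = j" and I: "I j s2"
        have r: "rest s2 = drop j (\<omega> i)" using I by (simp add: I_def)
        have rc: "(case rest s2 of [] \<Rightarrow> 2 | b # bs \<Rightarrow> of_bool b) = sym j" "tl (rest s2) = drop (Suc j) (\<omega> i)"
          unfolding r by (cases "j < length (\<omega> i)"; auto simp: sym_def simp flip: Cons_nth_drop_Suc)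
            (simp add: drop_Suc tl_drop)
        show "reaches w \<omega> (Read ''v'' ;; Store ''out'' (Var ''j'') (Var ''v'')) s2 10
          (\<lambda>s'. frame ({''j'', ''v''} - {''j''}) {''out''} s2 s' \<and> I (Suc j) s')"
        proof (rule reaches_Seq[where Ta = 1 and Tb = 9], rule reaches_Read, simp, unfold rc)
          show "reaches w \<omega> (Store ''out'' (Var ''j'') (Var ''v''))
            (s2\<lparr>var := (var s2)(''v'' := sym j), rest := drop (Suc j) (\<omega> i)\<rparr>) 9
            (\<lambda>s'. frame ({''j'', ''v''} - {''j''}) {''out''} s2 s' \<and> I (Suc j) s')"
            using I vj by (intro reaches_Store[where j = j and x = "sym j"])
              (auto simp: evals frame_def I_def less_Suc_eq)
        qed simp
      qed (use n in \<open>auto simp: evals\<close>)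
      show "reaches w \<omega> (Draw ;; ?inner ;; ?check) s1 (n * 20 + 25)
        (\<lambda>s'. frame (?V - {''i''}) {''out''} s1 s' \<and> J (Suc i) s')"
      proof (rule reaches_Seq[where Ta = 1 and Tb = "n * 20 + 20"], rule reaches_Draw, simp,
          rule reaches_SeqI[OF inner, where Tb = 10])
        fix s2 :: state
        assume 2: "frame {''j'', ''v''} {''out''} ?s s2 \<and> I n s2 \<and> var s2 ''j'' = n"
        have v: "var s2 ''v'' < 2 \<longleftrightarrow> n \<le> length (\<omega> i)" using 2 n by (auto simp: I_def sym_def of_bool_def)
        have f2: "frame {''j'', ''v''} {''out''} s1 s2" using 2 by (simp add: frame_def)
        have flag2: "var s2 ''flag'' = 0" using flag frame_var[OF f2] by simp
        have d2: "drawn s2 = Suc i" and out: "\<And>j. j < n \<Longrightarrow> arr s2 ''out'' j = sym j" using 2 by (auto simp: I_def)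
        show "reaches w \<omega> ?check s2 10 (\<lambda>s'. frame (?V - {''i''}) {''out''} s1 s' \<and> J (Suc i) s')"
        proof (rule reaches_Cond[where T' = 4])
          show "eval w (Var ''v'' [<] Const 2) s2 = of_bool (n \<le> length (\<omega> i))" using v w by (simp add: evals)
        next
          assume "of_bool (n \<le> length (\<omega> i)) \<noteq> (0 :: nat)"
          then have "n \<le> length (\<omega> i)" by simp
          then show "reaches w \<omega> (''flag'' ::= Const 1) s2 4 (\<lambda>s'. frame (?V - {''i''}) {''out''} s1 s' \<and> J (Suc i) s')"
            using w f2 d2 out by (intro reaches_Assign[where x = 1]) (auto simp: evals frame_def J_def sym_def)
        next
          assume "of_bool (n \<le> length (\<omega> i)) = (0 :: nat)"
          then show "reaches w \<omega> Skip s2 4 (\<lambda>s'. frame (?V - {''i''}) {''out''} s1 s' \<and> J (Suc i) s')"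
            using f2 d2 flag2 short by (intro reaches_Skip) (auto simp: frame_def J_def less_Suc_eq)
        qed simp
      qed simp_all
    qed simp
  qed (use M in \<open>auto simp: evals algebra_simps\<close>)
  then show ?thesis unfolding s_def[symmetric] by (rule reaches_mono) (force simp: J_def)+
qed

section \<open>The probability that one of the traces is complete\<close>

lemma self_in_deletion_channel:
  assumes "0 < \<delta>" "\<delta> < 1"
  shows "x \<in> set_pmf (deletion_channel \<delta> x)"
proof -
  have "(\<lambda>_. False) \<in> set_pmf (Pi_pmf {..<length x} False (\<lambda>_. bernoulli_pmf \<delta>))"
    using assms by (simp add: set_Pi_pmf PiE_dflt_def set_pmf_bernoulli)
  moreover have "nths x {i. \<not> False} = x" by (rule nths_all) simp
  ultimately show ?thesis unfolding deletion_channel_def by (force simp: set_map_pmf)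
qed

lemma full_length_trace:
  assumes "y \<in> set_pmf (deletion_channel \<delta> x)" "length x \<le> length y"
  shows "y = x"
proof -
  obtain A where y: "y = nths x A" using assms(1) by (auto simp: deletion_channel_def set_map_pmf)
  have "card {i. i < length x \<and> i \<in> A} \<ge> card {..<length x}" using assms(2) y by (simp add: length_nths)
  then have "{i. i < length x \<and> i \<in> A} = {..<length x}"
    by (intro card_seteq) auto
  then show ?thesis using y by (intro trans[OF y nths_all]) auto
qed

lemma (in pmf_samples) prob_all_in:
  "prob {\<omega> \<in> space PM. \<forall>i<M. \<omega> i \<in> A} = measure_pmf.prob D A ^ M"
proof -
  interpret S: product_prob_space "\<lambda>_. measure_pmf D" "UNIV :: nat set"
    by unfold_locales
  have "emeasure PM {\<omega> \<in> space PM. \<forall>i\<in>{..<M}. \<omega> i \<in> A} = (\<Prod>i<M. emeasure (measure_pmf D) A)"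
    by (rule S.emeasure_PiM_Collect) auto
  then have "measure PM {\<omega> \<in> space PM. \<forall>i\<in>{..<M}. \<omega> i \<in> A} = measure (measure_pmf D) A ^ M"
    by (simp add: measure_pmf.emeasure_eq_measure measure_def[of PM] ennreal_power)
  then show ?thesis by (simp add: lessThan_def)
qed

lemma prob_no_full_trace:
  assumes "0 < \<delta>" "\<delta> < 1"
  shows "measure_pmf.prob (deletion_channel \<delta> x) {y. length y < length x} < 1"
proof -
  have "0 < pmf (deletion_channel \<delta> x) x" using self_in_deletion_channel[OF assms] by (simp add: pmf_positive)
  also have "\<dots> = measure_pmf.prob (deletion_channel \<delta> x) {x}" by (simp add: measure_pmf_single)
  also have "\<dots> \<le> measure_pmf.prob (deletion_channel \<delta> x) (UNIV - {y. length y < length x})"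
    by (intro measure_pmf.finite_measure_mono) auto
  also have "\<dots> = 1 - measure_pmf.prob (deletion_channel \<delta> x) {y. length y < length x}"
    using measure_pmf.prob_compl[of "{y. length y < length x}" "deletion_channel \<delta> x"] by simp
  finally show ?thesis by simp
qed

lemma full_trace_prob:
  fixes \<delta> :: real and x :: "bool list"
  defines "P \<equiv> \<Pi>\<^sub>M i\<in>(UNIV :: nat set). measure_pmf (deletion_channel \<delta> x)"
  shows "measure P {\<omega> \<in> space P. (\<exists>i<M. length x \<le> length (\<omega> i)) \<and> (\<forall>i<M. length x \<le> length (\<omega> i) \<longrightarrow> \<omega> i = x)}
    = 1 - measure_pmf.prob (deletion_channel \<delta> x) {y. length y < length x} ^ M"
proof -
  interpret pmf_samples "deletion_channel \<delta> x" .
  let ?A = "{\<omega> \<in> space PM. \<forall>i<M. \<omega> i \<in> {y. length y < length x}}"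
  have meas: "?A \<in> sets PM" by (rule measurable_prefix_event[where N = M]) auto
  have "AE \<omega> in PM. \<forall>i. \<omega> i \<in> set_pmf (deletion_channel \<delta> x)" by (simp add: AE_all_countable AE_sample)
  then have "AE \<omega> in PM. (\<exists>i<M. length x \<le> length (\<omega> i)) \<and> (\<forall>i<M. length x \<le> length (\<omega> i) \<longrightarrow> \<omega> i = x)
      \<longleftrightarrow> \<not> (\<forall>i<M. \<omega> i \<in> {y. length y < length x})"
    by eventually_elim (use full_length_trace in \<open>force simp: not_less\<close>)
  then have "prob {\<omega> \<in> space PM. (\<exists>i<M. length x \<le> length (\<omega> i)) \<and> (\<forall>i<M. length x \<le> length (\<omega> i) \<longrightarrow> \<omega> i = x)}
      = prob {\<omega> \<in> space PM. \<not> (\<forall>i<M. \<omega> i \<in> {y. length y < length x})}"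
    by (intro measure_eq_AE measurable_prefix_event[where N = M]) auto
  also have "\<dots> = 1 - prob ?A" by (rule prob_neg[OF meas])
  finally show ?thesis by (simp only: P_def prob_all_in)
qed

text \<open>
  The event is measurable because the bound on \<open>drawn\<close> holds for all \<open>\<omega>\<close>, so that the run depends only on the
  first \<open>N\<close> traces.
\<close>

lemma prob_run_ge:
  fixes \<delta> :: real and x :: "bool list"
  defines "P \<equiv> \<Pi>\<^sub>M i\<in>(UNIV :: nat set). measure_pmf (deletion_channel \<delta> x)"
  assumes det: "\<And>\<omega>. reaches w \<omega> c s T (\<lambda>s'. drawn s' \<le> N \<and> (G \<omega> \<longrightarrow> A s'))"
    and G: "p \<le> measure P {\<omega> \<in> space P. G \<omega>}"
  shows "p \<le> measure P {\<omega> \<in> space P. \<exists>t s'. big_step w \<omega> c s t s' \<and> A s'}"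
proof -
  interpret pmf_samples "deletion_channel \<delta> x" .
  have drawn: "drawn s' \<le> N" if "big_step w \<omega> c s t s'" for \<omega> t s'
    using det[of \<omega>] big_step_deterministic[OF that] unfolding reaches_def by blast
  have "{\<omega> \<in> space P. \<exists>t s'. big_step w \<omega> c s t s' \<and> A s'} \<in> sets P" unfolding P_def
  proof (rule measurable_prefix_event[where N = N])
    fix \<omega> \<omega>' :: "nat \<Rightarrow> bool list" assume e: "\<And>i. i < N \<Longrightarrow> \<omega> i = \<omega>' i"
    have "\<exists>t s'. big_step w b c s t s' \<and> A s'"
      if "\<exists>t s'. big_step w a c s t s' \<and> A s'" "\<And>i. i < N \<Longrightarrow> a i = b i" for a b
      using that drawn big_step_cong[where \<omega> = a and \<omega>' = b] by (meson order.strict_trans2)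
    then show "(\<exists>t s'. big_step w \<omega> c s t s' \<and> A s') \<longleftrightarrow> (\<exists>t s'. big_step w \<omega>' c s t s' \<and> A s')" using e by metis
  qed
  moreover have "{\<omega> \<in> space P. G \<omega>} \<subseteq> {\<omega> \<in> space P. \<exists>t s'. big_step w \<omega> c s t s' \<and> A s'}"
    using det unfolding reaches_def by blast
  ultimately show ?thesis using G finite_measure_mono unfolding P_def by (meson order.trans)
qed

text \<open>All terms are brought to the form \<open>n * r ^ 4\<close>: a step handles
  \<open>r ^ 2\<close> traces, \<open>O(r)\<close> start positions in each and \<open>O(r)\<close>
  letters from each start. Lower-order terms are absorbed by means of
  \<open>1 \<le> r\<close>.\<close>

lemma (in ram_setup) time_long_le:
  assumes r: "N = r ^ 2" "R \<le> r"
  shows "time_long \<le> 10000 * (K + 1) ^ 2 * (n * r ^ 4)"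
proof -
  have r1: "1 \<le> r" using N(1) r(1) by (cases r) auto
  define k where "k = K + 1"
  have tw: "time_window \<le> 3000 * k * r ^ 2"
  proof -
    have "time_window \<le> (2 * r + 1) * (100 * k * (8 * r + 1) + 80) + 20"
      unfolding time_window_def k_def using r(2) by (intro add_mono mult_mono) auto
    also have "\<dots> \<le> (3 * r) * (100 * k * (9 * r) + 80 * (k * r)) + 20 * (k * (r * r))"
    proof (intro add_mono mult_mono)
      have "0 < k * (r * r)" using r1 by (simp add: k_def)
      then show "20 \<le> 20 * (k * (r * r))" by linarith
    qed (use r1 in \<open>auto simp: k_def\<close>)
    also have "\<dots> \<le> 3000 * k * r ^ 2" by (simp add: power2_eq_square)
    finally show ?thesis .
  qed
  have ts: "time_step \<le> 5000 * k * r ^ 4"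
  proof -
    have "time_step \<le> r ^ 2 * (8 + 3000 * k * r ^ 2) + (4 * r) * (24 * (8 * r) + 50) + 200"
      unfolding time_step_def r(1)[symmetric] using tw r(2) by (intro add_mono mult_mono) (auto simp: r(1))
    also have "\<dots> \<le> r ^ 2 * (8 * (k * r ^ 2) + 3000 * k * r ^ 2) + (4 * r) * (24 * (8 * r) + 50 * r) + 200 * (k * r ^ 4)"
    proof -
      have "0 < k" using r1 by (simp add: k_def)
      then have "1 \<le> k * r ^ 2" "1 \<le> k * r ^ 4" using r1 by (simp_all add: Suc_le_eq)
      then show ?thesis using r1 by (intro add_mono mult_mono) auto
    qed
    also have "\<dots> = 3208 * (k * r ^ 4) + 968 * r ^ 2"
      by (simp add: algebra_simps power2_eq_square power4_eq_xxxx)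
    also have "\<dots> \<le> 3208 * (k * r ^ 4) + 968 * (k * r ^ 4)"
    proof (intro add_mono mult_mono order.refl)
      have "r ^ 2 \<le> r ^ 4" using r1 by (intro power_increasing) auto
      also have "\<dots> \<le> k * r ^ 4" by (simp add: k_def)
      finally show "r ^ 2 \<le> k * r ^ 4" .
    qed auto
    finally show ?thesis by simp
  qed
  define B where "B = n * r ^ 4"
  have nB: "n \<le> B" "1 \<le> B" "r ^ 2 * n \<le> B" "r ^ 2 \<le> B"
  proof -
    have "r ^ 2 \<le> r ^ 4" using r1 by (intro power_increasing) auto
    then show "r ^ 2 * n \<le> B" by (simp add: B_def)
    show "n \<le> B" "1 \<le> B" using r1 n2 by (auto simp: B_def)
    have "r ^ 2 \<le> r ^ 2 * n" using n2 by simp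
    then show "r ^ 2 \<le> B" using \<open>r ^ 2 * n \<le> B\<close> by linarith
  qed
  have main: "n * (8 + time_step) \<le> 8 * B + 5000 * k * B"
  proof -
    have "n * time_step \<le> n * (5000 * k * r ^ 4)" using ts by (rule mult_left_mono) simp
    also have "\<dots> = 5000 * k * B" by (simp add: B_def)
    finally show ?thesis using nB(1) by (simp add: distrib_left)
  qed
  have w: "k * (K * 30 + 40) \<le> 40 * k ^ 2 * B"
  proof -
    have "k * (K * 30 + 40) \<le> k * (40 * k)" by (intro mult_left_mono) (auto simp: k_def)
    also have "\<dots> \<le> 40 * k ^ 2 * B" using nB(2) by (simp add: power2_eq_square)
    finally show ?thesis .
  qed
  have read: "N * (60 * n + 20) \<le> 80 * B" using nB by (simp add: r(1) algebra_simps)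
  have "time_long \<le> 40 * B + 10 * B + (40 * B + 20 * B + (60 * B + (80 * B + 10 * B + (40 * k ^ 2 * B + 30 * B + (8 * B + 5000 * k * B + 6 * B)))))"
    unfolding time_long_def k_def[symmetric] using nB main w read by (intro add_mono) auto
  also have "\<dots> = (304 + 5000 * k + 40 * k ^ 2) * B" by (simp add: algebra_simps)
  also have "\<dots> \<le> (10000 * k ^ 2) * B"
  proof (rule mult_right_mono)
    have "1 \<le> k" "k \<le> k ^ 2" by (simp_all add: k_def power2_eq_square)
    then show "304 + 5000 * k + 40 * k ^ 2 \<le> 10000 * k ^ 2" by linarith
  qed simp
  finally show ?thesis by (simp add: B_def k_def)
qed

subsection \<open>The algorithm\<close>

definition reconstruction_com :: "nat \<Rightarrow> nat \<Rightarrow> nat \<Rightarrow> com" where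
  "reconstruction_com n0 M K = Cond (Var ''n'' [<] Const n0) (small_com M) (long_com K)"

lemma cube_root_exists:
  fixes n :: nat
  obtains r where "r ^ 3 \<le> n" "n < (r + 1) ^ 3"
proof -
  define r where "r = (GREATEST r. r ^ 3 \<le> n)"
  have b: "y \<le> n" if "y ^ 3 \<le> n" for y
  proof -
    have "y \<le> y ^ 3" by (cases y) (auto simp: power3_eq_cube)
    then show ?thesis using that by simp
  qed
  have "r ^ 3 \<le> n" unfolding r_def by (rule GreatestI_nat[where k = 0 and b = n]) (use b in auto)
  moreover have "\<not> (r + 1) ^ 3 \<le> n"
  proof
    assume "(r + 1) ^ 3 \<le> n"
    then have "r + 1 \<le> r" unfolding r_def using b by (intro Greatest_le_nat[where b = n]) (auto simp: r_def)
    then show False by simp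
  qed
  ultimately show ?thesis using that by (simp add: not_le)
qed

text \<open>The first bound serves quantities that grow with \<open>n\<close>. The second serves the
  constants of the program, which must fit even for the smallest \<open>n\<close>; a word has at
  least \<open>k\<close> bits.\<close>

lemma word_size_ge:
  assumes "1 \<le> n"
  shows "n ^ k \<le> 2 ^ word_size k n" "m < k \<Longrightarrow> m < 2 ^ word_size k n"
proof -
  have "n < 2 ^ floorlog 2 n" using floorlog_bounds[of n 2] assms by simp
  then have "n ^ k \<le> (2 ^ floorlog 2 n) ^ k" by (intro power_mono) auto
  then show "n ^ k \<le> 2 ^ word_size k n" by (simp add: word_size_def mult.commute flip: power_mult)
  have "0 < floorlog 2 n" using assms by (simp add: floorlog_def)
  then have "k \<le> word_size k n" by (simp add: word_size_def)
  then have "m < 2 ^ word_size k n" if "m < k" using that less_exp[of "word_size k n"] by linarith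
  then show "m < k \<Longrightarrow> m < 2 ^ word_size k n" .
qed

lemma small_reaches:
  assumes "2 \<le> n" "n < n0" "n0 + M + 2 < k"
  shows "reaches (word_size k n) \<omega> (reconstruction_com n0 M K) (init_state n) (M * (n * 20 + 40) + 20)
    (\<lambda>s'. drawn s' \<le> M \<and>
      ((\<exists>i<M. n \<le> length (\<omega> i)) \<longrightarrow> (\<exists>i<M. n \<le> length (\<omega> i) \<and> (\<forall>j<n. arr s' ''out'' j = of_bool (\<omega> i ! j)))))"
proof -
  have w: "m < 2 ^ word_size k n" if "m \<le> n0 + M + 2" for m using word_size_ge(2)[of n m k] assms that by simp
  note small = small_com[of n "word_size k n" M \<omega>, OF _ w[of n] w[of M] w[of 2]]
  show ?thesis unfolding reconstruction_com_def
  proof (rule reaches_Cond[where T' = "M * (n * 20 + 40) + 10"])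
    show "eval (word_size k n) (Var ''n'' [<] Const n0) (init_state n) = 1"
      using w[of n0] w[of 1] assms by (simp add: evals init_state_def)
  qed (simp, rule small, use assms in auto)
qed

lemma outputs_iff: "outputs (length x) s x \<longleftrightarrow> (\<forall>i<length x. arr s ''out'' i = of_bool (x ! i))"
  unfolding outputs_def by (simp add: list_eq_iff_nth_eq[of "map _ _"] del: of_bool_eq_iff)

text \<open>Only finitely many strings are shorter than \<open>n0\<close>, and each of them survives
  undeleted with positive probability, so one number of repetitions serves them all.\<close>

lemma full_trace_repetitions:
  fixes \<delta> :: "nat \<Rightarrow> real"
  assumes "\<And>n. 2 \<le> n \<Longrightarrow> 0 < \<delta> n \<and> \<delta> n < 1"
  obtains M where "\<And>x. 2 \<le> length x \<Longrightarrow> length x < n0 \<Longrightarrow>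
    measure_pmf.prob (deletion_channel (\<delta> (length x)) x) {y. length y < length x} ^ M \<le> 1 / 10"
proof -
  let ?q = "\<lambda>x. measure_pmf.prob (deletion_channel (\<delta> (length x)) x) {y. length y < length x}"
  let ?S = "{x :: bool list. 2 \<le> length x \<and> length x < n0}"
  have "finite {x. set x \<subseteq> (UNIV :: bool set) \<and> length x \<le> n0}" by (rule finite_lists_length_le) simp
  then have "finite ?S" by (rule finite_subset[rotated]) auto
  moreover have "\<forall>\<^sub>F M in sequentially. ?q x ^ M < 1 / 10" if "x \<in> ?S" for x
  proof -
    have "(\<lambda>M. ?q x ^ M) \<longlonglongrightarrow> 0"
      using assms[of "length x"] that by (intro LIMSEQ_realpow_zero prob_no_full_trace) auto
    then show ?thesis by (rule order_tendstoD) simp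
  qed
  ultimately have "\<forall>\<^sub>F M in sequentially. \<forall>x\<in>?S. ?q x ^ M < 1 / 10" by (intro eventually_ball_finite) auto
  then obtain M where "\<forall>x\<in>?S. ?q x ^ M < 1 / 10" by (auto simp: eventually_sequentially)
  then show ?thesis by (intro that[of M]) (auto intro: less_imp_le)
qed

lemma long_reaches:
  assumes r: "r ^ 3 \<le> n" "n < (r + 1) ^ 3" and NR: "N = r ^ 2" "R = r div floorlog 2 n"
    and x: "reconstruct_params n N K R \<delta> \<psi> \<beta> x"
    and ge: "2 \<le> n" "n0 \<le> n" and k: "n0 + 5 * K + 20 < k"
  shows "reaches (word_size k n) \<omega> (reconstruction_com n0 M K) (init_state n) (10000 * (K + 1) ^ 2 * (n * r ^ 4) + 10)
    (\<lambda>s'. drawn s' = N \<and> arr s' ''out'' = reconstruct.recon n N K R (reconstruct.mem n N \<omega>) (reconstruct.total n N \<omega>) n)"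
proof -
  have lim: "m < 2 ^ word_size k n" if "m \<le> n0 + 5 * K + 20" for m using word_size_ge(2)[of n m k] k ge that by simp
  interpret reconstruct_params n N K R \<delta> \<psi> \<beta> x by (rule x)
  have r1: "1 \<le> r" using r(2) ge(1) by (cases r) auto
  have N': "1 \<le> N" "N \<le> n"
  proof -
    have "r ^ 2 \<le> r ^ 3" using r1 by (intro power_increasing) auto
    then show "N \<le> n" using r(1) NR by simp
    show "1 \<le> N" using r1 NR by simp
  qed
  \<comment> \<open>This holds for every \<open>\<omega>\<close> because \<open>total\<close> caps
    each length at \<open>2 * n\<close>; absence of overflow does not presuppose that the answers
    are traces of \<open>x\<close>.\<close>
  have "total \<omega> \<le> (\<Sum>i<N. 2 * n)" unfolding total_def by (intro sum_mono) simp
  moreover have "n ^ (5 * K + 20) \<le> 2 ^ word_size k n"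
  proof -
    have "n ^ (5 * K + 20) \<le> n ^ k" using ge k by (intro power_increasing) auto
    then show ?thesis using word_size_ge(1)[of n k] ge by linarith
  qed
  ultimately interpret ram_setup n N K R "word_size k n" "total \<omega>"
    using ge N' R n by unfold_locales (auto simp: mult_ac)
  have "R \<le> r" using NR by simp
  then have t: "time_long \<le> 10000 * (K + 1) ^ 2 * (n * r ^ 4)" by (rule time_long_le[OF NR(1)])
  show ?thesis unfolding reconstruction_com_def
  proof (rule reaches_Cond[where T' = time_long])
    show "eval (word_size k n) (Var ''n'' [<] Const n0) (init_state n) = 0"
      using lim[of n0] lim[of 1] ge by (simp add: evals init_state_def)
    show "reaches (word_size k n) \<omega> (long_com K) (init_state n) time_long
      (\<lambda>s'. drawn s' = N \<and> arr s' ''out'' = recon (mem \<omega>) (total \<omega>) n)"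
      by (rule reaches_mono[OF long_com[OF r NR refl]]) auto
  qed (use t in auto)
qed

theorem theorem1:
  fixes \<epsilon> :: real
  assumes "\<epsilon> > 0"
  defines "\<delta> \<equiv> (\<lambda>n::nat. real n powr (- (1/3 + \<epsilon>)))"
  shows "\<exists>(c :: com) (k :: nat) (traces :: nat \<Rightarrow> nat) (time :: nat \<Rightarrow> nat).
    k \<ge> 1 \<and>
    (\<lambda>n. real (traces n)) \<in> O(\<lambda>n. real n powr (4/3)) \<and>
    (\<lambda>n. real (time n)) \<in> O(\<lambda>n. real n powr (7/3)) \<and>
    (\<forall>n\<ge>2. \<forall>x :: bool list. length x = n \<longrightarrow>
      (\<forall>\<omega>. (\<forall>i. \<omega> i \<in> set_pmf (deletion_channel (\<delta> n) x)) \<longrightarrow>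
        (\<exists>t s. run k c n \<omega> t s \<and> t \<le> time n \<and> drawn s \<le> traces n)) \<and>
      \<P>(\<omega> in (\<Pi>\<^sub>M i\<in>(UNIV :: nat set). measure_pmf (deletion_channel (\<delta> n) x)).
         \<exists>t s. run k c n \<omega> t s \<and> outputs n s x) \<ge> 9/10)"
proof -
  have \<delta>: "0 < \<delta> n \<and> \<delta> n < 1" if "2 \<le> n" for n
    using that \<open>\<epsilon> > 0\<close> powr_less_one[of "real n" "- (1/3 + \<epsilon>)"] by (auto simp: \<delta>_def)
  obtain K n1 where long: "\<And>n r R N x. n1 \<le> n \<Longrightarrow> r ^ 3 \<le> n \<Longrightarrow> n < (r + 1) ^ 3 \<Longrightarrow>
      N = r ^ 2 \<Longrightarrow> R = r div floorlog 2 n \<Longrightarrow> length x = n \<Longrightarrow>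
      (\<exists>\<psi> \<beta>. reconstruct_params n N K R (\<delta> n) \<psi> \<beta> x) \<and>
      real n * real (n + 3) * (2 * exp (- real N / (2048 * (real R + 3)\<^sup>2)))
        + 10000 * (real n * \<delta> n) / real N \<le> 1 / 10"
    using eventually_reconstruct_params[OF \<open>\<epsilon> > 0\<close>] unfolding eventually_sequentially \<delta>_def by metis
  define n0 where "n0 = max n1 2"
  obtain M where M: "\<And>x. 2 \<le> length x \<Longrightarrow> length x < n0 \<Longrightarrow>
      measure_pmf.prob (deletion_channel (\<delta> (length x)) x) {y. length y < length x} ^ M \<le> 1 / 10"
    using full_trace_repetitions[of \<delta> n0] \<delta> by metis
  define C where "C = 10000 * (K + 1) ^ 2"
  define c where "c = reconstruction_com n0 M K"
  \<comment> \<open>Large enough for the word-size conditions of both \<open>small_reaches\<close>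
    and \<open>long_reaches\<close>.\<close>
  define k where "k = n0 + M + 5 * K + 21"
  define traces where "traces n = (if n < n0 then M else nat \<lfloor>real n powr (4/3)\<rfloor>)" for n
  define time where "time n = (if n < n0 then M * (n * 20 + 40) + 20 else nat \<lfloor>real C * real n powr (7/3)\<rfloor> + 10)" for n
  have "\<forall>\<^sub>F n in sequentially. norm (real (traces n)) \<le> 1 * norm (real n powr (4/3))"
    using eventually_ge_at_top[of n0] by eventually_elim (auto simp: traces_def of_nat_nat)
  then have traces_O: "(\<lambda>n. real (traces n)) \<in> O(\<lambda>n. real n powr (4/3))" by (rule bigoI)
  have "\<forall>\<^sub>F n in sequentially. norm (real (time n)) \<le> (real C + 10) * norm (real n powr (7/3))"
    using eventually_ge_at_top[of n0]
  proof eventually_elim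
    case (elim n)
    then have "1 \<le> real n powr (7/3)" by (intro ge_one_powr_ge_zero) (auto simp: n0_def)
    moreover have "real (nat \<lfloor>real C * real n powr (7/3)\<rfloor>) \<le> real C * real n powr (7/3)" by (simp add: of_nat_nat)
    ultimately have "real (nat \<lfloor>real C * real n powr (7/3)\<rfloor>) + 10 \<le> (real C + 10) * real n powr (7/3)"
      by (simp only: distrib_right)
    then show ?case using elim by (simp add: time_def)
  qed
  then have time_O: "(\<lambda>n. real (time n)) \<in> O(\<lambda>n. real n powr (7/3))" by (rule bigoI)
  \<comment> \<open>The bounds on time and draws are shown for every \<open>\<omega>\<close>, not
    only for sequences of possible traces; \<open>prob_run_ge\<close> uses the bound on draws for
    measurability.\<close>
  have "(\<forall>\<omega>. \<exists>t s. run k c n \<omega> t s \<and> t \<le> time n \<and> drawn s \<le> traces n) \<and>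
      9/10 \<le> \<P>(\<omega> in (\<Pi>\<^sub>M i\<in>(UNIV :: nat set). measure_pmf (deletion_channel (\<delta> n) x)).
         \<exists>t s. run k c n \<omega> t s \<and> outputs n s x)"
    if ge: "2 \<le> n" and x: "length x = n" for n x
  proof -
    let ?P = "\<Pi>\<^sub>M i\<in>(UNIV :: nat set). measure_pmf (deletion_channel (\<delta> n) x)"
    \<comment> \<open>Both ranges of \<open>n\<close> are brought to one form: resource bounds for
      every \<open>\<omega>\<close>, correct output on an event \<open>G\<close> of probability at
      least 9/10.\<close>
    have "\<exists>G. (\<forall>\<omega>. reaches (word_size k n) \<omega> c (init_state n) (time n)
        (\<lambda>s'. drawn s' \<le> traces n \<and> (G \<omega> \<longrightarrow> outputs n s' x))) \<and> 9/10 \<le> measure ?P {\<omega> \<in> space ?P. G \<omega>}"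
    proof (cases "n < n0")
      case True
      let ?G = "\<lambda>\<omega> :: nat \<Rightarrow> bool list. (\<exists>i<M. n \<le> length (\<omega> i)) \<and> (\<forall>i<M. n \<le> length (\<omega> i) \<longrightarrow> \<omega> i = x)"
      have "reaches (word_size k n) \<omega> c (init_state n) (time n)
        (\<lambda>s'. drawn s' \<le> traces n \<and> (?G \<omega> \<longrightarrow> outputs n s' x))" for \<omega>
        unfolding c_def time_def traces_def using True ge
        by (intro reaches_mono[OF small_reaches]) (auto simp: k_def outputs_iff simp flip: x)
      moreover have "9/10 \<le> measure ?P {\<omega> \<in> space ?P. ?G \<omega>}"
        using full_trace_prob[of "\<delta> n" x M] M[of x] True ge x by simp
      ultimately show ?thesis by (intro exI[of _ ?G] conjI allI)
    next
      case False
      obtain r where r: "r ^ 3 \<le> n" "n < (r + 1) ^ 3" by (rule cube_root_exists)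
      define N where "N = r ^ 2"
      define R where "R = r div floorlog 2 n"
      have n1: "n1 \<le> n" using False by (simp add: n0_def)
      obtain \<psi> \<beta> where rp: "reconstruct_params n N K R (\<delta> n) \<psi> \<beta> x"
        and err: "real n * real (n + 3) * (2 * exp (- real N / (2048 * (real R + 3)\<^sup>2)))
          + 10000 * (real n * \<delta> n) / real N \<le> 1 / 10"
        using long[OF n1 r N_def R_def x] by blast
      interpret reconstruct_params n N K R "\<delta> n" \<psi> \<beta> x by (rule rp)
      let ?G = "\<lambda>\<omega>. \<forall>i<n. recon (mem \<omega>) (total \<omega>) n i = of_bool (x ! i)"
      define X where "X = real n powr (1/3)"
      have X1: "1 \<le> X" unfolding X_def using ge by (intro ge_one_powr_ge_zero) auto
      have Xp: "X ^ m = real n powr (real m / 3)" for m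
        using ge by (simp add: X_def powr_powr flip: powr_realpow)
      have rX: "real r \<le> X" using cuberoot_bounds(1)[OF r] by (simp add: X_def)
      have "real N \<le> X ^ 2" using rX by (simp add: N_def power_mono)
      also have "\<dots> \<le> X ^ 4" using X1 by (intro power_increasing) auto
      finally have "real N \<le> real n powr (4/3)" by (simp add: Xp)
      then have NT: "N \<le> traces n" using False by (simp add: traces_def le_nat_floor)
      have "real (C * (n * r ^ 4)) \<le> real C * (X ^ 3 * X ^ 4)"
        using rX by (auto simp: Xp[of 3] power_mono intro!: mult_left_mono)
      also have "X ^ 3 * X ^ 4 = real n powr (7/3)" using Xp[of 7] by (simp flip: power_add)
      finally have tT: "C * (n * r ^ 4) + 10 \<le> time n"
        using False le_nat_floor[of "C * (n * r ^ 4)"] by (simp add: time_def)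
      have "reaches (word_size k n) \<omega> c (init_state n) (time n)
        (\<lambda>s'. drawn s' \<le> traces n \<and> (?G \<omega> \<longrightarrow> outputs n s' x))" for \<omega>
        unfolding c_def
      proof (rule reaches_mono[OF long_reaches[OF r N_def R_def rp ge, of n0 k \<omega> M]])
        show "n0 \<le> n" "n0 + 5 * K + 20 < k" using False by (simp_all add: k_def)
        show "10000 * (K + 1)\<^sup>2 * (n * r ^ 4) + 10 \<le> time n" using tT by (simp only: C_def)
        show "drawn s' \<le> traces n \<and> (?G \<omega> \<longrightarrow> outputs n s' x)"
          if "drawn s' = N \<and> arr s' ''out'' = recon (mem \<omega>) (total \<omega>) n" for s'
          using that NT outputs_iff[of x s'] unfolding x by metis
      qed
      moreover have "9/10 \<le> measure ?P {\<omega> \<in> space ?P. ?G \<omega>}" using recon_prob err by simp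
      ultimately show ?thesis by (intro exI[of _ ?G] conjI allI)
    qed
    then obtain G where G: "\<And>\<omega>. reaches (word_size k n) \<omega> c (init_state n) (time n)
        (\<lambda>s'. drawn s' \<le> traces n \<and> (G \<omega> \<longrightarrow> outputs n s' x))" "9/10 \<le> measure ?P {\<omega> \<in> space ?P. G \<omega>}" by blast
    from prob_run_ge[OF G] G(1) show ?thesis unfolding run_def reaches_def by blast
  qed
  then show ?thesis using traces_O time_O
    by (intro exI[of _ c] exI[of _ k] exI[of _ traces] exI[of _ time]) (simp add: k_def)
qed

end
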